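(* Let $\delta>0$ and $h>0$ be fixed. Each of the following four optimal control problems has a unique solution, i.e. there is a unique pair minimizing $I$ over the indicated class of pairs (and this pair in particular satisfies the corresponding state equation). (1) (Nonlocal continuous problem) Minimize $I(u,g)$ over all $(u,g)\in X_0(\Omega_\delta;\mathbb{R}^n)\times Z_{\mathrm{ad}}$ such that $B_\delta(u,v)=\langle g,v\rangle$ for all $v\in X_0(\Omega_\delta;\mathbb{R}^n)$. (2) (Local continuous problem) Minimize $I(u,g)$ over all $(u,g)\in H^1_0(\Omega;\mathbb{R}^n)\times Z_{\mathrm{ad}}$ such that $B_0(u,v)=\langle g,v\rangle$ for all $v\in H^1_0(\Omega;\mathbb{R}^n)$. (3) (Nonlocal discrete problem) Minimize $I(u,g)$ over all $(u,g)\in X_{\delta,h}\times (Z_{\mathrm{ad}}\cap Z_h)$ such that $B_\delta(u,v)=\langle g,v\rangle$ for all $v\in X_{\delta,h}$. (4) (Local discrete problem) Minimize $I(u,g)$ over all $(u,g)\in X_h\times (Z_{\mathrm{ad}}\cap Z_h)$ such that $B_0(u,v)=\langle g,v\rangle$ for all $v\in X_h$.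
   Context: $\Omega\subset\mathbb{R}^n$ is a bounded open set with Lipschitz boundary; for $\delta>0$, $\Omega_\delta=\Omega\cup\{x\in\mathbb{R}^n:\operatorname{dist}(x,\Omega)<\delta\}$ and $\mathcal{D}_\delta=(\Omega\times\Omega_\delta)\cup(\Omega_\delta\times\Omega)$. Kernels: $\{k_\delta\}_{\delta>0}$ is a family of radial nonnegative functions in $L^1(\mathbb{R}^n)$ (written $k_\delta(\xi)=k_\delta(|\xi|)$), supported in $B_\delta(0)$, with $\int_{\mathbb{R}^n}k_\delta(|\xi|)\,d\xi=1$, $\lim_{\delta\to0^+}\int_{\mathbb{R}^n\setminus B_\epsilon(0)}k_\delta(|\xi|)\,d\xi=0$ for all $\epsilon>0$, and such that for each $\delta$ the function $r\mapsto k_\delta(r)r^{-2}$ is non-increasing. Coefficient: $H(x,y)=\frac12(h(x)+h(y))$ where $h$ is a measurable function with $0<h_{\min}\le h(x)\le h_{\max}$ on $\Omega_\delta$ for constants $h_{\min},h_{\max}$ (this function $h$ is unrelated to the mesh size $h$). Spaces: $Du(x,y)=(u(x)-u(y))\cdot\frac{x-y}{|x-y|}$. $X(\Omega_\delta;\mathbb{R}^n)$ is the space of measurable $u:\Omega_\delta\to\mathbb{R}^n$ with $u|_\Omega\in L^2(\Omega;\mathbb{R}^n)$ and $[u]_X^2:=\iint_{\mathcal{D}_\delta}k_\delta(|x-y|)\frac{|Du(x,y)|^2}{|x-y|^2}\,dx\,dy<\infty$, with norm $(\|u\|_{L^2(\Omega)}^2+[u]_X^2)^{1/2}$. $X_0(\Omega_\delta;\mathbb{R}^n)=\{u\in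 X(\Omega_\delta;\mathbb{R}^n): u=0\text{ on }\Omega_\delta\setminus\Omega\}$. $H^1_0(\Omega;\mathbb{R}^n)$ is the usual Sobolev space. $\langle\cdot,\cdot\rangle$ is the $L^2(\Omega;\mathbb{R}^n)$ inner product. Bilinear forms: $B_\delta(u,v)=\frac12\iint_{\mathcal{D}_\delta}H(x,y)k_\delta(x-y)\frac{Du(x,y)}{|x-y|}\frac{Dv(x,y)}{|x-y|}\,dx\,dy$ and $B_0(u,v)=\frac{1}{n(n+2)}\int_\Omega h(x)\big(2\langle\operatorname{Sym}(\nabla u),\operatorname{Sym}(\nabla v)\rangle_F+\operatorname{div}u\,\operatorname{div}v\big)dx$, with $\langle\cdot,\cdot\rangle_F$ the Frobenius inner product and $\operatorname{Sym}(A)=\frac12(A+A^\top)$. Controls: $Z_{\mathrm{ad}}=\{z\in L^2(\Omega;\mathbb{R}^n): a(x)\preceq z(x)\preceq b(x)\text{ a.e.}\}$ with $a,b\in L^\infty(\Omega;\mathbb{R}^n)$, $\preceq$ componentwise; it is assumed $0\in Z_{\mathrm{ad}}$. Objective: $I(u,g)=\int_\Omega F(x,u(x))\,dx+\int_\Omega\Gamma(x)|g(x)|^2\,dx$, with $\Gamma\in L^1(\Omega)$, $\Gamma>0$, and $F:\Omega\times\mathbb{R}^n\to\mathbb{R}$ such that $F(\cdot,v)$ is measurable for all $v$, $F(x,\cdot)$ is continuous and convex for all $x$, and $|F(x,v)|\le c_1|v|^2+l(x)$ for all $x,v$, for some $c_1>0$, $l\in L^1(\Omega)$. Discrete spaces: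 $\{\mathscr{T}_h\}_{h>0}$ is a quasi-uniform family of meshes of size $h$ discretizing $\Omega_\delta$. $X_h$ and $X_{\delta,h}$ both denote the space of continuous functions $\overline{\Omega_\delta}\to\mathbb{R}^n$ that are affine on each $T\in\mathscr{T}_h$ and vanish on $\Omega_\delta\setminus\Omega$ (equipped with the $H^1(\Omega)$ norm and the $X(\Omega_\delta;\mathbb{R}^n)$ norm, respectively). $Z_h$ is the space of $\mathbb{R}^n$-valued functions that are constant on each $T\in\mathscr{T}_h$; in $Z_{\mathrm{ad}}\cap Z_h$ such functions are regarded as functions on $\Omega$ (by restriction). *)

theory Defs
  imports "HOL-Analysis.Analysis"
begin

section \<open>Domains\<close>

text \<open>Near every boundary point, \<open>\<Omega>\<close> is the strict epigraph, in some direction \<open>e\<close>, of a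
  Lipschitz function on the hyperplane orthogonal to \<open>e\<close>.\<close>

definition lipschitz_boundary :: "(real^'n) set \<Rightarrow> bool" where
  "lipschitz_boundary \<Omega> \<longleftrightarrow>
     (\<forall>p\<in>frontier \<Omega>. \<exists>r>0. \<exists>e \<gamma> L. norm e = 1 \<and> L-lipschitz_on {w. w \<bullet> e = 0} \<gamma> \<and>
        (\<forall>x\<in>ball p r. x \<in> \<Omega> \<longleftrightarrow> \<gamma> (x - (x \<bullet> e) *\<^sub>R e) < x \<bullet> e))"

text \<open>The library sets \<^term>\<open>infdist x {} = 0\<close>, whereas the distance to the empty set is infinite
  here; hence the guard.\<close>

definition enlarged :: "(real^'n) set \<Rightarrow> real \<Rightarrow> (real^'n) set" where
  "enlarged \<Omega> \<delta> = \<Omega> \<union> {x. \<Omega> \<noteq> {} \<and> infdist x \<Omega> < \<delta>}"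

definition interaction_set :: "(real^'n) set \<Rightarrow> real \<Rightarrow> ((real^'n) \<times> (real^'n)) set" where
  "interaction_set \<Omega> \<delta> = \<Omega> \<times> enlarged \<Omega> \<delta> \<union> enlarged \<Omega> \<delta> \<times> \<Omega>"

section \<open>Kernels\<close>

definition radial_kernel :: "real \<Rightarrow> (real^'n \<Rightarrow> real) \<Rightarrow> bool" where
  "radial_kernel \<delta> \<kappa> \<longleftrightarrow>
     (\<exists>\<rho>. (\<forall>\<xi>. \<kappa> \<xi> = \<rho> (norm \<xi>)) \<and>
          (\<forall>r s. 0 < r \<and> r \<le> s \<longrightarrow> \<rho> s / s\<^sup>2 \<le> \<rho> r / r\<^sup>2)) \<and>
     (\<forall>\<xi>. 0 \<le> \<kappa> \<xi>) \<and>
     integrable lebesgue \<kappa> \<and>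
     (\<forall>\<xi>. \<xi> \<notin> ball 0 \<delta> \<longrightarrow> \<kappa> \<xi> = 0) \<and>
     (LINT \<xi>|lebesgue. \<kappa> \<xi>) = 1"

definition kernel_family :: "(real \<Rightarrow> real^'n \<Rightarrow> real) \<Rightarrow> bool" where
  "kernel_family k \<longleftrightarrow>
     (\<forall>\<delta>>0. radial_kernel \<delta> (k \<delta>)) \<and>
     (\<forall>\<epsilon>>0. ((\<lambda>\<delta>. LINT \<xi>:(- ball 0 \<epsilon>)|lebesgue. k \<delta> \<xi>) \<longlongrightarrow> 0) (at_right 0))"

section \<open>Functions on a set\<close>

text \<open>A function on \<open>S\<close> is represented by a total function whose values off \<open>S\<close> are irrelevant;
  elements of Lebesgue and Sobolev spaces are representatives, compared by \<open>ae_eq\<close>.\<close>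

definition ae_eq :: "(real^'n) set \<Rightarrow> (real^'n \<Rightarrow> 'b) \<Rightarrow> (real^'n \<Rightarrow> 'b) \<Rightarrow> bool" where
  "ae_eq S f g \<longleftrightarrow> (AE x in lebesgue_on S. f x = g x)"

definition L2 :: "(real^'n) set \<Rightarrow> (real^'n \<Rightarrow> 'b::euclidean_space) set" where
  "L2 \<Omega> = {u. u \<in> borel_measurable (lebesgue_on \<Omega>) \<and>
              integrable (lebesgue_on \<Omega>) (\<lambda>x. (norm (u x))\<^sup>2)}"

definition Linf :: "(real^'n) set \<Rightarrow> (real^'n \<Rightarrow> 'b::euclidean_space) set" where
  "Linf \<Omega> = {u. u \<in> borel_measurable (lebesgue_on \<Omega>) \<and>
                (\<exists>C. AE x in lebesgue_on \<Omega>. norm (u x) \<le> C)}"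

definition L2_inner ::
  "(real^'n) set \<Rightarrow> (real^'n \<Rightarrow> 'b::euclidean_space) \<Rightarrow> (real^'n \<Rightarrow> 'b) \<Rightarrow> real" where
  "L2_inner \<Omega> u v = (LINT x|lebesgue_on \<Omega>. u x \<bullet> v x)"

section \<open>The nonlocal space and form\<close>

definition proj_diff :: "(real^'n \<Rightarrow> real^'n) \<Rightarrow> real^'n \<Rightarrow> real^'n \<Rightarrow> real" where
  "proj_diff u x y = (u x - u y) \<bullet> ((x - y) /\<^sub>R norm (x - y))"

definition X_space ::
  "(real^'n) set \<Rightarrow> real \<Rightarrow> (real^'n \<Rightarrow> real) \<Rightarrow> (real^'n \<Rightarrow> real^'n) set" where
  "X_space \<Omega> \<delta> \<kappa> =
     {u. u \<in> borel_measurable (lebesgue_on (enlarged \<Omega> \<delta>)) \<and> u \<in> L2 \<Omega> \<and>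
         (\<integral>\<^sup>+p\<in>interaction_set \<Omega> \<delta>.
            (case p of (x, y) \<Rightarrow>
               ennreal (\<kappa> (x - y) * \<bar>proj_diff u x y\<bar>\<^sup>2 / (norm (x - y))\<^sup>2)) \<partial>lebesgue) < \<infinity>}"

definition X0_space ::
  "(real^'n) set \<Rightarrow> real \<Rightarrow> (real^'n \<Rightarrow> real) \<Rightarrow> (real^'n \<Rightarrow> real^'n) set" where
  "X0_space \<Omega> \<delta> \<kappa> = {u \<in> X_space \<Omega> \<delta> \<kappa>. AE x in lebesgue_on (enlarged \<Omega> \<delta> - \<Omega>). u x = 0}"

definition B_nonlocal ::
  "(real^'n) set \<Rightarrow> real \<Rightarrow> (real^'n \<Rightarrow> real) \<Rightarrow> (real^'n \<Rightarrow> real) \<Rightarrow>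
   (real^'n \<Rightarrow> real^'n) \<Rightarrow> (real^'n \<Rightarrow> real^'n) \<Rightarrow> real" where
  "B_nonlocal \<Omega> \<delta> \<kappa> c u v =
     1/2 * (LINT p:interaction_set \<Omega> \<delta>|lebesgue.
       (case p of (x, y) \<Rightarrow>
          ((c x + c y) / 2) * \<kappa> (x - y) *
          (proj_diff u x y / norm (x - y)) * (proj_diff v x y / norm (x - y))))"

section \<open>Sobolev spaces and the local form\<close>

definition partial_deriv :: "'n \<Rightarrow> (real^'n \<Rightarrow> real) \<Rightarrow> real^'n \<Rightarrow> real" where
  "partial_deriv j f x = frechet_derivative f (at x) (axis j 1)"

fun Ck :: "nat \<Rightarrow> (real^'n \<Rightarrow> real) \<Rightarrow> bool" where
  "Ck 0 f \<longleftrightarrow> continuous_on UNIV f"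
| "Ck (Suc m) f \<longleftrightarrow> f differentiable_on UNIV \<and> (\<forall>j. Ck m (partial_deriv j f))"

definition test_function :: "(real^'n) set \<Rightarrow> (real^'n \<Rightarrow> real) \<Rightarrow> bool" where
  "test_function \<Omega> \<phi> \<longleftrightarrow> (\<forall>m. Ck m \<phi>) \<and>
     compact (closure {x. \<phi> x \<noteq> 0}) \<and> closure {x. \<phi> x \<noteq> 0} \<subseteq> \<Omega>"

text \<open>Entry \<open>G x $ i $ j\<close> is the weak derivative of the \<open>i\<close>-th component in direction \<open>j\<close>.\<close>

definition is_weak_grad ::
  "(real^'n) set \<Rightarrow> (real^'n \<Rightarrow> real^'n) \<Rightarrow> (real^'n \<Rightarrow> real^'n^'n) \<Rightarrow> bool" where
  "is_weak_grad \<Omega> u G \<longleftrightarrow>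
     (\<forall>\<phi> i j. test_function \<Omega> \<phi> \<longrightarrow>
        (LINT x|lebesgue_on \<Omega>. u x $ i * partial_deriv j \<phi> x) =
        - (LINT x|lebesgue_on \<Omega>. G x $ i $ j * \<phi> x))"

definition H1_space :: "(real^'n) set \<Rightarrow> (real^'n \<Rightarrow> real^'n) set" where
  "H1_space \<Omega> = {u \<in> L2 \<Omega>. \<exists>G \<in> L2 \<Omega>. is_weak_grad \<Omega> u G}"

text \<open>The choice is unique up to null sets on \<^const>\<open>H1_space\<close>.\<close>

definition weak_grad :: "(real^'n) set \<Rightarrow> (real^'n \<Rightarrow> real^'n) \<Rightarrow> real^'n \<Rightarrow> real^'n^'n" where
  "weak_grad \<Omega> u = (SOME G. G \<in> L2 \<Omega> \<and> is_weak_grad \<Omega> u G)"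

definition H1_norm :: "(real^'n) set \<Rightarrow> (real^'n \<Rightarrow> real^'n) \<Rightarrow> real" where
  "H1_norm \<Omega> u = sqrt ((LINT x|lebesgue_on \<Omega>. (norm (u x))\<^sup>2) +
                       (LINT x|lebesgue_on \<Omega>. (norm (weak_grad \<Omega> u x))\<^sup>2))"

definition H10_space :: "(real^'n) set \<Rightarrow> (real^'n \<Rightarrow> real^'n) set" where
  "H10_space \<Omega> =
     {u \<in> H1_space \<Omega>. \<forall>\<epsilon>>0. \<exists>\<phi>. (\<forall>i. test_function \<Omega> (\<lambda>x. \<phi> x $ i)) \<and>
                                 H1_norm \<Omega> (\<lambda>x. u x - \<phi> x) < \<epsilon>}"

definition Sym :: "real^'n^'n \<Rightarrow> real^'n^'n" where
  "Sym A = (1/2) *\<^sub>R (A + transpose A)"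

text \<open>The inner product of \<^typ>\<open>real^'n^'n\<close> is the Frobenius one, and the divergence is the trace
  of the gradient.\<close>

definition B_local ::
  "(real^'n) set \<Rightarrow> (real^'n \<Rightarrow> real) \<Rightarrow>
   (real^'n \<Rightarrow> real^'n) \<Rightarrow> (real^'n \<Rightarrow> real^'n) \<Rightarrow> real" where
  "B_local \<Omega> c u v =
     1 / (real CARD('n) * (real CARD('n) + 2)) *
     (LINT x|lebesgue_on \<Omega>.
        c x * (2 * (Sym (weak_grad \<Omega> u x) \<bullet> Sym (weak_grad \<Omega> v x)) +
               trace (weak_grad \<Omega> u x) * trace (weak_grad \<Omega> v x)))"

section \<open>Controls and objective\<close>

definition Z_ad ::
  "(real^'n) set \<Rightarrow> (real^'n \<Rightarrow> real^'n) \<Rightarrow> (real^'n \<Rightarrow> real^'n) \<Rightarrow> (real^'n \<Rightarrow> real^'n) set" where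
  "Z_ad \<Omega> a b =
     {z \<in> L2 \<Omega>. AE x in lebesgue_on \<Omega>. \<forall>i. a x $ i \<le> z x $ i \<and> z x $ i \<le> b x $ i}"

definition objective ::
  "(real^'n) set \<Rightarrow> (real^'n \<Rightarrow> real^'n \<Rightarrow> real) \<Rightarrow> (real^'n \<Rightarrow> real) \<Rightarrow>
   (real^'n \<Rightarrow> real^'n) \<Rightarrow> (real^'n \<Rightarrow> real^'n) \<Rightarrow> real" where
  "objective \<Omega> F \<Gamma> u g =
     (LINT x|lebesgue_on \<Omega>. F x (u x)) + (LINT x|lebesgue_on \<Omega>. \<Gamma> x * (norm (g x))\<^sup>2)"

definition admissible_integrand ::
  "(real^'n) set \<Rightarrow> (real^'n \<Rightarrow> real^'n \<Rightarrow> real) \<Rightarrow> bool" where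
  "admissible_integrand \<Omega> F \<longleftrightarrow>
     (\<forall>v. (\<lambda>x. F x v) \<in> borel_measurable (lebesgue_on \<Omega>)) \<and>
     (\<forall>x\<in>\<Omega>. continuous_on UNIV (F x) \<and> convex_on UNIV (F x)) \<and>
     (\<exists>c\<^sub>1>0. \<exists>l. integrable (lebesgue_on \<Omega>) l \<and>
        (\<forall>x\<in>\<Omega>. \<forall>v. \<bar>F x v\<bar> \<le> c\<^sub>1 * (norm v)\<^sup>2 + l x))"

section \<open>Discrete spaces\<close>

text \<open>The elements of a mesh of \<open>D\<close> are the sets \<open>T \<inter> closure D\<close>, with \<open>T\<close> ranging over a conforming
  family of full-dimensional closed simplices that covers \<open>D\<close>. Simplices are allowed to stick out of
  \<open>D\<close> because a \<open>\<delta>\<close>-neighbourhood has no convex corners, so for \<open>n \<ge> 2\<close> it is never a finite union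
  of simplices; meshes with \<open>\<Union>\<T> = closure D\<close> are included as a special case.\<close>

definition mesh_of :: "(real^'n) set \<Rightarrow> (real^'n) set set \<Rightarrow> bool" where
  "mesh_of D \<T> \<longleftrightarrow>
     triangulation \<T> \<and>
     (\<forall>T\<in>\<T>. int CARD('n) simplex T \<and> T \<inter> D \<noteq> {}) \<and>
     closure D \<subseteq> \<Union>\<T>"

definition quasi_uniform :: "(real \<Rightarrow> (real^'n) set set) \<Rightarrow> bool" where
  "quasi_uniform \<T> \<longleftrightarrow>
     (\<exists>\<sigma>>0. \<forall>m>0. \<forall>T\<in>\<T> m. diameter T \<le> m \<and> (\<exists>p. cball p (\<sigma> * m) \<subseteq> T))"

text \<open>Underlies both \<open>X\<^sub>h\<close> and \<open>X\<^bsub>\<delta>,h\<^esub>\<close>, which differ only in their norms.\<close>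

definition P1_space ::
  "(real^'n) set \<Rightarrow> real \<Rightarrow> (real^'n) set set \<Rightarrow> (real^'n \<Rightarrow> real^'n) set" where
  "P1_space \<Omega> \<delta> \<T> =
     {u. continuous_on (closure (enlarged \<Omega> \<delta>)) u \<and>
         (\<forall>T\<in>\<T>. \<exists>(A::real^'n^'n) b. \<forall>x\<in>T \<inter> closure (enlarged \<Omega> \<delta>). u x = A *v x + b) \<and>
         (\<forall>x\<in>enlarged \<Omega> \<delta> - \<Omega>. u x = 0)}"

text \<open>Constancy is required on interiors only: neighbouring closed elements overlap, and the values
  on the null set of their boundaries are immaterial.\<close>

definition P0_space ::
  "(real^'n) set \<Rightarrow> real \<Rightarrow> (real^'n) set set \<Rightarrow> (real^'n \<Rightarrow> real^'n) set" where
  "P0_space \<Omega> \<delta> \<T> = {z. \<forall>T\<in>\<T>. \<exists>c. \<forall>x\<in>interior T \<inter> enlarged \<Omega> \<delta>. z x = c}"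

section \<open>Optimal control problems\<close>

definition state_control_pairs ::
  "(real^'n) set \<Rightarrow> ((real^'n \<Rightarrow> real^'n) \<Rightarrow> (real^'n \<Rightarrow> real^'n) \<Rightarrow> real) \<Rightarrow>
   (real^'n \<Rightarrow> real^'n) set \<Rightarrow> (real^'n \<Rightarrow> real^'n) set \<Rightarrow>
   ((real^'n \<Rightarrow> real^'n) \<times> (real^'n \<Rightarrow> real^'n)) set" where
  "state_control_pairs \<Omega> B U Z =
     {(u, g). u \<in> U \<and> g \<in> Z \<and> (\<forall>v\<in>U. B u v = L2_inner \<Omega> g v)}"

text \<open>States are identified if they agree almost everywhere on \<open>D\<close>, controls if they agree almost
  everywhere on \<open>\<Omega>\<close>.\<close>

definition unique_minimizer ::
  "(real^'n) set \<Rightarrow> (real^'n) set \<Rightarrow>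
   ((real^'n \<Rightarrow> real^'n) \<Rightarrow> (real^'n \<Rightarrow> real^'n) \<Rightarrow> real) \<Rightarrow>
   ((real^'n \<Rightarrow> real^'n) \<times> (real^'n \<Rightarrow> real^'n)) set \<Rightarrow> bool" where
  "unique_minimizer D \<Omega> J P \<longleftrightarrow>
     (\<exists>u g. is_arg_min (\<lambda>(u, g). J u g) (\<lambda>q. q \<in> P) (u, g) \<and>
        (\<forall>u' g'. is_arg_min (\<lambda>(u, g). J u g) (\<lambda>q. q \<in> P) (u', g') \<longrightarrow>
           ae_eq D u' u \<and> ae_eq \<Omega> g' g))"

end

theory Submission
  imports Defs
begin

text \<open>All four problems are instances of one minimization result, \<open>unique_minimizer_state_control\<close>,
  proved by the direct method with strong instead of weak convergence. The pair \<open>(0, 0)\<close> is feasible.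
  Testing the state equation with the state bounds the state by the control (\<open>state_bound\<close>), and the
  controls are uniformly bounded, so the objective is bounded below on feasible pairs. Feasible pairs form
  a convex set, and by the parallelogram law the objective at the midpoint of two of them lies below
  the average of its two values by at least \<open>\<integral> \<Gamma> |g - g'|\<^sup>2 / 4\<close>. Hence the controls of a minimizing sequence
  are Cauchy in \<open>L\<^sup>2(\<Gamma> dx)\<close>. As \<open>\<Gamma> > 0\<close>, a subsequence converges almost everywhere and, by the
  uniform bound, in \<open>L\<^sup>2\<close>. Differences of states solve the equation for the differences of controls, so the
  states converge as well, to the state of the limit control (\<open>state_control_pairs_closed\<close>). Fatou's lemma
  makes \<open>\<integral> F(x, u)\<close> lower semicontinuous along them (\<open>integrand_lsc\<close>), and the limit is a minimizer. The
  midpoint gap also forces two minimizers to have the same control, and then coercivity the same state.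

  What this asks of a bilinear form is collected in the locale \<open>coercive_form\<close>: its energy dominates the
  \<open>L\<^sup>2\<close> norm on \<open>\<Omega>\<close>, and the state space is complete for the energy.

  Nonlocal form. Stepping repeatedly by \<open>\<xi>\<close> leads out of the bounded set \<open>\<Omega>\<close>, where the state vanishes,
  so \<open>2 \<integral> f\<^sup>2 \<le> N\<^sup>2 \<integral> |f(x + \<xi>) - f(x)|\<^sup>2\<close> with \<open>N\<close> of order \<open>1/|\<xi>|\<close> (\<open>shift_Poincare\<close>). For \<open>f = u \<bullet> \<xi>/|\<xi>|\<close>
  this is integrated against \<open>\<kappa>(\<xi>)/|\<xi>|\<^sup>2\<close>. The right-hand side becomes the energy, the left-hand side
  the integral of the quadratic form \<open>\<integral> \<kappa>(\<xi>) (u(x) \<bullet> \<xi>/|\<xi>|)\<^sup>2 d\<xi>\<close>, which bounds \<open>|u(x)|\<^sup>2\<close> from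
  above up to a factor since no hyperplane carries \<open>\<kappa>\<close> (\<open>kernel_form_coercive\<close>).

  Local form. For fields vanishing off \<open>\<Omega>\<close>, exchanging derivatives gives Korn's inequality, and Poincare's
  inequality for \<open>u\<^sub>i\<close> in direction \<open>i\<close> involves only the diagonal of \<open>\<nabla>u\<close>, which is that of
  its symmetric part (\<open>Korn_lipc\<close>, \<open>Poincare_Sym_lipc\<close>). Both pass from test fields to \<open>H\<^sup>1\<^sub>0\<close>
  by density. The same inequalities are needed for piecewise affine fields, so they are proved for Lipschitz
  functions of bounded support that are differentiable almost everywhere, by means of difference quotients.
  Weak gradients are unique by the fundamental lemma of the calculus of variations (\<open>fundamental_lemma\<close>),
  for which smooth bump functions on boxes are built from \<open>exp (- 1/x)\<close>.

  Discrete forms. Extended by zero, a piecewise affine field vanishing on \<open>D - \<Omega>\<close>, where \<open>D\<close> is the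
  \<open>\<delta>\<close>-neighbourhood of \<open>\<Omega>\<close>, is Lipschitz, with its steepest slope as constant (\<open>zero_ext_Lipschitz\<close>), and its
  gradient vanishes almost everywhere off \<open>\<Omega>\<close>. So it inherits the coercivity of both forms. Almost
  everywhere convergence of such fields makes the slopes converge on each of the finitely many cells, which
  gives completeness (\<open>P1_limit\<close>, \<open>coercive_form_P1\<close>).\<close>

section \<open>Square-integrable functions\<close>

definition sq_integrable :: "'a measure \<Rightarrow> ('a \<Rightarrow> 'b::euclidean_space) \<Rightarrow> bool" where
  "sq_integrable M f \<longleftrightarrow> f \<in> borel_measurable M \<and> integrable M (\<lambda>x. (norm (f x))\<^sup>2)"

lemma L2_iff_sq_integrable: "u \<in> L2 \<Omega> \<longleftrightarrow> sq_integrable (lebesgue_on \<Omega>) u"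
  by (simp add: L2_def sq_integrable_def)

lemma sq_integrableD:
  assumes "sq_integrable M f"
  shows "f \<in> borel_measurable M" "integrable M (\<lambda>x. (norm (f x))\<^sup>2)"
  using assms by (auto simp: sq_integrable_def)

lemma norm_add_sq_le: "(norm (x + y))\<^sup>2 \<le> 2 * (norm x)\<^sup>2 + 2 * (norm (y::'a::real_inner))\<^sup>2"
proof -
  have "0 \<le> (norm (x - y))\<^sup>2" by simp
  then show ?thesis by (simp add: power2_norm_eq_inner algebra_simps inner_commute)
qed

lemma norm_diff_sq_le: "(norm (x - y))\<^sup>2 \<le> 2 * (norm x)\<^sup>2 + 2 * (norm (y::'a::real_inner))\<^sup>2"
  using norm_add_sq_le[of x "-y"] by simp

text \<open>The bilinear estimates in this theory use Cauchy-Schwarz in this additive form, with a free weight,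
  which survives integration without roots.\<close>

lemma abs_inner_le:
  fixes x y :: "'a::real_inner"
  assumes "e > 0"
  shows "\<bar>x \<bullet> y\<bar> \<le> (norm x)\<^sup>2 / (2*e) + e / 2 * (norm y)\<^sup>2"
proof -
  have "\<bar>x \<bullet> y\<bar> \<le> norm x * norm y" by (rule Cauchy_Schwarz_ineq2)
  also have "\<dots> \<le> (norm x)\<^sup>2 / (2*e) + e / 2 * (norm y)\<^sup>2"
  proof -
    have "0 \<le> (norm x - e * norm y)\<^sup>2 / (2*e)" using assms by simp
    also have "\<dots> = (norm x)\<^sup>2 / (2*e) + e / 2 * (norm y)\<^sup>2 - norm x * norm y"
      using assms by (simp add: power2_eq_square field_simps)
    finally show ?thesis by simp
  qed
  finally show ?thesis .
qed

lemma sq_integrable_bound: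
  assumes "g \<in> borel_measurable M" "integrable M w" "AE x in M. (norm (g x))\<^sup>2 \<le> w x"
  shows "sq_integrable M g"
  unfolding sq_integrable_def
proof
  show "integrable M (\<lambda>x. (norm (g x))\<^sup>2)"
    by (rule Bochner_Integration.integrable_bound[OF assms(2)])
       (use assms in \<open>auto intro: AE_mp\<close>)
qed (use assms in auto)

lemma sq_integrable_scaleR: "sq_integrable M f \<Longrightarrow> sq_integrable M (\<lambda>x. c *\<^sub>R f x)"
  by (auto simp: sq_integrable_def power_mult_distrib)

lemma sq_integrable_add:
  assumes "sq_integrable M f" "sq_integrable M g"
  shows "sq_integrable M (\<lambda>x. f x + g x)"
proof (rule sq_integrable_bound)
  show "integrable M (\<lambda>x. 2 * (norm (f x))\<^sup>2 + 2 * (norm (g x))\<^sup>2)"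
    using assms by (auto simp: sq_integrable_def)
qed (use assms norm_add_sq_le in \<open>auto simp: sq_integrable_def\<close>)

lemma sq_integrable_lincomb:
  "sq_integrable M f \<Longrightarrow> sq_integrable M g \<Longrightarrow> sq_integrable M (\<lambda>x. c *\<^sub>R f x + d *\<^sub>R g x)"
  by (intro sq_integrable_add sq_integrable_scaleR)

lemma sq_integrable_diff:
  "sq_integrable M f \<Longrightarrow> sq_integrable M g \<Longrightarrow> sq_integrable M (\<lambda>x. f x - g x)"
  using sq_integrable_lincomb[of M f g 1 "-1"] by simp

lemma sq_integrable_inner:
  assumes "sq_integrable M f" "sq_integrable M g"
  shows "integrable M (\<lambda>x. f x \<bullet> g x)"
proof (rule Bochner_Integration.integrable_bound)
  show "integrable M (\<lambda>x. (norm (f x))\<^sup>2 + (norm (g x))\<^sup>2)"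
    using assms by (auto simp: sq_integrable_def)
  show "(\<lambda>x. f x \<bullet> g x) \<in> borel_measurable M"
    using assms by (auto simp: sq_integrable_def)
  show "AE x in M. norm (f x \<bullet> g x) \<le> norm ((norm (f x))\<^sup>2 + (norm (g x))\<^sup>2)"
  proof (rule AE_I2)
    fix x
    have "0 \<le> (norm (f x))\<^sup>2" "0 \<le> (norm (g x))\<^sup>2" by auto
    then show "norm (f x \<bullet> g x) \<le> norm ((norm (f x))\<^sup>2 + (norm (g x))\<^sup>2)"
      using abs_inner_le[of 1 "f x" "g x"] by (simp del: zero_le_power2)
  qed
qed

lemma sq_integrable_cong_AE:
  assumes "sq_integrable M f" "g \<in> borel_measurable M" "AE x in M. f x = g x"
  shows "sq_integrable M g"
  by (rule sq_integrable_bound[where w="\<lambda>x. (norm (f x))\<^sup>2"])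
     (use assms in \<open>auto simp: sq_integrable_def\<close>)

lemma tendsto_LINT_inner:
  assumes "\<And>n. sq_integrable M (f n)" "sq_integrable M g" "sq_integrable M h"
    and "(\<lambda>n. LINT x|M. (norm (f n x - g x))\<^sup>2) \<longlonglongrightarrow> 0"
  shows "(\<lambda>n. LINT x|M. f n x \<bullet> h x) \<longlonglongrightarrow> (LINT x|M. g x \<bullet> h x)"
proof (rule LIMSEQ_I)
  fix r :: real assume "r > 0"
  define H where "H = (LINT x|M. (norm (h x))\<^sup>2) + 1"
  have H: "H > 0" by (simp add: H_def add_nonneg_pos)
  define e where "e = r / H"
  have e: "e > 0" using \<open>r > 0\<close> H by (simp add: e_def)
  obtain N where N: "\<And>n. n \<ge> N \<Longrightarrow> \<bar>LINT x|M. (norm (f n x - g x))\<^sup>2\<bar> < r * e"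
    using LIMSEQ_D[OF assms(4), of "r * e"] \<open>r > 0\<close> e by auto
  have "norm ((LINT x|M. f n x \<bullet> h x) - (LINT x|M. g x \<bullet> h x)) < r" if "n \<ge> N" for n
  proof -
    have d: "sq_integrable M (\<lambda>x. f n x - g x)" using assms by (intro sq_integrable_diff)
    have "(LINT x|M. f n x \<bullet> h x) - (LINT x|M. g x \<bullet> h x) = (LINT x|M. (f n x - g x) \<bullet> h x)"
      using assms by (simp add: inner_diff_left sq_integrable_inner)
    also have "\<bar>\<dots>\<bar> \<le> (LINT x|M. \<bar>(f n x - g x) \<bullet> h x\<bar>)"
      by (rule integral_abs_bound)
    also have "\<dots> \<le> (LINT x|M. (norm (f n x - g x))\<^sup>2 / (2*e) + e / 2 * (norm (h x))\<^sup>2)"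
      using d assms(3) e
      by (intro integral_mono integrable_abs sq_integrable_inner abs_inner_le Bochner_Integration.integrable_add)
        (auto dest: sq_integrableD)
    also have "\<dots> = (LINT x|M. (norm (f n x - g x))\<^sup>2) / (2*e) + e / 2 * (H - 1)"
      using sq_integrableD(2)[OF d] sq_integrableD(2)[OF assms(3)] by (simp add: H_def)
    also have "\<dots> < r * e / (2*e) + e / 2 * H"
    proof -
      have "(LINT x|M. (norm (f n x - g x))\<^sup>2) < r * e" using N[OF that] by linarith
      then have "(LINT x|M. (norm (f n x - g x))\<^sup>2) / (2*e) < r * e / (2*e)"
        by (rule divide_strict_right_mono) (use e in simp)
      moreover have "e / 2 * (H - 1) \<le> e / 2 * H" using e by simp
      ultimately show ?thesis by linarith
    qed
    also have "\<dots> = r" using e H by (simp add: e_def)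
    finally show ?thesis by simp
  qed
  then show "\<exists>N. \<forall>n\<ge>N. norm ((LINT x|M. f n x \<bullet> h x) - (LINT x|M. g x \<bullet> h x)) < r" by blast
qed

text \<open>Solved for the square of \<open>f\<close>, so that convergence of the two terms on the right carries over to it.\<close>

lemma LINT_sq_diff_expand:
  assumes "sq_integrable M f" "sq_integrable M g"
  shows "(LINT x|M. (norm (f x))\<^sup>2) = (LINT x|M. (norm (f x - g x))\<^sup>2)
    + 2 * (LINT x|M. f x \<bullet> g x) - (LINT x|M. (norm (g x))\<^sup>2)"
proof -
  have "(LINT x|M. (norm (f x - g x))\<^sup>2)
      = (LINT x|M. (norm (f x))\<^sup>2 - 2 * (f x \<bullet> g x) + (norm (g x))\<^sup>2)"
    by (intro Bochner_Integration.integral_cong refl)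
       (simp add: power2_norm_eq_inner inner_diff_left inner_diff_right inner_commute)
  also have "\<dots> = (LINT x|M. (norm (f x))\<^sup>2) - 2 * (LINT x|M. f x \<bullet> g x) + (LINT x|M. (norm (g x))\<^sup>2)"
    using sq_integrableD(2)[OF assms(1)] sq_integrableD(2)[OF assms(2)] sq_integrable_inner[OF assms]
    by simp
  finally show ?thesis by simp
qed

lemma tendsto_LINT_norm_sq:
  assumes "\<And>n. sq_integrable M (f n)" "sq_integrable M g"
    and lim: "(\<lambda>n. LINT x|M. (norm (f n x - g x))\<^sup>2) \<longlonglongrightarrow> 0"
  shows "(\<lambda>n. LINT x|M. (norm (f n x))\<^sup>2) \<longlonglongrightarrow> (LINT x|M. (norm (g x))\<^sup>2)"
proof -
  have "(\<lambda>n. (LINT x|M. (norm (f n x - g x))\<^sup>2) + 2 * (LINT x|M. f n x \<bullet> g x) - (LINT x|M. (norm (g x))\<^sup>2))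
     \<longlonglongrightarrow> 0 + 2 * (LINT x|M. g x \<bullet> g x) - (LINT x|M. (norm (g x))\<^sup>2)"
    by (intro tendsto_intros lim tendsto_LINT_inner assms)
  then show ?thesis
    unfolding LINT_sq_diff_expand[OF assms(1,2), symmetric] by (simp add: power2_norm_eq_inner)
qed

lemma L2_tendsto_imp_AE_subseq:
  assumes "\<And>n. sq_integrable M (f n)" "sq_integrable M g"
    and "(\<lambda>n. LINT x|M. (norm (f n x - g x))\<^sup>2) \<longlonglongrightarrow> 0"
  obtains r :: "nat \<Rightarrow> nat" where "strict_mono r" "AE x in M. (\<lambda>n. f (r n) x) \<longlonglongrightarrow> g x"
proof -
  have d: "sq_integrable M (\<lambda>x. f n x - g x)" for n using assms by (intro sq_integrable_diff)
  have "\<exists>r::nat\<Rightarrow>nat. strict_mono r \<and> (AE x in M. (\<lambda>n. (norm (f (r n) x - g x))\<^sup>2) \<longlonglongrightarrow> 0)"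
    by (rule tendsto_L1_AE_subseq) (use sq_integrableD(2)[OF d] assms in auto)
  then obtain r :: "nat \<Rightarrow> nat" where r: "strict_mono r"
    and ae: "AE x in M. (\<lambda>n. (norm (f (r n) x - g x))\<^sup>2) \<longlonglongrightarrow> 0" by blast
  have "AE x in M. (\<lambda>n. f (r n) x) \<longlonglongrightarrow> g x"
    using ae
  proof eventually_elim
    case (elim x)
    from tendsto_real_sqrt[OF this] have "(\<lambda>n. norm (f (r n) x - g x)) \<longlonglongrightarrow> 0" by simp
    then show ?case by (simp add: LIM_zero_iff tendsto_norm_zero_iff)
  qed
  with r that show thesis by blast
qed

definition L2_Cauchy :: "'a measure \<Rightarrow> (nat \<Rightarrow> 'a \<Rightarrow> 'b::euclidean_space) \<Rightarrow> bool" where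
  "L2_Cauchy M f \<longleftrightarrow>
     (\<forall>e>0. \<exists>N. \<forall>m\<ge>N. \<forall>n\<ge>N. (LINT x|M. (norm (f m x - f n x))\<^sup>2) < e)"

text \<open>A subsequence with \<open>\<integral>|f\<^sub>n\<^sub>+\<^sub>1 - f\<^sub>n|\<^sup>2 < 4\<^sup>-\<^sup>n\<close> has \<open>\<Sum> 2\<^sup>n |f\<^sub>n\<^sub>+\<^sub>1 - f\<^sub>n|\<^sup>2\<close> finite almost everywhere,
  and then \<open>2|d\<^sub>n| \<le> 2\<^sup>n |d\<^sub>n|\<^sup>2 + 2\<^sup>-\<^sup>n\<close> makes the increments \<open>d\<^sub>n\<close> summable; Fatou's lemma turns the pointwise
  limit into a limit in the mean.\<close>

lemma L2_complete:
  fixes f :: "nat \<Rightarrow> 'a \<Rightarrow> 'b::euclidean_space"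
  assumes sq: "\<And>n. sq_integrable M (f n)" and cau: "L2_Cauchy M f"
  obtains r :: "nat \<Rightarrow> nat" and g where "strict_mono r" "sq_integrable M g"
    "AE x in M. (\<lambda>n. f (r n) x) \<longlonglongrightarrow> g x"
    "(\<lambda>n. LINT x|M. (norm (f n x - g x))\<^sup>2) \<longlonglongrightarrow> 0"
proof -
  have "\<forall>k. \<exists>N. \<forall>m\<ge>N. \<forall>n\<ge>N. (LINT x|M. (norm (f m x - f n x))\<^sup>2) < (1/4::real)^k"
    using cau by (auto simp: L2_Cauchy_def)
  then obtain Nf where Nf: "\<And>k m n. m \<ge> Nf k \<Longrightarrow> n \<ge> Nf k \<Longrightarrow> (LINT x|M. (norm (f m x - f n x))\<^sup>2) < (1/4::real)^k"
    by metis
  (* The summand n makes r strictly increasing even where the thresholds Nf vanish. *)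
  define r where "r n = n + (\<Sum>i\<le>n. Nf i)" for n
  have r: "strict_mono r" by (simp add: strict_mono_Suc_iff r_def)
  have rN: "r n \<ge> Nf n" for n
    unfolding r_def by (metis member_le_sum[of n "{..n}" Nf] atMost_iff finite_atMost le_add2 le_trans order_refl zero_le)
  define d where "d n x = f (r (Suc n)) x - f (r n) x" for n x
  have sqd: "sq_integrable M (d n)" for n unfolding d_def by (intro sq_integrable_diff sq)
  have dm[measurable]: "d n \<in> borel_measurable M" for n using sqd by (auto dest: sq_integrableD)
  have small: "(LINT x|M. (norm (d n x))\<^sup>2) \<le> (1/4)^n" for n
    unfolding d_def using Nf[of n "r (Suc n)" "r n"] rN[of n] strict_mono_less_eq[OF r, of n "Suc n"] by auto
  have "(\<integral>\<^sup>+x. (\<Sum>n. ennreal (2^n * (norm (d n x))\<^sup>2)) \<partial>M) = (\<Sum>n. \<integral>\<^sup>+x. ennreal (2^n * (norm (d n x))\<^sup>2) \<partial>M)"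
    by (rule nn_integral_suminf) auto
  also have "\<dots> = (\<Sum>n. ennreal (2^n * (LINT x|M. (norm (d n x))\<^sup>2)))"
    using sq_integrableD(2)[OF sqd] by (subst nn_integral_eq_integral) auto
  also have "\<dots> \<le> (\<Sum>n. ennreal ((1/2)^n))"
  proof (intro suminf_le ennreal_leI)
    fix n :: nat
    have "2^n * (LINT x|M. (norm (d n x))\<^sup>2) \<le> 2^n * (1/4::real)^n" using small by simp
    also have "\<dots> = (1/2)^n" by (simp flip: power_mult_distrib)
    finally show "2^n * (LINT x|M. (norm (d n x))\<^sup>2) \<le> (1/2::real)^n" .
  qed auto
  also have "\<dots> < \<infinity>"
    by (subst suminf_ennreal2) (auto simp: summable_geometric)
  finally have fin: "(\<integral>\<^sup>+x. (\<Sum>n. ennreal (2^n * (norm (d n x))\<^sup>2)) \<partial>M) \<noteq> \<infinity>" by simp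
  have ae0: "AE x in M. (\<Sum>n. ennreal (2^n * (norm (d n x))\<^sup>2)) \<noteq> \<infinity>"
    by (rule nn_integral_PInf_AE[OF _ fin]) measurable
  define g where "g x = lim (\<lambda>n. f (r n) x)" for x
  have ae: "AE x in M. (\<lambda>n. f (r n) x) \<longlonglongrightarrow> g x"
    using ae0
  proof eventually_elim
    case (elim x)
    have s1: "summable (\<lambda>n. 2^n * (norm (d n x))\<^sup>2)"
      by (rule summable_suminf_not_top) (use elim in auto)
    have s2: "summable (\<lambda>n. (1/2::real)^n)" by (simp add: summable_geometric)
    have "summable (\<lambda>n. norm (d n x))"
    proof (rule summable_comparison_test'[OF summable_add[OF s1 s2]])
      fix n :: nat
      have "0 \<le> 2^n * (norm (d n x) - (1/2)^n)\<^sup>2" by simp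
      also have "\<dots> = 2^n * (norm (d n x))\<^sup>2 - 2 * norm (d n x) + (1/2)^n"
        by (simp add: power2_eq_square field_simps power_one_over)
      finally have "2 * norm (d n x) \<le> 2^n * (norm (d n x))\<^sup>2 + (1/2)^n" by simp
      then show "norm (norm (d n x)) \<le> 2^n * (norm (d n x))\<^sup>2 + (1/2)^n"
        using norm_ge_zero[of "d n x"] by (simp del: norm_ge_zero)
    qed
    then have "summable (\<lambda>n. d n x)" by (rule summable_norm_cancel)
    then have "convergent (\<lambda>n. \<Sum>i<n. d i x)" by (simp add: summable_iff_convergent)
    also have "(\<lambda>n. \<Sum>i<n. d i x) = (\<lambda>n. f (r n) x - f (r 0) x)"
      unfolding d_def by (rule ext) (rule sum_lessThan_telescope[where f="\<lambda>n. f (r n) x"])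
    finally have "convergent (\<lambda>n. (f (r n) x - f (r 0) x) + f (r 0) x)"
      by (intro convergent_add convergent_const)
    then show ?case by (simp add: g_def convergent_LIMSEQ_iff)
  qed
  have fm[measurable]: "f n \<in> borel_measurable M" for n using sq by (auto dest: sq_integrableD)
  have gm[measurable]: "g \<in> borel_measurable M" unfolding g_def by measurable
  have nn: "(\<integral>\<^sup>+x. ennreal ((norm (f m x - g x))\<^sup>2) \<partial>M) \<le> ennreal e"
    if "e > 0" and N: "\<And>n. n \<ge> N \<Longrightarrow> (LINT x|M. (norm (f m x - f n x))\<^sup>2) < e" for m e N
  proof -
    have "(\<integral>\<^sup>+x. ennreal ((norm (f m x - g x))\<^sup>2) \<partial>M)
        \<le> (\<integral>\<^sup>+x. liminf (\<lambda>k. ennreal ((norm (f m x - f (r k) x))\<^sup>2)) \<partial>M)"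
    proof (rule nn_integral_mono_AE)
      show "AE x in M. ennreal ((norm (f m x - g x))\<^sup>2) \<le> liminf (\<lambda>k. ennreal ((norm (f m x - f (r k) x))\<^sup>2))"
        using ae
      proof eventually_elim
        case (elim x)
        then have "(\<lambda>k. ennreal ((norm (f m x - f (r k) x))\<^sup>2)) \<longlonglongrightarrow> ennreal ((norm (f m x - g x))\<^sup>2)"
          by (intro tendsto_ennrealI tendsto_intros)
        from lim_imp_Liminf[OF sequentially_bot this] show ?case by simp
      qed
    qed
    also have "\<dots> \<le> liminf (\<lambda>k. \<integral>\<^sup>+x. ennreal ((norm (f m x - f (r k) x))\<^sup>2) \<partial>M)"
      by (rule nn_integral_liminf) measurable
    also have "\<dots> \<le> ennreal e"
    proof (rule Liminf_le)
      have "\<forall>\<^sub>F k in sequentially. r k \<ge> N"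
        using filterlim_subseq[OF r] by (simp add: filterlim_at_top)
      then show "\<forall>\<^sub>F k in sequentially. (\<integral>\<^sup>+x. ennreal ((norm (f m x - f (r k) x))\<^sup>2) \<partial>M) \<le> ennreal e"
      proof eventually_elim
        case (elim k)
        have "sq_integrable M (\<lambda>x. f m x - f (r k) x)" by (intro sq_integrable_diff sq)
        from sq_integrableD(2)[OF this] N[OF elim] show ?case
          by (subst nn_integral_eq_integral) (auto intro: ennreal_leI)
      qed
    qed simp
    finally show ?thesis .
  qed
  have sqd: "sq_integrable M (\<lambda>x. f m x - g x)"
    and le: "(LINT x|M. (norm (f m x - g x))\<^sup>2) \<le> e"
    if "e > 0" and N: "\<And>n. n \<ge> N \<Longrightarrow> (LINT x|M. (norm (f m x - f n x))\<^sup>2) < e" for m e N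
  proof -
    have le: "(\<integral>\<^sup>+x. ennreal ((norm (f m x - g x))\<^sup>2) \<partial>M) \<le> ennreal e" by (rule nn[OF that])
    have i: "integrable M (\<lambda>x. (norm (f m x - g x))\<^sup>2)"
      by (rule integrableI_nonneg) (use le in \<open>auto intro: order.strict_trans1\<close>)
    then show "sq_integrable M (\<lambda>x. f m x - g x)" by (simp add: sq_integrable_def)
    show "(LINT x|M. (norm (f m x - g x))\<^sup>2) \<le> e"
      using le i \<open>e > 0\<close> by (subst (asm) nn_integral_eq_integral) auto
  qed
  obtain m0 where "\<And>n. n \<ge> m0 \<Longrightarrow> (LINT x|M. (norm (f m0 x - f n x))\<^sup>2) < 1"
    using cau unfolding L2_Cauchy_def by (metis order_refl zero_less_one)
  from sq_integrable_diff[OF sq[of m0] sqd[OF _ this]] have sqg: "sq_integrable M g" by simp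
  have "(\<lambda>n. LINT x|M. (norm (f n x - g x))\<^sup>2) \<longlonglongrightarrow> 0"
  proof (rule LIMSEQ_I)
    fix e :: real assume "e > 0"
    then obtain N where N: "\<And>m n. m \<ge> N \<Longrightarrow> n \<ge> N \<Longrightarrow> (LINT x|M. (norm (f m x - f n x))\<^sup>2) < e/2"
      using cau unfolding L2_Cauchy_def by (metis half_gt_zero)
    have "(LINT x|M. (norm (f m x - g x))\<^sup>2) \<le> e/2" if "m \<ge> N" for m
      by (rule le[where N=N]) (use \<open>e > 0\<close> N[OF that] in auto)
    then show "\<exists>no. \<forall>n\<ge>no. norm ((LINT x|M. (norm (f n x - g x))\<^sup>2) - 0) < e"
      using \<open>e > 0\<close> by (intro exI[of _ N]) (force simp: abs_of_nonneg)
  qed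
  with r sqg ae that show thesis by blast
qed

lemma L2_Cauchy_of_tendsto:
  assumes sq: "\<And>n. sq_integrable M (f n)" "sq_integrable M g"
    and lim: "(\<lambda>n. LINT x|M. (norm (f n x - g x))\<^sup>2) \<longlonglongrightarrow> 0"
  shows "L2_Cauchy M f"
  unfolding L2_Cauchy_def
proof (intro allI impI)
  fix e :: real assume "e > 0"
  then obtain N where N: "\<And>n. n \<ge> N \<Longrightarrow> (LINT x|M. (norm (f n x - g x))\<^sup>2) < e/4"
    using LIMSEQ_D[OF lim, of "e/4"] by auto
  have d: "integrable M (\<lambda>x. (norm (f n x - g x))\<^sup>2)" for n
    by (rule sq_integrableD(2)[OF sq_integrable_diff]) (use sq in auto)
  have "(LINT x|M. (norm (f m x - f n x))\<^sup>2) < e" if "m \<ge> N" "n \<ge> N" for m n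
  proof -
    have "(LINT x|M. (norm (f m x - f n x))\<^sup>2)
        \<le> (LINT x|M. 2 * (norm (f m x - g x))\<^sup>2 + 2 * (norm (f n x - g x))\<^sup>2)"
    proof (rule integral_mono)
      show "integrable M (\<lambda>x. (norm (f m x - f n x))\<^sup>2)"
        by (rule sq_integrableD(2)[OF sq_integrable_diff]) (use sq in auto)
      show "(norm (f m x - f n x))\<^sup>2 \<le> 2 * (norm (f m x - g x))\<^sup>2 + 2 * (norm (f n x - g x))\<^sup>2" for x
        using norm_diff_sq_le[of "f m x - g x" "f n x - g x"] by simp
    qed (use d in auto)
    also have "\<dots> = 2 * (LINT x|M. (norm (f m x - g x))\<^sup>2) + 2 * (LINT x|M. (norm (f n x - g x))\<^sup>2)"
      using d by simp
    also have "\<dots> < e" using N[OF that(1)] N[OF that(2)] by simp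
    finally show ?thesis .
  qed
  then show "\<exists>N. \<forall>m\<ge>N. \<forall>n\<ge>N. (LINT x|M. (norm (f m x - f n x))\<^sup>2) < e" by blast
qed

text \<open>Transfers the Cauchy property from an energy to an \<open>L\<^sup>2\<close> norm that it dominates.\<close>

lemma L2_Cauchy_dominated:
  assumes b: "\<forall>e>0. \<exists>N. \<forall>m\<ge>N. \<forall>n\<ge>N. b m n < e" and C: "C > 0"
    and le: "\<And>m n. (LINT x|M. (norm (f m x - f n x))\<^sup>2) \<le> C * b m n"
  shows "L2_Cauchy M f"
  unfolding L2_Cauchy_def
proof (intro allI impI)
  fix e :: real assume "e > 0"
  then have "e / C > 0" using C by simp
  then obtain N where N: "\<And>m n. m \<ge> N \<Longrightarrow> n \<ge> N \<Longrightarrow> b m n < e / C"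
    using b by metis
  have "(LINT x|M. (norm (f m x - f n x))\<^sup>2) < e" if "m \<ge> N" "n \<ge> N" for m n
    by (rule order.strict_trans1[OF le]) (use N[OF that] C in \<open>simp add: less_divide_eq mult.commute\<close>)
  then show "\<exists>N. \<forall>m\<ge>N. \<forall>n\<ge>N. (LINT x|M. (norm (f m x - f n x))\<^sup>2) < e" by blast
qed

section \<open>The objective\<close>

text \<open>A Caratheodory integrand composed with a simple function is measurable because only finitely many values
  occur; continuity in the second argument passes this to limits.\<close>

lemma integrand_measurable:
  fixes F :: "real^'n \<Rightarrow> real^'n \<Rightarrow> real"
  assumes F: "admissible_integrand \<Omega> F" and u: "u \<in> borel_measurable (lebesgue_on \<Omega>)"
  shows "(\<lambda>x. F x (u x)) \<in> borel_measurable (lebesgue_on \<Omega>)"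
proof -
  obtain s where s: "\<And>i. simple_function (lebesgue_on \<Omega>) (s i)"
    and lim: "\<And>x. x \<in> \<Omega> \<Longrightarrow> (\<lambda>i. s i x) \<longlonglongrightarrow> u x"
    using borel_measurable_implies_sequence_metric[OF u, of 0] by auto
  show ?thesis
  proof (rule borel_measurable_LIMSEQ_metric)
    fix i
    have fin: "finite (s i ` space (lebesgue_on \<Omega>))" using simple_functionD(1)[OF s] .
    show "(\<lambda>x. F x (s i x)) \<in> borel_measurable (lebesgue_on \<Omega>)"
    proof (rule measurable_compose_countable'[where f="\<lambda>v x. F x v"])
      show "s i \<in> lebesgue_on \<Omega> \<rightarrow>\<^sub>M count_space (s i ` space (lebesgue_on \<Omega>))"
        using simple_functionD(2)[OF s] fin by (subst measurable_count_space_eq2) auto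
    qed (use F fin in \<open>auto simp: admissible_integrand_def countable_finite\<close>)
  next
    fix x assume x: "x \<in> space (lebesgue_on \<Omega>)"
    then have "isCont (F x) (u x)"
      using F by (auto simp: admissible_integrand_def continuous_on_eq_continuous_at)
    then show "(\<lambda>i. F x (s i x)) \<longlonglongrightarrow> F x (u x)"
      by (rule isCont_tendsto_compose) (use lim x in simp)
  qed
qed

lemma integrand_integrable:
  assumes F: "admissible_integrand \<Omega> F" and u: "sq_integrable (lebesgue_on \<Omega>) u"
  shows "integrable (lebesgue_on \<Omega>) (\<lambda>x. F x (u x))"
proof -
  obtain c l where l: "integrable (lebesgue_on \<Omega>) l"
    and b: "\<And>x v. x \<in> \<Omega> \<Longrightarrow> \<bar>F x v\<bar> \<le> c * (norm v)\<^sup>2 + l x"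
    using F unfolding admissible_integrand_def by blast
  show ?thesis
  proof (rule Bochner_Integration.integrable_bound)
    show "integrable (lebesgue_on \<Omega>) (\<lambda>x. c * (norm (u x))\<^sup>2 + l x)"
      using l sq_integrableD(2)[OF u] by simp
    show "AE x in lebesgue_on \<Omega>. norm (F x (u x)) \<le> norm (c * (norm (u x))\<^sup>2 + l x)"
      by (rule AE_I2) (auto intro: order_trans[OF b])
  qed (rule integrand_measurable[OF F sq_integrableD(1)[OF u]])
qed

lemma integrand_midpoint:
  assumes F: "admissible_integrand \<Omega> F"
    and u: "sq_integrable (lebesgue_on \<Omega>) u" and v: "sq_integrable (lebesgue_on \<Omega>) v"
  shows "(LINT x|lebesgue_on \<Omega>. F x ((1/2) *\<^sub>R u x + (1/2) *\<^sub>R v x))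
    \<le> ((LINT x|lebesgue_on \<Omega>. F x (u x)) + (LINT x|lebesgue_on \<Omega>. F x (v x))) / 2"
proof -
  have "(LINT x|lebesgue_on \<Omega>. F x ((1/2) *\<^sub>R u x + (1/2) *\<^sub>R v x))
      \<le> (LINT x|lebesgue_on \<Omega>. (1/2) * F x (u x) + (1/2) * F x (v x))"
  proof (rule integral_mono)
    show "integrable (lebesgue_on \<Omega>) (\<lambda>x. F x ((1/2) *\<^sub>R u x + (1/2) *\<^sub>R v x))"
      by (rule integrand_integrable[OF F sq_integrable_lincomb[OF u v]])
    fix x assume "x \<in> space (lebesgue_on \<Omega>)"
    then have "convex_on UNIV (F x)" using F by (auto simp: admissible_integrand_def)
    from convex_onD[OF this, of "1/2" "u x" "v x"]
    show "F x ((1/2) *\<^sub>R u x + (1/2) *\<^sub>R v x) \<le> (1/2) * F x (u x) + (1/2) * F x (v x)" by simp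
  qed (use integrand_integrable[OF F u] integrand_integrable[OF F v] in simp)
  also have "\<dots> = ((LINT x|lebesgue_on \<Omega>. F x (u x)) + (LINT x|lebesgue_on \<Omega>. F x (v x))) / 2"
    using integrand_integrable[OF F u] integrand_integrable[OF F v] by simp
  finally show ?thesis .
qed

text \<open>Fatou's lemma applies to \<open>F(x,u\<^sub>n) + c|u\<^sub>n|\<^sup>2 + l \<ge> 0\<close>, and the added quadratic term converges.\<close>

lemma integrand_lsc:
  assumes F: "admissible_integrand \<Omega> F"
    and s: "\<And>n. sq_integrable (lebesgue_on \<Omega>) (s n)" and u: "sq_integrable (lebesgue_on \<Omega>) u"
    and lim: "(\<lambda>n. LINT x|lebesgue_on \<Omega>. (norm (s n x - u x))\<^sup>2) \<longlonglongrightarrow> 0"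
    and val: "\<And>n. (LINT x|lebesgue_on \<Omega>. F x (s n x)) \<le> \<alpha> n" "\<alpha> \<longlonglongrightarrow> \<alpha>'"
  shows "(LINT x|lebesgue_on \<Omega>. F x (u x)) \<le> \<alpha>'"
proof -
  let ?M = "lebesgue_on \<Omega>"
  obtain c l where l: "integrable ?M l"
    and b: "\<And>x v. x \<in> \<Omega> \<Longrightarrow> \<bar>F x v\<bar> \<le> c * (norm v)\<^sup>2 + l x"
    using F unfolding admissible_integrand_def by blast
  obtain r where r: "strict_mono r" and ae: "AE x in ?M. (\<lambda>n. s (r n) x) \<longlonglongrightarrow> u x"
    by (rule L2_tendsto_imp_AE_subseq[OF s u lim])
  define \<phi> where "\<phi> v x = F x (v x) + c * (norm (v x))\<^sup>2 + l x" for v x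
  have \<phi>0: "0 \<le> \<phi> v x" if "x \<in> \<Omega>" for v x using b[OF that, of "v x"] by (simp add: \<phi>_def)
  have \<phi>i: "integrable ?M (\<phi> v)" if "sq_integrable ?M v" for v
    unfolding \<phi>_def using integrand_integrable[OF F that] l sq_integrableD(2)[OF that] by simp
  have \<phi>v: "(LINT x|?M. \<phi> v x) = (LINT x|?M. F x (v x)) + c * (LINT x|?M. (norm (v x))\<^sup>2) + (LINT x|?M. l x)"
    if "sq_integrable ?M v" for v
    unfolding \<phi>_def using integrand_integrable[OF F that] l sq_integrableD(2)[OF that] by simp
  have \<phi>nn: "(\<integral>\<^sup>+x. ennreal (\<phi> v x) \<partial>?M) = ennreal (LINT x|?M. \<phi> v x)" if "sq_integrable ?M v" for v
    by (rule nn_integral_eq_integral[OF \<phi>i[OF that] AE_I2]) (simp add: \<phi>0)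
  define \<beta> where "\<beta> n = \<alpha> (r n) + c * (LINT x|?M. (norm (s (r n) x))\<^sup>2) + (LINT x|?M. l x)" for n
  have \<beta>: "\<beta> \<longlonglongrightarrow> \<alpha>' + c * (LINT x|?M. (norm (u x))\<^sup>2) + (LINT x|?M. l x)"
    unfolding \<beta>_def
    by (intro tendsto_intros LIMSEQ_subseq_LIMSEQ[OF val(2) r, unfolded comp_def]
         LIMSEQ_subseq_LIMSEQ[OF tendsto_LINT_norm_sq[OF s u lim] r, unfolded comp_def])
  have \<beta>ge: "(LINT x|?M. \<phi> (s (r n)) x) \<le> \<beta> n" for n
    using \<phi>v[OF s, of "r n"] val(1)[of "r n"] by (simp add: \<beta>_def)
  have \<beta>0: "0 \<le> \<beta> n" for n
    by (rule order_trans[OF integral_nonneg_AE[OF AE_I2] \<beta>ge]) (simp add: \<phi>0)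
  have "ennreal (LINT x|?M. \<phi> u x) = (\<integral>\<^sup>+x. ennreal (\<phi> u x) \<partial>?M)" using \<phi>nn[OF u] by simp
  also have "\<dots> \<le> (\<integral>\<^sup>+x. liminf (\<lambda>n. ennreal (\<phi> (s (r n)) x)) \<partial>?M)"
  proof (rule nn_integral_mono_AE)
    show "AE x in ?M. ennreal (\<phi> u x) \<le> liminf (\<lambda>n. ennreal (\<phi> (s (r n)) x))"
      using ae AE_space
    proof eventually_elim
      case (elim x)
      then have "isCont (F x) (u x)"
        using F by (auto simp: admissible_integrand_def continuous_on_eq_continuous_at)
      then have "(\<lambda>n. F x (s (r n) x)) \<longlonglongrightarrow> F x (u x)"
        using elim(1) by (rule isCont_tendsto_compose)
      then have "(\<lambda>n. ennreal (\<phi> (s (r n)) x)) \<longlonglongrightarrow> ennreal (\<phi> u x)"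
        unfolding \<phi>_def by (intro tendsto_ennrealI tendsto_intros elim)
      from lim_imp_Liminf[OF sequentially_bot this] show ?case by simp
    qed
  qed
  also have "\<dots> \<le> liminf (\<lambda>n. \<integral>\<^sup>+x. ennreal (\<phi> (s (r n)) x) \<partial>?M)"
    by (rule nn_integral_liminf) (use borel_measurable_integrable[OF \<phi>i[OF s]] in auto)
  also have "\<dots> \<le> liminf (\<lambda>n. ennreal (\<beta> n))"
    using \<beta>ge by (intro Liminf_mono always_eventually) (auto simp: \<phi>nn[OF s] intro: ennreal_leI)
  also have "\<dots> = ennreal (\<alpha>' + c * (LINT x|?M. (norm (u x))\<^sup>2) + (LINT x|?M. l x))"
    by (rule lim_imp_Liminf[OF sequentially_bot tendsto_ennrealI[OF \<beta>]])
  finally have "(LINT x|?M. \<phi> u x) \<le> \<alpha>' + c * (LINT x|?M. (norm (u x))\<^sup>2) + (LINT x|?M. l x)"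
    using LIMSEQ_le_const[OF \<beta>, of 0] \<beta>0 by (subst (asm) ennreal_le_iff) auto
  with \<phi>v[OF u] show ?thesis by simp
qed

lemma integrand_lower_bound:
  assumes F: "admissible_integrand \<Omega> F"
  obtains c d where "c > 0" "\<And>u. sq_integrable (lebesgue_on \<Omega>) u \<Longrightarrow>
     - c * (LINT x|lebesgue_on \<Omega>. (norm (u x))\<^sup>2) - d \<le> (LINT x|lebesgue_on \<Omega>. F x (u x))"
proof -
  let ?M = "lebesgue_on \<Omega>"
  obtain c l where c: "c > 0" and l: "integrable ?M l"
    and b: "\<And>x v. x \<in> \<Omega> \<Longrightarrow> \<bar>F x v\<bar> \<le> c * (norm v)\<^sup>2 + l x"
    using F unfolding admissible_integrand_def by blast
  have "- c * (LINT x|?M. (norm (u x))\<^sup>2) - (LINT x|?M. l x) \<le> (LINT x|?M. F x (u x))"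
    if u: "sq_integrable ?M u" for u
  proof -
    have "- c * (LINT x|?M. (norm (u x))\<^sup>2) - (LINT x|?M. l x) = (LINT x|?M. - c * (norm (u x))\<^sup>2 - l x)"
      using l sq_integrableD(2)[OF u] by simp
    also have "\<dots> \<le> (LINT x|?M. F x (u x))"
    proof (rule integral_mono)
      fix x assume "x \<in> space ?M"
      then show "- c * (norm (u x))\<^sup>2 - l x \<le> F x (u x)" using b[of x "u x"] by auto
    qed (use l sq_integrableD(2)[OF u] integrand_integrable[OF F u] in auto)
    finally show ?thesis .
  qed
  with c that show thesis by blast
qed

section \<open>Minimization over state-control pairs\<close>

text \<open>States are compared almost everywhere on \<open>D\<close>, controls and the form's coercivity live on \<open>\<Omega>\<close>; the last
  assumption bridges the two. Completeness refers to the energy and to a subsequence, so that it can be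
  verified by pointwise limits.\<close>

locale coercive_form =
  fixes \<Omega> D :: "(real^'n) set" and U :: "(real^'n \<Rightarrow> real^'n) set"
    and B :: "(real^'n \<Rightarrow> real^'n) \<Rightarrow> (real^'n \<Rightarrow> real^'n) \<Rightarrow> real" and C :: real
  assumes U_L2: "u \<in> U \<Longrightarrow> sq_integrable (lebesgue_on \<Omega>) u"
    and zero: "(\<lambda>_. 0) \<in> U"
    and lincomb: "u \<in> U \<Longrightarrow> v \<in> U \<Longrightarrow> (\<lambda>x. c *\<^sub>R u x + d *\<^sub>R v x) \<in> U"
    and B_lincomb: "u \<in> U \<Longrightarrow> v \<in> U \<Longrightarrow> w \<in> U \<Longrightarrow>
      B (\<lambda>x. c *\<^sub>R u x + d *\<^sub>R v x) w = c * B u w + d * B v w"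
    and B_commute: "u \<in> U \<Longrightarrow> v \<in> U \<Longrightarrow> B u v = B v u"
    and C_pos: "0 < C"
    and coercive: "u \<in> U \<Longrightarrow> (LINT x|lebesgue_on \<Omega>. (norm (u x))\<^sup>2) \<le> C * B u u"
    and complete: "(\<And>n. (s :: nat \<Rightarrow> real^'n \<Rightarrow> real^'n) n \<in> U) \<Longrightarrow>
      (\<forall>e>0. \<exists>N. \<forall>m\<ge>N. \<forall>n\<ge>N. B (\<lambda>x. s m x - s n x) (\<lambda>x. s m x - s n x) < e) \<Longrightarrow>
      \<exists>u\<in>U. \<exists>r::nat \<Rightarrow> nat. strict_mono r \<and> (\<lambda>n. B (\<lambda>x. s (r n) x - u x) (\<lambda>x. s (r n) x - u x)) \<longlonglongrightarrow> 0"
    and AE_zero: "u \<in> U \<Longrightarrow> AE x in lebesgue_on \<Omega>. u x = 0 \<Longrightarrow> AE x in lebesgue_on D. u x = 0"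
begin

lemma diff: "u \<in> U \<Longrightarrow> v \<in> U \<Longrightarrow> (\<lambda>x. u x - v x) \<in> U"
  using lincomb[of u v 1 "-1"] by simp

lemma B_diff: "u \<in> U \<Longrightarrow> v \<in> U \<Longrightarrow> w \<in> U \<Longrightarrow> B (\<lambda>x. u x - v x) w = B u w - B v w"
  using B_lincomb[of u v w 1 "-1"] by simp

lemma B_nonneg: "u \<in> U \<Longrightarrow> 0 \<le> B u u"
proof -
  assume u: "u \<in> U"
  have "0 \<le> C * B u u" by (rule order_trans[OF integral_nonneg_AE coercive[OF u]]) auto
  then show ?thesis using C_pos by (simp add: zero_le_mult_iff)
qed

lemma B_Cauchy_Schwarz:
  assumes u: "u \<in> U" and v: "v \<in> U" and "e > 0"
  shows "\<bar>B u v\<bar> \<le> B u u / (2*e) + e / 2 * B v v"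
proof -
  have quad: "0 \<le> B u u + 2 * t * B u v + t\<^sup>2 * B v v" for t
  proof -
    have w: "(\<lambda>x. 1 *\<^sub>R u x + t *\<^sub>R v x) \<in> U" by (rule lincomb[OF u v])
    have "B (\<lambda>x. 1 *\<^sub>R u x + t *\<^sub>R v x) (\<lambda>x. 1 *\<^sub>R u x + t *\<^sub>R v x)
        = 1 * B u (\<lambda>x. 1 *\<^sub>R u x + t *\<^sub>R v x) + t * B v (\<lambda>x. 1 *\<^sub>R u x + t *\<^sub>R v x)"
      by (rule B_lincomb[OF u v w])
    also have "\<dots> = B u u + 2 * t * B u v + t\<^sup>2 * B v v"
      unfolding B_commute[OF u w] B_commute[OF v w] B_lincomb[OF u v u] B_lincomb[OF u v v]
      by (simp add: B_commute[OF v u] power2_eq_square algebra_simps)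
    finally show ?thesis using B_nonneg[OF w] by simp
  qed
  have "\<bar>B u v\<bar> * (2*e) \<le> B u u + e\<^sup>2 * B v v"
    using quad[of e] quad[of "-e"] by (auto simp: abs_if algebra_simps)
  then have "\<bar>B u v\<bar> \<le> (B u u + e\<^sup>2 * B v v) / (2*e)" using \<open>e > 0\<close> by (simp add: le_divide_eq)
  also have "\<dots> = B u u / (2*e) + e / 2 * B v v"
    using \<open>e > 0\<close> by (simp add: power2_eq_square field_simps)
  finally show ?thesis .
qed

lemma tendsto_B:
  assumes s: "\<And>n. s n \<in> U" and u: "u \<in> U" and v: "v \<in> U"
    and lim: "(\<lambda>n. B (\<lambda>x. s n x - u x) (\<lambda>x. s n x - u x)) \<longlonglongrightarrow> 0"
  shows "(\<lambda>n. B (s n) v) \<longlonglongrightarrow> B u v"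
proof (rule LIMSEQ_I)
  fix \<epsilon> :: real assume "\<epsilon> > 0"
  define e where "e = \<epsilon> / (B v v + 1)"
  have e: "e > 0" using \<open>\<epsilon> > 0\<close> B_nonneg[OF v] by (simp add: e_def)
  obtain N where N: "\<And>n. n \<ge> N \<Longrightarrow> \<bar>B (\<lambda>x. s n x - u x) (\<lambda>x. s n x - u x)\<bar> < \<epsilon> * e"
    using LIMSEQ_D[OF lim, of "\<epsilon> * e"] \<open>\<epsilon> > 0\<close> e by auto
  have "norm (B (s n) v - B u v) < \<epsilon>" if "n \<ge> N" for n
  proof -
    have "\<bar>B (s n) v - B u v\<bar> = \<bar>B (\<lambda>x. s n x - u x) v\<bar>" using s u v by (simp add: B_diff)
    also have "\<dots> \<le> B (\<lambda>x. s n x - u x) (\<lambda>x. s n x - u x) / (2*e) + e / 2 * B v v"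
      by (rule B_Cauchy_Schwarz) (use e s u v diff in auto)
    also have "\<dots> < (\<epsilon> * e) / (2*e) + e / 2 * (B v v + 1)"
    proof (rule add_less_le_mono)
      have "B (\<lambda>x. s n x - u x) (\<lambda>x. s n x - u x) < \<epsilon> * e" using N[OF that] by linarith
      then show "B (\<lambda>x. s n x - u x) (\<lambda>x. s n x - u x) / (2*e) < (\<epsilon> * e) / (2*e)"
        by (rule divide_strict_right_mono) (use e in simp)
    qed (use e in simp)
    also have "\<dots> = \<epsilon>"
    proof -
      have "e * (B v v + 1) = \<epsilon>" using B_nonneg[OF v] by (simp add: e_def)
      then show ?thesis using e by simp
    qed
    finally show ?thesis by simp
  qed
  then show "\<exists>N. \<forall>n\<ge>N. norm (B (s n) v - B u v) < \<epsilon>" by blast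
qed

text \<open>The state equation tested with the state itself reads \<open>B u u = \<integral> g \<bullet> u\<close>; with weight \<open>1/C\<close> in
  the additive Cauchy-Schwarz inequality, coercivity absorbs half of the right-hand side.\<close>

lemma state_bound:
  assumes u: "u \<in> U" and g: "sq_integrable (lebesgue_on \<Omega>) g" and eq: "B u u = L2_inner \<Omega> g u"
  shows "B u u \<le> C * (LINT x|lebesgue_on \<Omega>. (norm (g x))\<^sup>2)"
    and "(LINT x|lebesgue_on \<Omega>. (norm (u x))\<^sup>2) \<le> C * (C * (LINT x|lebesgue_on \<Omega>. (norm (g x))\<^sup>2))"
proof -
  let ?M = "lebesgue_on \<Omega>"
  have "B u u = (LINT x|?M. g x \<bullet> u x)" using eq by (simp add: L2_inner_def)
  also have "\<dots> \<le> (LINT x|?M. (norm (g x))\<^sup>2 / (2*(1/C)) + (1/C) / 2 * (norm (u x))\<^sup>2)"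
  proof (rule integral_mono)
    show "g x \<bullet> u x \<le> (norm (g x))\<^sup>2 / (2*(1/C)) + (1/C) / 2 * (norm (u x))\<^sup>2" for x
      using abs_inner_le[of "1/C" "g x" "u x"] C_pos by simp
  qed (use sq_integrable_inner[OF g U_L2[OF u]] sq_integrableD(2)[OF g] sq_integrableD(2)[OF U_L2[OF u]] in auto)
  also have "\<dots> = C / 2 * (LINT x|?M. (norm (g x))\<^sup>2) + (LINT x|?M. (norm (u x))\<^sup>2) / (2 * C)"
    using sq_integrableD(2)[OF g] sq_integrableD(2)[OF U_L2[OF u]] by (simp add: mult.commute)
  also have "\<dots> \<le> C / 2 * (LINT x|?M. (norm (g x))\<^sup>2) + (C * B u u) / (2 * C)"
    using coercive[OF u] C_pos by (intro add_left_mono divide_right_mono) auto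
  also have "\<dots> = C / 2 * (LINT x|?M. (norm (g x))\<^sup>2) + B u u / 2" using C_pos by simp
  finally show *: "B u u \<le> C * (LINT x|?M. (norm (g x))\<^sup>2)" by simp
  show "(LINT x|?M. (norm (u x))\<^sup>2) \<le> C * (C * (LINT x|?M. (norm (g x))\<^sup>2))"
    using coercive[OF u] mult_left_mono[OF * less_imp_le[OF C_pos]] by linarith
qed

text \<open>By \<open>state_bound\<close> applied to differences, states converge along with their controls.\<close>

lemma state_control_pairs_closed:
  assumes q: "\<And>n. (s n, g n) \<in> state_control_pairs \<Omega> B U Z"
    and g: "\<And>n. sq_integrable (lebesgue_on \<Omega>) (g n)" and g': "sq_integrable (lebesgue_on \<Omega>) g'" "g' \<in> Z"
    and lim: "(\<lambda>n. LINT x|lebesgue_on \<Omega>. (norm (g n x - g' x))\<^sup>2) \<longlonglongrightarrow> 0"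
  obtains r u where "strict_mono r" "(u, g') \<in> state_control_pairs \<Omega> B U Z"
    "(\<lambda>n. LINT x|lebesgue_on \<Omega>. (norm (s (r n) x - u x))\<^sup>2) \<longlonglongrightarrow> 0"
proof -
  let ?M = "lebesgue_on \<Omega>"
  have s: "s n \<in> U" and eq: "v \<in> U \<Longrightarrow> B (s n) v = L2_inner \<Omega> (g n) v" for n v
    using q by (auto simp: state_control_pairs_def)
  have bd: "B (\<lambda>x. s m x - s n x) (\<lambda>x. s m x - s n x) \<le> C * (LINT x|?M. (norm (g m x - g n x))\<^sup>2)" for m n
  proof (rule state_bound(1))
    have d: "(\<lambda>x. s m x - s n x) \<in> U" using s by (intro diff)
    show "B (\<lambda>x. s m x - s n x) (\<lambda>x. s m x - s n x) = L2_inner \<Omega> (\<lambda>x. g m x - g n x) (\<lambda>x. s m x - s n x)"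
      unfolding B_diff[OF s s d] eq[OF d] L2_inner_def inner_diff_left
      by (intro Bochner_Integration.integral_diff[symmetric] sq_integrable_inner g U_L2 d)
  qed (use s diff g in \<open>auto intro: sq_integrable_diff\<close>)
  have "L2_Cauchy ?M g" by (rule L2_Cauchy_of_tendsto[OF g g'(1) lim])
  then have "\<forall>e>0. \<exists>N. \<forall>m\<ge>N. \<forall>n\<ge>N. B (\<lambda>x. s m x - s n x) (\<lambda>x. s m x - s n x) < e"
  proof (intro allI impI)
    fix e :: real assume "e > 0"
    then have "e / C > 0" using C_pos by simp
    then obtain N where N: "\<And>m n. m \<ge> N \<Longrightarrow> n \<ge> N \<Longrightarrow> (LINT x|?M. (norm (g m x - g n x))\<^sup>2) < e / C"
      using \<open>L2_Cauchy ?M g\<close> unfolding L2_Cauchy_def by metis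
    have "B (\<lambda>x. s m x - s n x) (\<lambda>x. s m x - s n x) < e" if "m \<ge> N" "n \<ge> N" for m n
    proof -
      have "C * (LINT x|?M. (norm (g m x - g n x))\<^sup>2) < e"
        using N[OF that] C_pos by (simp add: less_divide_eq mult.commute)
      with bd[of m n] show ?thesis by linarith
    qed
    then show "\<exists>N. \<forall>m\<ge>N. \<forall>n\<ge>N. B (\<lambda>x. s m x - s n x) (\<lambda>x. s m x - s n x) < e" by blast
  qed
  from complete[OF s this] obtain u r where u: "u \<in> U" and r: "strict_mono r"
    and Blim: "(\<lambda>n. B (\<lambda>x. s (r n) x - u x) (\<lambda>x. s (r n) x - u x)) \<longlonglongrightarrow> 0" by blast
  have "B u v = L2_inner \<Omega> g' v" if v: "v \<in> U" for v
  proof (rule LIMSEQ_unique)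
    show "(\<lambda>n. B (s (r n)) v) \<longlonglongrightarrow> B u v" by (rule tendsto_B[OF s u v Blim])
    have "(\<lambda>n. L2_inner \<Omega> (g n) v) \<longlonglongrightarrow> L2_inner \<Omega> g' v"
      unfolding L2_inner_def by (rule tendsto_LINT_inner[OF g g'(1) U_L2[OF v] lim])
    from LIMSEQ_subseq_LIMSEQ[OF this r]
    show "(\<lambda>n. B (s (r n)) v) \<longlonglongrightarrow> L2_inner \<Omega> g' v" by (simp add: eq[OF v] comp_def)
  qed
  then have "(u, g') \<in> state_control_pairs \<Omega> B U Z" using u g' by (simp add: state_control_pairs_def)
  moreover have "(\<lambda>n. LINT x|?M. (norm (s (r n) x - u x))\<^sup>2) \<longlonglongrightarrow> 0"
  proof (rule tendsto_sandwich[OF _ _ tendsto_const])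
    show "(\<lambda>n. C * B (\<lambda>x. s (r n) x - u x) (\<lambda>x. s (r n) x - u x)) \<longlonglongrightarrow> 0"
      using tendsto_mult_left[OF Blim, of C] by simp
  qed (auto intro!: always_eventually coercive diff s u)
  ultimately show thesis using r that by blast
qed

text \<open>The midpoint of two feasible pairs is feasible, and there the objective lies below the average of
  the two values by a quarter of \<open>\<integral>\<Gamma>|g - g'|\<^sup>2\<close>. So the controls of a minimizing sequence form
  a Cauchy sequence in \<open>L\<^sup>2(\<Gamma> dx)\<close>; since \<open>\<Gamma> > 0\<close> and the controls are uniformly bounded, a subsequence
  converges almost everywhere and in \<open>L\<^sup>2\<close>.\<close>

lemma unique_minimizer_state_control:
  fixes F :: "real^'n \<Rightarrow> real^'n \<Rightarrow> real" and \<Gamma> :: "real^'n \<Rightarrow> real"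
  assumes fin: "finite_measure (lebesgue_on \<Omega>)"
    and Z_meas: "\<And>g. g \<in> Z \<Longrightarrow> g \<in> borel_measurable (lebesgue_on \<Omega>)"
    and Z_bd: "\<And>g. g \<in> Z \<Longrightarrow> AE x in lebesgue_on \<Omega>. norm (g x) \<le> K"
    and Z_0: "(\<lambda>_. 0) \<in> Z"
    and Z_mid: "\<And>g g'. g \<in> Z \<Longrightarrow> g' \<in> Z \<Longrightarrow> (\<lambda>x. (1/2) *\<^sub>R g x + (1/2) *\<^sub>R g' x) \<in> Z"
    and Z_lim: "\<And>g. (\<And>n. g n \<in> Z) \<Longrightarrow> AE x in lebesgue_on \<Omega>. convergent (\<lambda>n. g n x) \<Longrightarrow>
       (\<lambda>x. lim (\<lambda>n. g n x)) \<in> Z"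
    and \<Gamma>: "integrable (lebesgue_on \<Omega>) \<Gamma>" "AE x in lebesgue_on \<Omega>. \<Gamma> x > 0"
    and F: "admissible_integrand \<Omega> F"
  shows "unique_minimizer D \<Omega> (objective \<Omega> F \<Gamma>) (state_control_pairs \<Omega> B U Z)"
proof -
  let ?M = "lebesgue_on \<Omega>"
  let ?P = "state_control_pairs \<Omega> B U Z"
  let ?J = "objective \<Omega> F \<Gamma>"
  interpret finite_measure ?M by fact
  have \<Gamma>m[measurable]: "\<Gamma> \<in> borel_measurable ?M" using \<Gamma>(1) by auto
  have sqZ: "sq_integrable ?M g" if "g \<in> Z" for g
    by (rule sq_integrable_bound[where w="\<lambda>_. K\<^sup>2"])
       (use Z_meas[OF that] Z_bd[OF that] in \<open>auto elim!: eventually_mono intro!: power_mono\<close>)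
  have K2: "AE x in ?M. (norm (g x))\<^sup>2 \<le> K\<^sup>2" if "g \<in> Z" for g
    using Z_bd[OF that] by eventually_elim (auto intro!: power_mono)
  have \<Gamma>int: "integrable ?M (\<lambda>x. \<Gamma> x * (norm (h x))\<^sup>2)"
    if h: "h \<in> borel_measurable ?M" and b: "AE x in ?M. (norm (h x))\<^sup>2 \<le> k" for h :: "real^'n \<Rightarrow> real^'n" and k
  proof (rule Bochner_Integration.integrable_bound)
    show "integrable ?M (\<lambda>x. k * \<Gamma> x)" using \<Gamma> by simp
    show "AE x in ?M. norm (\<Gamma> x * (norm (h x))\<^sup>2) \<le> norm (k * \<Gamma> x)"
      using b by eventually_elim
        (auto simp: abs_mult mult.commute[of "\<bar>\<Gamma> _\<bar>"] intro!: mult_right_mono)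
  qed (use h in simp)
  have \<Gamma>Z: "integrable ?M (\<lambda>x. \<Gamma> x * (norm (g x))\<^sup>2)" if "g \<in> Z" for g
    by (rule \<Gamma>int[OF Z_meas[OF that] K2[OF that]])
  have \<Gamma>0: "0 \<le> (LINT x|?M. \<Gamma> x * (norm (h x))\<^sup>2)" for h :: "real^'n \<Rightarrow> real^'n"
    by (rule integral_nonneg_AE) (use \<Gamma>(2) in \<open>auto elim!: eventually_mono\<close>)
  have \<Gamma>diff: "integrable ?M (\<lambda>x. \<Gamma> x * (norm (g x - g' x))\<^sup>2)" if "g \<in> Z" "g' \<in> Z" for g g'
  proof (rule \<Gamma>int)
    show "AE x in ?M. (norm (g x - g' x))\<^sup>2 \<le> 4 * K\<^sup>2"
      using K2[OF that(1)] K2[OF that(2)]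
    proof eventually_elim
      case (elim x)
      then show ?case using norm_diff_sq_le[of "g x" "g' x"] by simp
    qed
  qed (use that Z_meas in auto)
  have PD: "u \<in> U" "g \<in> Z" "\<And>v. v \<in> U \<Longrightarrow> B u v = L2_inner \<Omega> g v" if "(u, g) \<in> ?P" for u g
    using that by (auto simp: state_control_pairs_def)
  have mid: "(\<lambda>x. (1/2) *\<^sub>R u x + (1/2) *\<^sub>R u' x, \<lambda>x. (1/2) *\<^sub>R g x + (1/2) *\<^sub>R g' x) \<in> ?P"
    if p: "(u, g) \<in> ?P" "(u', g') \<in> ?P" for u g u' g'
  proof -
    have "B (\<lambda>x. (1/2) *\<^sub>R u x + (1/2) *\<^sub>R u' x) v = L2_inner \<Omega> (\<lambda>x. (1/2) *\<^sub>R g x + (1/2) *\<^sub>R g' x) v"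
      if v: "v \<in> U" for v
      unfolding B_lincomb[OF PD(1)[OF p(1)] PD(1)[OF p(2)] v] PD(3)[OF p(1) v] PD(3)[OF p(2) v]
      using sq_integrable_inner[OF sqZ[OF PD(2)[OF p(1)]] U_L2[OF v]]
        sq_integrable_inner[OF sqZ[OF PD(2)[OF p(2)]] U_L2[OF v]]
      by (simp add: L2_inner_def inner_add_left)
    then show ?thesis using PD[OF p(1)] PD[OF p(2)]
      by (auto simp: state_control_pairs_def intro!: lincomb Z_mid)
  qed
  have gap: "?J (\<lambda>x. (1/2) *\<^sub>R u x + (1/2) *\<^sub>R u' x) (\<lambda>x. (1/2) *\<^sub>R g x + (1/2) *\<^sub>R g' x)
      \<le> (?J u g + ?J u' g') / 2 - (LINT x|?M. \<Gamma> x * (norm (g x - g' x))\<^sup>2) / 4"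
    if p: "(u, g) \<in> ?P" "(u', g') \<in> ?P" for u g u' g'
  proof -
    have arith: "x + y \<le> (p + r + (q + s)) / 2 - z / 4"
      if "x \<le> (p + q) / 2" "y = (r + s) / 2 - z / 4" for x y z p q r s :: real
      using that by (simp add: field_simps)
    have par: "\<Gamma> x * (norm ((1/2) *\<^sub>R g x + (1/2) *\<^sub>R g' x))\<^sup>2 =
       (1/2) * (\<Gamma> x * (norm (g x))\<^sup>2) + (1/2) * (\<Gamma> x * (norm (g' x))\<^sup>2) - (1/4) * (\<Gamma> x * (norm (g x - g' x))\<^sup>2)" for x
      by (simp add: power2_norm_eq_inner algebra_simps inner_commute)
    have "(LINT x|?M. \<Gamma> x * (norm ((1/2) *\<^sub>R g x + (1/2) *\<^sub>R g' x))\<^sup>2)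
      = ((LINT x|?M. \<Gamma> x * (norm (g x))\<^sup>2) + (LINT x|?M. \<Gamma> x * (norm (g' x))\<^sup>2)) / 2
        - (LINT x|?M. \<Gamma> x * (norm (g x - g' x))\<^sup>2) / 4"
      unfolding par using \<Gamma>Z[OF PD(2)[OF p(1)]] \<Gamma>Z[OF PD(2)[OF p(2)]] \<Gamma>diff[OF PD(2)[OF p(1)] PD(2)[OF p(2)]]
      by simp
    with integrand_midpoint[OF F U_L2[OF PD(1)[OF p(1)]] U_L2[OF PD(1)[OF p(2)]]]
    show ?thesis
      unfolding objective_def using arith by blast
  qed
  obtain c d where c: "c > 0" and low: "\<And>u. sq_integrable ?M u \<Longrightarrow>
     - c * (LINT x|?M. (norm (u x))\<^sup>2) - d \<le> (LINT x|?M. F x (u x))"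
    by (rule integrand_lower_bound[OF F]) auto
  (* The controls are bounded by K, hence the states by state_bound, hence the objective from below. *)
  define m0 where "m0 = - c * (C * (C * (LINT x|?M. K\<^sup>2))) - d"
  have Jlow: "m0 \<le> ?J u g" if p: "(u, g) \<in> ?P" for u g
  proof -
    have "(LINT x|?M. (norm (g x))\<^sup>2) \<le> (LINT x|?M. K\<^sup>2)"
      by (rule integral_mono_AE) (use K2[OF PD(2)[OF p]] sq_integrableD(2)[OF sqZ[OF PD(2)[OF p]]] in auto)
    then have "C * (C * (LINT x|?M. (norm (g x))\<^sup>2)) \<le> C * (C * (LINT x|?M. K\<^sup>2))"
      using C_pos by (intro mult_left_mono) auto
    with state_bound(2)[OF PD(1)[OF p] sqZ[OF PD(2)[OF p]] PD(3)[OF p PD(1)[OF p]]]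
    have "(LINT x|?M. (norm (u x))\<^sup>2) \<le> C * (C * (LINT x|?M. K\<^sup>2))" by linarith
    then have "- c * (C * (C * (LINT x|?M. K\<^sup>2))) \<le> - c * (LINT x|?M. (norm (u x))\<^sup>2)"
      using c by simp
    then show ?thesis using low[OF U_L2[OF PD(1)[OF p]]] \<Gamma>0[of g] by (simp add: objective_def m0_def)
  qed
  define V where "V = (\<lambda>(u, g). ?J u g) ` ?P"
  have "B (\<lambda>_. 0) v = L2_inner \<Omega> (\<lambda>_. 0) v" if "v \<in> U" for v
    using B_diff[OF zero zero that] by (simp add: L2_inner_def)
  then have P0: "((\<lambda>_. 0), (\<lambda>_. 0)) \<in> ?P" using zero Z_0 by (simp add: state_control_pairs_def)
  have V: "V \<noteq> {}" "bdd_below V" using P0 Jlow by (auto simp: V_def intro!: bdd_belowI[of _ m0])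
  define m where "m = Inf V"
  have m: "m \<le> ?J u g" if "(u, g) \<in> ?P" for u g
    unfolding m_def by (rule cInf_lower[OF _ V(2)]) (use that in \<open>auto simp: V_def\<close>)
  have gapm: "(LINT x|?M. \<Gamma> x * (norm (g x - g' x))\<^sup>2) \<le> 2 * (?J u g - m) + 2 * (?J u' g' - m)"
    if p: "(u, g) \<in> ?P" "(u', g') \<in> ?P" for u g u' g'
    using order_trans[OF m[OF mid[OF p]] gap[OF p]] by (simp add: field_simps)
  have "\<forall>n. \<exists>u g. (u, g) \<in> ?P \<and> ?J u g < m + 1 / Suc n"
  proof
    fix n
    have "\<exists>v\<in>V. v < m + 1 / Suc n"
      using cInf_lessD[OF V(1), of "m + 1 / Suc n"] by (simp add: m_def)
    then show "\<exists>u g. (u, g) \<in> ?P \<and> ?J u g < m + 1 / Suc n" by (auto simp: V_def)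
  qed
  then obtain s g where P: "\<And>n. (s n, g n) \<in> ?P" and J: "\<And>n. ?J (s n) (g n) < m + 1 / Suc n" by metis
  have gZ: "g n \<in> Z" for n using PD(2)[OF P] .
  define e where "e n = ?J (s n) (g n) - m" for n
  have e0: "e \<longlonglongrightarrow> 0"
  proof (rule tendsto_sandwich[OF _ _ tendsto_const])
    show "\<forall>\<^sub>F n in sequentially. e n \<le> 1 / Suc n"
    proof (rule always_eventually, rule allI)
      show "e n \<le> 1 / Suc n" for n using J[of n] unfolding e_def by linarith
    qed
    show "(\<lambda>n. 1 / real (Suc n)) \<longlonglongrightarrow> 0" by (rule LIMSEQ_Suc[OF lim_1_over_n])
  qed (use m[OF P] in \<open>auto simp: e_def\<close>)
  (* Weighting with sqrt \<Gamma> turns convergence in L^2(\<Gamma> dx) into convergence in L^2(dx). *)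
  define f where "f n x = sqrt (\<Gamma> x) *\<^sub>R g n x" for n x
  have fsq: "AE x in ?M. (norm (f n x))\<^sup>2 = \<Gamma> x * (norm (g n x))\<^sup>2" for n
    using \<Gamma>(2) by eventually_elim (simp add: f_def power_mult_distrib)
  have gm[measurable]: "g n \<in> borel_measurable ?M" for n using Z_meas[OF gZ] .
  have fm[measurable]: "f n \<in> borel_measurable ?M" for n unfolding f_def by measurable
  have fi: "sq_integrable ?M (f n)" for n
    by (rule sq_integrable_bound[OF fm \<Gamma>Z[OF gZ[of n]]]) (use fsq[of n] in \<open>auto elim!: eventually_mono\<close>)
  have fd: "(LINT x|?M. (norm (f i x - f j x))\<^sup>2) \<le> 2 * e i + 2 * e j" for i j
  proof -
    have "(LINT x|?M. (norm (f i x - f j x))\<^sup>2) = (LINT x|?M. \<Gamma> x * (norm (g i x - g j x))\<^sup>2)"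
    proof (rule integral_cong_AE)
      show "AE x in ?M. (norm (f i x - f j x))\<^sup>2 = \<Gamma> x * (norm (g i x - g j x))\<^sup>2"
        using \<Gamma>(2) by eventually_elim (simp add: f_def power_mult_distrib flip: scaleR_diff_right)
    qed measurable
    with gapm[OF P P, of i j] show ?thesis by (simp add: e_def)
  qed
  have "L2_Cauchy ?M f"
    unfolding L2_Cauchy_def
  proof (intro allI impI)
    fix \<epsilon> :: real assume "\<epsilon> > 0"
    then obtain N where N: "\<And>n. n \<ge> N \<Longrightarrow> e n < \<epsilon> / 4"
      using order_tendstoD(2)[OF e0, of "\<epsilon>/4"] by (auto simp: eventually_sequentially)
    have "(LINT x|?M. (norm (f i x - f j x))\<^sup>2) < \<epsilon>" if "i \<ge> N" "j \<ge> N" for i j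
      using fd[of i j] N[OF that(1)] N[OF that(2)] by linarith
    then show "\<exists>N. \<forall>i\<ge>N. \<forall>j\<ge>N. (LINT x|?M. (norm (f i x - f j x))\<^sup>2) < \<epsilon>" by blast
  qed
  then obtain r G where r: "strict_mono r" and "sq_integrable ?M G"
    and fae: "AE x in ?M. (\<lambda>n. f (r n) x) \<longlonglongrightarrow> G x"
    and "(\<lambda>n. LINT x|?M. (norm (f n x - G x))\<^sup>2) \<longlonglongrightarrow> 0"
    by (rule L2_complete[OF fi])
  have conv: "AE x in ?M. convergent (\<lambda>n. g (r n) x)"
    using fae \<Gamma>(2)
  proof eventually_elim
    case (elim x)
    then have "(\<lambda>n. (1 / sqrt (\<Gamma> x)) *\<^sub>R f (r n) x) \<longlonglongrightarrow> (1 / sqrt (\<Gamma> x)) *\<^sub>R G x"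
      by (intro tendsto_intros)
    moreover have "(1 / sqrt (\<Gamma> x)) *\<^sub>R f (r n) x = g (r n) x" for n
      using elim(2) by (simp add: f_def)
    ultimately show ?case by (auto simp: convergent_def)
  qed
  define g' where "g' x = lim (\<lambda>n. g (r n) x)" for x
  have g'Z: "g' \<in> Z" unfolding g'_def by (rule Z_lim[OF gZ conv])
  have [measurable]: "g' \<in> borel_measurable ?M" using Z_meas[OF g'Z] .
  have gae: "AE x in ?M. (\<lambda>n. g (r n) x) \<longlonglongrightarrow> g' x"
    using conv by eventually_elim (simp add: g'_def convergent_LIMSEQ_iff)
  have glim: "(\<lambda>n. LINT x|?M. (norm (g (r n) x - g' x))\<^sup>2) \<longlonglongrightarrow> (LINT x|?M. 0)"
  proof (rule integral_dominated_convergence[where w="\<lambda>_. 4 * K\<^sup>2"])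
    show "AE x in ?M. (\<lambda>n. (norm (g (r n) x - g' x))\<^sup>2) \<longlonglongrightarrow> 0"
      using gae
    proof eventually_elim
      case (elim x)
      then have "(\<lambda>n. (norm (g (r n) x - g' x))\<^sup>2) \<longlonglongrightarrow> (norm (g' x - g' x))\<^sup>2" by (intro tendsto_intros)
      then show ?case by simp
    qed
    show "AE x in ?M. norm ((norm (g (r n) x - g' x))\<^sup>2) \<le> 4 * K\<^sup>2" for n
      using K2[OF gZ[of "r n"]] K2[OF g'Z]
    proof eventually_elim
      case (elim x)
      then show ?case using norm_diff_sq_le[of "g (r n) x" "g' x"] by simp
    qed
  qed auto
  have Glim: "(\<lambda>n. LINT x|?M. \<Gamma> x * (norm (g (r n) x))\<^sup>2) \<longlonglongrightarrow> (LINT x|?M. \<Gamma> x * (norm (g' x))\<^sup>2)"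
  proof (rule integral_dominated_convergence[where w="\<lambda>x. K\<^sup>2 * \<Gamma> x"])
    show "AE x in ?M. (\<lambda>n. \<Gamma> x * (norm (g (r n) x))\<^sup>2) \<longlonglongrightarrow> \<Gamma> x * (norm (g' x))\<^sup>2"
      using gae by eventually_elim (intro tendsto_intros)
    show "AE x in ?M. norm (\<Gamma> x * (norm (g (r n) x))\<^sup>2) \<le> K\<^sup>2 * \<Gamma> x" for n
      using K2[OF gZ[of "r n"]] \<Gamma>(2) by eventually_elim (auto simp: mult.commute[of "\<Gamma> _"] intro!: mult_right_mono)
  qed (use \<Gamma>(1) in auto)
  obtain r' u where r': "strict_mono r'" and p: "(u, g') \<in> ?P"
    and ulim: "(\<lambda>n. LINT x|?M. (norm (s (r (r' n)) x - u x))\<^sup>2) \<longlonglongrightarrow> 0"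
    by (rule state_control_pairs_closed[of "\<lambda>n. s (r n)" "\<lambda>n. g (r n)", OF P sqZ[OF gZ] sqZ[OF g'Z] g'Z])
       (use glim in auto)
  have "(LINT x|?M. F x (u x)) \<le> m - (LINT x|?M. \<Gamma> x * (norm (g' x))\<^sup>2)"
  proof (rule integrand_lsc[OF F _ _ ulim])
    have "(\<lambda>n. m + e n) \<longlonglongrightarrow> m + 0" by (intro tendsto_intros e0)
    then have "(\<lambda>n. m + e (r n)) \<longlonglongrightarrow> m" using LIMSEQ_subseq_LIMSEQ[OF _ r] by (fastforce simp: comp_def)
    then have "(\<lambda>n. m + e (r n) - (LINT x|?M. \<Gamma> x * (norm (g (r n) x))\<^sup>2)) \<longlonglongrightarrow> m - (LINT x|?M. \<Gamma> x * (norm (g' x))\<^sup>2)"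
      by (intro tendsto_diff Glim)
    from LIMSEQ_subseq_LIMSEQ[OF this r']
    show "(\<lambda>n. m + e (r (r' n)) - (LINT x|?M. \<Gamma> x * (norm (g (r (r' n)) x))\<^sup>2)) \<longlonglongrightarrow> m - (LINT x|?M. \<Gamma> x * (norm (g' x))\<^sup>2)"
      by (simp add: comp_def)
  qed (use U_L2[OF PD(1)[OF P]] U_L2[OF PD(1)[OF p]] in \<open>auto simp: e_def objective_def\<close>)
  then have "?J u g' \<le> m" by (simp add: objective_def)
  then have min: "is_arg_min (\<lambda>(u, g). ?J u g) (\<lambda>q. q \<in> ?P) (u, g')"
    using p m by (fastforce simp: is_arg_min_linorder)
  have "ae_eq D u1 u \<and> ae_eq \<Omega> g1 g'" if min1: "is_arg_min (\<lambda>(u, g). ?J u g) (\<lambda>q. q \<in> ?P) (u1, g1)" for u1 g1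
  proof -
    have p1: "(u1, g1) \<in> ?P" and le: "?J u1 g1 \<le> ?J u g'"
      using min1 p by (auto simp: is_arg_min_linorder)
    have g1Z: "g1 \<in> Z" using PD(2)[OF p1] .
    have "(LINT x|?M. \<Gamma> x * (norm (g1 x - g' x))\<^sup>2) \<le> 0"
      using gapm[OF p1 p] le \<open>?J u g' \<le> m\<close> by (simp add: algebra_simps)
    then have "(LINT x|?M. \<Gamma> x * (norm (g1 x - g' x))\<^sup>2) = 0" using \<Gamma>0[of "\<lambda>x. g1 x - g' x"] by simp
    then have "AE x in ?M. \<Gamma> x * (norm (g1 x - g' x))\<^sup>2 = 0"
      by (subst (asm) integral_nonneg_eq_0_iff_AE) (use \<Gamma>diff[OF g1Z g'Z] \<Gamma>(2) in \<open>auto elim!: eventually_mono\<close>)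
    then have geq: "AE x in ?M. g1 x = g' x" using \<Gamma>(2) by eventually_elim auto
    have uU: "u1 \<in> U" "u \<in> U" using PD(1) p p1 by auto
    have d: "(\<lambda>x. u1 x - u x) \<in> U" by (intro diff uU)
    have "B (\<lambda>x. u1 x - u x) (\<lambda>x. u1 x - u x) = L2_inner \<Omega> g1 (\<lambda>x. u1 x - u x) - L2_inner \<Omega> g' (\<lambda>x. u1 x - u x)"
      unfolding B_diff[OF uU d] PD(3)[OF p d] PD(3)[OF p1 d] ..
    also have "L2_inner \<Omega> g1 (\<lambda>x. u1 x - u x) = L2_inner \<Omega> g' (\<lambda>x. u1 x - u x)"
      unfolding L2_inner_def
      by (rule integral_cong_AE)
         (use geq Z_meas[OF g1Z] sq_integrableD(1)[OF U_L2[OF uU(1)]] sq_integrableD(1)[OF U_L2[OF uU(2)]] in auto)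
    finally have "(LINT x|?M. (norm (u1 x - u x))\<^sup>2) \<le> 0" using coercive[OF d] by simp
    then have "(LINT x|?M. (norm (u1 x - u x))\<^sup>2) = 0" by (simp add: order_antisym)
    then have "AE x in ?M. (norm (u1 x - u x))\<^sup>2 = 0"
      by (subst (asm) integral_nonneg_eq_0_iff_AE) (use sq_integrableD(2)[OF U_L2[OF d]] in auto)
    then have "AE x in lebesgue_on D. u1 x - u x = 0"
      by (intro AE_zero[OF d]) auto
    with geq show ?thesis by (simp add: ae_eq_def)
  qed
  with min show ?thesis unfolding unique_minimizer_def by blast
qed

end

section \<open>Translations and Poincare's inequality\<close>

lemma nn_integral_lborel_translation:
  fixes f :: "'a::euclidean_space \<Rightarrow> ennreal"
  assumes [measurable]: "f \<in> borel_measurable borel"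
  shows "(\<integral>\<^sup>+x. f (x + c) \<partial>lborel) = (\<integral>\<^sup>+x. f x \<partial>lborel)"
proof -
  have "(\<integral>\<^sup>+x. f x \<partial>lborel) = (\<integral>\<^sup>+x. f x \<partial>distr lborel borel ((+) c))"
    by (simp add: lborel_distr_plus)
  also have "\<dots> = (\<integral>\<^sup>+x. f (c + x) \<partial>lborel)" by (rule nn_integral_distr) auto
  finally show ?thesis by (simp add: add.commute)
qed

text \<open>After \<open>N\<close> steps the translate of \<open>f\<close> no longer meets \<open>f\<close>, so the squared distance of the two
  is \<open>2\<integral>f\<^sup>2\<close>; each single step costs at most the right-hand integral.\<close>

lemma shift_Poincare:
  fixes f :: "'a::euclidean_space \<Rightarrow> real"
  assumes [measurable]: "f \<in> borel_measurable borel"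
    and sep: "\<And>x. f x = 0 \<or> f (x + real N *\<^sub>R \<xi>) = 0"
  shows "2 * (\<integral>\<^sup>+x. ennreal ((f x)\<^sup>2) \<partial>lborel)
     \<le> ennreal ((real N)\<^sup>2) * (\<integral>\<^sup>+x. ennreal ((f (x + \<xi>) - f x)\<^sup>2) \<partial>lborel)"
proof -
  define d where "d x = f (x + \<xi>) - f x" for x
  have [measurable]: "d \<in> borel_measurable borel" unfolding d_def by measurable
  have tel: "(\<Sum>j<N. d (x + real j *\<^sub>R \<xi>)) = f (x + real N *\<^sub>R \<xi>) - f x" for x
    using sum_lessThan_telescope[of "\<lambda>j. f (x + real j *\<^sub>R \<xi>)" N]
    by (simp add: d_def algebra_simps)
  have "2 * (\<integral>\<^sup>+x. ennreal ((f x)\<^sup>2) \<partial>lborel)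
      = (\<integral>\<^sup>+x. ennreal ((f (x + real N *\<^sub>R \<xi>))\<^sup>2) \<partial>lborel) + (\<integral>\<^sup>+x. ennreal ((f x)\<^sup>2) \<partial>lborel)"
    using nn_integral_lborel_translation[of "\<lambda>x. ennreal ((f x)\<^sup>2)" "real N *\<^sub>R \<xi>"] by (simp add: mult_2)
  also have "\<dots> = (\<integral>\<^sup>+x. ennreal ((f (x + real N *\<^sub>R \<xi>))\<^sup>2) + ennreal ((f x)\<^sup>2) \<partial>lborel)"
    by (rule nn_integral_add[symmetric]) auto
  also have "\<dots> = (\<integral>\<^sup>+x. ennreal ((\<Sum>j<N. d (x + real j *\<^sub>R \<xi>))\<^sup>2) \<partial>lborel)"
  proof (rule nn_integral_cong)
    fix x
    have "(f (x + real N *\<^sub>R \<xi>) - f x)\<^sup>2 = (f (x + real N *\<^sub>R \<xi>))\<^sup>2 + (f x)\<^sup>2"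
      using sep[of x] by (auto simp: power2_eq_square algebra_simps)
    then show "ennreal ((f (x + real N *\<^sub>R \<xi>))\<^sup>2) + ennreal ((f x)\<^sup>2)
        = ennreal ((\<Sum>j<N. d (x + real j *\<^sub>R \<xi>))\<^sup>2)"
      by (simp add: tel)
  qed
  also have "\<dots> \<le> (\<integral>\<^sup>+x. (\<Sum>j<N. ennreal N * ennreal ((d (x + real j *\<^sub>R \<xi>))\<^sup>2)) \<partial>lborel)"
  proof (rule nn_integral_mono)
    fix x
    have "(\<Sum>j<N. d (x + real j *\<^sub>R \<xi>))\<^sup>2 \<le> (\<Sum>j<N. (d (x + real j *\<^sub>R \<xi>))\<^sup>2) * card {..<N}"
      by (rule sum_squared_le_sum_of_squares)
    also have "\<dots> = (\<Sum>j<N. real N * (d (x + real j *\<^sub>R \<xi>))\<^sup>2)"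
      by (simp add: sum_distrib_left mult.commute)
    finally have "ennreal ((\<Sum>j<N. d (x + real j *\<^sub>R \<xi>))\<^sup>2) \<le> ennreal (\<Sum>j<N. real N * (d (x + real j *\<^sub>R \<xi>))\<^sup>2)"
      by (rule ennreal_leI)
    also have "\<dots> = (\<Sum>j<N. ennreal N * ennreal ((d (x + real j *\<^sub>R \<xi>))\<^sup>2))"
      by (subst sum_ennreal[symmetric]) (auto simp: ennreal_mult)
    finally show "ennreal ((\<Sum>j<N. d (x + real j *\<^sub>R \<xi>))\<^sup>2) \<le> (\<Sum>j<N. ennreal N * ennreal ((d (x + real j *\<^sub>R \<xi>))\<^sup>2))" .
  qed
  also have "\<dots> = (\<Sum>j<N. \<integral>\<^sup>+x. ennreal N * ennreal ((d (x + real j *\<^sub>R \<xi>))\<^sup>2) \<partial>lborel)"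
    by (rule nn_integral_sum) auto
  also have "\<dots> = (\<Sum>j<N. ennreal N * (\<integral>\<^sup>+x. ennreal ((d x)\<^sup>2) \<partial>lborel))"
  proof (rule sum.cong[OF refl])
    fix j
    have "(\<integral>\<^sup>+x. ennreal N * ennreal ((d (x + real j *\<^sub>R \<xi>))\<^sup>2) \<partial>lborel)
        = ennreal N * (\<integral>\<^sup>+x. ennreal ((d (x + real j *\<^sub>R \<xi>))\<^sup>2) \<partial>lborel)"
      by (rule nn_integral_cmult) auto
    also have "(\<integral>\<^sup>+x. ennreal ((d (x + real j *\<^sub>R \<xi>))\<^sup>2) \<partial>lborel) = (\<integral>\<^sup>+x. ennreal ((d x)\<^sup>2) \<partial>lborel)"
      by (rule nn_integral_lborel_translation[of "\<lambda>x. ennreal ((d x)\<^sup>2)"]) auto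
    finally show "(\<integral>\<^sup>+x. ennreal N * ennreal ((d (x + real j *\<^sub>R \<xi>))\<^sup>2) \<partial>lborel)
        = ennreal N * (\<integral>\<^sup>+x. ennreal ((d x)\<^sup>2) \<partial>lborel)" .
  qed
  also have "\<dots> = ennreal ((real N)\<^sup>2) * (\<integral>\<^sup>+x. ennreal ((d x)\<^sup>2) \<partial>lborel)"
    by (simp add: power2_eq_square ennreal_mult ennreal_of_nat_eq_real_of_nat mult.assoc)
  finally show ?thesis by (simp add: d_def)
qed

text \<open>The number of steps of size \<open>|\<xi>|\<close> needed to pass a distance \<open>R\<close>. The upper bound keeps \<open>N |\<xi>|\<close> bounded
  as \<open>\<xi> \<rightarrow> 0\<close>, which is what makes the constants below independent of the step.\<close>

lemma step_count:
  fixes \<xi> :: "'a::real_normed_vector"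
  assumes "R \<ge> 0" "\<xi> \<noteq> 0"
  obtains N :: nat where "R < real N * norm \<xi>" "real N * norm \<xi> \<le> R + 2 * norm \<xi>"
proof -
  define N where "N = nat \<lfloor>R / norm \<xi>\<rfloor> + 1"
  have n: "norm \<xi> > 0" using assms by simp
  have q: "0 \<le> R / norm \<xi>" using assms by simp
  have "real (nat \<lfloor>R / norm \<xi>\<rfloor>) = of_int \<lfloor>R / norm \<xi>\<rfloor>" using q by simp
  then have "R / norm \<xi> < real N" "real N \<le> R / norm \<xi> + 2"
    unfolding N_def using real_of_int_floor_add_one_gt[of "R / norm \<xi>"] of_int_floor_le[of "R / norm \<xi>"]
    by linarith+
  then have "R < real N * norm \<xi>" "real N * norm \<xi> \<le> (R / norm \<xi> + 2) * norm \<xi>"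
    using n by (auto simp: pos_divide_less_eq intro!: mult_right_mono)
  then show thesis using n by (intro that) (auto simp: distrib_right)
qed

section \<open>Radial kernels\<close>

lemma radial_kernelD:
  fixes \<kappa> :: "real^'n \<Rightarrow> real"
  assumes "radial_kernel \<delta> \<kappa>"
  shows "\<And>\<xi>. 0 \<le> \<kappa> \<xi>" "\<And>\<xi>. \<kappa> (- \<xi>) = \<kappa> \<xi>" "\<And>\<xi>. norm \<xi> \<ge> \<delta> \<Longrightarrow> \<kappa> \<xi> = 0"
  using assms by (auto simp: radial_kernel_def)

text \<open>Integrability gives Lebesgue measurability. Borel measurability, which passes to \<open>(x, y) \<mapsto> \<kappa>(x - y)\<close> by
  composition, comes from monotonicity of the profile \<open>\<rho>(r)/r\<^sup>2\<close>.\<close>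

lemma radial_kernel_borel:
  fixes \<kappa> :: "real^'n \<Rightarrow> real"
  assumes "radial_kernel \<delta> \<kappa>"
  shows "\<kappa> \<in> borel_measurable borel"
proof -
  obtain \<rho> where \<rho>: "\<And>\<xi>. \<kappa> \<xi> = \<rho> (norm \<xi>)"
    and dec: "\<And>r s. 0 < r \<Longrightarrow> r \<le> s \<Longrightarrow> \<rho> s / s\<^sup>2 \<le> \<rho> r / r\<^sup>2"
    using assms unfolding radial_kernel_def by blast
  have "mono_on {0<..} (\<lambda>r. - (\<rho> r / r\<^sup>2))" by (auto simp: monotone_on_def dec)
  from borel_measurable_mono_on_fnc[OF this]
  have m[measurable]: "(\<lambda>r. indicator {0<..} r *\<^sub>R - (\<rho> r / r\<^sup>2)) \<in> borel_measurable borel"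
    by (subst (asm) borel_measurable_restrict_space_iff) auto
  have "\<kappa> = (\<lambda>\<xi>. if \<xi> = 0 then \<kappa> 0 else - ((indicator {0<..} (norm \<xi>) *\<^sub>R - (\<rho> (norm \<xi>) / (norm \<xi>)\<^sup>2)) * (norm \<xi>)\<^sup>2))"
    by (auto simp: fun_eq_iff \<rho>)
  also have "\<dots> \<in> borel_measurable borel" by measurable
  finally show ?thesis .
qed

lemma radial_kernel_integral:
  fixes \<kappa> :: "real^'n \<Rightarrow> real"
  assumes "radial_kernel \<delta> \<kappa>"
  shows "integrable lborel \<kappa>" "(LINT \<xi>|lborel. \<kappa> \<xi>) = 1"
  using assms radial_kernel_borel[OF assms]
  by (auto simp: radial_kernel_def integrable_completion integral_completion)

text \<open>The quadratic form \<open>v \<mapsto> \<integral> \<kappa>(\<xi>) (v \<bullet> \<xi>/|\<xi>|)\<^sup>2 d\<xi>\<close> is continuous and vanishes only at \<open>0\<close>, because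
  hyperplanes are null sets; so it is bounded below on the unit sphere.\<close>

lemma kernel_form_coercive:
  fixes \<kappa> :: "real^'n \<Rightarrow> real"
  assumes \<kappa>: "radial_kernel \<delta> \<kappa>"
  obtains q where "q > 0" "\<And>v. q * (norm v)\<^sup>2 \<le> (LINT \<xi>|lborel. \<kappa> \<xi> * (v \<bullet> sgn \<xi>)\<^sup>2)"
    "\<And>v. integrable lborel (\<lambda>\<xi>. \<kappa> \<xi> * (v \<bullet> sgn \<xi>)\<^sup>2)"
proof -
  note k0 = radial_kernelD(1)[OF \<kappa>]
  have [measurable]: "\<kappa> \<in> borel_measurable borel" by (rule radial_kernel_borel[OF \<kappa>])
  have [measurable]: "(sgn :: real^'n \<Rightarrow> real^'n) \<in> borel_measurable borel"
    unfolding sgn_div_norm[abs_def] by measurable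
  define Q where "Q v = (LINT \<xi>|lborel. \<kappa> \<xi> * (v \<bullet> sgn \<xi>)\<^sup>2)" for v
  have le: "(v \<bullet> sgn \<xi>)\<^sup>2 \<le> (norm v)\<^sup>2" for v \<xi> :: "real^'n"
  proof -
    have "\<bar>v \<bullet> sgn \<xi>\<bar> \<le> norm v * norm (sgn \<xi>)" by (rule Cauchy_Schwarz_ineq2)
    also have "\<dots> \<le> norm v" by (simp add: norm_sgn)
    finally show ?thesis using power_mono[of "\<bar>v \<bullet> sgn \<xi>\<bar>" "norm v" 2] by simp
  qed
  have bd: "norm (\<kappa> \<xi> * (v \<bullet> sgn \<xi>)\<^sup>2) \<le> (norm v)\<^sup>2 * \<kappa> \<xi>" for v \<xi>
    using le[of v \<xi>] k0[of \<xi>] by (simp add: abs_mult mult.commute mult_left_mono)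
  have int: "integrable lborel (\<lambda>\<xi>. \<kappa> \<xi> * (v \<bullet> sgn \<xi>)\<^sup>2)" for v
  proof (rule Bochner_Integration.integrable_bound)
    show "integrable lborel (\<lambda>\<xi>. (norm v)\<^sup>2 * \<kappa> \<xi>)"
      using radial_kernel_integral(1)[OF \<kappa>] by simp
    show "AE \<xi> in lborel. norm (\<kappa> \<xi> * (v \<bullet> sgn \<xi>)\<^sup>2) \<le> norm ((norm v)\<^sup>2 * \<kappa> \<xi>)"
      by (intro AE_I2 order_trans[OF bd]) simp
  qed measurable
  have cont: "continuous_on (sphere 0 1) Q"
  proof (rule continuous_on_sequentiallyI)
    fix s :: "nat \<Rightarrow> real^'n" and v
    assume s: "\<forall>n. s n \<in> sphere 0 1" and v: "v \<in> sphere 0 1" and lim: "s \<longlonglongrightarrow> v"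
    show "(\<lambda>n. Q (s n)) \<longlonglongrightarrow> Q v"
      unfolding Q_def
    proof (rule integral_dominated_convergence[where w=\<kappa>])
      show "AE \<xi> in lborel. (\<lambda>n. \<kappa> \<xi> * (s n \<bullet> sgn \<xi>)\<^sup>2) \<longlonglongrightarrow> \<kappa> \<xi> * (v \<bullet> sgn \<xi>)\<^sup>2"
        by (intro AE_I2 tendsto_intros lim)
      show "AE \<xi> in lborel. norm (\<kappa> \<xi> * (s n \<bullet> sgn \<xi>)\<^sup>2) \<le> \<kappa> \<xi>" for n
        by (intro AE_I2 order_trans[OF bd]) (use s in simp)
    qed (use radial_kernel_integral(1)[OF \<kappa>] in measurable)
  qed
  have "axis undefined 1 \<in> (sphere 0 1 :: (real^'n) set)" by simp
  then have "(sphere 0 1 :: (real^'n) set) \<noteq> {}" by blast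
  from continuous_attains_inf[OF compact_sphere this cont]
  obtain e where e: "norm e = 1" and min: "\<And>v. norm v = 1 \<Longrightarrow> Q e \<le> Q v" by auto
  have "Q e \<noteq> 0"
  proof
    assume "Q e = 0"
    then have ae: "AE \<xi> in lborel. \<kappa> \<xi> * (e \<bullet> sgn \<xi>)\<^sup>2 = 0"
      unfolding Q_def by (subst (asm) integral_nonneg_eq_0_iff_AE) (use int k0 in auto)
    have "negligible {\<xi>. e \<bullet> \<xi> = 0}" using e by (intro negligible_hyperplane) auto
    moreover have "{\<xi>. e \<bullet> \<xi> = 0} \<in> sets lborel" by simp
    ultimately have "{\<xi>. e \<bullet> \<xi> = 0} \<in> null_sets lborel"
      by (metis negligible_iff_null_sets null_sets_completion_iff)
    then have "AE \<xi> in lborel. e \<bullet> \<xi> \<noteq> 0" by (auto dest: AE_not_in)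
    with ae have "AE \<xi> in lborel. \<kappa> \<xi> = 0"
    proof eventually_elim
      case (elim \<xi>)
      moreover have "e \<bullet> sgn \<xi> \<noteq> 0" using elim(2) by (auto simp: sgn_div_norm)
      ultimately show ?case by simp
    qed
    then have "(LINT \<xi>|lborel. \<kappa> \<xi>) = 0" by (rule integral_eq_zero_AE)
    then show False using radial_kernel_integral(2)[OF \<kappa>] by simp
  qed
  moreover have "0 \<le> Q e" unfolding Q_def by (rule integral_nonneg_AE) (auto simp: k0)
  ultimately have "Q e > 0" by simp
  moreover have "Q e * (norm v)\<^sup>2 \<le> Q v" for v
  proof (cases "v = 0")
    case False
    have le: "Q e \<le> Q (sgn v)" using False by (intro min) (simp add: norm_sgn)
    have "Q (sgn v) * (norm v)\<^sup>2 = Q v"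
    proof -
      have "Q v = (LINT \<xi>|lborel. (\<kappa> \<xi> * (sgn v \<bullet> sgn \<xi>)\<^sup>2) * (norm v)\<^sup>2)"
        unfolding Q_def using False
        by (intro Bochner_Integration.integral_cong refl) (simp add: sgn_div_norm[of v] power_mult_distrib power_inverse)
      then show ?thesis by (simp add: Q_def)
    qed
    then show ?thesis using mult_right_mono[OF le, of "(norm v)\<^sup>2"] by simp
  qed (simp add: Q_def)
  ultimately show thesis using int by (intro that[of "Q e"]) (auto simp: Q_def)
qed

section \<open>The nonlocal energy space\<close>

text \<open>A projection pulls null sets back to null sets, hence is measurable between the completed measures.\<close>

lemma lebesgue_measurable_fst: "fst \<in> (lebesgue :: ('a::euclidean_space \<times> 'b::euclidean_space) measure) \<rightarrow>\<^sub>M (lebesgue :: 'a measure)"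
  and lebesgue_measurable_snd: "snd \<in> (lebesgue :: ('a::euclidean_space \<times> 'b::euclidean_space) measure) \<rightarrow>\<^sub>M (lebesgue :: 'b measure)"
proof -
  have f: "fst \<in> (lebesgue :: ('a \<times> 'b) measure) \<rightarrow>\<^sub>M (lborel :: 'a measure)"
    by (rule measurable_completion) (simp add: borel_prod[symmetric])
  have s: "snd \<in> (lebesgue :: ('a \<times> 'b) measure) \<rightarrow>\<^sub>M (lborel :: 'b measure)"
    by (rule measurable_completion) (simp add: borel_prod[symmetric])
  have nf: "N \<in> null_sets (distr (lebesgue :: ('a \<times> 'b) measure) lborel fst)" if N: "N \<in> null_sets lborel" for N :: "'a set"
  proof -
    have "N \<times> UNIV \<in> null_sets (lborel \<Otimes>\<^sub>M (lborel :: 'b measure))" using N by auto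
    then have "N \<times> UNIV \<in> null_sets (lebesgue :: ('a \<times> 'b) measure)"
      by (auto simp: lborel_prod intro: null_sets_completionI)
    moreover have "fst -` N \<inter> space (lebesgue :: ('a \<times> 'b) measure) = N \<times> UNIV" by auto
    ultimately show ?thesis using N f by (auto simp: null_sets_def emeasure_distr)
  qed
  have ns: "N \<in> null_sets (distr (lebesgue :: ('a \<times> 'b) measure) lborel snd)" if N: "N \<in> null_sets lborel" for N :: "'b set"
  proof -
    have "UNIV \<times> N \<in> null_sets ((lborel :: 'a measure) \<Otimes>\<^sub>M lborel)" using N by auto
    then have "UNIV \<times> N \<in> null_sets (lebesgue :: ('a \<times> 'b) measure)"
      by (auto simp: lborel_prod intro: null_sets_completionI)
    moreover have "snd -` N \<inter> space (lebesgue :: ('a \<times> 'b) measure) = UNIV \<times> N" by auto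
    ultimately show ?thesis using N s by (auto simp: null_sets_def emeasure_distr)
  qed
  show "fst \<in> (lebesgue :: ('a \<times> 'b) measure) \<rightarrow>\<^sub>M (lebesgue :: 'a measure)"
    by (rule completion.measurable_completion2[OF f]) (use nf in blast)
  show "snd \<in> (lebesgue :: ('a \<times> 'b) measure) \<rightarrow>\<^sub>M (lebesgue :: 'b measure)"
    by (rule completion.measurable_completion2[OF s]) (use ns in blast)
qed

lemma AE_lebesgue_prod:
  assumes "AE x in (lebesgue :: 'a::euclidean_space measure). P x"
  shows "AE p in (lebesgue :: ('a \<times> 'a) measure). P (fst p) \<and> P (snd p)"
proof -
  from assms obtain N where N: "{x. \<not> P x} \<subseteq> N" "N \<in> null_sets lborel"
    unfolding AE_completion_iff by (auto simp: eventually_ae_filter)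
  have "N \<times> UNIV \<in> null_sets (lborel \<Otimes>\<^sub>M (lborel :: 'a measure))"
    "UNIV \<times> N \<in> null_sets ((lborel :: 'a measure) \<Otimes>\<^sub>M lborel)" using N by auto
  then have "N \<times> UNIV \<union> UNIV \<times> N \<in> null_sets (lebesgue :: ('a \<times> 'a) measure)"
    by (auto simp: lborel_prod intro!: null_sets_completionI)
  then show ?thesis
    by (rule AE_I') (use N(1) in auto)
qed

text \<open>Tonelli's theorem below is used for the Borel product measure, so states are first replaced by Borel functions.\<close>

lemma borel_representative:
  fixes u :: "real^'n \<Rightarrow> real^'m"
  assumes "u \<in> borel_measurable lebesgue"
  obtains v where "v \<in> borel_measurable borel" "AE x in lebesgue. u x = v x"
proof -
  have "\<forall>i. \<exists>g\<in>borel_measurable lborel. AE x in lborel. u x $ i = g x"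
    by (intro allI completion_ex_borel_measurable_real measurable_compose[OF assms]) simp
  then obtain g where g: "\<And>i. g i \<in> borel_measurable borel" and ae: "\<And>i. AE x in lborel. u x $ i = g i x"
    by (metis measurable_lborel2)
  have "AE x in lborel. \<forall>i. u x $ i = g i x" using ae by (simp add: AE_all_countable)
  then have "AE x in lebesgue. u x = (\<chi> i. g i x)"
    unfolding AE_completion_iff by eventually_elim (simp add: vec_eq_iff)
  moreover have "(\<lambda>x. \<chi> i. g i x) \<in> borel_measurable borel"
    by (rule borel_measurable_euclidean_space[THEN iffD2]) (auto simp: Basis_vec_def inner_axis g)
  ultimately show thesis using that by blast
qed

lemma open_enlarged: "open \<Omega> \<Longrightarrow> open (enlarged \<Omega> \<delta>)"
  unfolding enlarged_def
  by (cases "\<Omega> = {}") (auto intro!: open_Un open_Collect_less continuous_intros)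

lemma subset_enlarged: "\<Omega> \<subseteq> enlarged \<Omega> \<delta>"
  by (auto simp: enlarged_def)

text \<open>Beyond \<open>D\<close> the kernel no longer reaches \<open>\<Omega>\<close>; so the energy over the interaction set is already the energy
  over the whole space for functions vanishing off \<open>\<Omega>\<close>.\<close>

lemma enlarged_far:
  assumes "x \<in> \<Omega>" "y \<notin> enlarged \<Omega> \<delta>"
  shows "\<delta> \<le> norm (x - y)"
proof -
  have "\<delta> \<le> infdist y \<Omega>" using assms by (auto simp: enlarged_def)
  also have "\<dots> \<le> dist y x" by (rule infdist_le[OF assms(1)])
  finally show ?thesis by (simp add: dist_norm norm_minus_commute)
qed

locale nonlocal_setting =
  fixes \<Omega> :: "(real^'n) set" and \<delta> :: real and \<kappa> c :: "real^'n \<Rightarrow> real" and c_min c_max :: real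
  assumes op: "open \<Omega>" and bd: "bounded \<Omega>" and \<delta>_pos: "\<delta> > 0" and kernel: "radial_kernel \<delta> \<kappa>"
    and c_meas: "c \<in> borel_measurable (lebesgue_on (enlarged \<Omega> \<delta>))"
    and c_min: "0 < c_min" and c_bounds: "\<And>x. x \<in> enlarged \<Omega> \<delta> \<Longrightarrow> c_min \<le> c x \<and> c x \<le> c_max"
begin

definition energy_kernel :: "(real^'n \<Rightarrow> real^'n) \<Rightarrow> (real^'n) \<times> (real^'n) \<Rightarrow> real" where
  "energy_kernel u p = (case p of (x, y) \<Rightarrow> \<kappa> (x - y) * (proj_diff u x y)\<^sup>2 / (norm (x - y))\<^sup>2)"

text \<open>The form is \<open>B u v = \<integral> T u * T v\<close> with \<open>T =\<close> \<open>weighted_diff\<close>, so that its energy is the squared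
  \<open>L\<^sup>2\<close> norm of a linear image of \<open>u\<close>.\<close>

definition weighted_diff :: "(real^'n \<Rightarrow> real^'n) \<Rightarrow> (real^'n) \<times> (real^'n) \<Rightarrow> real" where
  "weighted_diff u p = (case p of (x, y) \<Rightarrow> indicator (interaction_set \<Omega> \<delta>) (x, y) *
     sqrt ((c x + c y) / 4 * \<kappa> (x - y)) * (proj_diff u x y / norm (x - y)))"

abbreviation "D \<equiv> enlarged \<Omega> \<delta>"
abbreviation "A \<equiv> interaction_set \<Omega> \<delta>"
abbreviation "X0 \<equiv> X0_space \<Omega> \<delta> \<kappa>"
abbreviation "B \<equiv> B_nonlocal \<Omega> \<delta> \<kappa> c"

lemma D_open: "open D" and \<Omega>_D: "\<Omega> \<subseteq> D"
  using op by (auto intro: open_enlarged simp: subset_enlarged[THEN subsetD])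

lemma lebesgue_sets[measurable]: "\<Omega> \<in> sets lebesgue" "D \<in> sets lebesgue" "A \<in> sets lebesgue"
proof -
  have "open A" unfolding interaction_set_def by (intro open_Un open_Times op D_open)
  then show "\<Omega> \<in> sets lebesgue" "D \<in> sets lebesgue" "A \<in> sets lebesgue" using op D_open by auto
qed

lemma AD: "(x, y) \<in> A \<Longrightarrow> x \<in> D \<and> y \<in> D"
  using \<Omega>_D by (auto simp: interaction_set_def)

lemma AE_\<Omega>_iff: "(AE x in lebesgue_on \<Omega>. P x) \<longleftrightarrow> (AE x in lebesgue. x \<in> \<Omega> \<longrightarrow> P x)"
  and AE_D_iff: "(AE x in lebesgue_on D. P x) \<longleftrightarrow> (AE x in lebesgue. x \<in> D \<longrightarrow> P x)"
  by (auto simp: AE_restrict_space_iff)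

lemma weighted_diff_lincomb:
  "weighted_diff (\<lambda>x. s *\<^sub>R u x + t *\<^sub>R v x) p = s * weighted_diff u p + t * weighted_diff v p"
  by (cases p) (simp add: weighted_diff_def proj_diff_def inner_diff_left inner_add_left algebra_simps
     add_divide_distrib diff_divide_distrib)

lemma B_nonlocal_eq: "B u v = (LINT p|lebesgue. weighted_diff u p * weighted_diff v p)"
proof -
  have "B u v = (LINT p|lebesgue. 1/2 * (indicator A p *\<^sub>R (case p of (x, y) \<Rightarrow>
          ((c x + c y) / 2) * \<kappa> (x - y) *
          (proj_diff u x y / norm (x - y)) * (proj_diff v x y / norm (x - y)))))"
    by (simp add: B_nonlocal_def set_lebesgue_integral_def)
  also have "\<dots> = (LINT p|lebesgue. weighted_diff u p * weighted_diff v p)"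
  proof (intro Bochner_Integration.integral_cong refl)
    fix p :: "(real^'n) \<times> (real^'n)"
    obtain x y where p: "p = (x, y)" by (cases p)
    show "1/2 * (indicator A p *\<^sub>R (case p of (x, y) \<Rightarrow>
          ((c x + c y) / 2) * \<kappa> (x - y) *
          (proj_diff u x y / norm (x - y)) * (proj_diff v x y / norm (x - y)))) = weighted_diff u p * weighted_diff v p"
    proof (cases "(x, y) \<in> A")
      case True
      then have "0 \<le> (c x + c y) / 4 * \<kappa> (x - y)"
        using AD[OF True] c_bounds[of x] c_bounds[of y] c_min radial_kernelD(1)[OF kernel, of "x - y"] by simp
      then have sq: "sqrt ((c x + c y) / 4 * \<kappa> (x - y)) * sqrt ((c x + c y) / 4 * \<kappa> (x - y)) = (c x + c y) / 4 * \<kappa> (x - y)"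
        by simp
      have "weighted_diff u p * weighted_diff v p
          = (sqrt ((c x + c y) / 4 * \<kappa> (x - y)) * sqrt ((c x + c y) / 4 * \<kappa> (x - y)))
            * ((proj_diff u x y / norm (x - y)) * (proj_diff v x y / norm (x - y)))"
        using True unfolding p weighted_diff_def by (simp only: prod.case indicator_simps mult_1 ac_simps)
      also have "\<dots> = 1/2 * (((c x + c y) / 2) * \<kappa> (x - y) *
          (proj_diff u x y / norm (x - y)) * (proj_diff v x y / norm (x - y)))"
        unfolding sq by simp
      finally show ?thesis using True by (simp add: p)
    qed (simp add: p weighted_diff_def)
  qed
  finally show ?thesis .
qed

lemma weighted_diff_sq_bounds:
  "c_min / 2 * (energy_kernel u p * indicator A p) \<le> (weighted_diff u p)\<^sup>2"
  "(weighted_diff u p)\<^sup>2 \<le> c_max / 2 * (energy_kernel u p * indicator A p)"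
  "0 \<le> energy_kernel u p"
proof -
  obtain x y where p: "p = (x, y)" by (cases p)
  note k = radial_kernelD(1)[OF kernel, of "x - y"]
  show e0: "0 \<le> energy_kernel u p" using k by (simp add: energy_kernel_def p)
  have "c_min / 2 * (energy_kernel u p * indicator A p) \<le> (weighted_diff u p)\<^sup>2
      \<and> (weighted_diff u p)\<^sup>2 \<le> c_max / 2 * (energy_kernel u p * indicator A p)"
  proof (cases "(x, y) \<in> A")
    case True
    have b: "c_min \<le> (c x + c y) / 2" "(c x + c y) / 2 \<le> c_max"
      using AD[OF True] c_bounds[of x] c_bounds[of y] by auto
    then have "0 \<le> (c x + c y) / 4 * \<kappa> (x - y)" using c_min k by (intro mult_nonneg_nonneg) auto
    note sq = real_sqrt_pow2[OF this]
    have "weighted_diff u p = sqrt ((c x + c y) / 4 * \<kappa> (x - y)) * (proj_diff u x y / norm (x - y))"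
      using True unfolding p weighted_diff_def by (simp only: prod.case indicator_simps mult_1)
    then have "(weighted_diff u p)\<^sup>2 = (c x + c y) / 4 * \<kappa> (x - y) * (proj_diff u x y / norm (x - y))\<^sup>2"
      by (simp only: power_mult_distrib sq)
    also have "\<dots> = (c x + c y) / 2 / 2 * energy_kernel u p"
      by (simp add: energy_kernel_def p power_divide)
    finally have eq: "(weighted_diff u p)\<^sup>2 = (c x + c y) / 2 / 2 * energy_kernel u p" .
    have "c_min / 2 \<le> (c x + c y) / 2 / 2" "(c x + c y) / 2 / 2 \<le> c_max / 2" using b by auto
    from mult_right_mono[OF this(1) e0] mult_right_mono[OF this(2) e0]
    show ?thesis unfolding eq using True by (simp add: p)
  qed (simp add: p weighted_diff_def)
  then show "c_min / 2 * (energy_kernel u p * indicator A p) \<le> (weighted_diff u p)\<^sup>2"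
    "(weighted_diff u p)\<^sup>2 \<le> c_max / 2 * (energy_kernel u p * indicator A p)" by auto
qed

lemma weighted_diff_measurable:
  assumes u: "u \<in> borel_measurable (lebesgue_on D)"
  shows "weighted_diff u \<in> borel_measurable lebesgue"
proof -
  define u' where "u' x = (if x \<in> D then u x else 0)" for x
  define c' where "c' x = (if x \<in> D then c x else 0)" for x
  note [measurable] = radial_kernel_borel[OF kernel]
  have u': "u' \<in> borel_measurable lebesgue" and c': "c' \<in> borel_measurable lebesgue"
    unfolding u'_def[abs_def] c'_def[abs_def] using u c_meas by (simp_all add: borel_measurable_if)
  note [measurable] = measurable_compose[OF lebesgue_measurable_fst u'] measurable_compose[OF lebesgue_measurable_snd u']
    measurable_compose[OF lebesgue_measurable_fst c'] measurable_compose[OF lebesgue_measurable_snd c']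
  have m: "(\<lambda>p. g (fst p - snd p)) \<in> borel_measurable lebesgue"
    if "g \<in> borel_measurable borel" for g :: "real^'n \<Rightarrow> 'z::topological_space"
    by (rule measurable_completion) (use that in \<open>simp add: borel_prod[symmetric] measurable_compose[OF _ that]\<close>)
  have [measurable]: "(\<lambda>p. fst p - snd p) \<in> borel_measurable (lebesgue :: ((real^'n) \<times> (real^'n)) measure)"
    by (rule m[of "\<lambda>x. x"]) simp
  have "weighted_diff u = (\<lambda>p. indicator A p *
     sqrt ((c' (fst p) + c' (snd p)) / 4 * \<kappa> (fst p - snd p)) *
     (((u' (fst p) - u' (snd p)) \<bullet> ((fst p - snd p) /\<^sub>R norm (fst p - snd p))) / norm (fst p - snd p)))"
  proof
    fix p :: "(real^'n) \<times> (real^'n)"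
    obtain x y where p: "p = (x, y)" by (cases p)
    show "weighted_diff u p = indicator A p *
     sqrt ((c' (fst p) + c' (snd p)) / 4 * \<kappa> (fst p - snd p)) *
     (((u' (fst p) - u' (snd p)) \<bullet> ((fst p - snd p) /\<^sub>R norm (fst p - snd p))) / norm (fst p - snd p))"
      using AD[of x y] by (cases "(x, y) \<in> A") (auto simp: p weighted_diff_def u'_def c'_def proj_diff_def)
  qed
  also have "\<dots> \<in> borel_measurable lebesgue" by measurable
  finally show ?thesis .
qed

lemma energy_kernel_measurable:
  assumes u: "u \<in> borel_measurable borel"
  shows "energy_kernel u \<in> borel_measurable borel"
proof -
  note [measurable] = radial_kernel_borel[OF kernel] u
  have "energy_kernel u = (\<lambda>p. \<kappa> (fst p - snd p) * ((u (fst p) - u (snd p)) \<bullet> ((fst p - snd p) /\<^sub>R norm (fst p - snd p)))\<^sup>2 / (norm (fst p - snd p))\<^sup>2)"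
    by (auto simp: energy_kernel_def proj_diff_def fun_eq_iff)
  also have "\<dots> \<in> borel_measurable (borel \<Otimes>\<^sub>M borel)" by measurable
  finally show ?thesis by (simp add: borel_prod)
qed

lemma X_space_iff:
  "u \<in> X_space \<Omega> \<delta> \<kappa> \<longleftrightarrow> u \<in> borel_measurable (lebesgue_on D) \<and> sq_integrable (lebesgue_on \<Omega>) u
     \<and> (\<integral>\<^sup>+p. ennreal (energy_kernel u p * indicator A p) \<partial>lebesgue) < \<infinity>"
proof -
  have "(\<integral>\<^sup>+p\<in>A. (case p of (x, y) \<Rightarrow>
               ennreal (\<kappa> (x - y) * \<bar>proj_diff u x y\<bar>\<^sup>2 / (norm (x - y))\<^sup>2)) \<partial>lebesgue)
      = (\<integral>\<^sup>+p. ennreal (energy_kernel u p * indicator A p) \<partial>lebesgue)"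
    by (intro nn_integral_cong) (auto simp: energy_kernel_def indicator_def split: prod.splits)
  then show ?thesis by (simp add: X_space_def L2_iff_sq_integrable)
qed

lemma energy_le_weighted_diff:
  assumes u: "u \<in> borel_measurable (lebesgue_on D)"
  shows "(\<integral>\<^sup>+p. ennreal (energy_kernel u p * indicator A p) \<partial>lebesgue)
     \<le> ennreal (2 / c_min) * (\<integral>\<^sup>+p. ennreal ((weighted_diff u p)\<^sup>2) \<partial>lebesgue)"
proof -
  note [measurable] = weighted_diff_measurable[OF u]
  have "(\<integral>\<^sup>+p. ennreal (energy_kernel u p * indicator A p) \<partial>lebesgue)
      \<le> (\<integral>\<^sup>+p. ennreal (2 / c_min) * ennreal ((weighted_diff u p)\<^sup>2) \<partial>lebesgue)"
  proof (rule nn_integral_mono)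
    fix p
    have "energy_kernel u p * indicator A p \<le> 2 / c_min * (weighted_diff u p)\<^sup>2"
      using weighted_diff_sq_bounds(1)[of u p] c_min by (simp add: field_simps)
    then show "ennreal (energy_kernel u p * indicator A p) \<le> ennreal (2 / c_min) * ennreal ((weighted_diff u p)\<^sup>2)"
      using c_min by (subst ennreal_mult[symmetric]) (auto intro!: ennreal_leI)
  qed
  also have "\<dots> = ennreal (2 / c_min) * (\<integral>\<^sup>+p. ennreal ((weighted_diff u p)\<^sup>2) \<partial>lebesgue)"
    by (rule nn_integral_cmult) measurable
  finally show ?thesis .
qed

text \<open>Finite nonlocal seminorm is square integrability of the weighted difference, because the coefficient lies
  between two positive constants.\<close>

lemma weighted_diff_sq_integrable_iff:
  assumes u: "u \<in> borel_measurable (lebesgue_on D)"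
  shows "sq_integrable lebesgue (weighted_diff u) \<longleftrightarrow> (\<integral>\<^sup>+p. ennreal (energy_kernel u p * indicator A p) \<partial>lebesgue) < \<infinity>"
proof -
  have m: "weighted_diff u \<in> borel_measurable lebesgue" by (rule weighted_diff_measurable[OF u])
  have cm: "0 < c_max" if "A \<noteq> {}"
  proof -
    have "\<exists>x. x \<in> D" using that AD by fastforce
    then obtain x where "x \<in> D" ..
    then show ?thesis using c_bounds[of x] c_min by auto
  qed
  show ?thesis
  proof
    assume "sq_integrable lebesgue (weighted_diff u)"
    then have fin: "(\<integral>\<^sup>+p. ennreal ((weighted_diff u p)\<^sup>2) \<partial>lebesgue) < \<infinity>"
      by (auto simp: sq_integrable_def integrable_iff_bounded)
    note energy_le_weighted_diff[OF u]
    also have "ennreal (2 / c_min) * (\<integral>\<^sup>+p. ennreal ((weighted_diff u p)\<^sup>2) \<partial>lebesgue) < \<infinity>"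
      using fin by (simp add: ennreal_mult_less_top)
    finally show "(\<integral>\<^sup>+p. ennreal (energy_kernel u p * indicator A p) \<partial>lebesgue) < \<infinity>" .
  next
    assume fin: "(\<integral>\<^sup>+p. ennreal (energy_kernel u p * indicator A p) \<partial>lebesgue) < \<infinity>"
    have "(\<integral>\<^sup>+p. ennreal ((weighted_diff u p)\<^sup>2) \<partial>lebesgue)
        = (\<integral>\<^sup>+p. ennreal (c_max / 2) * ennreal (2 / c_max * (weighted_diff u p)\<^sup>2) \<partial>lebesgue)"
    proof (rule nn_integral_cong)
      fix p
      show "ennreal ((weighted_diff u p)\<^sup>2) = ennreal (c_max / 2) * ennreal (2 / c_max * (weighted_diff u p)\<^sup>2)"
      proof (cases "A = {}")
        case True then show ?thesis by (simp add: weighted_diff_def split: prod.splits)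
      next
        case False then show ?thesis using cm[OF False] by (subst ennreal_mult[symmetric]) auto
      qed
    qed
    also have "\<dots> = ennreal (c_max / 2) * (\<integral>\<^sup>+p. ennreal (2 / c_max * (weighted_diff u p)\<^sup>2) \<partial>lebesgue)"
      by (rule nn_integral_cmult) (use m in measurable)
    also have "\<dots> \<le> ennreal (c_max / 2) * (\<integral>\<^sup>+p. ennreal (energy_kernel u p * indicator A p) \<partial>lebesgue)"
    proof (intro mult_left_mono nn_integral_mono ennreal_leI)
      fix p
      show "2 / c_max * (weighted_diff u p)\<^sup>2 \<le> energy_kernel u p * indicator A p"
      proof (cases "A = {}")
        case True then show ?thesis by (simp add: weighted_diff_def split: prod.splits)
      next
        case False then show ?thesis
          using cm[OF False] weighted_diff_sq_bounds(2)[of u p] by (simp add: field_simps)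
      qed
    qed simp
    also have "\<dots> < \<infinity>" using fin by (simp add: ennreal_mult_less_top)
    finally show "sq_integrable lebesgue (weighted_diff u)"
      using m by (auto simp: sq_integrable_def integrable_iff_bounded)
  qed
qed

lemma X_space_iff_sq_integrable:
  "u \<in> X_space \<Omega> \<delta> \<kappa> \<longleftrightarrow> u \<in> borel_measurable (lebesgue_on D) \<and> sq_integrable (lebesgue_on \<Omega>) u
     \<and> sq_integrable lebesgue (weighted_diff u)"
  using X_space_iff weighted_diff_sq_integrable_iff by blast

lemma AE_weighted_diff_cong:
  assumes "AE x in lebesgue_on D. u x = v x"
  shows "AE p in lebesgue. p \<in> A \<longrightarrow> u (fst p) = v (fst p) \<and> u (snd p) = v (snd p)"
  using AE_lebesgue_prod[OF assms[unfolded AE_D_iff]] by eventually_elim (use AD in auto)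

text \<open>The inequality \<open>shift_Poincare\<close> for \<open>v \<bullet> \<xi>/|\<xi>|\<close> in direction \<open>\<xi>\<close>, weighted with \<open>\<kappa>(\<xi>)/|\<xi>|\<^sup>2\<close> and integrated
  over \<open>\<xi>\<close>: the steps leave \<open>\<Omega>\<close> after \<open>N\<close> of them with \<open>N|\<xi>| \<le> diam \<Omega> + 2\<delta>\<close>, and the left-hand side is the
  coercive form of \<open>kernel_form_coercive\<close>.\<close>

lemma energy_Poincare_borel:
  assumes v[measurable]: "v \<in> borel_measurable borel" and v0: "\<And>x. x \<notin> \<Omega> \<Longrightarrow> v x = 0"
    and R: "R \<ge> 0" "\<And>x y. x \<in> \<Omega> \<Longrightarrow> y \<in> \<Omega> \<Longrightarrow> norm (x - y) \<le> R"
    and q: "q > 0" "\<And>w. q * (norm w)\<^sup>2 \<le> (LINT \<xi>|lborel. \<kappa> \<xi> * (w \<bullet> sgn \<xi>)\<^sup>2)"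
      "\<And>w. integrable lborel (\<lambda>\<xi>. \<kappa> \<xi> * (w \<bullet> sgn \<xi>)\<^sup>2)"
  shows "2 * (\<integral>\<^sup>+x. ennreal (q * (norm (v x))\<^sup>2) \<partial>lborel)
     \<le> ennreal ((R + 2 * \<delta>)\<^sup>2) * (\<integral>\<^sup>+p. ennreal (energy_kernel v p * indicator A p) \<partial>lebesgue)"
proof -
  note k0 = radial_kernelD(1)[OF kernel]
  note [measurable] = radial_kernel_borel[OF kernel]
  have [measurable]: "(sgn :: real^'n \<Rightarrow> real^'n) \<in> borel_measurable borel"
    unfolding sgn_div_norm[abs_def] by measurable
  have ek: "energy_kernel v p * indicator A p = energy_kernel v p" for p
  proof (cases p)
    case (Pair x y)
    show ?thesis
    proof (cases "(x, y) \<in> A")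
      case False
      then consider "x \<notin> \<Omega>" "y \<notin> \<Omega>" | "x \<in> \<Omega>" "y \<notin> D" | "y \<in> \<Omega>" "x \<notin> D"
        by (auto simp: interaction_set_def)
      then have "energy_kernel v p = 0"
      proof cases
        case 1 then show ?thesis by (simp add: Pair energy_kernel_def proj_diff_def v0)
      next
        case 2 then show ?thesis using radial_kernelD(3)[OF kernel enlarged_far[OF 2]] by (simp add: Pair energy_kernel_def)
      next
        case 3 then show ?thesis using radial_kernelD(3)[OF kernel, of "x - y"] enlarged_far[OF 3]
          by (simp add: Pair energy_kernel_def norm_minus_commute)
      qed
      then show ?thesis by simp
    qed (simp add: Pair)
  qed
  have em[measurable]: "energy_kernel v \<in> borel_measurable (lborel \<Otimes>\<^sub>M lborel)"
    using energy_kernel_measurable[OF v] by (simp add: lborel_prod)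
  define f where "f \<xi> x = v x \<bullet> sgn \<xi>" for \<xi> x
  have [measurable]: "(\<lambda>p. f (fst p) (snd p)) \<in> borel_measurable (borel \<Otimes>\<^sub>M borel)" unfolding f_def by measurable
  have shift: "energy_kernel v (x, x + \<xi>) = \<kappa> \<xi> * (f \<xi> (x + \<xi>) - f \<xi> x)\<^sup>2 / (norm \<xi>)\<^sup>2" for x \<xi>
    using radial_kernelD(2)[OF kernel, of \<xi>]
    by (simp add: energy_kernel_def proj_diff_def f_def sgn_div_norm inner_diff_left power2_commute algebra_simps)
  have main: "2 * (\<integral>\<^sup>+x. ennreal (\<kappa> \<xi> * (f \<xi> x)\<^sup>2) \<partial>lborel)
      \<le> ennreal ((R + 2 * \<delta>)\<^sup>2) * (\<integral>\<^sup>+x. ennreal (energy_kernel v (x, x + \<xi>)) \<partial>lborel)" for \<xi>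
  proof (cases "\<xi> = 0 \<or> norm \<xi> \<ge> \<delta>")
    case True
    then have z: "\<kappa> \<xi> * (f \<xi> x)\<^sup>2 = 0" for x using radial_kernelD(3)[OF kernel, of \<xi>] by (auto simp: f_def)
    show ?thesis unfolding z by simp
  next
    case False
    then have \<xi>: "\<xi> \<noteq> 0" "norm \<xi> < \<delta>" by auto
    obtain N :: nat where N: "R < real N * norm \<xi>" "real N * norm \<xi> \<le> R + 2 * norm \<xi>"
      by (rule step_count[OF R(1) \<xi>(1)])
    have "f \<xi> x = 0 \<or> f \<xi> (x + real N *\<^sub>R \<xi>) = 0" for x
    proof (rule ccontr)
      assume "\<not> ?thesis"
      then have "x \<in> \<Omega>" "x + real N *\<^sub>R \<xi> \<in> \<Omega>" by (metis f_def inner_zero_left v0)+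
      from R(2)[OF this(2,1)] N(1) show False by simp
    qed
    then have sp: "2 * (\<integral>\<^sup>+x. ennreal ((f \<xi> x)\<^sup>2) \<partial>lborel)
       \<le> ennreal ((real N)\<^sup>2) * (\<integral>\<^sup>+x. ennreal ((f \<xi> (x + \<xi>) - f \<xi> x)\<^sup>2) \<partial>lborel)"
      by (intro shift_Poincare) (simp_all add: f_def)
    have [measurable]: "f \<xi> \<in> borel_measurable borel" unfolding f_def by measurable
    have nn: "(real N)\<^sup>2 * (norm \<xi>)\<^sup>2 \<le> (R + 2 * \<delta>)\<^sup>2"
      unfolding power_mult_distrib[symmetric] using N \<xi> R by (intro power_mono) auto
    have "2 * (\<integral>\<^sup>+x. ennreal (\<kappa> \<xi> * (f \<xi> x)\<^sup>2) \<partial>lborel) = ennreal (\<kappa> \<xi>) * (2 * (\<integral>\<^sup>+x. ennreal ((f \<xi> x)\<^sup>2) \<partial>lborel))"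
      using k0 by (simp add: ennreal_mult nn_integral_cmult mult.left_commute)
    also have "\<dots> \<le> ennreal (\<kappa> \<xi>) * (ennreal ((real N)\<^sup>2) * (\<integral>\<^sup>+x. ennreal ((f \<xi> (x + \<xi>) - f \<xi> x)\<^sup>2) \<partial>lborel))"
      by (rule mult_left_mono[OF sp]) simp
    also have "\<dots> = (\<integral>\<^sup>+x. ennreal (\<kappa> \<xi>) * (ennreal ((real N)\<^sup>2) * ennreal ((f \<xi> (x + \<xi>) - f \<xi> x)\<^sup>2)) \<partial>lborel)"
      by (simp add: nn_integral_cmult)
    also have "\<dots> \<le> (\<integral>\<^sup>+x. ennreal ((R + 2 * \<delta>)\<^sup>2) * ennreal (energy_kernel v (x, x + \<xi>)) \<partial>lborel)"
    proof (rule nn_integral_mono)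
      fix x
      have "\<kappa> \<xi> * ((real N)\<^sup>2 * (f \<xi> (x + \<xi>) - f \<xi> x)\<^sup>2)
          = ((real N)\<^sup>2 * (norm \<xi>)\<^sup>2) * energy_kernel v (x, x + \<xi>)"
        using \<xi> by (simp add: shift)
      also have "\<dots> \<le> (R + 2 * \<delta>)\<^sup>2 * energy_kernel v (x, x + \<xi>)"
        by (rule mult_right_mono[OF nn weighted_diff_sq_bounds(3)])
      finally have "ennreal (\<kappa> \<xi> * ((real N)\<^sup>2 * (f \<xi> (x + \<xi>) - f \<xi> x)\<^sup>2)) \<le> ennreal ((R + 2 * \<delta>)\<^sup>2 * energy_kernel v (x, x + \<xi>))"
        by (rule ennreal_leI)
      then show "ennreal (\<kappa> \<xi>) * (ennreal ((real N)\<^sup>2) * ennreal ((f \<xi> (x + \<xi>) - f \<xi> x)\<^sup>2))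
         \<le> ennreal ((R + 2 * \<delta>)\<^sup>2) * ennreal (energy_kernel v (x, x + \<xi>))"
        using k0 weighted_diff_sq_bounds(3) by (simp add: ennreal_mult)
    qed
    also have "\<dots> = ennreal ((R + 2 * \<delta>)\<^sup>2) * (\<integral>\<^sup>+x. ennreal (energy_kernel v (x, x + \<xi>)) \<partial>lborel)"
      by (rule nn_integral_cmult) (simp add: shift)
    finally show ?thesis .
  qed
  have "2 * (\<integral>\<^sup>+x. ennreal (q * (norm (v x))\<^sup>2) \<partial>lborel)
      \<le> 2 * (\<integral>\<^sup>+x. (\<integral>\<^sup>+\<xi>. ennreal (\<kappa> \<xi> * (f \<xi> x)\<^sup>2) \<partial>lborel) \<partial>lborel)"
  proof (intro mult_left_mono nn_integral_mono)
    fix x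
    have "ennreal (q * (norm (v x))\<^sup>2) \<le> ennreal (LINT \<xi>|lborel. \<kappa> \<xi> * (v x \<bullet> sgn \<xi>)\<^sup>2)"
      by (rule ennreal_leI[OF q(2)])
    also have "\<dots> = (\<integral>\<^sup>+\<xi>. ennreal (\<kappa> \<xi> * (f \<xi> x)\<^sup>2) \<partial>lborel)"
      unfolding f_def using k0 by (intro nn_integral_eq_integral[symmetric] q(3)) simp
    finally show "ennreal (q * (norm (v x))\<^sup>2) \<le> (\<integral>\<^sup>+\<xi>. ennreal (\<kappa> \<xi> * (f \<xi> x)\<^sup>2) \<partial>lborel)" .
  qed simp
  also have "\<dots> = 2 * (\<integral>\<^sup>+\<xi>. (\<integral>\<^sup>+x. ennreal (\<kappa> \<xi> * (f \<xi> x)\<^sup>2) \<partial>lborel) \<partial>lborel)"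
    by (subst lborel_pair.Fubini') (simp_all add: f_def case_prod_unfold)
  also have "\<dots> = (\<integral>\<^sup>+\<xi>. 2 * (\<integral>\<^sup>+x. ennreal (\<kappa> \<xi> * (f \<xi> x)\<^sup>2) \<partial>lborel) \<partial>lborel)"
    by (rule nn_integral_cmult[symmetric]) (simp add: f_def)
  also have "\<dots> \<le> (\<integral>\<^sup>+\<xi>. ennreal ((R + 2 * \<delta>)\<^sup>2) * (\<integral>\<^sup>+x. ennreal (energy_kernel v (x, x + \<xi>)) \<partial>lborel) \<partial>lborel)"
    by (rule nn_integral_mono[OF main])
  also have "\<dots> = ennreal ((R + 2 * \<delta>)\<^sup>2) * (\<integral>\<^sup>+\<xi>. (\<integral>\<^sup>+x. ennreal (energy_kernel v (x, x + \<xi>)) \<partial>lborel) \<partial>lborel)"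
    by (rule nn_integral_cmult) (simp add: shift f_def)
  also have "(\<integral>\<^sup>+\<xi>. (\<integral>\<^sup>+x. ennreal (energy_kernel v (x, x + \<xi>)) \<partial>lborel) \<partial>lborel)
      = (\<integral>\<^sup>+x. (\<integral>\<^sup>+\<xi>. ennreal (energy_kernel v (x, x + \<xi>)) \<partial>lborel) \<partial>lborel)"
    by (subst lborel_pair.Fubini') (simp_all add: shift f_def case_prod_unfold)
  also have "\<dots> = (\<integral>\<^sup>+x. (\<integral>\<^sup>+y. ennreal (energy_kernel v (x, y)) \<partial>lborel) \<partial>lborel)"
  proof (rule nn_integral_cong)
    fix x
    have "(\<integral>\<^sup>+\<xi>. ennreal (energy_kernel v (x, \<xi> + x)) \<partial>lborel) = (\<integral>\<^sup>+y. ennreal (energy_kernel v (x, y)) \<partial>lborel)"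
    proof (rule nn_integral_lborel_translation[of "\<lambda>y. ennreal (energy_kernel v (x, y))"])
      have "(\<lambda>y. energy_kernel v (x, y)) \<in> borel_measurable lborel"
        by (rule measurable_compose[OF _ em]) simp
      then show "(\<lambda>y. ennreal (energy_kernel v (x, y))) \<in> borel_measurable borel" by simp
    qed
    then show "(\<integral>\<^sup>+\<xi>. ennreal (energy_kernel v (x, x + \<xi>)) \<partial>lborel) = (\<integral>\<^sup>+y. ennreal (energy_kernel v (x, y)) \<partial>lborel)"
      by (simp add: add.commute)
  qed
  also have "\<dots> = (\<integral>\<^sup>+p. ennreal (energy_kernel v p) \<partial>(lborel \<Otimes>\<^sub>M lborel))"
    by (rule lborel.nn_integral_fst) measurable
  also have "\<dots> = (\<integral>\<^sup>+p. ennreal (energy_kernel v p * indicator A p) \<partial>lebesgue)"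
    by (simp add: ek lborel_prod nn_integral_completion)
  finally show ?thesis .
qed

lemma X0_space_iff:
  "u \<in> X0 \<longleftrightarrow> u \<in> borel_measurable (lebesgue_on D) \<and> sq_integrable (lebesgue_on \<Omega>) u
     \<and> sq_integrable lebesgue (weighted_diff u) \<and> (AE x in lebesgue. x \<in> D - \<Omega> \<longrightarrow> u x = 0)"
  unfolding X0_space_def X_space_iff_sq_integrable by (auto simp: AE_restrict_space_iff)

lemma AE_D_of_\<Omega>:
  assumes "AE x in lebesgue. x \<in> D - \<Omega> \<longrightarrow> P x" "AE x in lebesgue_on \<Omega>. P x"
  shows "AE x in lebesgue_on D. P x"
  using assms unfolding AE_\<Omega>_iff AE_D_iff by eventually_elim auto

lemma nn_integral_\<Omega>:
  assumes "sq_integrable (lebesgue_on \<Omega>) u" "AE x in lebesgue. v x = (if x \<in> \<Omega> then u x else 0)"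
  shows "(\<integral>\<^sup>+x. ennreal ((norm (v x))\<^sup>2) \<partial>lborel) = ennreal (LINT x|lebesgue_on \<Omega>. (norm (u x))\<^sup>2)"
proof -
  have "(\<integral>\<^sup>+x. ennreal ((norm (v x))\<^sup>2) \<partial>lborel) = (\<integral>\<^sup>+x. ennreal ((norm (v x))\<^sup>2) \<partial>lebesgue)"
    by (simp add: nn_integral_completion)
  also have "\<dots> = (\<integral>\<^sup>+x. ennreal ((norm (u x))\<^sup>2) * indicator \<Omega> x \<partial>lebesgue)"
    by (rule nn_integral_cong_AE) (use assms(2) in eventually_elim, auto)
  also have "\<dots> = (\<integral>\<^sup>+x. ennreal ((norm (u x))\<^sup>2) \<partial>lebesgue_on \<Omega>)"
    by (rule nn_integral_restrict_space[symmetric]) simp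
  also have "\<dots> = ennreal (LINT x|lebesgue_on \<Omega>. (norm (u x))\<^sup>2)"
    by (rule nn_integral_eq_integral) (use sq_integrableD(2)[OF assms(1)] in auto)
  finally show ?thesis .
qed

text \<open>\<open>energy_Poincare_borel\<close> for a Borel representative of the extension of \<open>u\<close> by zero, rewritten in terms of the form.\<close>

lemma nonlocal_Poincare:
  obtains C where "C > 0" "\<And>u. u \<in> X0 \<Longrightarrow>
    (LINT x|lebesgue_on \<Omega>. (norm (u x))\<^sup>2) \<le> C * B u u"
proof -
  obtain R0 where R0: "\<And>x y. x \<in> \<Omega> \<Longrightarrow> y \<in> \<Omega> \<Longrightarrow> dist x y \<le> R0"
    using bd unfolding bounded_two_points by blast
  define R where "R = max R0 0"
  have R: "R \<ge> 0" "\<And>x y. x \<in> \<Omega> \<Longrightarrow> y \<in> \<Omega> \<Longrightarrow> norm (x - y) \<le> R"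
    using R0 by (auto simp: R_def dist_norm le_max_iff_disj)
  obtain q where q: "q > 0" "\<And>w. q * (norm w)\<^sup>2 \<le> (LINT \<xi>|lborel. \<kappa> \<xi> * (w \<bullet> sgn \<xi>)\<^sup>2)"
      "\<And>w. integrable lborel (\<lambda>\<xi>. \<kappa> \<xi> * (w \<bullet> sgn \<xi>)\<^sup>2)"
    by (rule kernel_form_coercive[OF kernel]) (rule that)
  define M where "M = (R + 2 * \<delta>)\<^sup>2"
  have M: "M > 0" using R \<delta>_pos by (simp add: M_def)
  define C where "C = M / (q * c_min)"
  have "(LINT x|lebesgue_on \<Omega>. (norm (u x))\<^sup>2) \<le> C * B u u"
    if u: "u \<in> X0" for u
  proof -
    from u have um: "u \<in> borel_measurable (lebesgue_on D)" and usq: "sq_integrable (lebesgue_on \<Omega>) u"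
      and wd: "sq_integrable lebesgue (weighted_diff u)" and u0: "AE x in lebesgue. x \<in> D - \<Omega> \<longrightarrow> u x = 0"
      by (auto simp: X0_space_iff)
    have "(\<lambda>x. if x \<in> \<Omega> then u x else 0) \<in> borel_measurable lebesgue"
      using sq_integrableD(1)[OF usq] by (simp add: borel_measurable_if)
    then obtain v1 where v1[measurable]: "v1 \<in> borel_measurable borel"
      and ae: "AE x in lebesgue. (if x \<in> \<Omega> then u x else 0) = v1 x" by (rule borel_representative)
    define v where "v x = (if x \<in> \<Omega> then v1 x else 0)" for x
    have [measurable]: "\<Omega> \<in> sets borel" using op by simp
    have vm: "v \<in> borel_measurable borel" unfolding v_def by measurable
    have vae: "AE x in lebesgue. v x = (if x \<in> \<Omega> then u x else 0)"
      using ae by eventually_elim (auto simp: v_def)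
    have "AE x in lebesgue_on D. v x = u x"
      unfolding AE_D_iff using vae u0 by eventually_elim auto
    from AE_weighted_diff_cong[OF this]
    have ek: "(\<integral>\<^sup>+p. ennreal (energy_kernel v p * indicator A p) \<partial>lebesgue)
       = (\<integral>\<^sup>+p. ennreal (energy_kernel u p * indicator A p) \<partial>lebesgue)"
      by (intro nn_integral_cong_AE, eventually_elim)
         (auto simp: energy_kernel_def proj_diff_def indicator_def split: prod.splits)
    have Bu: "B u u = (LINT p|lebesgue. (norm (weighted_diff u p))\<^sup>2)"
      by (simp add: B_nonlocal_eq power2_eq_square)
    note energy_le_weighted_diff[OF um]
    also have "(\<integral>\<^sup>+p. ennreal ((weighted_diff u p)\<^sup>2) \<partial>lebesgue) = ennreal (B u u)"
      unfolding Bu real_norm_def power2_abs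
      by (rule nn_integral_eq_integral) (use sq_integrableD(2)[OF wd] in auto)
    finally have E: "(\<integral>\<^sup>+p. ennreal (energy_kernel u p * indicator A p) \<partial>lebesgue)
        \<le> ennreal (2 / c_min) * ennreal (B u u)" .
    have B0: "0 \<le> B u u" unfolding Bu by (rule integral_nonneg_AE) auto
    have "ennreal (2 * q * (LINT x|lebesgue_on \<Omega>. (norm (u x))\<^sup>2)) = 2 * (ennreal q * (\<integral>\<^sup>+x. ennreal ((norm (v x))\<^sup>2) \<partial>lborel))"
      unfolding nn_integral_\<Omega>[OF usq vae] using q(1) by (simp add: ennreal_mult mult.assoc)
    also have "\<dots> = 2 * (\<integral>\<^sup>+x. ennreal (q * (norm (v x))\<^sup>2) \<partial>lborel)"
      using q(1) vm by (simp add: nn_integral_cmult ennreal_mult)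
    also have "\<dots> \<le> ennreal M * (\<integral>\<^sup>+p. ennreal (energy_kernel v p * indicator A p) \<partial>lebesgue)"
      unfolding M_def by (rule energy_Poincare_borel[OF vm _ R q]) (auto simp: v_def)
    also have "\<dots> \<le> ennreal M * (ennreal (2 / c_min) * ennreal (B u u))"
      unfolding ek by (intro mult_left_mono E) simp
    also have "\<dots> = ennreal (M * (2 / c_min * B u u))"
    proof -
      have a: "0 \<le> 2 / c_min" using c_min by simp
      have b: "0 \<le> 2 / c_min * B u u" by (rule mult_nonneg_nonneg[OF a B0])
      show ?thesis by (simp only: ennreal_mult[OF less_imp_le[OF M] b] ennreal_mult[OF a B0])
    qed
    finally have "2 * q * (LINT x|lebesgue_on \<Omega>. (norm (u x))\<^sup>2) \<le> M * (2 / c_min * B u u)"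
      using M c_min B0 by (subst (asm) ennreal_le_iff) auto
    then show ?thesis using q(1) c_min by (simp add: C_def field_simps)
  qed
  moreover have "C > 0" using M q(1) c_min by (simp add: C_def)
  ultimately show thesis using that by blast
qed

lemma X0_lincomb:
  assumes "u \<in> X0" "v \<in> X0"
  shows "(\<lambda>x. s *\<^sub>R u x + t *\<^sub>R v x) \<in> X0"
  unfolding X0_space_iff
proof (intro conjI)
  show "(\<lambda>x. s *\<^sub>R u x + t *\<^sub>R v x) \<in> borel_measurable (lebesgue_on D)"
    "sq_integrable (lebesgue_on \<Omega>) (\<lambda>x. s *\<^sub>R u x + t *\<^sub>R v x)"
    using assms by (auto simp: X0_space_iff intro: sq_integrable_lincomb)
  show "sq_integrable lebesgue (weighted_diff (\<lambda>x. s *\<^sub>R u x + t *\<^sub>R v x))"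
    using assms sq_integrable_lincomb[of lebesgue "weighted_diff u" "weighted_diff v" s t]
    by (simp add: X0_space_iff weighted_diff_lincomb[abs_def])
  have "AE x in lebesgue. x \<in> D - \<Omega> \<longrightarrow> u x = 0" "AE x in lebesgue. x \<in> D - \<Omega> \<longrightarrow> v x = 0"
    using assms by (auto simp: X0_space_iff)
  then show "AE x in lebesgue. x \<in> D - \<Omega> \<longrightarrow> s *\<^sub>R u x + t *\<^sub>R v x = 0"
    by eventually_elim auto
qed

lemma B_nonlocal_lincomb:
  assumes "u \<in> X0" "v \<in> X0" "w \<in> X0"
  shows "B (\<lambda>x. s *\<^sub>R u x + t *\<^sub>R v x) w = s * B u w + t * B v w"
proof -
  have "integrable lebesgue (\<lambda>p. weighted_diff u p * weighted_diff w p)"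
    "integrable lebesgue (\<lambda>p. weighted_diff v p * weighted_diff w p)"
    using assms sq_integrable_inner[of lebesgue "weighted_diff u" "weighted_diff w"]
      sq_integrable_inner[of lebesgue "weighted_diff v" "weighted_diff w"] by (auto simp: X0_space_iff)
  then show ?thesis
    by (simp add: B_nonlocal_eq weighted_diff_lincomb distrib_right mult.assoc)
qed

text \<open>By coercivity an energy-Cauchy sequence has an almost everywhere convergent subsequence. Its weighted
  differences converge almost everywhere too, and they are Cauchy in \<open>L\<^sup>2\<close>, so their \<open>L\<^sup>2\<close> limit is the weighted
  difference of the limit.\<close>

lemma X0_complete:
  assumes s: "\<And>n. s n \<in> X0"
    and cau: "\<forall>e>0. \<exists>N. \<forall>m\<ge>N. \<forall>n\<ge>N. B (\<lambda>x. s m x - s n x) (\<lambda>x. s m x - s n x) < e"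
  shows "\<exists>u\<in>X0. \<exists>r::nat\<Rightarrow>nat. strict_mono r \<and>
    (\<lambda>n. B (\<lambda>x. s (r n) x - u x) (\<lambda>x. s (r n) x - u x)) \<longlonglongrightarrow> 0"
proof -
  obtain C where C: "C > 0" and P: "\<And>u. u \<in> X0 \<Longrightarrow>
    (LINT x|lebesgue_on \<Omega>. (norm (u x))\<^sup>2) \<le> C * B u u"
    by (rule nonlocal_Poincare) auto
  have wdiff: "weighted_diff (\<lambda>x. u x - v x) p = weighted_diff u p - weighted_diff v p" for u v p
    using weighted_diff_lincomb[of 1 u "-1" v p] by simp
  have Bd: "B (\<lambda>x. u x - v x) (\<lambda>x. u x - v x)
     = (LINT p|lebesgue. (norm (weighted_diff u p - weighted_diff v p))\<^sup>2)" for u v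
    by (simp add: B_nonlocal_eq wdiff power2_eq_square)
  have diffX: "(\<lambda>x. s m x - s n x) \<in> X0" for m n
    using X0_lincomb[OF s[of m] s[of n], of 1 "-1"] by simp
  have ssq: "sq_integrable (lebesgue_on \<Omega>) (s n)" and swd: "sq_integrable lebesgue (weighted_diff (s n))"
    and sm: "s n \<in> borel_measurable (lebesgue_on D)" and s0: "AE x in lebesgue. x \<in> D - \<Omega> \<longrightarrow> s n x = 0" for n
    using s[of n] by (auto simp: X0_space_iff)
  have "L2_Cauchy (lebesgue_on \<Omega>) s"
    by (rule L2_Cauchy_dominated[OF cau C P[OF diffX]])
  then obtain r u0 where r: "strict_mono r" and u0: "sq_integrable (lebesgue_on \<Omega>) u0"
    and ae: "AE x in lebesgue_on \<Omega>. (\<lambda>n. s (r n) x) \<longlonglongrightarrow> u0 x"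
    and "(\<lambda>n. LINT x|lebesgue_on \<Omega>. (norm (s n x - u0 x))\<^sup>2) \<longlonglongrightarrow> 0"
    by (rule L2_complete[OF ssq])
  define u where "u x = (if x \<in> \<Omega> then u0 x else 0)" for x
  have um': "u \<in> borel_measurable lebesgue"
    unfolding u_def using sq_integrableD(1)[OF u0] by (simp add: borel_measurable_if)
  have um: "u \<in> borel_measurable (lebesgue_on D)" by (rule measurable_restrict_space1[OF um'])
  have usq: "sq_integrable (lebesgue_on \<Omega>) u"
    by (rule sq_integrable_cong_AE[OF u0 measurable_restrict_space1[OF um']]) (auto simp: u_def)
  have "AE x in lebesgue. \<forall>n. x \<in> D - \<Omega> \<longrightarrow> s n x = 0"
    using s0 unfolding AE_all_countable by blast
  then have aeD: "AE x in lebesgue. x \<in> D \<longrightarrow> (\<lambda>n. s (r n) x) \<longlonglongrightarrow> u x"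
    using ae[unfolded AE_\<Omega>_iff] by eventually_elim (auto simp: u_def)
  have wdlim: "AE p in lebesgue. (\<lambda>n. weighted_diff (s (r n)) p) \<longlonglongrightarrow> weighted_diff u p"
    using AE_lebesgue_prod[OF aeD]
  proof eventually_elim
    case (elim p)
    show ?case
    proof (cases p)
      case (Pair x y)
      show ?thesis
      proof (cases "(x, y) \<in> A")
        case True
        then have "(\<lambda>n. s (r n) x) \<longlonglongrightarrow> u x" "(\<lambda>n. s (r n) y) \<longlonglongrightarrow> u y" using elim AD[OF True] by (auto simp: Pair)
        then show ?thesis unfolding Pair weighted_diff_def proj_diff_def prod.case divide_inverse
          by (intro tendsto_intros)
      qed (simp add: Pair weighted_diff_def)
    qed
  qed
  have "L2_Cauchy lebesgue (\<lambda>n. weighted_diff (s (r n)))"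
    unfolding L2_Cauchy_def
  proof (intro allI impI)
    fix e :: real assume "e > 0"
    then obtain N where N: "\<And>m n. m \<ge> N \<Longrightarrow> n \<ge> N \<Longrightarrow> B (\<lambda>x. s m x - s n x) (\<lambda>x. s m x - s n x) < e"
      using cau by metis
    have "(LINT p|lebesgue. (norm (weighted_diff (s (r m)) p - weighted_diff (s (r n)) p))\<^sup>2) < e" if "m \<ge> N" "n \<ge> N" for m n
      unfolding Bd[symmetric] using N that seq_suble[OF r, of m] seq_suble[OF r, of n] by (meson order_trans)
    then show "\<exists>N. \<forall>m\<ge>N. \<forall>n\<ge>N. (LINT p|lebesgue. (norm (weighted_diff (s (r m)) p - weighted_diff (s (r n)) p))\<^sup>2) < e" by blast
  qed
  then obtain r2 w where r2: "strict_mono r2" and w: "sq_integrable lebesgue w"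
    and wae: "AE p in lebesgue. (\<lambda>n. weighted_diff (s (r (r2 n))) p) \<longlonglongrightarrow> w p"
    and wlim: "(\<lambda>n. LINT p|lebesgue. (norm (weighted_diff (s (r n)) p - w p))\<^sup>2) \<longlonglongrightarrow> 0"
    by (rule L2_complete[OF swd])
  have weq: "AE p in lebesgue. w p = weighted_diff u p"
    using wae wdlim
  proof eventually_elim
    case (elim p)
    from LIMSEQ_subseq_LIMSEQ[OF elim(2) r2] elim(1) show ?case
      by (intro LIMSEQ_unique) (auto simp: comp_def)
  qed
  have [measurable]: "weighted_diff u \<in> borel_measurable lebesgue" by (rule weighted_diff_measurable[OF um])
  have "sq_integrable lebesgue (weighted_diff u)"
    by (rule sq_integrable_cong_AE[OF w _ weq]) measurable
  then have uX: "u \<in> X0" using um usq by (auto simp: X0_space_iff u_def)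
  have [measurable]: "weighted_diff (s n) \<in> borel_measurable lebesgue" "w \<in> borel_measurable lebesgue" for n
    using sq_integrableD(1)[OF swd] sq_integrableD(1)[OF w] by auto
  have "(LINT p|lebesgue. (norm (weighted_diff (s (r n)) p - w p))\<^sup>2)
     = B (\<lambda>x. s (r n) x - u x) (\<lambda>x. s (r n) x - u x)" for n
    unfolding Bd by (rule integral_cong_AE) (use weq in \<open>auto elim!: eventually_mono\<close>)
  with wlim uX r show ?thesis by auto
qed

lemma coercive_form_X0: "\<exists>C. coercive_form \<Omega> D X0 B C"
proof -
  obtain C where C: "C > 0" and P: "\<And>u. u \<in> X0 \<Longrightarrow>
    (LINT x|lebesgue_on \<Omega>. (norm (u x))\<^sup>2) \<le> C * B u u"
    by (rule nonlocal_Poincare) auto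
  have "coercive_form \<Omega> D X0 B C"
  proof
    have "weighted_diff (\<lambda>_. 0) = (\<lambda>_. 0)"
      by (auto simp: weighted_diff_def proj_diff_def fun_eq_iff)
    then show "(\<lambda>_. 0) \<in> X0" by (simp add: X0_space_iff sq_integrable_def)
    show "AE x in lebesgue_on D. u x = 0"
      if "u \<in> X0" "AE x in lebesgue_on \<Omega>. u x = 0" for u
      by (rule AE_D_of_\<Omega>[OF _ that(2)]) (use that(1) in \<open>auto simp: X0_space_iff\<close>)
    show "B u v = B v u" for u v
      by (simp add: B_nonlocal_eq mult.commute)
    show "sq_integrable (lebesgue_on \<Omega>) u" if "u \<in> X0" for u
      using that by (simp add: X0_space_iff)
  qed (fact X0_lincomb B_nonlocal_lincomb C P X0_complete)+
  then show ?thesis ..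
qed

end

section \<open>Lipschitz functions of bounded support\<close>

lemma LINT_lborel_translation:
  fixes f :: "'a::euclidean_space \<Rightarrow> real"
  assumes [measurable]: "f \<in> borel_measurable borel"
  shows "(LINT x|lborel. f (x + c)) = (LINT x|lborel. f x)"
proof -
  have "(LINT x|lborel. f x) = (LINT x|distr lborel borel ((+) c). f x)"
    by (simp add: lborel_distr_plus)
  also have "\<dots> = (LINT x|lborel. f (c + x))" by (rule integral_distr) auto
  finally show ?thesis by (simp add: add.commute)
qed

text \<open>Subsets of null sets are measurable because the Lebesgue measure is complete.\<close>

lemma borel_measurable_lebesgue_cong_AE:
  fixes f g :: "'a::euclidean_space \<Rightarrow> 'b::topological_space"
  assumes f: "f \<in> borel_measurable lebesgue" and ae: "AE x in lebesgue. f x = g x"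
  shows "g \<in> borel_measurable lebesgue"
proof (rule measurableI)
  fix A :: "'b set" assume A: "A \<in> sets borel"
  from ae obtain N where N: "{x. f x \<noteq> g x} \<subseteq> N" "N \<in> null_sets lebesgue"
    by (auto simp: eventually_ae_filter)
  have eq: "f x = g x" if "x \<notin> N" for x using N(1) that by blast
  have sub: "X \<in> sets lebesgue" if "X \<subseteq> N" for X
    using null_sets_completion_subset[OF that N(2)] by blast
  have "f -` A \<in> sets lebesgue" using measurable_sets[OF f A] by simp
  moreover have "g -` A \<inter> N \<in> sets lebesgue" by (rule sub) auto
  ultimately have "(f -` A - N) \<union> (g -` A \<inter> N) \<in> sets lebesgue"
    using null_setsD2[OF N(2)] by (intro sets.Un sets.Diff)
  also have "(f -` A - N) \<union> (g -` A \<inter> N) = g -` A" using eq by auto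
  finally show "g -` A \<inter> space lebesgue \<in> sets lebesgue" by simp
qed simp

lemma integrable_indicator_cball:
  "integrable lborel (\<lambda>x::'a::euclidean_space. c * indicator (cball 0 R) x :: real)"
  "integrable lebesgue (\<lambda>x::'a. c * indicator (cball 0 R) x :: real)"
proof -
  show *: "integrable lborel (\<lambda>x::'a. c * indicator (cball 0 R) x :: real)"
    using emeasure_lborel_cball_finite[of "0::'a" R]
    by (intro integrable_mult_right integrable_real_indicator) auto
  show "integrable lebesgue (\<lambda>x::'a. c * indicator (cball 0 R) x :: real)"
    using * by (subst integrable_completion) auto
qed

lemma bounded_supportE:
  fixes f :: "'a::real_normed_vector \<Rightarrow> real"
  assumes "bounded {x. f x \<noteq> 0}"
  obtains R where "{x. f x \<noteq> 0} \<subseteq> cball 0 R"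
proof -
  obtain R where "\<And>x. f x \<noteq> 0 \<Longrightarrow> norm x \<le> R" using assms by (auto simp: bounded_iff)
  then show thesis by (intro that[of R]) auto
qed

text \<open>A class closed under translations and products all of whose members are integrable: enough to
  manipulate integrals of difference quotients freely.\<close>

definition tame :: "(real^'n \<Rightarrow> real) \<Rightarrow> bool" where
  "tame f \<longleftrightarrow> f \<in> borel_measurable borel \<and> (\<exists>B. \<forall>x. \<bar>f x\<bar> \<le> B) \<and> bounded {x. f x \<noteq> 0}"

lemma tame_integrable:
  assumes "tame f"
  shows "integrable lborel f"
proof -
  obtain B where B: "\<And>x. \<bar>f x\<bar> \<le> B" using assms by (auto simp: tame_def)
  obtain R where R: "{x. f x \<noteq> 0} \<subseteq> cball 0 R"
    using assms bounded_supportE unfolding tame_def by blast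
  show ?thesis
  proof (rule Bochner_Integration.integrable_bound)
    show "integrable lborel (\<lambda>x. B * indicator (cball 0 R) x)"
      by (rule integrable_indicator_cball)
    show "AE x in lborel. norm (f x) \<le> norm (B * indicator (cball 0 R) x)"
    proof (rule AE_I2)
      fix x show "norm (f x) \<le> norm (B * indicator (cball 0 R) x)"
        using B[of x] R by (cases "f x = 0") (auto simp: indicator_def)
    qed
  qed (use assms in \<open>auto simp: tame_def\<close>)
qed

lemma tame_mult:
  assumes "tame f" "tame g"
  shows "tame (\<lambda>x. f x * g x)"
proof -
  obtain A B where "\<And>x. \<bar>f x\<bar> \<le> A" "\<And>x. \<bar>g x\<bar> \<le> B" using assms by (auto simp: tame_def)
  then have "\<bar>f x * g x\<bar> \<le> A * B" for x
    unfolding abs_mult by (meson abs_ge_zero mult_mono order_trans)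
  moreover have "bounded {x. f x * g x \<noteq> 0}"
    using assms by (auto simp: tame_def elim: bounded_subset)
  ultimately show ?thesis using assms by (auto simp: tame_def)
qed

lemma tame_translation:
  assumes "tame f"
  shows "tame (\<lambda>x. f (x + c))"
proof -
  obtain R where R: "{x. f x \<noteq> 0} \<subseteq> cball 0 R"
    using assms bounded_supportE unfolding tame_def by blast
  have "{x. f (x + c) \<noteq> 0} \<subseteq> cball 0 (R + norm c)"
  proof
    fix x assume "x \<in> {x. f (x + c) \<noteq> 0}"
    then have "norm (x + c) \<le> R" using R by auto
    then show "x \<in> cball 0 (R + norm c)" using norm_triangle_ineq4[of "x + c" c] by simp
  qed
  then have "bounded {x. f (x + c) \<noteq> 0}" by (rule bounded_subset[OF bounded_cball])
  then show ?thesis using assms by (auto simp: tame_def)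
qed

lemma tame_diff:
  assumes "tame f" "tame g"
  shows "tame (\<lambda>x. f x - g x)"
proof -
  obtain A B where AB: "\<And>x. \<bar>f x\<bar> \<le> A" "\<And>x. \<bar>g x\<bar> \<le> B" using assms by (auto simp: tame_def)
  have "\<bar>f x - g x\<bar> \<le> A + B" for x using AB(1)[of x] AB(2)[of x] by linarith
  moreover have "bounded {x. f x - g x \<noteq> 0}"
    by (rule bounded_subset[of "{x. f x \<noteq> 0} \<union> {x. g x \<noteq> 0}"]) (use assms in \<open>auto simp: tame_def\<close>)
  ultimately show ?thesis using assms by (auto simp: tame_def)
qed

lemma tame_divide: "tame f \<Longrightarrow> tame (\<lambda>x. f x / t)" for t :: real
proof -
  assume f: "tame f"
  then obtain A where "\<And>x. \<bar>f x\<bar> \<le> A" by (auto simp: tame_def)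
  then have "\<bar>f x / t\<bar> \<le> A / \<bar>t\<bar>" for x by (simp add: divide_right_mono)
  moreover have "bounded {x. f x / t \<noteq> 0}"
    by (rule bounded_subset[of "{x. f x \<noteq> 0}"]) (use f in \<open>auto simp: tame_def\<close>)
  ultimately show ?thesis using f by (auto simp: tame_def)
qed

definition diff_quot :: "real \<Rightarrow> 'n \<Rightarrow> (real^'n \<Rightarrow> real) \<Rightarrow> real^'n \<Rightarrow> real" where
  "diff_quot t j f x = (f (x + t *\<^sub>R axis j 1) - f x) / t"

lemma tame_diff_quot: "tame f \<Longrightarrow> tame (diff_quot t j f)"
  unfolding diff_quot_def[abs_def] by (intro tame_divide tame_diff tame_translation)

lemma diff_quot_commute: "diff_quot s i (diff_quot t j f) x = diff_quot t j (diff_quot s i f) x"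
proof -
  have c: "x + s *\<^sub>R axis i 1 + t *\<^sub>R axis j 1 = x + t *\<^sub>R axis j 1 + s *\<^sub>R axis i 1" by (simp add: add_ac)
  show ?thesis unfolding diff_quot_def c by (simp add: diff_divide_distrib mult.commute)
qed

text \<open>Summation by parts: a translation moves the shift from one factor to the other with opposite sign.\<close>

lemma LINT_diff_quot_parts:
  fixes f g :: "real^'n \<Rightarrow> real"
  assumes f: "tame f" and g: "tame g"
  shows "(LINT x|lborel. diff_quot t j f x * g x) = - (LINT x|lborel. f x * diff_quot (- t) j g x)"
proof -
  let ?e = "t *\<^sub>R axis j 1 :: real^'n"
  have i: "integrable lborel (\<lambda>x. f (x + ?e) * g x)" "integrable lborel (\<lambda>x. f x * g x)"
    "integrable lborel (\<lambda>x. f x * g (x + - ?e))"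
    by (intro tame_integrable tame_mult tame_translation f g)+
  have "(LINT x|lborel. f (x + ?e) * g x) = (LINT x|lborel. (\<lambda>y. f y * g (y + - ?e)) (x + ?e))" by simp
  also have "\<dots> = (LINT x|lborel. f x * g (x + - ?e))"
    by (rule LINT_lborel_translation) (use f g in \<open>auto simp: tame_def\<close>)
  finally have tr: "(LINT x|lborel. f (x + ?e) * g x) = (LINT x|lborel. f x * g (x + - ?e))" .
  have "(LINT x|lborel. diff_quot t j f x * g x) = (LINT x|lborel. (f (x + ?e) * g x - f x * g x) / t)"
    by (simp add: diff_quot_def left_diff_distrib)
  also have "\<dots> = ((LINT x|lborel. f (x + ?e) * g x) - (LINT x|lborel. f x * g x)) / t" using i by simp
  also have "\<dots> = (LINT x|lborel. (f x * g (x + - ?e) - f x * g x) / t)" unfolding tr using i by simp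
  also have "\<dots> = (LINT x|lborel. - (f x * diff_quot (- t) j g x))"
    by (intro Bochner_Integration.integral_cong refl) (simp add: diff_quot_def right_diff_distrib)
  finally show ?thesis by simp
qed

text \<open>Translations commute, so the roles of the two directions can be exchanged before passing to
  the limit; second derivatives never appear.\<close>

lemma LINT_diff_quot_swap:
  fixes f g :: "real^'n \<Rightarrow> real"
  assumes f: "tame f" and g: "tame g"
  shows "(LINT x|lborel. diff_quot t i f x * diff_quot t j g x)
       = (LINT x|lborel. diff_quot (- t) j f x * diff_quot (- t) i g x)"
proof -
  have "(LINT x|lborel. diff_quot t i f x * diff_quot t j g x)
      = - (LINT x|lborel. f x * diff_quot (- t) i (diff_quot t j g) x)"
    by (rule LINT_diff_quot_parts) (intro f g tame_diff_quot)+
  also have "\<dots> = - (LINT x|lborel. f x * diff_quot (- (- t)) j (diff_quot (- t) i g) x)"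
    by (simp add: diff_quot_commute[of "- t"])
  also have "\<dots> = (LINT x|lborel. diff_quot (- t) j f x * diff_quot (- t) i g x)"
    by (rule LINT_diff_quot_parts[symmetric]) (intro f g tame_diff_quot)+
  finally show ?thesis .
qed

text \<open>Differentiability almost everywhere is made part of the definition, as test functions and piecewise
  affine functions have it for elementary reasons.\<close>

definition lipc :: "(real^'n \<Rightarrow> real) \<Rightarrow> bool" where
  "lipc f \<longleftrightarrow> (\<exists>L. L-lipschitz_on UNIV f) \<and> bounded {x. f x \<noteq> 0} \<and> (AE x in lebesgue. f differentiable (at x))"

lemma lipcE:
  assumes "lipc f"
  obtains L where "L \<ge> 0" "\<And>x y. \<bar>f x - f y\<bar> \<le> L * norm (x - y)"
proof -
  obtain L where L: "L-lipschitz_on UNIV f" using assms by (auto simp: lipc_def)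
  show thesis
    using lipschitz_on_nonneg[OF L] lipschitz_on_normD[OF L] by (intro that[of L]) auto
qed

lemma lipc_continuous: "lipc f \<Longrightarrow> continuous_on UNIV f"
  by (auto simp: lipc_def intro: lipschitz_on_continuous_on)

lemma lipc_tame:
  assumes f: "lipc f"
  shows "tame f"
proof -
  have c: "continuous_on UNIV f" by (rule lipc_continuous[OF f])
  have b: "bounded {x. f x \<noteq> 0}" using f by (simp add: lipc_def)
  then obtain R where R: "{x. f x \<noteq> 0} \<subseteq> cball 0 R" by (rule bounded_supportE)
  have "bounded (f ` cball 0 R)"
    by (intro compact_imp_bounded compact_continuous_image continuous_on_subset[OF c]) auto
  then have "\<exists>B. \<forall>x\<in>cball 0 R. \<bar>f x\<bar> \<le> B" by (auto simp: bounded_iff)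
  then obtain B where B: "\<And>x. x \<in> cball 0 R \<Longrightarrow> \<bar>f x\<bar> \<le> B" by blast
  have "\<bar>f x\<bar> \<le> max B 0" for x using B[of x] R by (cases "f x = 0") (auto simp: le_max_iff_disj)
  with b borel_measurable_continuous_onI[OF c] show ?thesis by (auto simp: tame_def)
qed

lemma diff_quot_tendsto:
  fixes f :: "real^'n \<Rightarrow> real"
  assumes f: "f differentiable (at x)" and t: "t \<longlonglongrightarrow> 0" "\<And>n. t n \<noteq> 0"
  shows "(\<lambda>n. diff_quot (t n) j f x) \<longlonglongrightarrow> partial_deriv j f x"
proof -
  let ?f' = "frechet_derivative f (at x)" and ?e = "axis j 1 :: real^'n"
  have d: "(f has_derivative ?f') (at (x + 0 *\<^sub>R ?e))"
    using f unfolding frechet_derivative_works by simp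
  have "((\<lambda>s. f (x + s *\<^sub>R ?e)) has_derivative (\<lambda>s. ?f' (s *\<^sub>R ?e))) (at 0)"
    by (rule has_derivative_compose[where g=f and f="\<lambda>s. x + s *\<^sub>R ?e", OF _ d]) (auto intro!: derivative_eq_intros)
  moreover have "?f' (s *\<^sub>R ?e) = s * ?f' ?e" for s
    using linear_cmul[OF has_derivative_linear[OF d]] by simp
  ultimately have "((\<lambda>s. f (x + s *\<^sub>R ?e)) has_real_derivative ?f' ?e) (at 0)"
    by (simp add: has_field_derivative_def mult.commute[of _ "?f' ?e"])
  then have "((\<lambda>h. (f (x + h *\<^sub>R ?e) - f x) / h) \<longlongrightarrow> ?f' ?e) (at 0)"
    by (simp add: DERIV_def)
  moreover have "filterlim t (at 0) sequentially"
    using t by (simp add: filterlim_at)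
  ultimately have "((\<lambda>n. (f (x + t n *\<^sub>R ?e) - f x) / t n) \<longlonglongrightarrow> ?f' ?e)"
    by (rule filterlim_compose)
  then show ?thesis by (simp add: diff_quot_def partial_deriv_def)
qed

lemma AE_diff_quot_tendsto:
  assumes "lipc f" "t \<longlonglongrightarrow> 0" "\<And>n. t n \<noteq> 0"
  shows "AE x in lebesgue. (\<lambda>n. diff_quot (t n) j f x) \<longlonglongrightarrow> partial_deriv j f x"
proof -
  have "AE x in lebesgue. f differentiable (at x)" using assms(1) by (simp add: lipc_def)
  then show ?thesis by eventually_elim (rule diff_quot_tendsto[OF _ assms(2,3)])
qed

definition step :: "nat \<Rightarrow> real" where "step n = 1 / real (Suc n)"

lemma step: "step \<longlonglongrightarrow> 0" "step n \<noteq> 0" "0 < step n" "step n \<le> 1" "(\<lambda>n. - step n) \<longlonglongrightarrow> 0" "- step n \<noteq> 0"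
proof -
  show *: "step \<longlonglongrightarrow> 0" unfolding step_def[abs_def] by (rule LIMSEQ_Suc[OF lim_1_over_n])
  show "(\<lambda>n. - step n) \<longlonglongrightarrow> 0" using tendsto_minus[OF *] by simp
qed (auto simp: step_def)

lemma lipc_diff_quot_bound:
  assumes "\<And>x y. \<bar>f x - f y\<bar> \<le> L * norm (x - y)" "L \<ge> 0"
  shows "\<bar>diff_quot t j f x\<bar> \<le> L"
proof (cases "t = 0")
  case False
  have "\<bar>f (x + t *\<^sub>R axis j 1) - f x\<bar> \<le> L * \<bar>t\<bar>"
    using assms(1)[of "x + t *\<^sub>R axis j 1" x] by simp
  then show ?thesis using False by (simp add: diff_quot_def pos_divide_le_eq)
qed (simp add: diff_quot_def assms)

lemma diff_quot_support:
  assumes R: "{x. f x \<noteq> 0} \<subseteq> cball 0 R" and t: "\<bar>t\<bar> \<le> 1" and x: "x \<notin> cball 0 (R + 1)"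
  shows "diff_quot t j f x = 0"
proof -
  have "norm x > R + 1" using x by simp
  moreover have "norm x \<le> norm (x + t *\<^sub>R axis j 1) + \<bar>t\<bar>"
    using norm_triangle_ineq4[of "x + t *\<^sub>R axis j 1" "t *\<^sub>R axis j 1"] by simp
  ultimately have "norm (x + t *\<^sub>R axis j 1) > R" "norm x > R" using t by linarith+
  then have "f (x + t *\<^sub>R axis j 1) = 0" "f x = 0" using R by (auto simp: subset_iff)
  then show ?thesis by (simp add: diff_quot_def)
qed

text \<open>As almost everywhere limits of difference quotients, partial derivatives are measurable, bounded by the
  Lipschitz constant, and of bounded support.\<close>

lemma lipc_partial_deriv:
  fixes f :: "real^'n \<Rightarrow> real"
  assumes f: "lipc f"
  shows "partial_deriv j f \<in> borel_measurable lebesgue" "sq_integrable lebesgue (partial_deriv j f)"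
    "sq_integrable lebesgue f"
    and "(\<And>x y. \<bar>f x - f y\<bar> \<le> L * norm (x - y)) \<Longrightarrow> L \<ge> 0 \<Longrightarrow> AE x in lebesgue. \<bar>partial_deriv j f x\<bar> \<le> L"
proof -
  have [measurable]: "f \<in> borel_measurable borel" using lipc_tame[OF f] by (simp add: tame_def)
  have [measurable]: "diff_quot t j f \<in> borel_measurable borel" for t unfolding diff_quot_def by measurable
  have ae: "AE x in lebesgue. (\<lambda>n. diff_quot (step n) j f x) \<longlonglongrightarrow> partial_deriv j f x"
    by (rule AE_diff_quot_tendsto[OF f step(1,2)])
  show m: "partial_deriv j f \<in> borel_measurable lebesgue"
  proof (rule borel_measurable_lebesgue_cong_AE)
    show "(\<lambda>x. lim (\<lambda>n. diff_quot (step n) j f x)) \<in> borel_measurable lebesgue"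
      by (rule measurable_completion) measurable
    show "AE x in lebesgue. lim (\<lambda>n. diff_quot (step n) j f x) = partial_deriv j f x"
      using ae by eventually_elim (rule limI)
  qed
  show bound: "AE x in lebesgue. \<bar>partial_deriv j f x\<bar> \<le> L"
    if L: "\<And>x y. \<bar>f x - f y\<bar> \<le> L * norm (x - y)" "L \<ge> 0" for L
    using ae
  proof eventually_elim
    case (elim x)
    show ?case
      by (rule LIMSEQ_le_const2[OF tendsto_rabs[OF elim]]) (auto intro: lipc_diff_quot_bound[OF L])
  qed
  obtain L where L: "L \<ge> 0" "\<And>x y. \<bar>f x - f y\<bar> \<le> L * norm (x - y)" by (rule lipcE[OF f]) (rule that)
  obtain R where R: "{x. f x \<noteq> 0} \<subseteq> cball 0 R"
    using f bounded_supportE unfolding lipc_def by blast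
  show "sq_integrable lebesgue (partial_deriv j f)"
  proof (rule sq_integrable_bound[OF m])
    show "integrable lebesgue (\<lambda>x. L\<^sup>2 * indicator (cball 0 (R + 1)) x)"
      by (rule integrable_indicator_cball)
    show "AE x in lebesgue. (norm (partial_deriv j f x))\<^sup>2 \<le> L\<^sup>2 * indicator (cball 0 (R + 1)) x"
      using bound[OF L(2,1)] ae
    proof eventually_elim
      case (elim x)
      show ?case
      proof (cases "x \<in> cball 0 (R + 1)")
        case True
        then show ?thesis using power_mono[OF elim(1), of 2] by simp
      next
        case False
        have "\<bar>step n\<bar> \<le> 1" for n using step(3,4)[of n] by simp
        then have "(\<lambda>n. diff_quot (step n) j f x) = (\<lambda>_. 0)"
          using diff_quot_support[OF R _ False] by blast
        with elim(2) have "(\<lambda>_::nat. 0) \<longlonglongrightarrow> partial_deriv j f x" by (simp only:)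
        then have "partial_deriv j f x = 0" by (simp add: LIMSEQ_const_iff)
        then show ?thesis by simp
      qed
    qed
  qed
  have "integrable lborel (\<lambda>x. f x * f x)" by (intro tame_integrable tame_mult lipc_tame f)
  then show "sq_integrable lebesgue f"
    by (auto simp: sq_integrable_def power2_eq_square integrable_completion measurable_completion)
qed

text \<open>Dominated convergence, with a multiple of the indicator of a ball as majorant.\<close>

lemma tendsto_LINT_mult:
  fixes a b :: "nat \<Rightarrow> real^'n \<Rightarrow> real"
  assumes m: "\<And>n. a n \<in> borel_measurable borel" "\<And>n. b n \<in> borel_measurable borel"
    and m': "a' \<in> borel_measurable lebesgue" "b' \<in> borel_measurable lebesgue"
    and bd: "\<And>n x. \<bar>a n x\<bar> \<le> A" "\<And>n x. \<bar>b n x\<bar> \<le> B"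
    and supp: "\<And>n x. x \<notin> cball 0 R \<Longrightarrow> a n x = 0"
    and lim: "AE x in lebesgue. (\<lambda>n. a n x) \<longlonglongrightarrow> a' x" "AE x in lebesgue. (\<lambda>n. b n x) \<longlonglongrightarrow> b' x"
  shows "(\<lambda>n. LINT x|lborel. a n x * b n x) \<longlonglongrightarrow> (LINT x|lebesgue. a' x * b' x)"
proof -
  have "(\<lambda>n. LINT x|lebesgue. a n x * b n x) \<longlonglongrightarrow> (LINT x|lebesgue. a' x * b' x)"
  proof (rule integral_dominated_convergence[where w="\<lambda>x. (A * B) * indicator (cball 0 R) x"])
    show "integrable lebesgue (\<lambda>x::real^'n. (A * B) * indicator (cball 0 R) x)"
      by (rule integrable_indicator_cball)
    show "AE x in lebesgue. (\<lambda>n. a n x * b n x) \<longlonglongrightarrow> a' x * b' x"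
      using lim by eventually_elim (intro tendsto_intros)
    show "AE x in lebesgue. norm (a n x * b n x) \<le> (A * B) * indicator (cball 0 R) x" for n
    proof (rule AE_I2)
      fix x
      have "0 \<le> A" using bd(1)[of 0 0] by (meson abs_ge_zero order_trans)
      then show "norm (a n x * b n x) \<le> (A * B) * indicator (cball 0 R) x"
        using supp[of x n] bd(1)[of n x] bd(2)[of n x]
        by (cases "x \<in> cball 0 R") (auto simp: abs_mult intro!: mult_mono)
    qed
    show "(\<lambda>x. a n x * b n x) \<in> borel_measurable lebesgue" for n
      using m by (intro measurable_completion) simp
  qed (use m' in measurable)
  moreover have "(LINT x|lebesgue. a n x * b n x) = (LINT x|lborel. a n x * b n x)" for n
    using m by (intro integral_completion) simp
  ultimately show ?thesis by simp
qed

lemma lipc_limits: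
  fixes f g :: "real^'n \<Rightarrow> real"
  assumes f: "lipc f" and g: "lipc g" and t: "t \<longlonglongrightarrow> 0" "\<And>n. t n \<noteq> 0" "\<And>n. \<bar>t n\<bar> \<le> 1"
  shows "(\<lambda>n. LINT x|lborel. diff_quot (t n) i f x * diff_quot (t n) j g x)
      \<longlonglongrightarrow> (LINT x|lebesgue. partial_deriv i f x * partial_deriv j g x)"
    and "(\<lambda>n. LINT x|lborel. diff_quot (t n) i f x * g x) \<longlonglongrightarrow> (LINT x|lebesgue. partial_deriv i f x * g x)"
proof -
  obtain L where L: "L \<ge> 0" "\<And>x y. \<bar>f x - f y\<bar> \<le> L * norm (x - y)" by (rule lipcE[OF f]) (rule that)
  obtain L' where L': "L' \<ge> 0" "\<And>x y. \<bar>g x - g y\<bar> \<le> L' * norm (x - y)" by (rule lipcE[OF g]) (rule that)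
  obtain R where R: "{x. f x \<noteq> 0} \<subseteq> cball 0 R"
    using f bounded_supportE unfolding lipc_def by blast
  have tm: "tame f" "tame g" using f g by (auto intro: lipc_tame)
  then obtain B where B: "\<And>x. \<bar>g x\<bar> \<le> B" by (auto simp: tame_def)
  have dm: "diff_quot s k h \<in> borel_measurable borel" if "tame h" for s k and h :: "real^'n \<Rightarrow> real"
    using tame_diff_quot[OF that] by (simp add: tame_def)
  show "(\<lambda>n. LINT x|lborel. diff_quot (t n) i f x * diff_quot (t n) j g x)
      \<longlonglongrightarrow> (LINT x|lebesgue. partial_deriv i f x * partial_deriv j g x)"
  proof (rule tendsto_LINT_mult[where A=L and B=L' and R="R+1"])
    show "\<bar>diff_quot (t n) i f x\<bar> \<le> L" "\<bar>diff_quot (t n) j g x\<bar> \<le> L'" for n x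
      by (rule lipc_diff_quot_bound[OF L(2,1)], rule lipc_diff_quot_bound[OF L'(2,1)])
    show "x \<notin> cball 0 (R + 1) \<Longrightarrow> diff_quot (t n) i f x = 0" for n x
      by (rule diff_quot_support[OF R t(3)])
    show "AE x in lebesgue. (\<lambda>n. diff_quot (t n) i f x) \<longlonglongrightarrow> partial_deriv i f x"
      "AE x in lebesgue. (\<lambda>n. diff_quot (t n) j g x) \<longlonglongrightarrow> partial_deriv j g x"
      by (rule AE_diff_quot_tendsto[OF f t(1,2)], rule AE_diff_quot_tendsto[OF g t(1,2)])
  qed (intro dm tm lipc_partial_deriv(1) f g)+
  have gm: "g \<in> borel_measurable borel" using tm(2) by (simp add: tame_def)
  show "(\<lambda>n. LINT x|lborel. diff_quot (t n) i f x * g x) \<longlonglongrightarrow> (LINT x|lebesgue. partial_deriv i f x * g x)"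
  proof (rule tendsto_LINT_mult[where A=L and B=B and R="R+1"])
    show "\<bar>diff_quot (t n) i f x\<bar> \<le> L" for n x
      by (rule lipc_diff_quot_bound[OF L(2,1)])
    show "x \<notin> cball 0 (R + 1) \<Longrightarrow> diff_quot (t n) i f x = 0" for n x
      by (rule diff_quot_support[OF R t(3)])
    show "AE x in lebesgue. (\<lambda>n. diff_quot (t n) i f x) \<longlonglongrightarrow> partial_deriv i f x"
      by (rule AE_diff_quot_tendsto[OF f t(1,2)])
    show "AE x in lebesgue. (\<lambda>n. g x) \<longlonglongrightarrow> g x" by simp
    show "g \<in> borel_measurable lebesgue" using gm by (simp add: measurable_completion)
  qed (intro B gm dm tm lipc_partial_deriv(1) f)+
qed

lemma abs_step: "\<bar>step n\<bar> \<le> 1" "\<bar>- step n\<bar> \<le> 1"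
  using step(3,4)[of n] by auto

lemma lipc_integration_by_parts:
  assumes f: "lipc f" and g: "lipc g"
  shows "(LINT x|lebesgue. f x * partial_deriv j g x) = - (LINT x|lebesgue. partial_deriv j f x * g x)"
proof -
  have "(\<lambda>n. LINT x|lborel. diff_quot (step n) j f x * g x) \<longlonglongrightarrow> (LINT x|lebesgue. partial_deriv j f x * g x)"
    by (rule lipc_limits(2)[OF f g step(1,2) abs_step(1)])
  moreover have "(LINT x|lborel. diff_quot (step n) j f x * g x) = - (LINT x|lborel. diff_quot (- step n) j g x * f x)" for n
    using LINT_diff_quot_parts[OF lipc_tame[OF f] lipc_tame[OF g], of "step n" j] by (simp add: mult.commute)
  moreover have "(\<lambda>n. - (LINT x|lborel. diff_quot (- step n) j g x * f x)) \<longlonglongrightarrow> - (LINT x|lebesgue. partial_deriv j g x * f x)"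
    by (intro tendsto_minus lipc_limits(2)[OF g f step(5,6) abs_step(2)])
  ultimately have "- (LINT x|lebesgue. partial_deriv j g x * f x) = (LINT x|lebesgue. partial_deriv j f x * g x)"
    using LIMSEQ_unique by auto
  then show ?thesis by (simp add: mult.commute)
qed

lemma lipc_swap_derivatives:
  assumes f: "lipc f" and g: "lipc g"
  shows "(LINT x|lebesgue. partial_deriv i f x * partial_deriv j g x) = (LINT x|lebesgue. partial_deriv j f x * partial_deriv i g x)"
proof (rule LIMSEQ_unique)
  show "(\<lambda>n. LINT x|lborel. diff_quot (step n) i f x * diff_quot (step n) j g x)
     \<longlonglongrightarrow> (LINT x|lebesgue. partial_deriv i f x * partial_deriv j g x)"
    by (rule lipc_limits(1)[OF f g step(1,2) abs_step(1)])
  have "(LINT x|lborel. diff_quot (step n) i f x * diff_quot (step n) j g x)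
      = (LINT x|lborel. diff_quot (- step n) j f x * diff_quot (- step n) i g x)" for n
    by (rule LINT_diff_quot_swap[OF lipc_tame[OF f] lipc_tame[OF g]])
  with lipc_limits(1)[OF f g step(5,6) abs_step(2), of j i]
  show "(\<lambda>n. LINT x|lborel. diff_quot (step n) i f x * diff_quot (step n) j g x)
     \<longlonglongrightarrow> (LINT x|lebesgue. partial_deriv j f x * partial_deriv i g x)"
    by presburger
qed

text \<open>\<open>shift_Poincare\<close> for steps \<open>t e\<^sub>j\<close> with \<open>N t \<le> R + 2t\<close>, divided by \<open>t\<^sup>2\<close>, in the limit \<open>t \<rightarrow> 0\<close>.\<close>

lemma lipc_Poincare:
  fixes f :: "real^'n \<Rightarrow> real"
  assumes f: "lipc f" and R: "R \<ge> 0" "\<And>x y. f x \<noteq> 0 \<Longrightarrow> f y \<noteq> 0 \<Longrightarrow> norm (x - y) \<le> R"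
  shows "2 * (LINT x|lebesgue. (f x)\<^sup>2) \<le> R\<^sup>2 * (LINT x|lebesgue. (partial_deriv j f x)\<^sup>2)"
proof -
  have [measurable]: "f \<in> borel_measurable borel" using lipc_tame[OF f] by (simp add: tame_def)
  have bound: "2 * (LINT x|lebesgue. (f x)\<^sup>2) \<le> (R + 2 * step n)\<^sup>2 * (LINT x|lborel. diff_quot (step n) j f x * diff_quot (step n) j f x)" for n
  proof -
    let ?\<xi> = "step n *\<^sub>R axis j 1 :: real^'n"
    have n\<xi>: "norm ?\<xi> = step n" using step(3)[of n] by simp
    have "?\<xi> \<noteq> 0" using n\<xi> step(3)[of n] by (metis norm_zero less_irrefl)
    then obtain N :: nat where N: "R < real N * norm ?\<xi>" "real N * norm ?\<xi> \<le> R + 2 * norm ?\<xi>"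
      by (rule step_count[OF R(1)])
    have sep: "f x = 0 \<or> f (x + real N *\<^sub>R ?\<xi>) = 0" for x
    proof (rule ccontr)
      assume "\<not> ?thesis"
      then have "norm ((x + real N *\<^sub>R ?\<xi>) - x) \<le> R" using R(2) by blast
      moreover have "norm ((x + real N *\<^sub>R ?\<xi>) - x) = real N * norm ?\<xi>"
        by (simp only: add_diff_cancel_left' norm_scaleR abs_of_nat)
      ultimately show False using N(1) by linarith
    qed
    let ?Q = "LINT x|lborel. diff_quot (step n) j f x * diff_quot (step n) j f x"
    have i1: "integrable lborel (\<lambda>x. (f x)\<^sup>2)"
      unfolding power2_eq_square by (intro tame_integrable tame_mult lipc_tame f)
    have i2: "integrable lborel (\<lambda>x. diff_quot (step n) j f x * diff_quot (step n) j f x)"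
      by (intro tame_integrable tame_mult lipc_tame f tame_diff_quot)
    have "ennreal (2 * (LINT x|lborel. (f x)\<^sup>2)) = 2 * (\<integral>\<^sup>+x. ennreal ((f x)\<^sup>2) \<partial>lborel)"
      by (subst nn_integral_eq_integral[OF i1]) (auto simp: ennreal_mult)
    also have "\<dots> \<le> ennreal ((real N)\<^sup>2) * (\<integral>\<^sup>+x. ennreal ((f (x + ?\<xi>) - f x)\<^sup>2) \<partial>lborel)"
      by (rule shift_Poincare[of f N ?\<xi>, OF _ sep]) measurable
    also have "(\<integral>\<^sup>+x. ennreal ((f (x + ?\<xi>) - f x)\<^sup>2) \<partial>lborel) = (\<integral>\<^sup>+x. ennreal ((step n)\<^sup>2 * (diff_quot (step n) j f x * diff_quot (step n) j f x)) \<partial>lborel)"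
    proof (rule nn_integral_cong)
      fix x
      have "f (x + ?\<xi>) - f x = step n * diff_quot (step n) j f x" using step(2) by (simp add: diff_quot_def)
      then have "(f (x + ?\<xi>) - f x)\<^sup>2 = (step n)\<^sup>2 * (diff_quot (step n) j f x * diff_quot (step n) j f x)"
        by (simp only: power_mult_distrib power2_eq_square[of "diff_quot _ _ _ _"])
      then show "ennreal ((f (x + ?\<xi>) - f x)\<^sup>2) = ennreal ((step n)\<^sup>2 * (diff_quot (step n) j f x * diff_quot (step n) j f x))"
        by (rule arg_cong)
    qed
    also have "\<dots> = ennreal (LINT x|lborel. (step n)\<^sup>2 * (diff_quot (step n) j f x * diff_quot (step n) j f x))"
      by (rule nn_integral_eq_integral) (use i2 in auto)
    also have "\<dots> = ennreal ((step n)\<^sup>2 * ?Q)" by simp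
    also have "ennreal ((real N)\<^sup>2) * \<dots> = ennreal ((real N * step n)\<^sup>2 * ?Q)"
      by (subst ennreal_mult[symmetric]) (auto simp: power_mult_distrib mult.assoc)
    finally have "2 * (LINT x|lborel. (f x)\<^sup>2) \<le> (real N * step n)\<^sup>2 * ?Q"
      by (subst (asm) ennreal_le_iff) auto
    also have "\<dots> \<le> (R + 2 * step n)\<^sup>2 * ?Q"
      using N n\<xi> step(3)[of n] R by (intro mult_right_mono power_mono) auto
    finally show ?thesis by (simp add: integral_completion)
  qed
  have "(\<lambda>n. (R + 2 * step n)\<^sup>2 * (LINT x|lborel. diff_quot (step n) j f x * diff_quot (step n) j f x))
     \<longlonglongrightarrow> (R + 2 * 0)\<^sup>2 * (LINT x|lebesgue. partial_deriv j f x * partial_deriv j f x)"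
    by (intro tendsto_intros step(1) lipc_limits(1)[OF f f step(1,2) abs_step(1)])
  from LIMSEQ_le_const[OF this, of "2 * (LINT x|lebesgue. (f x)\<^sup>2)"] bound
  show ?thesis by (simp add: power2_eq_square)
qed

section \<open>Test functions and uniqueness of weak gradients\<close>

text \<open>The functions \<open>exp (- 1/x) / x\<^sup>k\<close>, extended by zero, are closed under differentiation up to linear
  combinations, so that smoothness is proved for all \<open>k\<close> at once.\<close>

definition flat_exp :: "nat \<Rightarrow> real \<Rightarrow> real" where
  "flat_exp k x = (if x > 0 then exp (- (1 / x)) / x ^ k else 0)"

lemma flat_exp_tendsto_0: "(flat_exp k \<longlongrightarrow> 0) (at 0)"
proof (rule filterlim_split_at)
  have "\<forall>\<^sub>F x in at_left (0::real). flat_exp k x = 0"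
    unfolding eventually_at_filter by (auto simp: flat_exp_def intro!: always_eventually)
  then show "(flat_exp k \<longlongrightarrow> 0) (at_left 0)" by (rule tendsto_eventually)
  have "((\<lambda>x. inverse x ^ k / exp (inverse x)) \<longlongrightarrow> (0::real)) (at_right 0)"
    by (rule filterlim_compose[OF tendsto_power_div_exp_0 filterlim_inverse_at_top_right])
  moreover have "\<forall>\<^sub>F x in at_right (0::real). inverse x ^ k / exp (inverse x) = flat_exp k x"
    unfolding eventually_at_filter
    by (auto simp: flat_exp_def exp_minus field_simps intro!: always_eventually)
  ultimately show "(flat_exp k \<longlongrightarrow> 0) (at_right 0)" by (rule Lim_transform_eventually)
qed

lemma flat_exp_deriv:
  "(flat_exp k has_real_derivative (flat_exp (k + 2) x - real k * flat_exp (k + 1) x)) (at x)"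
proof -
  consider "x > 0" | "x < 0" | "x = 0" by linarith
  then show ?thesis
  proof cases
    case 1
    have "((\<lambda>x. exp (- (1 / x)) / x ^ k) has_real_derivative (flat_exp (k + 2) x - real k * flat_exp (k + 1) x)) (at x)"
    proof -
      have "((\<lambda>x. exp (- (1 / x))) has_real_derivative exp (- (1 / x)) / x\<^sup>2) (at x)"
        using 1 by (auto intro!: derivative_eq_intros simp: field_simps power2_eq_square)
      from DERIV_divide[OF this DERIV_pow[of k x UNIV]] 1
      have "((\<lambda>x. exp (- (1 / x)) / x ^ k) has_real_derivative
          (exp (- (1 / x)) / x\<^sup>2 * x ^ k - exp (- (1 / x)) * (real k * x ^ (k - Suc 0))) / (x ^ k * x ^ k)) (at x)"
        by simp
      moreover have "(exp (- (1 / x)) / x\<^sup>2 * x ^ k - exp (- (1 / x)) * (real k * x ^ (k - Suc 0))) / (x ^ k * x ^ k)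
          = flat_exp (k + 2) x - real k * flat_exp (k + 1) x"
        using 1 by (cases k) (simp_all add: flat_exp_def field_simps power2_eq_square)
      ultimately show ?thesis by simp
    qed
    then show ?thesis
      by (rule has_field_derivative_transform_within_open[where S="{0<..}"]) (use 1 in \<open>auto simp: flat_exp_def\<close>)
  next
    case 2
    have "((\<lambda>x. 0) has_real_derivative 0) (at x)" by simp
    then have "(flat_exp k has_real_derivative 0) (at x)"
      by (rule has_field_derivative_transform_within_open[where S="{..<0}"]) (use 2 in \<open>auto simp: flat_exp_def\<close>)
    then show ?thesis using 2 by (simp add: flat_exp_def)
  next
    case 3
    have "\<forall>\<^sub>F h in at 0. flat_exp (k + 1) h = (flat_exp k (0 + h) - flat_exp k 0) / h"
      unfolding eventually_at_filter by (auto simp: flat_exp_def intro!: always_eventually)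
    with flat_exp_tendsto_0[of "k + 1"] have "((\<lambda>h. (flat_exp k (0 + h) - flat_exp k 0) / h) \<longlongrightarrow> 0) (at 0)"
      by (rule Lim_transform_eventually)
    then show ?thesis using 3 by (simp add: DERIV_def flat_exp_def)
  qed
qed

lemma partial_deriv_eq:
  assumes "(f has_derivative f') (at x)"
  shows "partial_deriv j f x = f' (axis j 1)"
  using frechet_derivative_at[OF assms] by (simp add: partial_deriv_def)

lemma Ck_SucD: "Ck (Suc m) f \<Longrightarrow> Ck m f"
proof (induction m arbitrary: f)
  case 0 then show ?case by (auto intro: differentiable_imp_continuous_on)
next
  case (Suc m)
  then have "f differentiable_on UNIV" "\<And>j. Ck (Suc m) (partial_deriv j f)" by auto
  with Suc.IH show ?case by simp
qed

lemma Ck_const: "Ck m (\<lambda>_. c)"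
proof (induction m arbitrary: c)
  case (Suc m)
  have "partial_deriv j (\<lambda>_. c) = (\<lambda>_. 0)" for j :: 'a
    by (rule ext) (simp add: partial_deriv_def)
  with Suc[of 0] show ?case by simp
qed simp

lemma Ck_add: "Ck m f \<Longrightarrow> Ck m g \<Longrightarrow> Ck m (\<lambda>x. f x + g x)"
proof (induction m arbitrary: f g)
  case 0 then show ?case by (simp add: continuous_on_add)
next
  case (Suc m)
  have d: "(f has_derivative frechet_derivative f (at x)) (at x)" "(g has_derivative frechet_derivative g (at x)) (at x)" for x
    using Suc.prems by (auto simp: differentiable_on_def frechet_derivative_works)
  have "partial_deriv j (\<lambda>x. f x + g x) = (\<lambda>x. partial_deriv j f x + partial_deriv j g x)" for j
  proof
    fix x show "partial_deriv j (\<lambda>x. f x + g x) x = partial_deriv j f x + partial_deriv j g x"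
      using partial_deriv_eq[OF has_derivative_add[OF d[of x]], of j] by (simp add: partial_deriv_def)
  qed
  with Suc show ?case by (auto intro: differentiable_on_add)
qed

lemma Ck_mult: "Ck m f \<Longrightarrow> Ck m g \<Longrightarrow> Ck m (\<lambda>x. f x * g x)"
proof (induction m arbitrary: f g)
  case 0 then show ?case by (simp add: continuous_on_mult)
next
  case (Suc m)
  have d: "(f has_derivative frechet_derivative f (at x)) (at x)" "(g has_derivative frechet_derivative g (at x)) (at x)" for x
    using Suc.prems by (auto simp: differentiable_on_def frechet_derivative_works)
  have eq: "partial_deriv j (\<lambda>x. f x * g x) = (\<lambda>x. f x * partial_deriv j g x + partial_deriv j f x * g x)" for j
  proof
    fix x show "partial_deriv j (\<lambda>x. f x * g x) x = f x * partial_deriv j g x + partial_deriv j f x * g x"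
      using partial_deriv_eq[OF has_derivative_mult[OF d[of x]], of j] by (simp add: partial_deriv_def)
  qed
  have "Ck m (partial_deriv j (\<lambda>x. f x * g x))" for j
    unfolding eq using Suc.prems Ck_SucD[OF Suc.prems(1)] Ck_SucD[OF Suc.prems(2)]
    by (intro Ck_add Suc.IH) auto
  moreover have "(\<lambda>x. f x * g x) differentiable_on UNIV"
    using Suc.prems by (intro differentiable_on_mult) auto
  ultimately show ?case by simp
qed

lemma Ck_prod: "finite I \<Longrightarrow> (\<And>i. i \<in> I \<Longrightarrow> Ck m (f i)) \<Longrightarrow> Ck m (\<lambda>x. \<Prod>i\<in>I. f i x)"
  by (induction I rule: finite_induct) (auto intro: Ck_const Ck_mult)

lemma Ck_flat_exp: "Ck m (\<lambda>x::real^'n. flat_exp k (c * x $ i + d))"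
proof (induction m arbitrary: k)
  case 0
  have "continuous_on UNIV (flat_exp k)"
    by (intro continuous_at_imp_continuous_on ballI DERIV_isCont) (rule flat_exp_deriv)
  then show ?case
    by (auto intro!: continuous_on_compose2[of UNIV "flat_exp k"] continuous_intros)
next
  case (Suc m)
  let ?D = "\<lambda>x::real^'n. flat_exp (k + 2) (c * x $ i + d) + (- real k) * flat_exp (k + 1) (c * x $ i + d)"
  have d: "((\<lambda>x::real^'n. flat_exp k (c * x $ i + d)) has_derivative (\<lambda>v. ?D x * (c * v $ i))) (at x)" for x
  proof -
    have "(flat_exp k has_derivative (\<lambda>h. ?D x * h)) (at (c * x $ i + d))"
      using flat_exp_deriv[of k "c * x $ i + d"] unfolding has_field_derivative_def by simp
    moreover have "((\<lambda>x. c * x $ i + d) has_derivative (\<lambda>v. c * v $ i)) (at x)"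
      by (auto intro!: derivative_eq_intros bounded_linear.has_derivative[OF bounded_linear_vec_nth])
    ultimately show ?thesis
      using has_derivative_compose[of "\<lambda>x. c * x $ i + d" "\<lambda>v. c * v $ i" x UNIV "flat_exp k" "\<lambda>h. ?D x * h"] by simp
  qed
  have eq: "partial_deriv j (\<lambda>x::real^'n. flat_exp k (c * x $ i + d)) = (\<lambda>x. ?D x * (c * (axis j 1 :: real^'n) $ i))" for j
    by (rule ext) (rule partial_deriv_eq[OF d])
  have "Ck m (partial_deriv j (\<lambda>x::real^'n. flat_exp k (c * x $ i + d)))" for j
    unfolding eq by (intro Ck_mult Ck_add Ck_const Suc.IH)
  moreover have "(\<lambda>x::real^'n. flat_exp k (c * x $ i + d)) differentiable_on UNIV"
    using d by (auto simp: differentiable_on_def differentiable_def)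
  ultimately show ?case by simp
qed

text \<open>Smooth, positive exactly on the open box, and tending to its indicator from below: rescaling the argument of
  \<open>exp (- 1/x)\<close> by \<open>n + 1\<close> pushes its values towards \<open>1\<close> on the positive axis.\<close>

definition box_bump :: "real^'n \<Rightarrow> real^'n \<Rightarrow> nat \<Rightarrow> real^'n \<Rightarrow> real" where
  "box_bump a b n x = (\<Prod>i\<in>UNIV. flat_exp 0 (real (Suc n) * x $ i + - real (Suc n) * a $ i)
      * flat_exp 0 (- real (Suc n) * x $ i + real (Suc n) * b $ i))"

lemma flat_exp_0: "0 \<le> flat_exp 0 x" "flat_exp 0 x \<le> 1" "flat_exp 0 x \<noteq> 0 \<longleftrightarrow> x > 0"
  by (auto simp: flat_exp_def)

lemma box_bump_nonzero_iff: "box_bump a b n x \<noteq> 0 \<longleftrightarrow> x \<in> box a b"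
proof -
  have "real (Suc n) * x $ i + - real (Suc n) * a $ i > 0 \<longleftrightarrow> a $ i < x $ i" for i
    using mult_less_cancel_left_pos[of "real (Suc n)" "a $ i" "x $ i"] by (simp add: algebra_simps)
  moreover have "- real (Suc n) * x $ i + real (Suc n) * b $ i > 0 \<longleftrightarrow> x $ i < b $ i" for i
    using mult_less_cancel_left_pos[of "real (Suc n)" "x $ i" "b $ i"] by (simp add: algebra_simps)
  ultimately show ?thesis
    unfolding box_bump_def mem_box_cart by (simp only: prod_zero_iff finite_class.finite_UNIV mult_eq_0_iff flat_exp_0(3)[symmetric]) (metis UNIV_I)
qed

lemma box_bump_bounds: "0 \<le> box_bump a b n x" "box_bump a b n x \<le> 1"
  unfolding box_bump_def by (auto intro!: prod_nonneg prod_le_1 mult_nonneg_nonneg mult_le_one flat_exp_0)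

lemma box_bump_tendsto: "(\<lambda>n. box_bump a b n x) \<longlonglongrightarrow> indicator (box a b) x"
proof (cases "x \<in> box a b")
  case False
  then have "box_bump a b n x = 0" for n using box_bump_nonzero_iff by blast
  with False show ?thesis by simp
next
  case True
  have lim: "(\<lambda>n. flat_exp 0 (real (Suc n) * s)) \<longlonglongrightarrow> 1" if "s > 0" for s
  proof -
    have "(\<lambda>n. exp (- ((1 / s) * step n))) \<longlonglongrightarrow> exp (- ((1 / s) * 0))" by (intro tendsto_intros step(1))
    moreover have "flat_exp 0 (real (Suc n) * s) = exp (- ((1 / s) * step n))" for n
      using that by (simp add: flat_exp_def step_def mult.commute)
    ultimately show ?thesis by simp
  qed
  have "(\<lambda>n. box_bump a b n x) \<longlonglongrightarrow> (\<Prod>i\<in>(UNIV::'a set). 1 * 1)"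
    unfolding box_bump_def
  proof (intro tendsto_prod tendsto_mult)
    fix i
    have "x $ i - a $ i > 0" "b $ i - x $ i > 0" using True by (auto simp: mem_box_cart)
    note l = this[THEN lim]
    have eq: "real (Suc n) * x $ i + - real (Suc n) * a $ i = real (Suc n) * (x $ i - a $ i)"
      "- real (Suc n) * x $ i + real (Suc n) * b $ i = real (Suc n) * (b $ i - x $ i)" for n
      by (simp_all add: algebra_simps)
    show "(\<lambda>n. flat_exp 0 (real (Suc n) * x $ i + - real (Suc n) * a $ i)) \<longlonglongrightarrow> 1"
      "(\<lambda>n. flat_exp 0 (- real (Suc n) * x $ i + real (Suc n) * b $ i)) \<longlonglongrightarrow> 1"
      unfolding eq by (fact l)+
  qed
  with True show ?thesis by simp
qed

lemma test_function_box_bump: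
  assumes "cbox a b \<subseteq> \<Omega>"
  shows "test_function \<Omega> (box_bump a b n)"
proof -
  have eq: "{x. box_bump a b n x \<noteq> 0} = box a b" by (auto simp: box_bump_nonzero_iff)
  have "closure (box a b) \<subseteq> cbox a b" by (rule closure_minimal[OF box_subset_cbox closed_cbox])
  moreover have "compact (closure (box a b))" by (simp add: compact_closure bounded_box)
  moreover have "Ck m (box_bump a b n)" for m
    unfolding box_bump_def[abs_def] by (intro Ck_prod Ck_mult Ck_flat_exp) simp
  ultimately show ?thesis using assms unfolding test_function_def eq by blast
qed

text \<open>The measures with densities the positive and negative parts of \<open>h\<close> agree on boxes, which are stable under
  intersection and generate the Borel sets.\<close>

lemma AE_zero_of_box_integrals:
  fixes h :: "real^'n \<Rightarrow> real"
  assumes h: "integrable lborel h" and z: "\<And>a b. (LINT x|lborel. h x * indicator (box a b) x) = 0"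
  shows "AE x in lborel. h x = 0"
proof -
  have [measurable]: "h \<in> borel_measurable borel" using borel_measurable_integrable[OF h] by simp
  let ?M1 = "density lborel (\<lambda>x. ennreal (h x))" and ?M2 = "density lborel (\<lambda>x. ennreal (- h x))"
  have em: "emeasure (density lborel (\<lambda>x. ennreal (g x))) X = ennreal (LINT x|lborel. max 0 (g x) * indicator X x)"
    if "integrable lborel g" "X \<in> sets borel" for g :: "real^'n \<Rightarrow> real" and X
  proof -
    have [measurable]: "g \<in> borel_measurable borel" "X \<in> sets borel" using borel_measurable_integrable[OF that(1)] that by auto
    have "emeasure (density lborel (\<lambda>x. ennreal (g x))) X = (\<integral>\<^sup>+x. ennreal (max 0 (g x) * indicator X x) \<partial>lborel)"
      by (subst emeasure_density) (auto intro!: nn_integral_cong simp: indicator_def max_def ennreal_neg)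
    also have "\<dots> = ennreal (LINT x|lborel. max 0 (g x) * indicator X x)"
      by (rule nn_integral_eq_integral) (use that in \<open>auto intro!: integrable_real_mult_indicator\<close>)
    finally show ?thesis .
  qed
  have eq: "?M1 = ?M2"
  proof (rule measure_eqI_generator_eq)
    let ?E = "range (\<lambda>(a, b). box a b::(real^'n) set)"
    show "Int_stable ?E"
      by (auto simp: Int_stable_def box_Int_box)
    show "?E \<subseteq> Pow UNIV" "sets ?M1 = sigma_sets UNIV ?E" "sets ?M2 = sigma_sets UNIV ?E"
      by (simp_all add: borel_eq_box)
    let ?A = "\<lambda>n::nat. box (- (real n *\<^sub>R One)) (real n *\<^sub>R One) :: (real^'n) set"
    show "range ?A \<subseteq> ?E" "(\<Union>i. ?A i) = UNIV"
      unfolding UN_box_eq_UNIV by auto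
    show "emeasure ?M1 (?A i) \<noteq> \<infinity>" for i using em[OF h, of "?A i"] by simp
    show "emeasure ?M1 X = emeasure ?M2 X" if "X \<in> ?E" for X
    proof -
      from that obtain a b where X: "X = box a b" by auto
      have i: "integrable lborel (\<lambda>x. max 0 (h x) * indicator (box a b) x)"
        "integrable lborel (\<lambda>x. max 0 (- h x) * indicator (box a b) x)"
        using h by (auto intro!: integrable_real_mult_indicator)
      have "(LINT x|lborel. max 0 (h x) * indicator (box a b) x) - (LINT x|lborel. max 0 (- h x) * indicator (box a b) x)
          = (LINT x|lborel. h x * indicator (box a b) x)"
        unfolding Bochner_Integration.integral_diff[OF i, symmetric]
        by (intro Bochner_Integration.integral_cong refl) (auto simp: max_def indicator_def)
      also have "\<dots> = 0" by (rule z)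
      finally show ?thesis using em[OF h, of X] em[OF integrable_minus[OF h], of X] by (simp add: X)
    qed
  qed
  have "AE x in lborel. ennreal (h x) = ennreal (- h x)"
    by (rule sigma_finite_measure.density_unique_iff[OF sigma_finite_lborel, THEN iffD1, OF _ _ eq]) measurable
  then show ?thesis
  proof eventually_elim
    case (elim x)
    then show ?case by (cases "h x" "0::real" rule: linorder_cases) (auto simp: ennreal_neg)
  qed
qed

lemma LINT_lebesgue_on_eq:
  fixes f :: "real^'n \<Rightarrow> real"
  assumes "\<Omega> \<in> sets lebesgue" "\<And>x. x \<notin> \<Omega> \<Longrightarrow> f x = 0"
  shows "(LINT x|lebesgue_on \<Omega>. f x) = (LINT x|lebesgue. f x)"
proof -
  have "(LINT x|lebesgue_on \<Omega>. f x) = (LINT x|lebesgue. indicator \<Omega> x *\<^sub>R f x)"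
    using assms(1) by (intro integral_restrict_space) simp
  also have "\<dots> = (LINT x|lebesgue. f x)"
    using assms(2) by (intro Bochner_Integration.integral_cong refl) (auto simp: indicator_def)
  finally show ?thesis .
qed

text \<open>Bump functions identify the integrals of \<open>g\<close> over boxes whose closure lies in \<open>\<Omega>\<close> as zero; on each such box
  this makes \<open>g\<close> vanish almost everywhere, and countably many of them, with their negligible boundaries,
  cover \<open>\<Omega>\<close>.\<close>

lemma fundamental_lemma:
  fixes g :: "real^'n \<Rightarrow> real"
  assumes op: "open \<Omega>" and g: "sq_integrable (lebesgue_on \<Omega>) g"
    and z: "\<And>\<phi>. test_function \<Omega> \<phi> \<Longrightarrow> (LINT x|lebesgue_on \<Omega>. g x * \<phi> x) = 0"
  shows "AE x in lebesgue_on \<Omega>. g x = 0"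
proof -
  have \<Omega>[measurable]: "\<Omega> \<in> sets lebesgue" using op by simp
  have gm[measurable]: "g \<in> borel_measurable (lebesgue_on \<Omega>)" using g by (auto dest: sq_integrableD)
  have gi: "integrable (lebesgue_on \<Omega>) (\<lambda>x. g x * indicator (cbox a b) x)" for a b
  proof -
    have "integrable (lebesgue_on \<Omega>) (\<lambda>x. indicator (cbox a b) x :: real)"
    proof -
      have "integrable lebesgue (\<lambda>x. indicator (cbox a b) x :: real)"
        using emeasure_lborel_cbox_finite[of a b] by (intro integrable_real_indicator) auto
      then have "integrable lebesgue (\<lambda>x. indicator \<Omega> x *\<^sub>R (indicator (cbox a b) x :: real))"
        by (intro integrable_mult_indicator) simp_all
      then show ?thesis by (subst integrable_restrict_space) simp_all
    qed
    then have "sq_integrable (lebesgue_on \<Omega>) (\<lambda>x. indicator (cbox a b) x :: real)"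
      by (auto simp: sq_integrable_def power2_eq_square simp flip: indicator_inter_arith)
    from sq_integrable_inner[OF g this] show ?thesis by simp
  qed
  have box0: "(LINT x|lebesgue_on \<Omega>. g x * indicator (box a b) x) = 0" if "cbox a b \<subseteq> \<Omega>" for a b
  proof (rule LIMSEQ_unique)
    have z0: "(LINT x|lebesgue_on \<Omega>. g x * box_bump a b n x) = 0" for n
      by (rule z[OF test_function_box_bump[OF that]])
    show "(\<lambda>n. LINT x|lebesgue_on \<Omega>. g x * box_bump a b n x) \<longlonglongrightarrow> 0" unfolding z0 by simp
    show "(\<lambda>n. LINT x|lebesgue_on \<Omega>. g x * box_bump a b n x) \<longlonglongrightarrow> (LINT x|lebesgue_on \<Omega>. g x * indicator (box a b) x)"
    proof (rule integral_dominated_convergence[where w="\<lambda>x. \<bar>g x * indicator (cbox a b) x\<bar>"])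
      have "box_bump a b n \<in> borel_measurable borel" for n
        using test_function_box_bump[OF that, of n] unfolding test_function_def
        by (metis Ck.simps(1) borel_measurable_continuous_onI)
      then have bm: "box_bump a b n \<in> borel_measurable (lebesgue_on \<Omega>)" for n
        by (intro measurable_restrict_space1 measurable_completion) simp
      show "(\<lambda>x. g x * box_bump a b n x) \<in> borel_measurable (lebesgue_on \<Omega>)" for n
        using bm gm by measurable
      have "box a b \<in> sets lebesgue" by simp
      then have "(\<lambda>x. indicator (box a b) x :: real) \<in> borel_measurable (lebesgue_on \<Omega>)"
        by (intro measurable_restrict_space1 borel_measurable_indicator)
      then show "(\<lambda>x. g x * indicator (box a b) x) \<in> borel_measurable (lebesgue_on \<Omega>)"
        using gm by measurable
      show "integrable (lebesgue_on \<Omega>) (\<lambda>x. \<bar>g x * indicator (cbox a b) x\<bar>)" by (intro integrable_abs gi)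
      show "AE x in lebesgue_on \<Omega>. (\<lambda>n. g x * box_bump a b n x) \<longlonglongrightarrow> g x * indicator (box a b) x"
        by (intro AE_I2 tendsto_intros box_bump_tendsto)
      show "AE x in lebesgue_on \<Omega>. norm (g x * box_bump a b n x) \<le> \<bar>g x * indicator (cbox a b) x\<bar>" for n
      proof (rule AE_I2)
        fix x
        show "norm (g x * box_bump a b n x) \<le> \<bar>g x * indicator (cbox a b) x\<bar>"
        proof (cases "x \<in> box a b")
          case True
          then have "x \<in> cbox a b" using box_subset_cbox by blast
          then show ?thesis using box_bump_bounds[of a b n x] by (simp add: abs_mult mult_left_le)
        next
          case False
          then have "box_bump a b n x = 0" using box_bump_nonzero_iff by blast
          then show ?thesis by simp
        qed
      qed
    qed
  qed
  have local: "AE x in lebesgue. x \<in> box p q \<longrightarrow> g x = 0" if Q: "cbox p q \<subseteq> \<Omega>" for p q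
  proof -
    define f where "f x = (if x \<in> box p q then g x else 0)" for x
    have sub: "box p q \<subseteq> \<Omega>" using Q box_subset_cbox by blast
    have fz: "f x = 0" if "x \<notin> \<Omega>" for x using that sub by (auto simp: f_def)
    have fg: "(LINT x|lebesgue. f x * indicator (box a b) x) = (LINT x|lebesgue_on \<Omega>. g x * indicator (box p q \<inter> box a b) x)" for a b
    proof -
      have "(LINT x|lebesgue. f x * indicator (box a b) x) = (LINT x|lebesgue_on \<Omega>. f x * indicator (box a b) x)"
        by (rule LINT_lebesgue_on_eq[OF \<Omega>, symmetric]) (simp add: fz)
      also have "\<dots> = (LINT x|lebesgue_on \<Omega>. g x * indicator (box p q \<inter> box a b) x)"
        by (intro Bochner_Integration.integral_cong refl) (auto simp: f_def indicator_def)
      finally show ?thesis .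
    qed
    have "integrable (lebesgue_on \<Omega>) (\<lambda>x. f x)"
    proof (rule Bochner_Integration.integrable_bound[OF gi[of p q]])
      have "{x \<in> space (lebesgue_on \<Omega>). x \<in> box p q} \<in> sets (lebesgue_on \<Omega>)"
        by (auto simp: sets_restrict_space)
      then show "f \<in> borel_measurable (lebesgue_on \<Omega>)"
        unfolding f_def[abs_def] using gm by (intro measurable_If) auto
      show "AE x in lebesgue_on \<Omega>. norm (f x) \<le> norm (g x * indicator (cbox p q) x)"
        using box_subset_cbox by (intro AE_I2) (fastforce simp: f_def indicator_def)
    qed
    then have "integrable lebesgue (\<lambda>x. indicator \<Omega> x * f x)"
      by (simp add: integrable_restrict_space)
    moreover have "(\<lambda>x. indicator \<Omega> x * f x) = f"
    proof
      show "indicator \<Omega> x * f x = f x" for x using fz[of x] by (cases "x \<in> \<Omega>") auto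
    qed
    ultimately have fi: "integrable lebesgue f" by simp
    obtain h where h: "h \<in> borel_measurable lborel" and hae: "AE x in lborel. f x = h x"
      using completion_ex_borel_measurable_real[OF borel_measurable_integrable[OF fi]] by blast
    have hae': "AE x in lebesgue. h x = f x" using hae unfolding AE_completion_iff by (auto elim: eventually_mono)
    have hm: "h \<in> borel_measurable lebesgue" using h by (rule measurable_completion)
    have fm: "f \<in> borel_measurable lebesgue" using fi by auto
    have hi: "integrable lborel h"
      using integrable_cong_AE[OF hm fm hae'] fi integrable_completion[OF h] by simp
    have "AE x in lborel. h x = 0"
    proof (rule AE_zero_of_box_integrals[OF hi])
      fix a b
      have "(LINT x|lborel. h x * indicator (box a b) x) = (LINT x|lebesgue. h x * indicator (box a b) x)"
        by (rule integral_completion[symmetric]) (use h in measurable)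
      also have "\<dots> = (LINT x|lebesgue. f x * indicator (box a b) x)"
      proof (rule integral_cong_AE)
        have "(\<lambda>x. indicator (box a b) x :: real) \<in> borel_measurable lebesgue"
          by (intro borel_measurable_indicator) simp
        then show "(\<lambda>x. h x * indicator (box a b) x) \<in> borel_measurable lebesgue"
          "(\<lambda>x. f x * indicator (box a b) x) \<in> borel_measurable lebesgue"
          using hm fm by (auto intro: borel_measurable_times)
      qed (use hae' in \<open>auto elim: eventually_mono\<close>)
      also have "\<dots> = 0"
      proof (cases "box p q \<inter> box a b = {}")
        case True then show ?thesis unfolding fg by simp
      next
        case False
        obtain c d where cd: "box p q \<inter> box a b = box c d" unfolding box_Int_box by blast
        have "cbox c d = closure (box c d)" using False cd by (simp add: closure_box)
        also have "\<dots> \<subseteq> cbox p q"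
          by (rule closure_minimal[OF _ closed_cbox]) (use cd box_subset_cbox in blast)
        finally show ?thesis unfolding fg cd using Q by (intro box0) blast
      qed
      finally show "(LINT x|lborel. h x * indicator (box a b) x) = 0" .
    qed
    then have "AE x in lebesgue. h x = 0" by (rule AE_completion)
    with hae' show ?thesis by eventually_elim (auto simp: f_def)
  qed
  obtain \<D> where D: "countable \<D>" "\<D> \<subseteq> Pow \<Omega>" "\<And>X. X \<in> \<D> \<Longrightarrow> \<exists>a b. X = cbox a b" "\<Union>\<D> = \<Omega>"
    by (rule open_countable_Union_open_cbox[OF op]) (rule that)
  have "AE x in lebesgue. x \<in> X \<longrightarrow> g x = 0" if "X \<in> \<D>" for X
  proof -
    from D(3)[OF that] obtain p q where X: "X = cbox p q" by blast
    have "cbox p q - box p q \<in> null_sets lebesgue"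
      using negligible_frontier_interval[of p q] by (simp add: negligible_iff_null_sets)
    then have "AE x in lebesgue. x \<notin> cbox p q - box p q" by (rule AE_not_in)
    moreover have "AE x in lebesgue. x \<in> box p q \<longrightarrow> g x = 0"
      by (rule local) (use D(2) that X in blast)
    ultimately show ?thesis unfolding X by eventually_elim auto
  qed
  then have "AE x in lebesgue. \<forall>X\<in>\<D>. x \<in> X \<longrightarrow> g x = 0"
    by (subst AE_ball_countable[OF D(1)]) blast
  then have "AE x in lebesgue. x \<in> \<Omega> \<longrightarrow> g x = 0"
    by eventually_elim (use D(4) in blast)
  then show ?thesis by (simp add: AE_restrict_space_iff)
qed

definition classical_grad :: "(real^'n \<Rightarrow> real^'n) \<Rightarrow> real^'n \<Rightarrow> real^'n^'n" where
  "classical_grad u x = (\<chi> i j. partial_deriv j (\<lambda>y. u y $ i) x)"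

lemma sq_integrable_lebesgue_on:
  assumes "\<Omega> \<in> sets lebesgue" "sq_integrable lebesgue f"
  shows "sq_integrable (lebesgue_on \<Omega>) f"
proof -
  have "integrable lebesgue (\<lambda>x. indicator \<Omega> x *\<^sub>R (norm (f x))\<^sup>2)"
    using assms by (intro integrable_mult_indicator) (auto dest: sq_integrableD)
  then show ?thesis
    using assms unfolding sq_integrable_def
    by (auto simp: integrable_restrict_space intro: measurable_restrict_space1)
qed

lemma sq_integrable_nth:
  fixes u :: "'a \<Rightarrow> 'b::euclidean_space^'n"
  assumes "sq_integrable M u"
  shows "sq_integrable M (\<lambda>x. u x $ i)"
proof (rule sq_integrable_bound[OF _ sq_integrableD(2)[OF assms]])
  show "(\<lambda>x. u x $ i) \<in> borel_measurable M"
    using borel_measurable_continuous_onI[OF continuous_on_component[OF continuous_on_id]]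
      measurable_compose[OF sq_integrableD(1)[OF assms]] by blast
  show "AE x in M. (norm (u x $ i))\<^sup>2 \<le> (norm (u x))\<^sup>2"
    by (intro AE_I2 power_mono Finite_Cartesian_Product.norm_nth_le) simp
qed

lemma norm_sq_vec: "(norm (x :: 'b::real_inner^'n))\<^sup>2 = (\<Sum>i\<in>UNIV. (norm (x $ i))\<^sup>2)"
  by (simp add: power2_norm_eq_inner inner_vec_def)

lemma sq_integrable_vec:
  fixes u :: "'a \<Rightarrow> 'b::euclidean_space^'n"
  assumes "\<And>i. sq_integrable M (\<lambda>x. u x $ i)"
  shows "sq_integrable M u"
  unfolding sq_integrable_def norm_sq_vec
proof
  show "integrable M (\<lambda>x. \<Sum>i\<in>UNIV. (norm (u x $ i))\<^sup>2)"
    using assms by (intro Bochner_Integration.integrable_sum) (auto dest: sq_integrableD)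
  show "u \<in> borel_measurable M"
  proof (rule borel_measurable_euclidean_space[THEN iffD2, rule_format])
    fix b :: "'b^'n" assume "b \<in> Basis"
    then obtain i a where "b = axis i a" by (auto simp: Basis_vec_def)
    moreover have "(\<lambda>x. u x $ i \<bullet> a) \<in> borel_measurable M"
      using sq_integrableD(1)[OF assms[of i]] by simp
    ultimately show "(\<lambda>x. u x \<bullet> b) \<in> borel_measurable M" by (simp add: inner_axis)
  qed
qed

lemma test_function_differentiable: "test_function \<Omega> \<phi> \<Longrightarrow> \<phi> differentiable (at x)"
  unfolding test_function_def by (metis Ck.simps(2) differentiable_on_def UNIV_I)

lemma test_function_partial_deriv_zero:
  assumes "x \<notin> closure {x. \<phi> x \<noteq> 0}"
  shows "partial_deriv j \<phi> x = 0"
proof -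
  have "((\<lambda>_. 0) has_derivative (\<lambda>_. 0)) (at x)" by simp
  then have "(\<phi> has_derivative (\<lambda>_. 0)) (at x)"
    by (rule has_derivative_transform_within_open[where s="- closure {x. \<phi> x \<noteq> 0}"])
       (use assms closure_subset[of "{x. \<phi> x \<noteq> 0}"] in auto)
  then show ?thesis by (rule partial_deriv_eq)
qed

lemma linear_bound_axis:
  fixes f :: "real^'n \<Rightarrow> real"
  assumes "linear f" "\<And>j. \<bar>f (axis j 1)\<bar> \<le> M j"
  shows "\<bar>f v\<bar> \<le> (\<Sum>j\<in>UNIV. M j) * norm v"
proof -
  have "f v = f (\<Sum>j\<in>UNIV. (v $ j) *\<^sub>R axis j 1)"
    by (metis basis_expansion scalar_mult_eq_scaleR)
  also have "\<dots> = (\<Sum>j\<in>UNIV. v $ j * f (axis j 1))"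
    using assms(1) by (simp add: linear_sum linear_cmul)
  also have "\<bar>\<dots>\<bar> \<le> (\<Sum>j\<in>UNIV. \<bar>v $ j * f (axis j 1)\<bar>)" by (rule sum_abs)
  also have "\<dots> \<le> (\<Sum>j\<in>UNIV. norm v * M j)"
    unfolding abs_mult by (intro sum_mono mult_mono assms component_le_norm_cart) auto
  also have "\<dots> = (\<Sum>j\<in>UNIV. M j) * norm v" by (simp add: sum_distrib_left mult.commute)
  finally show ?thesis .
qed

text \<open>The gradient is continuous with compact support, hence bounded, and space is convex.\<close>

lemma test_function_lipc:
  assumes \<phi>: "test_function \<Omega> \<phi>"
  shows "lipc \<phi>"
  unfolding lipc_def
proof (intro conjI)
  let ?K = "closure {x. \<phi> x \<noteq> 0}"
  have K: "compact ?K" using \<phi> by (simp add: test_function_def)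
  show "bounded {x. \<phi> x \<noteq> 0}"
    using compact_imp_bounded[OF K] closure_subset bounded_subset by blast
  show "AE x in lebesgue. \<phi> differentiable (at x)"
    using test_function_differentiable[OF \<phi>] by simp
  have "\<exists>M. \<forall>x. \<bar>partial_deriv j \<phi> x\<bar> \<le> M" for j
  proof -
    have "continuous_on UNIV (partial_deriv j \<phi>)"
      using \<phi> unfolding test_function_def by (metis Ck.simps)
    then have "bounded (partial_deriv j \<phi> ` ?K)"
      using K by (intro compact_imp_bounded compact_continuous_image) (auto elim: continuous_on_subset)
    then obtain M where "\<forall>x\<in>?K. \<bar>partial_deriv j \<phi> x\<bar> \<le> M" by (auto simp: bounded_iff)
    then have "\<bar>partial_deriv j \<phi> x\<bar> \<le> max M 0" for x
      using test_function_partial_deriv_zero[of x \<phi> j] by (cases "x \<in> ?K") (auto simp: le_max_iff_disj)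
    then show ?thesis by blast
  qed
  then obtain M where M: "\<And>j x. \<bar>partial_deriv j \<phi> x\<bar> \<le> M j" by metis
  have M0: "0 \<le> M j" for j using M[of j 0] by linarith
  have B0: "0 \<le> (\<Sum>j\<in>UNIV. M j)" by (intro sum_nonneg M0)
  have d: "(\<phi> has_derivative frechet_derivative \<phi> (at x)) (at x)" for x
    using test_function_differentiable[OF \<phi>] unfolding frechet_derivative_works .
  have "norm (frechet_derivative \<phi> (at x) v) \<le> (\<Sum>j\<in>UNIV. M j) * norm v" for x v
    using linear_bound_axis[OF has_derivative_linear[OF d], of x M v] M unfolding partial_deriv_def by simp
  then have on: "onorm (frechet_derivative \<phi> (at x)) \<le> (\<Sum>j\<in>UNIV. M j)" for x
    by (intro onorm_bound B0)
  have "(\<Sum>j\<in>UNIV. M j)-lipschitz_on UNIV \<phi>"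
  proof (rule lipschitz_onI[OF _ B0])
    fix x y
    have "norm (\<phi> x - \<phi> y) \<le> (\<Sum>j\<in>UNIV. M j) * norm (x - y)"
      by (rule differentiable_bound[OF convex_UNIV _ on]) (use d in auto)
    then show "dist (\<phi> x) (\<phi> y) \<le> (\<Sum>j\<in>UNIV. M j) * dist x y" by (simp add: dist_norm)
  qed
  then show "\<exists>L. L-lipschitz_on UNIV \<phi>" by blast
qed

lemma test_function_outside:
  assumes "test_function \<Omega> \<phi>" "x \<notin> \<Omega>"
  shows "\<phi> x = 0" "partial_deriv j \<phi> x = 0"
proof -
  have "x \<notin> closure {x. \<phi> x \<noteq> 0}" using assms by (auto simp: test_function_def)
  then show "\<phi> x = 0" "partial_deriv j \<phi> x = 0"
    using closure_subset[of "{x. \<phi> x \<noteq> 0}"] test_function_partial_deriv_zero by auto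
qed

lemma is_weak_grad_lipc:
  assumes op: "open \<Omega>" and u: "\<And>i. lipc (\<lambda>x. u x $ i)"
  shows "is_weak_grad \<Omega> u (classical_grad u)"
  unfolding is_weak_grad_def
proof (intro allI impI)
  fix \<phi> i j assume \<phi>: "test_function \<Omega> \<phi>"
  have "(LINT x|lebesgue_on \<Omega>. u x $ i * partial_deriv j \<phi> x) = (LINT x|lebesgue. u x $ i * partial_deriv j \<phi> x)"
    by (rule LINT_lebesgue_on_eq) (use op test_function_outside[OF \<phi>] in auto)
  also have "\<dots> = - (LINT x|lebesgue. partial_deriv j (\<lambda>x. u x $ i) x * \<phi> x)"
    by (rule lipc_integration_by_parts[OF u test_function_lipc[OF \<phi>]])
  also have "(LINT x|lebesgue. partial_deriv j (\<lambda>x. u x $ i) x * \<phi> x) = (LINT x|lebesgue_on \<Omega>. partial_deriv j (\<lambda>x. u x $ i) x * \<phi> x)"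
    by (rule LINT_lebesgue_on_eq[symmetric]) (use op test_function_outside[OF \<phi>] in auto)
  finally show "(LINT x|lebesgue_on \<Omega>. u x $ i * partial_deriv j \<phi> x) = - (LINT x|lebesgue_on \<Omega>. classical_grad u x $ i $ j * \<phi> x)"
    by (simp add: classical_grad_def)
qed

lemma sq_integrable_classical_grad:
  assumes "\<And>i. lipc (\<lambda>x. u x $ i)"
  shows "sq_integrable lebesgue (classical_grad u)"
  by (intro sq_integrable_vec) (simp add: classical_grad_def lipc_partial_deriv(2)[OF assms])

lemma sq_integrable_lipc:
  fixes u :: "real^'n \<Rightarrow> real^'n"
  assumes "\<And>i. lipc (\<lambda>x. u x $ i)"
  shows "sq_integrable lebesgue u"
  by (intro sq_integrable_vec lipc_partial_deriv(3) assms)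

lemma sq_integrable_test_function:
  assumes "open \<Omega>" "test_function \<Omega> \<phi>"
  shows "sq_integrable (lebesgue_on \<Omega>) \<phi>" "sq_integrable (lebesgue_on \<Omega>) (partial_deriv j \<phi>)"
  using sq_integrable_lebesgue_on[OF _ lipc_partial_deriv(3)[OF test_function_lipc[OF assms(2)]], of \<Omega>]
    sq_integrable_lebesgue_on[OF _ lipc_partial_deriv(2)[OF test_function_lipc[OF assms(2)]], of \<Omega> j] assms(1)
  by auto

lemma integrable_times_test_function:
  fixes G :: "real^'n \<Rightarrow> real^'n^'n" and u :: "real^'n \<Rightarrow> real^'n"
  assumes "open \<Omega>" "test_function \<Omega> \<phi>"
  shows "sq_integrable (lebesgue_on \<Omega>) G \<Longrightarrow> integrable (lebesgue_on \<Omega>) (\<lambda>x. G x $ i $ j * \<phi> x)"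
    and "sq_integrable (lebesgue_on \<Omega>) u \<Longrightarrow> integrable (lebesgue_on \<Omega>) (\<lambda>x. u x $ i * partial_deriv j \<phi> x)"
  using sq_integrable_inner[OF sq_integrable_nth[OF sq_integrable_nth] sq_integrable_test_function(1)[OF assms]]
    sq_integrable_inner[OF sq_integrable_nth sq_integrable_test_function(2)[OF assms]] by auto

lemma is_weak_grad_lincomb:
  assumes op: "open \<Omega>" and sq: "sq_integrable (lebesgue_on \<Omega>) u" "sq_integrable (lebesgue_on \<Omega>) v"
      "sq_integrable (lebesgue_on \<Omega>) G" "sq_integrable (lebesgue_on \<Omega>) H"
    and w: "is_weak_grad \<Omega> u G" "is_weak_grad \<Omega> v H"
  shows "is_weak_grad \<Omega> (\<lambda>x. s *\<^sub>R u x + t *\<^sub>R v x) (\<lambda>x. s *\<^sub>R G x + t *\<^sub>R H x)"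
  unfolding is_weak_grad_def
proof (intro allI impI)
  fix \<phi> i j assume \<phi>: "test_function \<Omega> \<phi>"
  note int = integrable_times_test_function[OF op \<phi>]
  have "(LINT x|lebesgue_on \<Omega>. u x $ i * partial_deriv j \<phi> x) = - (LINT x|lebesgue_on \<Omega>. G x $ i $ j * \<phi> x)"
    "(LINT x|lebesgue_on \<Omega>. v x $ i * partial_deriv j \<phi> x) = - (LINT x|lebesgue_on \<Omega>. H x $ i $ j * \<phi> x)"
    using w \<phi> by (auto simp: is_weak_grad_def)
  then show "(LINT x|lebesgue_on \<Omega>. (s *\<^sub>R u x + t *\<^sub>R v x) $ i * partial_deriv j \<phi> x)
      = - (LINT x|lebesgue_on \<Omega>. (s *\<^sub>R G x + t *\<^sub>R H x) $ i $ j * \<phi> x)"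
    using int(1)[OF sq(3), of i j] int(1)[OF sq(4), of i j] int(2)[OF sq(1), of i j] int(2)[OF sq(2), of i j]
    by (simp add: distrib_right mult.assoc)
qed

lemma weak_grad_unique:
  fixes G H :: "real^'n \<Rightarrow> real^'n^'n"
  assumes op: "open \<Omega>" and sq: "sq_integrable (lebesgue_on \<Omega>) G" "sq_integrable (lebesgue_on \<Omega>) H"
    and w: "is_weak_grad \<Omega> u G" "is_weak_grad \<Omega> u H"
  shows "AE x in lebesgue_on \<Omega>. G x = H x"
proof -
  have "AE x in lebesgue_on \<Omega>. G x $ i $ j - H x $ i $ j = 0" for i j
  proof (rule fundamental_lemma[OF op])
    show "sq_integrable (lebesgue_on \<Omega>) (\<lambda>x. G x $ i $ j - H x $ i $ j)"
      by (intro sq_integrable_diff sq_integrable_nth sq)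
    fix \<phi> assume \<phi>: "test_function \<Omega> \<phi>"
    have "(LINT x|lebesgue_on \<Omega>. u x $ i * partial_deriv j \<phi> x) = - (LINT x|lebesgue_on \<Omega>. G x $ i $ j * \<phi> x)"
      "(LINT x|lebesgue_on \<Omega>. u x $ i * partial_deriv j \<phi> x) = - (LINT x|lebesgue_on \<Omega>. H x $ i $ j * \<phi> x)"
      using w \<phi> unfolding is_weak_grad_def by blast+
    then have "(LINT x|lebesgue_on \<Omega>. G x $ i $ j * \<phi> x) = (LINT x|lebesgue_on \<Omega>. H x $ i $ j * \<phi> x)"
      by linarith
    then show "(LINT x|lebesgue_on \<Omega>. (G x $ i $ j - H x $ i $ j) * \<phi> x) = 0"
      using integrable_times_test_function(1)[OF op \<phi> sq(1), of i j] integrable_times_test_function(1)[OF op \<phi> sq(2), of i j]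
      by (simp add: left_diff_distrib)
  qed
  then have "AE x in lebesgue_on \<Omega>. \<forall>i j. G x $ i $ j - H x $ i $ j = 0"
    by (simp add: AE_all_countable)
  then show ?thesis by eventually_elim (simp add: vec_eq_iff)
qed

text \<open>For functions with a square-integrable weak gradient, the chosen one can be computed with any other.\<close>

lemma weak_grad_eq:
  assumes op: "open \<Omega>" and G: "sq_integrable (lebesgue_on \<Omega>) G" "is_weak_grad \<Omega> u G"
  shows "sq_integrable (lebesgue_on \<Omega>) (weak_grad \<Omega> u)" "is_weak_grad \<Omega> u (weak_grad \<Omega> u)"
    "AE x in lebesgue_on \<Omega>. weak_grad \<Omega> u x = G x"
proof -
  have "\<exists>G. G \<in> L2 \<Omega> \<and> is_weak_grad \<Omega> u G" using G by (auto simp: L2_iff_sq_integrable)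
  from someI_ex[OF this] show *: "sq_integrable (lebesgue_on \<Omega>) (weak_grad \<Omega> u)" "is_weak_grad \<Omega> u (weak_grad \<Omega> u)"
    by (auto simp: weak_grad_def L2_iff_sq_integrable)
  show "AE x in lebesgue_on \<Omega>. weak_grad \<Omega> u x = G x"
    by (rule weak_grad_unique[OF op *(1) G(1) *(2) G(2)])
qed

lemma LINT_norm_sq_cong:
  assumes "f \<in> borel_measurable M" "g \<in> borel_measurable M" "AE x in M. f x = g x"
  shows "(LINT x|M. (norm (f x :: 'b::euclidean_space))\<^sup>2) = (LINT x|M. (norm (g x))\<^sup>2)"
  by (rule integral_cong_AE) (use assms in \<open>auto elim: eventually_mono\<close>)

text \<open>Both sides of the defining identity are \<open>L\<^sup>2\<close> inner products with fixed functions.\<close>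

lemma is_weak_grad_closed:
  fixes u :: "nat \<Rightarrow> real^'n \<Rightarrow> real^'n"
  assumes op: "open \<Omega>"
    and sq: "\<And>n. sq_integrable (lebesgue_on \<Omega>) (u n)" "\<And>n. sq_integrable (lebesgue_on \<Omega>) (G n)"
      "sq_integrable (lebesgue_on \<Omega>) u'" "sq_integrable (lebesgue_on \<Omega>) G'"
    and w: "\<And>n. is_weak_grad \<Omega> (u n) (G n)"
    and lim: "(\<lambda>n. LINT x|lebesgue_on \<Omega>. (norm (u n x - u' x))\<^sup>2) \<longlonglongrightarrow> 0"
      "(\<lambda>n. LINT x|lebesgue_on \<Omega>. (norm (G n x - G' x))\<^sup>2) \<longlonglongrightarrow> 0"
  shows "is_weak_grad \<Omega> u' G'"
  unfolding is_weak_grad_def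
proof (intro allI impI)
  fix \<phi> i j assume \<phi>: "test_function \<Omega> \<phi>"
  let ?M = "lebesgue_on \<Omega>"
  have nth: "(\<lambda>n. LINT x|?M. (norm (f n x $ i - f' x $ i))\<^sup>2) \<longlonglongrightarrow> 0"
    if "\<And>n. sq_integrable ?M (f n)" "sq_integrable ?M f'" "(\<lambda>n. LINT x|?M. (norm (f n x - f' x))\<^sup>2) \<longlonglongrightarrow> 0"
    for f :: "nat \<Rightarrow> real^'n \<Rightarrow> 'b::euclidean_space^'n" and f' i
  proof (rule tendsto_sandwich[OF _ _ tendsto_const that(3)])
    have sqd: "sq_integrable ?M (\<lambda>x. f n x - f' x)" for n by (intro sq_integrable_diff that)
    have "(LINT x|?M. (norm (f n x $ i - f' x $ i))\<^sup>2) \<le> (LINT x|?M. (norm (f n x - f' x))\<^sup>2)" for n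
    proof (rule integral_mono)
      show "integrable ?M (\<lambda>x. (norm (f n x $ i - f' x $ i))\<^sup>2)"
        using sq_integrableD(2)[OF sq_integrable_nth[OF sqd[of n], of i]] by simp
      show "(norm (f n x $ i - f' x $ i))\<^sup>2 \<le> (norm (f n x - f' x))\<^sup>2" for x
        using Finite_Cartesian_Product.norm_nth_le[of "f n x - f' x" i] by (intro power_mono) auto
    qed (use sq_integrableD(2)[OF sqd] in auto)
    then show "\<forall>\<^sub>F n in sequentially. (LINT x|?M. (norm (f n x $ i - f' x $ i))\<^sup>2) \<le> (LINT x|?M. (norm (f n x - f' x))\<^sup>2)"
      by simp
  qed simp
  have "(\<lambda>n. LINT x|?M. u n x $ i \<bullet> partial_deriv j \<phi> x) \<longlonglongrightarrow> (LINT x|?M. u' x $ i \<bullet> partial_deriv j \<phi> x)"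
    by (intro tendsto_LINT_inner sq_integrable_nth sq sq_integrable_test_function(2)[OF op \<phi>] nth lim)
  moreover have "(\<lambda>n. - (LINT x|?M. G n x $ i $ j \<bullet> \<phi> x)) \<longlonglongrightarrow> - (LINT x|?M. G' x $ i $ j \<bullet> \<phi> x)"
    by (intro tendsto_minus tendsto_LINT_inner sq_integrable_nth sq sq_integrable_test_function(1)[OF op \<phi>] nth[of "\<lambda>n x. G n x $ i"] nth[of G] lim)
  moreover have "(LINT x|?M. u n x $ i \<bullet> partial_deriv j \<phi> x) = - (LINT x|?M. G n x $ i $ j \<bullet> \<phi> x)" for n
    using w[of n] \<phi> by (simp add: is_weak_grad_def)
  ultimately show "(LINT x|?M. u' x $ i * partial_deriv j \<phi> x) = - (LINT x|?M. G' x $ i $ j * \<phi> x)"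
    using LIMSEQ_unique by fastforce
qed

section \<open>The local energy space\<close>

text \<open>The bilinear form of isotropic elasticity with both Lame constants equal to \<open>1\<close>.\<close>

definition elastic_form :: "real^'n^'n \<Rightarrow> real^'n^'n \<Rightarrow> real" where
  "elastic_form A B = 2 * (Sym A \<bullet> Sym B) + trace A * trace B"

lemma transpose_lincomb: "transpose (s *\<^sub>R A + t *\<^sub>R B) = s *\<^sub>R transpose A + t *\<^sub>R transpose (B :: real^'n^'n)"
  by (simp add: transpose_def vec_eq_iff)

lemma Sym_lincomb: "Sym (s *\<^sub>R A + t *\<^sub>R B) = s *\<^sub>R Sym A + t *\<^sub>R Sym B"
  by (simp add: Sym_def transpose_lincomb algebra_simps)

lemma trace_lincomb: "trace (s *\<^sub>R A + t *\<^sub>R B) = s * trace A + t * trace (B :: real^'n^'n)"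
  by (simp add: trace_def sum.distrib sum_distrib_left)

lemma elastic_form_lincomb:
  "elastic_form (s *\<^sub>R A + t *\<^sub>R B) C = s * elastic_form A C + t * elastic_form B C"
  by (simp add: elastic_form_def Sym_lincomb trace_lincomb inner_add_left algebra_simps)

lemma elastic_form_commute: "elastic_form A B = elastic_form B A"
  by (simp add: elastic_form_def inner_commute mult.commute)

lemma norm_transpose: "norm (transpose (A :: real^'n^'n)) = norm A"
proof -
  have "(norm (transpose A))\<^sup>2 = (norm A)\<^sup>2"
    unfolding norm_sq_vec by (subst sum.swap) (simp add: transpose_def)
  then show ?thesis by simp
qed

lemma norm_Sym_sq: "(norm (Sym A))\<^sup>2 = (norm A)\<^sup>2 / 2 + (A \<bullet> transpose A) / 2"
proof -
  have "(norm (Sym A))\<^sup>2 = ((norm A)\<^sup>2 + 2 * (A \<bullet> transpose A) + (norm (transpose A))\<^sup>2) / 4"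
    unfolding Sym_def power2_norm_eq_inner by (simp add: inner_add_left inner_add_right inner_commute)
  then show ?thesis by (simp add: norm_transpose)
qed

lemma norm_Sym_le: "norm (Sym A) \<le> norm A"
proof -
  have "norm (Sym A) \<le> (1/2) * (norm A + norm (transpose A))"
    unfolding Sym_def by (simp add: norm_triangle_ineq)
  then show ?thesis by (simp add: norm_transpose)
qed

lemma trace_sq_le: "(trace (A :: real^'n^'n))\<^sup>2 \<le> real CARD('n) * (norm A)\<^sup>2"
proof -
  have "(trace A)\<^sup>2 \<le> (\<Sum>i\<in>UNIV. (A $ i $ i)\<^sup>2) * CARD('n)"
    unfolding trace_def by (rule sum_squared_le_sum_of_squares)
  also have "(\<Sum>i\<in>UNIV. (A $ i $ i)\<^sup>2) \<le> (norm A)\<^sup>2"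
    unfolding norm_sq_vec
    by (intro sum_mono) (auto intro: member_le_sum)
  finally show ?thesis by (simp add: mult.commute mult_right_mono)
qed

lemma sum_diag_sq_le_Sym: "(\<Sum>i\<in>UNIV. (A $ i $ i)\<^sup>2) \<le> (norm (Sym (A :: real^'n^'n)))\<^sup>2"
proof -
  have d: "Sym A $ i $ i = A $ i $ i" for i by (simp add: Sym_def transpose_def)
  show ?thesis
    unfolding norm_sq_vec d[symmetric] by (intro sum_mono) (auto intro: member_le_sum)
qed

lemma elastic_form_bounds:
  fixes A B :: "real^'n^'n"
  shows "2 * (norm (Sym A))\<^sup>2 \<le> elastic_form A A"
    and "\<bar>elastic_form A B\<bar> \<le> (2 + real CARD('n)) * ((norm A)\<^sup>2 + (norm B)\<^sup>2)"
    and "elastic_form A A \<le> (2 + real CARD('n)) * (norm A)\<^sup>2"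
proof -
  show "2 * (norm (Sym A))\<^sup>2 \<le> elastic_form A A"
    by (simp add: elastic_form_def power2_norm_eq_inner)
  have S: "(norm (Sym C))\<^sup>2 \<le> (norm C)\<^sup>2" for C :: "real^'n^'n" by (intro power_mono norm_Sym_le) simp
  show "elastic_form A A \<le> (2 + real CARD('n)) * (norm A)\<^sup>2"
    using S[of A] trace_sq_le[of A]
    unfolding elastic_form_def power2_norm_eq_inner[symmetric] power2_eq_square[of "trace A", symmetric] distrib_right
    by linarith
  have "\<bar>elastic_form A B\<bar> \<le> 2 * \<bar>Sym A \<bullet> Sym B\<bar> + \<bar>trace A * trace B\<bar>"
    unfolding elastic_form_def using abs_triangle_ineq[of "2 * (Sym A \<bullet> Sym B)" "trace A * trace B"] by simp
  also have "\<bar>Sym A \<bullet> Sym B\<bar> \<le> (norm (Sym A))\<^sup>2 / 2 + (norm (Sym B))\<^sup>2 / 2"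
    using abs_inner_le[of 1 "Sym A" "Sym B"] by simp
  also have "\<bar>trace A * trace B\<bar> \<le> (trace A)\<^sup>2 / 2 + (trace B)\<^sup>2 / 2"
    using abs_inner_le[of 1 "trace A" "trace B"] by simp
  finally have "\<bar>elastic_form A B\<bar> \<le> (norm (Sym A))\<^sup>2 + (norm (Sym B))\<^sup>2 + ((trace A)\<^sup>2 + (trace B)\<^sup>2) / 2"
    by (simp add: add_divide_distrib)
  also have "\<dots> \<le> (norm A)\<^sup>2 + (norm B)\<^sup>2 + (real CARD('n) * (norm A)\<^sup>2 + real CARD('n) * (norm B)\<^sup>2) / 2"
    by (intro add_mono divide_right_mono S trace_sq_le) simp
  also have "\<dots> \<le> 2 * ((norm A)\<^sup>2 + (norm B)\<^sup>2) + (real CARD('n) * (norm A)\<^sup>2 + real CARD('n) * (norm B)\<^sup>2)"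
  proof -
    have "0 \<le> (norm A)\<^sup>2" "0 \<le> (norm B)\<^sup>2" "0 \<le> real CARD('n) * (norm A)\<^sup>2" "0 \<le> real CARD('n) * (norm B)\<^sup>2" by auto
    then show ?thesis unfolding distrib_left add_divide_distrib by linarith
  qed
  also have "\<dots> = (2 + real CARD('n)) * ((norm A)\<^sup>2 + (norm B)\<^sup>2)" by (simp add: algebra_simps)
  finally show "\<bar>elastic_form A B\<bar> \<le> (2 + real CARD('n)) * ((norm A)\<^sup>2 + (norm B)\<^sup>2)" .
qed

lemma Sym_measurable[measurable]: "(Sym :: real^'n^'n \<Rightarrow> real^'n^'n) \<in> borel_measurable borel"
proof (rule borel_measurable_continuous_onI)
  have "linear (Sym :: real^'n^'n \<Rightarrow> real^'n^'n)"
    using Sym_lincomb[of 1 _ 1] Sym_lincomb[of _ _ 0] by (intro linearI) auto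
  then show "continuous_on UNIV (Sym :: real^'n^'n \<Rightarrow> real^'n^'n)" by (rule linear_continuous_on[OF linear_conv_bounded_linear[THEN iffD1]])
qed

lemma trace_measurable[measurable]: "(trace :: real^'n^'n \<Rightarrow> real) \<in> borel_measurable borel"
  unfolding trace_def[abs_def] by (intro borel_measurable_continuous_onI continuous_intros)

lemma sq_integrable_Sym:
  fixes G :: "'a \<Rightarrow> real^'n^'n"
  shows "sq_integrable M G \<Longrightarrow> sq_integrable M (\<lambda>x. Sym (G x))"
  by (rule sq_integrable_bound[of _ _ "\<lambda>x. (norm (G x))\<^sup>2"])
     (auto simp: sq_integrable_def intro!: power_mono norm_Sym_le intro: measurable_compose[OF _ Sym_measurable])

text \<open>The last condition lets integrals of the gradient over \<open>\<Omega>\<close> be extended to the whole space even when the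
  boundary of \<open>\<Omega>\<close> has positive measure.\<close>

definition lipc_field :: "(real^'n) set \<Rightarrow> (real^'n \<Rightarrow> real^'n) \<Rightarrow> bool" where
  "lipc_field \<Omega> u \<longleftrightarrow> (\<forall>i. lipc (\<lambda>x. u x $ i)) \<and> (\<forall>x. x \<notin> \<Omega> \<longrightarrow> u x = 0) \<and>
     (AE x in lebesgue. x \<notin> \<Omega> \<longrightarrow> classical_grad u x = 0)"

text \<open>Korn's inequality for fields with zero boundary values: \<open>|Sym A|\<^sup>2 = |A|\<^sup>2/2 + A \<bullet> A\<^sup>T/2\<close>, and
  exchanging derivatives turns \<open>\<integral>\<nabla>u \<bullet> (\<nabla>u)\<^sup>T\<close> into \<open>\<integral>(div u)\<^sup>2 \<ge> 0\<close>.\<close>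

lemma Korn_lipc:
  assumes u: "\<And>i. lipc (\<lambda>x. u x $ i)"
  shows "(LINT x|lebesgue. (norm (classical_grad u x))\<^sup>2) \<le> 2 * (LINT x|lebesgue. (norm (Sym (classical_grad u x)))\<^sup>2)"
proof -
  let ?A = "classical_grad u"
  let ?p = "\<lambda>i j x. partial_deriv j (\<lambda>y. u y $ i) x"
  have int: "integrable lebesgue (\<lambda>x. ?p i j x * ?p k l x)" for i j k l
    using sq_integrable_inner[OF lipc_partial_deriv(2)[OF u] lipc_partial_deriv(2)[OF u]] by simp
  have sqA: "sq_integrable lebesgue ?A" by (rule sq_integrable_classical_grad[OF u])
  have AT: "?A x \<bullet> transpose (?A x) = (\<Sum>i\<in>UNIV. \<Sum>j\<in>UNIV. ?p i j x * ?p j i x)" for x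
    by (simp add: classical_grad_def inner_vec_def transpose_def)
  have tr: "(trace (?A x))\<^sup>2 = (\<Sum>i\<in>UNIV. \<Sum>j\<in>UNIV. ?p i i x * ?p j j x)" for x
    by (simp add: classical_grad_def trace_def power2_eq_square sum_product)
  have "(LINT x|lebesgue. ?A x \<bullet> transpose (?A x)) = (\<Sum>i\<in>UNIV. \<Sum>j\<in>UNIV. LINT x|lebesgue. ?p i j x * ?p j i x)"
    unfolding AT using int by simp
  also have "\<dots> = (\<Sum>i\<in>UNIV. \<Sum>j\<in>UNIV. LINT x|lebesgue. ?p i i x * ?p j j x)"
    by (intro sum.cong refl lipc_swap_derivatives u)
  also have "\<dots> = (LINT x|lebesgue. (trace (?A x))\<^sup>2)"
    unfolding tr using int by simp
  also have "\<dots> \<ge> 0" by (rule integral_nonneg_AE) simp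
  finally have AT0: "0 \<le> (LINT x|lebesgue. ?A x \<bullet> transpose (?A x))" .
  have ATi: "integrable lebesgue (\<lambda>x. ?A x \<bullet> transpose (?A x))"
    unfolding AT using int by (intro Bochner_Integration.integrable_sum)
  have "(LINT x|lebesgue. (norm (Sym (?A x)))\<^sup>2) = (LINT x|lebesgue. (norm (?A x))\<^sup>2) / 2 + (LINT x|lebesgue. ?A x \<bullet> transpose (?A x)) / 2"
    unfolding norm_Sym_sq using sq_integrableD(2)[OF sqA] ATi by simp
  then show ?thesis using AT0 by simp
qed

text \<open>The diagonal entries of \<open>\<nabla>u\<close> and of its symmetric part agree, so Poincare's inequality for the
  \<open>i\<close>-th component in the \<open>i\<close>-th direction needs the symmetric part only.\<close>

lemma Poincare_Sym_lipc:
  assumes u: "\<And>i. lipc (\<lambda>x. u x $ i)" and u0: "\<And>x. x \<notin> \<Omega> \<Longrightarrow> u x = 0"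
    and R: "R \<ge> 0" "\<And>x y. x \<in> \<Omega> \<Longrightarrow> y \<in> \<Omega> \<Longrightarrow> norm (x - y) \<le> R"
  shows "2 * (LINT x|lebesgue. (norm (u x))\<^sup>2) \<le> R\<^sup>2 * (LINT x|lebesgue. (norm (Sym (classical_grad u x)))\<^sup>2)"
proof -
  let ?A = "classical_grad u"
  have P: "2 * (LINT x|lebesgue. (u x $ i)\<^sup>2) \<le> R\<^sup>2 * (LINT x|lebesgue. (?A x $ i $ i)\<^sup>2)" for i
    unfolding classical_grad_def vec_lambda_beta
  proof (rule lipc_Poincare[OF u R(1)])
    fix x y assume "u x $ i \<noteq> 0" "u y $ i \<noteq> 0"
    then have "x \<in> \<Omega>" "y \<in> \<Omega>" using u0 by (metis zero_index)+
    then show "norm (x - y) \<le> R" by (rule R(2))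
  qed
  have i1: "integrable lebesgue (\<lambda>x. (u x $ i)\<^sup>2)" for i
    using sq_integrableD(2)[OF lipc_partial_deriv(3)[OF u]] by simp
  have i2: "integrable lebesgue (\<lambda>x. (?A x $ i $ i)\<^sup>2)" for i
    using sq_integrableD(2)[OF lipc_partial_deriv(2)[OF u]] by (simp add: classical_grad_def)
  have i3: "integrable lebesgue (\<lambda>x. (norm (Sym (?A x)))\<^sup>2)"
    by (rule sq_integrableD(2)[OF sq_integrable_Sym[OF sq_integrable_classical_grad[OF u]]])
  have "2 * (LINT x|lebesgue. (norm (u x))\<^sup>2) = (\<Sum>i\<in>UNIV. 2 * (LINT x|lebesgue. (u x $ i)\<^sup>2))"
    unfolding norm_sq_vec using i1 by (simp add: sum_distrib_left)
  also have "\<dots> \<le> (\<Sum>i\<in>UNIV. R\<^sup>2 * (LINT x|lebesgue. (?A x $ i $ i)\<^sup>2))" by (rule sum_mono[OF P])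
  also have "\<dots> = R\<^sup>2 * (LINT x|lebesgue. (\<Sum>i\<in>UNIV. (?A x $ i $ i)\<^sup>2))"
    using i2 by (simp add: sum_distrib_left)
  also have "\<dots> \<le> R\<^sup>2 * (LINT x|lebesgue. (norm (Sym (?A x)))\<^sup>2)"
    using i2 i3 by (intro mult_left_mono integral_mono sum_diag_sq_le_Sym Bochner_Integration.integrable_sum) auto
  finally show ?thesis .
qed

lemma L2_tendsto_lincomb:
  fixes f g :: "nat \<Rightarrow> 'a \<Rightarrow> 'b::euclidean_space"
  assumes sq: "\<And>n. sq_integrable M (f n)" "\<And>n. sq_integrable M (g n)" "sq_integrable M f'" "sq_integrable M g'"
    and lim: "(\<lambda>n. LINT x|M. (norm (f n x - f' x))\<^sup>2) \<longlonglongrightarrow> 0" "(\<lambda>n. LINT x|M. (norm (g n x - g' x))\<^sup>2) \<longlonglongrightarrow> 0"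
  shows "(\<lambda>n. LINT x|M. (norm ((s *\<^sub>R f n x + t *\<^sub>R g n x) - (s *\<^sub>R f' x + t *\<^sub>R g' x)))\<^sup>2) \<longlonglongrightarrow> 0"
proof (rule tendsto_sandwich[OF _ _ tendsto_const])
  have d: "integrable M (\<lambda>x. (norm (f n x - f' x))\<^sup>2)" "integrable M (\<lambda>x. (norm (g n x - g' x))\<^sup>2)" for n
    by (intro sq_integrableD(2) sq_integrable_diff sq)+
  have "(LINT x|M. (norm ((s *\<^sub>R f n x + t *\<^sub>R g n x) - (s *\<^sub>R f' x + t *\<^sub>R g' x)))\<^sup>2)
     \<le> 2 * s\<^sup>2 * (LINT x|M. (norm (f n x - f' x))\<^sup>2) + 2 * t\<^sup>2 * (LINT x|M. (norm (g n x - g' x))\<^sup>2)" for n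
  proof -
    have "(LINT x|M. (norm ((s *\<^sub>R f n x + t *\<^sub>R g n x) - (s *\<^sub>R f' x + t *\<^sub>R g' x)))\<^sup>2)
       \<le> (LINT x|M. 2 * s\<^sup>2 * (norm (f n x - f' x))\<^sup>2 + 2 * t\<^sup>2 * (norm (g n x - g' x))\<^sup>2)"
    proof (rule integral_mono)
      show "integrable M (\<lambda>x. (norm ((s *\<^sub>R f n x + t *\<^sub>R g n x) - (s *\<^sub>R f' x + t *\<^sub>R g' x)))\<^sup>2)"
        by (intro sq_integrableD(2) sq_integrable_diff sq_integrable_lincomb sq)
      fix x
      have "(s *\<^sub>R f n x + t *\<^sub>R g n x) - (s *\<^sub>R f' x + t *\<^sub>R g' x) = s *\<^sub>R (f n x - f' x) + t *\<^sub>R (g n x - g' x)"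
        by (simp add: algebra_simps)
      then show "(norm ((s *\<^sub>R f n x + t *\<^sub>R g n x) - (s *\<^sub>R f' x + t *\<^sub>R g' x)))\<^sup>2
         \<le> 2 * s\<^sup>2 * (norm (f n x - f' x))\<^sup>2 + 2 * t\<^sup>2 * (norm (g n x - g' x))\<^sup>2"
        using norm_add_sq_le[of "s *\<^sub>R (f n x - f' x)" "t *\<^sub>R (g n x - g' x)"]
        by (simp add: power_mult_distrib)
    qed (use d in simp)
    then show ?thesis using d by simp
  qed
  then show "\<forall>\<^sub>F n in sequentially. (LINT x|M. (norm ((s *\<^sub>R f n x + t *\<^sub>R g n x) - (s *\<^sub>R f' x + t *\<^sub>R g' x)))\<^sup>2)
     \<le> 2 * s\<^sup>2 * (LINT x|M. (norm (f n x - f' x))\<^sup>2) + 2 * t\<^sup>2 * (LINT x|M. (norm (g n x - g' x))\<^sup>2)"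
    by simp
  have "(\<lambda>n. 2 * s\<^sup>2 * (LINT x|M. (norm (f n x - f' x))\<^sup>2) + 2 * t\<^sup>2 * (LINT x|M. (norm (g n x - g' x))\<^sup>2))
    \<longlonglongrightarrow> 2 * s\<^sup>2 * 0 + 2 * t\<^sup>2 * 0" by (intro tendsto_intros lim)
  then show "(\<lambda>n. 2 * s\<^sup>2 * (LINT x|M. (norm (f n x - f' x))\<^sup>2) + 2 * t\<^sup>2 * (LINT x|M. (norm (g n x - g' x))\<^sup>2)) \<longlonglongrightarrow> 0"
    by simp
qed simp

lemma LINT_lebesgue_on_eq_AE:
  fixes f :: "real^'n \<Rightarrow> real"
  assumes \<Omega>: "\<Omega> \<in> sets lebesgue" and f: "f \<in> borel_measurable lebesgue" and z: "AE x in lebesgue. x \<notin> \<Omega> \<longrightarrow> f x = 0"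
  shows "(LINT x|lebesgue_on \<Omega>. f x) = (LINT x|lebesgue. f x)"
proof -
  have "(LINT x|lebesgue_on \<Omega>. f x) = (LINT x|lebesgue. indicator \<Omega> x *\<^sub>R f x)"
    using \<Omega> by (intro integral_restrict_space) simp
  also have "\<dots> = (LINT x|lebesgue. f x)"
  proof (rule integral_cong_AE)
    have "(\<lambda>x. indicator \<Omega> x :: real) \<in> borel_measurable lebesgue" using \<Omega> by simp
    then show "(\<lambda>x. indicator \<Omega> x *\<^sub>R f x) \<in> borel_measurable lebesgue" using f by simp
    show "AE x in lebesgue. indicator \<Omega> x *\<^sub>R f x = f x" using z by eventually_elim (auto simp: indicator_def)
  qed (rule f)
  finally show ?thesis .
qed

text \<open>Korn's and Poincare's inequality with the integrals restricted to \<open>\<Omega>\<close>, off which \<open>u\<close> and its gradient vanish.\<close>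

lemma lipc_field_inequalities:
  fixes u :: "real^'n \<Rightarrow> real^'n"
  assumes op: "open \<Omega>" and u: "lipc_field \<Omega> u"
    and R: "R \<ge> 0" "\<And>x y. x \<in> \<Omega> \<Longrightarrow> y \<in> \<Omega> \<Longrightarrow> norm (x - y) \<le> R"
  shows "(LINT x|lebesgue_on \<Omega>. (norm (classical_grad u x))\<^sup>2) \<le> 2 * (LINT x|lebesgue_on \<Omega>. (norm (Sym (classical_grad u x)))\<^sup>2)"
    and "2 * (LINT x|lebesgue_on \<Omega>. (norm (u x))\<^sup>2) \<le> R\<^sup>2 * (LINT x|lebesgue_on \<Omega>. (norm (Sym (classical_grad u x)))\<^sup>2)"
proof -
  have l: "\<And>i. lipc (\<lambda>x. u x $ i)" and u0: "\<And>x. x \<notin> \<Omega> \<Longrightarrow> u x = 0"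
    and g0: "AE x in lebesgue. x \<notin> \<Omega> \<longrightarrow> classical_grad u x = 0" using u by (auto simp: lipc_field_def)
  have [measurable]: "u \<in> borel_measurable lebesgue" "classical_grad u \<in> borel_measurable lebesgue"
    using sq_integrableD(1)[OF sq_integrable_lipc[OF l]] sq_integrableD(1)[OF sq_integrable_classical_grad[OF l]] by auto
  have [measurable]: "(\<lambda>x. Sym (classical_grad u x)) \<in> borel_measurable lebesgue"
    using sq_integrableD(1)[OF sq_integrable_Sym[OF sq_integrable_classical_grad[OF l]]] .
  have \<Omega>: "\<Omega> \<in> sets lebesgue" using op by simp
  have S0: "Sym (0 :: real^'n^'n) = 0" using Sym_lincomb[of 0 0 0 0] by simp
  have eq: "(LINT x|lebesgue_on \<Omega>. (norm (classical_grad u x))\<^sup>2) = (LINT x|lebesgue. (norm (classical_grad u x))\<^sup>2)"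
    "(LINT x|lebesgue_on \<Omega>. (norm (Sym (classical_grad u x)))\<^sup>2) = (LINT x|lebesgue. (norm (Sym (classical_grad u x)))\<^sup>2)"
    by (rule LINT_lebesgue_on_eq_AE[OF \<Omega>], measurable, use g0 S0 in \<open>auto elim!: eventually_mono\<close>)+
  have eq_u: "(LINT x|lebesgue_on \<Omega>. (norm (u x))\<^sup>2) = (LINT x|lebesgue. (norm (u x))\<^sup>2)"
    by (rule LINT_lebesgue_on_eq[OF \<Omega>]) (simp add: u0)
  show "(LINT x|lebesgue_on \<Omega>. (norm (classical_grad u x))\<^sup>2) \<le> 2 * (LINT x|lebesgue_on \<Omega>. (norm (Sym (classical_grad u x)))\<^sup>2)"
    unfolding eq by (rule Korn_lipc[OF l])
  show "2 * (LINT x|lebesgue_on \<Omega>. (norm (u x))\<^sup>2) \<le> R\<^sup>2 * (LINT x|lebesgue_on \<Omega>. (norm (Sym (classical_grad u x)))\<^sup>2)"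
    unfolding eq eq_u by (rule Poincare_Sym_lipc[OF l u0 R])
qed

lemma test_field_lipc_field:
  assumes "\<And>i. test_function \<Omega> (\<lambda>x. \<phi> x $ i)"
  shows "lipc_field \<Omega> \<phi>"
proof -
  have "classical_grad \<phi> x = 0" if "x \<notin> \<Omega>" for x
    using test_function_outside(2)[OF assms that] by (simp add: classical_grad_def vec_eq_iff)
  moreover have "\<phi> x = 0" if "x \<notin> \<Omega>" for x
    using test_function_outside(1)[OF assms that] by (simp add: vec_eq_iff)
  ultimately show ?thesis using test_function_lipc[OF assms] by (simp add: lipc_field_def)
qed

lemma test_function_lincomb:
  assumes f: "test_function \<Omega> f" and g: "test_function \<Omega> g"
  shows "test_function \<Omega> (\<lambda>x. s * f x + t * g x)"
proof -
  let ?K = "closure {x. f x \<noteq> 0} \<union> closure {x. g x \<noteq> 0}"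
  have sub: "closure {x. s * f x + t * g x \<noteq> 0} \<subseteq> ?K"
  proof (rule closure_minimal)
    have "{x. s * f x + t * g x \<noteq> 0} \<subseteq> {x. f x \<noteq> 0} \<union> {x. g x \<noteq> 0}" by auto
    also have "\<dots> \<subseteq> ?K" by (intro Un_mono closure_subset)
    finally show "{x. s * f x + t * g x \<noteq> 0} \<subseteq> ?K" .
  qed (intro closed_Un closed_closure)
  have K: "compact ?K" "?K \<subseteq> \<Omega>" using f g by (auto simp: test_function_def)
  have "compact (closure {x. s * f x + t * g x \<noteq> 0})"
    using compact_Int_closed[OF K(1) closed_closure[of "{x. s * f x + t * g x \<noteq> 0}"]] sub
    by (simp add: Int_absorb1)
  moreover have "Ck m (\<lambda>x. s * f x + t * g x)" for m
    using f g by (intro Ck_add Ck_mult Ck_const) (auto simp: test_function_def)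
  ultimately show ?thesis using sub K(2) unfolding test_function_def by blast
qed

lemma classical_grad_lincomb:
  assumes "\<And>i. (\<lambda>x. u x $ i) differentiable (at x)" "\<And>i. (\<lambda>x. v x $ i) differentiable (at x)"
  shows "classical_grad (\<lambda>x. s *\<^sub>R u x + t *\<^sub>R v x) x = s *\<^sub>R classical_grad u x + t *\<^sub>R classical_grad v x"
proof -
  have "partial_deriv j (\<lambda>x. s * u x $ i + t * v x $ i) x
      = s * partial_deriv j (\<lambda>x. u x $ i) x + t * partial_deriv j (\<lambda>x. v x $ i) x" for i j
  proof -
    have "((\<lambda>x. s * u x $ i + t * v x $ i) has_derivative
       (\<lambda>h. s * frechet_derivative (\<lambda>x. u x $ i) (at x) h + t * frechet_derivative (\<lambda>x. v x $ i) (at x) h)) (at x)"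
      using assms[unfolded frechet_derivative_works] by (intro has_derivative_add has_derivative_mult_right)
    from partial_deriv_eq[OF this, of j] show ?thesis by (simp add: partial_deriv_def)
  qed
  then show ?thesis by (simp add: classical_grad_def vec_eq_iff)
qed

lemma sq_integrable_test_field:
  assumes "open \<Omega>" "\<And>i. test_function \<Omega> (\<lambda>x. \<phi> x $ i)"
  shows "sq_integrable (lebesgue_on \<Omega>) \<phi>" "sq_integrable (lebesgue_on \<Omega>) (classical_grad \<phi>)"
  using assms(1)
  by (auto intro!: sq_integrable_lebesgue_on sq_integrable_lipc sq_integrable_classical_grad test_function_lipc[OF assms(2)])

text \<open>The norm involves the weak gradient chosen for the difference; by uniqueness it can be computed from any weak
  gradient of \<open>u\<close>.\<close>

lemma H1_norm_diff_test_field: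
  assumes op: "open \<Omega>" and \<phi>: "\<And>i. test_function \<Omega> (\<lambda>x. \<phi> x $ i)"
    and sq: "sq_integrable (lebesgue_on \<Omega>) u" "sq_integrable (lebesgue_on \<Omega>) G" and G: "is_weak_grad \<Omega> u G"
  shows "H1_norm \<Omega> (\<lambda>x. u x - \<phi> x) = sqrt ((LINT x|lebesgue_on \<Omega>. (norm (\<phi> x - u x))\<^sup>2)
    + (LINT x|lebesgue_on \<Omega>. (norm (classical_grad \<phi> x - G x))\<^sup>2))"
proof -
  note sq\<phi> = sq_integrable_test_field[OF op \<phi>]
  have "is_weak_grad \<Omega> (\<lambda>x. 1 *\<^sub>R u x + (- 1) *\<^sub>R \<phi> x) (\<lambda>x. 1 *\<^sub>R G x + (- 1) *\<^sub>R classical_grad \<phi> x)"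
    by (intro is_weak_grad_lincomb op sq sq\<phi> G is_weak_grad_lipc test_function_lipc[OF \<phi>])
  then have w: "is_weak_grad \<Omega> (\<lambda>x. u x - \<phi> x) (\<lambda>x. G x - classical_grad \<phi> x)" by simp
  have sqd: "sq_integrable (lebesgue_on \<Omega>) (\<lambda>x. G x - classical_grad \<phi> x)" by (intro sq_integrable_diff sq sq\<phi>)
  note we = weak_grad_eq[OF op sqd w]
  have "(LINT x|lebesgue_on \<Omega>. (norm (weak_grad \<Omega> (\<lambda>x. u x - \<phi> x) x))\<^sup>2)
      = (LINT x|lebesgue_on \<Omega>. (norm (G x - classical_grad \<phi> x))\<^sup>2)"
    by (rule LINT_norm_sq_cong[OF sq_integrableD(1)[OF we(1)] sq_integrableD(1)[OF sqd] we(3)])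
  then show ?thesis by (simp add: H1_norm_def norm_minus_commute)
qed

text \<open>Together with the converse \<open>H10_spaceI\<close> this describes \<open>H\<^sup>1\<^sub>0\<close> by sequences of test fields that converge along
  with their gradients. Such sequences can be combined linearly and passed to the limit, unlike the gradients
  chosen for differences in the norm.\<close>

lemma H10_spaceD:
  assumes op: "open \<Omega>" and u: "u \<in> H10_space \<Omega>"
  shows "sq_integrable (lebesgue_on \<Omega>) u" "sq_integrable (lebesgue_on \<Omega>) (weak_grad \<Omega> u)" "is_weak_grad \<Omega> u (weak_grad \<Omega> u)"
    and "\<exists>\<phi>. (\<forall>n i. test_function \<Omega> (\<lambda>x. \<phi> n x $ i))
      \<and> (\<lambda>n. LINT x|lebesgue_on \<Omega>. (norm (\<phi> n x - u x))\<^sup>2) \<longlonglongrightarrow> 0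
      \<and> (\<lambda>n. LINT x|lebesgue_on \<Omega>. (norm (classical_grad (\<phi> n) x - weak_grad \<Omega> u x))\<^sup>2) \<longlonglongrightarrow> 0"
proof -
  let ?M = "lebesgue_on \<Omega>"
  show sq: "sq_integrable ?M u" using u by (simp add: H10_space_def H1_space_def L2_iff_sq_integrable)
  have "\<exists>G. sq_integrable ?M G \<and> is_weak_grad \<Omega> u G"
    using u by (auto simp: H10_space_def H1_space_def Bex_def L2_iff_sq_integrable)
  then obtain G where G: "sq_integrable ?M G" "is_weak_grad \<Omega> u G" by blast
  show wg: "sq_integrable ?M (weak_grad \<Omega> u)" "is_weak_grad \<Omega> u (weak_grad \<Omega> u)" using weak_grad_eq[OF op G] by auto
  have "\<forall>n. \<exists>\<phi>. (\<forall>i. test_function \<Omega> (\<lambda>x. \<phi> x $ i)) \<and> H1_norm \<Omega> (\<lambda>x. u x - \<phi> x) < step n"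
    using u step(3) unfolding H10_space_def by blast
  then obtain \<phi> where \<phi>: "\<And>n i. test_function \<Omega> (\<lambda>x. \<phi> n x $ i)" and lt: "\<And>n. H1_norm \<Omega> (\<lambda>x. u x - \<phi> n x) < step n"
    by metis
  have small: "(LINT x|?M. (norm (\<phi> n x - u x))\<^sup>2) \<le> (step n)\<^sup>2
      \<and> (LINT x|?M. (norm (classical_grad (\<phi> n) x - weak_grad \<Omega> u x))\<^sup>2) \<le> (step n)\<^sup>2" for n
  proof -
    have "sqrt ((LINT x|?M. (norm (\<phi> n x - u x))\<^sup>2) + (LINT x|?M. (norm (classical_grad (\<phi> n) x - weak_grad \<Omega> u x))\<^sup>2)) \<le> step n"
      using lt[of n] unfolding H1_norm_diff_test_field[OF op \<phi> sq wg] by simp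
    then have "(LINT x|?M. (norm (\<phi> n x - u x))\<^sup>2) + (LINT x|?M. (norm (classical_grad (\<phi> n) x - weak_grad \<Omega> u x))\<^sup>2) \<le> (step n)\<^sup>2"
      by (rule sqrt_le_D)
    moreover have "0 \<le> (LINT x|?M. (norm (\<phi> n x - u x))\<^sup>2)" "0 \<le> (LINT x|?M. (norm (classical_grad (\<phi> n) x - weak_grad \<Omega> u x))\<^sup>2)"
      by (auto intro!: integral_nonneg_AE)
    ultimately show ?thesis by linarith
  qed
  have s2: "(\<lambda>n. (step n)\<^sup>2) \<longlonglongrightarrow> 0" using tendsto_power[OF step(1), of 2] by simp
  have "(\<lambda>n. LINT x|?M. (norm (\<phi> n x - u x))\<^sup>2) \<longlonglongrightarrow> 0"
    by (rule tendsto_sandwich[OF _ _ tendsto_const s2]) (use small in auto)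
  moreover have "(\<lambda>n. LINT x|?M. (norm (classical_grad (\<phi> n) x - weak_grad \<Omega> u x))\<^sup>2) \<longlonglongrightarrow> 0"
    by (rule tendsto_sandwich[OF _ _ tendsto_const s2]) (use small in auto)
  ultimately show "\<exists>\<phi>. (\<forall>n i. test_function \<Omega> (\<lambda>x. \<phi> n x $ i))
      \<and> (\<lambda>n. LINT x|?M. (norm (\<phi> n x - u x))\<^sup>2) \<longlonglongrightarrow> 0
      \<and> (\<lambda>n. LINT x|?M. (norm (classical_grad (\<phi> n) x - weak_grad \<Omega> u x))\<^sup>2) \<longlonglongrightarrow> 0"
    using \<phi> by blast
qed

lemma H10_spaceI:
  assumes op: "open \<Omega>" and \<phi>: "\<And>n i. test_function \<Omega> (\<lambda>x. \<phi> n x $ i)"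
    and sq: "sq_integrable (lebesgue_on \<Omega>) u" "sq_integrable (lebesgue_on \<Omega>) G"
    and lim: "(\<lambda>n. LINT x|lebesgue_on \<Omega>. (norm (\<phi> n x - u x))\<^sup>2) \<longlonglongrightarrow> 0"
      "(\<lambda>n. LINT x|lebesgue_on \<Omega>. (norm (classical_grad (\<phi> n) x - G x))\<^sup>2) \<longlonglongrightarrow> 0"
  shows "u \<in> H10_space \<Omega>" "AE x in lebesgue_on \<Omega>. weak_grad \<Omega> u x = G x"
proof -
  let ?M = "lebesgue_on \<Omega>"
  note sq\<phi> = sq_integrable_test_field[OF op \<phi>]
  have w\<phi>: "is_weak_grad \<Omega> (\<phi> n) (classical_grad (\<phi> n))" for n by (intro is_weak_grad_lipc op test_function_lipc[OF \<phi>])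
  have w: "is_weak_grad \<Omega> u G" by (rule is_weak_grad_closed[OF op sq\<phi> sq w\<phi> lim])
  show "AE x in lebesgue_on \<Omega>. weak_grad \<Omega> u x = G x" by (rule weak_grad_eq(3)[OF op sq(2) w])
  have "\<exists>\<psi>. (\<forall>i. test_function \<Omega> (\<lambda>x. \<psi> x $ i)) \<and> H1_norm \<Omega> (\<lambda>x. u x - \<psi> x) < \<epsilon>" if "\<epsilon> > 0" for \<epsilon>
  proof -
    have "(\<lambda>n. (LINT x|?M. (norm (\<phi> n x - u x))\<^sup>2) + (LINT x|?M. (norm (classical_grad (\<phi> n) x - G x))\<^sup>2)) \<longlonglongrightarrow> 0 + 0"
      by (intro tendsto_add lim)
    then have "\<forall>\<^sub>F n in sequentially. (LINT x|?M. (norm (\<phi> n x - u x))\<^sup>2) + (LINT x|?M. (norm (classical_grad (\<phi> n) x - G x))\<^sup>2) < \<epsilon>\<^sup>2"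
      using that by (intro order_tendstoD(2)) auto
    then obtain n where n: "(LINT x|?M. (norm (\<phi> n x - u x))\<^sup>2) + (LINT x|?M. (norm (classical_grad (\<phi> n) x - G x))\<^sup>2) < \<epsilon>\<^sup>2"
      by (auto simp: eventually_sequentially)
    then have "H1_norm \<Omega> (\<lambda>x. u x - \<phi> n x) < sqrt (\<epsilon>\<^sup>2)"
      unfolding H1_norm_diff_test_field[OF op \<phi> sq w] by (rule real_sqrt_less_mono)
    then show ?thesis using \<phi> that by (intro exI[of _ "\<phi> n"]) auto
  qed
  then show "u \<in> H10_space \<Omega>"
    using sq w by (auto simp: H10_space_def H1_space_def L2_iff_sq_integrable)
qed

lemma H10_lincomb:
  assumes op: "open \<Omega>" and uv: "u \<in> H10_space \<Omega>" "v \<in> H10_space \<Omega>"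
  shows "(\<lambda>x. s *\<^sub>R u x + t *\<^sub>R v x) \<in> H10_space \<Omega>"
    and "AE x in lebesgue_on \<Omega>. weak_grad \<Omega> (\<lambda>x. s *\<^sub>R u x + t *\<^sub>R v x) x = s *\<^sub>R weak_grad \<Omega> u x + t *\<^sub>R weak_grad \<Omega> v x"
proof -
  let ?M = "lebesgue_on \<Omega>"
  note Du = H10_spaceD[OF op uv(1)] and Dv = H10_spaceD[OF op uv(2)]
  obtain \<phi> where \<phi>: "\<And>n i. test_function \<Omega> (\<lambda>x. \<phi> n x $ i)"
    "(\<lambda>n. LINT x|?M. (norm (\<phi> n x - u x))\<^sup>2) \<longlonglongrightarrow> 0"
    "(\<lambda>n. LINT x|?M. (norm (classical_grad (\<phi> n) x - weak_grad \<Omega> u x))\<^sup>2) \<longlonglongrightarrow> 0" using Du(4) by blast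
  obtain \<psi> where \<psi>: "\<And>n i. test_function \<Omega> (\<lambda>x. \<psi> n x $ i)"
    "(\<lambda>n. LINT x|?M. (norm (\<psi> n x - v x))\<^sup>2) \<longlonglongrightarrow> 0"
    "(\<lambda>n. LINT x|?M. (norm (classical_grad (\<psi> n) x - weak_grad \<Omega> v x))\<^sup>2) \<longlonglongrightarrow> 0" using Dv(4) by blast
  note sq\<phi> = sq_integrable_test_field[OF op \<phi>(1)]
  note sq\<psi> = sq_integrable_test_field[OF op \<psi>(1)]
  have cg: "classical_grad (\<lambda>x. s *\<^sub>R \<phi> n x + t *\<^sub>R \<psi> n x) x = s *\<^sub>R classical_grad (\<phi> n) x + t *\<^sub>R classical_grad (\<psi> n) x" for n x
    by (rule classical_grad_lincomb) (use test_function_differentiable \<phi>(1) \<psi>(1) in blast)+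
  have t: "test_function \<Omega> (\<lambda>x. (s *\<^sub>R \<phi> n x + t *\<^sub>R \<psi> n x) $ i)" for n i
    using test_function_lincomb[OF \<phi>(1) \<psi>(1)] by simp
  have l1: "(\<lambda>n. LINT x|?M. (norm ((s *\<^sub>R \<phi> n x + t *\<^sub>R \<psi> n x) - (s *\<^sub>R u x + t *\<^sub>R v x)))\<^sup>2) \<longlonglongrightarrow> 0"
    by (rule L2_tendsto_lincomb[OF sq\<phi>(1) sq\<psi>(1) Du(1) Dv(1) \<phi>(2) \<psi>(2)])
  have l2: "(\<lambda>n. LINT x|?M. (norm (classical_grad (\<lambda>x. s *\<^sub>R \<phi> n x + t *\<^sub>R \<psi> n x) x - (s *\<^sub>R weak_grad \<Omega> u x + t *\<^sub>R weak_grad \<Omega> v x)))\<^sup>2) \<longlonglongrightarrow> 0"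
    unfolding cg by (rule L2_tendsto_lincomb[OF sq\<phi>(2) sq\<psi>(2) Du(2) Dv(2) \<phi>(3) \<psi>(3)])
  note I = H10_spaceI[OF op t sq_integrable_lincomb[OF Du(1) Dv(1)] sq_integrable_lincomb[OF Du(2) Dv(2)] l1 l2]
  show "(\<lambda>x. s *\<^sub>R u x + t *\<^sub>R v x) \<in> H10_space \<Omega>" by (rule I(1))
  show "AE x in lebesgue_on \<Omega>. weak_grad \<Omega> (\<lambda>x. s *\<^sub>R u x + t *\<^sub>R v x) x = s *\<^sub>R weak_grad \<Omega> u x + t *\<^sub>R weak_grad \<Omega> v x"
    by (rule I(2))
qed

lemma Sym_diff: "Sym A - Sym B = Sym (A - B)"
  using Sym_lincomb[of 1 A "-1" B] by simp

lemma H10_inequalities: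
  assumes op: "open \<Omega>" and u: "u \<in> H10_space \<Omega>"
    and R: "R \<ge> 0" "\<And>x y. x \<in> \<Omega> \<Longrightarrow> y \<in> \<Omega> \<Longrightarrow> norm (x - y) \<le> R"
  shows "(LINT x|lebesgue_on \<Omega>. (norm (weak_grad \<Omega> u x))\<^sup>2) \<le> 2 * (LINT x|lebesgue_on \<Omega>. (norm (Sym (weak_grad \<Omega> u x)))\<^sup>2)"
    and "2 * (LINT x|lebesgue_on \<Omega>. (norm (u x))\<^sup>2) \<le> R\<^sup>2 * (LINT x|lebesgue_on \<Omega>. (norm (Sym (weak_grad \<Omega> u x)))\<^sup>2)"
proof -
  let ?M = "lebesgue_on \<Omega>"
  note Du = H10_spaceD[OF op u]
  obtain \<phi> where \<phi>: "\<And>n i. test_function \<Omega> (\<lambda>x. \<phi> n x $ i)"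
    "(\<lambda>n. LINT x|?M. (norm (\<phi> n x - u x))\<^sup>2) \<longlonglongrightarrow> 0"
    "(\<lambda>n. LINT x|?M. (norm (classical_grad (\<phi> n) x - weak_grad \<Omega> u x))\<^sup>2) \<longlonglongrightarrow> 0" using Du(4) by blast
  note sq\<phi> = sq_integrable_test_field[OF op \<phi>(1)]
  have Slim: "(\<lambda>n. LINT x|?M. (norm (Sym (classical_grad (\<phi> n) x) - Sym (weak_grad \<Omega> u x)))\<^sup>2) \<longlonglongrightarrow> 0"
  proof (rule tendsto_sandwich[OF _ _ tendsto_const \<phi>(3)])
    have sqd: "sq_integrable ?M (\<lambda>x. classical_grad (\<phi> n) x - weak_grad \<Omega> u x)" for n by (intro sq_integrable_diff sq\<phi> Du)
    have "(LINT x|?M. (norm (Sym (classical_grad (\<phi> n) x) - Sym (weak_grad \<Omega> u x)))\<^sup>2) \<le> (LINT x|?M. (norm (classical_grad (\<phi> n) x - weak_grad \<Omega> u x))\<^sup>2)" for n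
      unfolding Sym_diff
      by (intro integral_mono sq_integrableD(2)[OF sqd] sq_integrableD(2)[OF sq_integrable_Sym[OF sqd]] power_mono norm_Sym_le) simp
    then show "\<forall>\<^sub>F n in sequentially. (LINT x|?M. (norm (Sym (classical_grad (\<phi> n) x) - Sym (weak_grad \<Omega> u x)))\<^sup>2) \<le> (LINT x|?M. (norm (classical_grad (\<phi> n) x - weak_grad \<Omega> u x))\<^sup>2)"
      by simp
  qed simp
  have S: "(\<lambda>n. LINT x|?M. (norm (Sym (classical_grad (\<phi> n) x)))\<^sup>2) \<longlonglongrightarrow> (LINT x|?M. (norm (Sym (weak_grad \<Omega> u x)))\<^sup>2)"
    by (rule tendsto_LINT_norm_sq[OF sq_integrable_Sym[OF sq\<phi>(2)] sq_integrable_Sym[OF Du(2)] Slim])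
  have G: "(\<lambda>n. LINT x|?M. (norm (classical_grad (\<phi> n) x))\<^sup>2) \<longlonglongrightarrow> (LINT x|?M. (norm (weak_grad \<Omega> u x))\<^sup>2)"
    by (rule tendsto_LINT_norm_sq[OF sq\<phi>(2) Du(2) \<phi>(3)])
  have U: "(\<lambda>n. LINT x|?M. (norm (\<phi> n x))\<^sup>2) \<longlonglongrightarrow> (LINT x|?M. (norm (u x))\<^sup>2)"
    by (rule tendsto_LINT_norm_sq[OF sq\<phi>(1) Du(1) \<phi>(2)])
  note ineq = lipc_field_inequalities[OF op test_field_lipc_field[OF \<phi>(1)] R]
  show "(LINT x|?M. (norm (weak_grad \<Omega> u x))\<^sup>2) \<le> 2 * (LINT x|?M. (norm (Sym (weak_grad \<Omega> u x)))\<^sup>2)"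
    by (rule LIMSEQ_le[OF G tendsto_mult[OF tendsto_const S]]) (use ineq(1) in blast)
  show "2 * (LINT x|?M. (norm (u x))\<^sup>2) \<le> R\<^sup>2 * (LINT x|?M. (norm (Sym (weak_grad \<Omega> u x)))\<^sup>2)"
    by (rule LIMSEQ_le[OF tendsto_mult[OF tendsto_const U] tendsto_mult[OF tendsto_const S]]) (use ineq(2) in blast)
qed

locale local_setting =
  fixes \<Omega> :: "(real^'n) set" and c :: "real^'n \<Rightarrow> real" and c_min c_max :: real
  assumes op: "open \<Omega>" and bd: "bounded \<Omega>"
    and c_meas: "c \<in> borel_measurable (lebesgue_on \<Omega>)"
    and c_min: "0 < c_min" and c_bounds: "\<And>x. x \<in> \<Omega> \<Longrightarrow> c_min \<le> c x \<and> c x \<le> c_max"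
begin

abbreviation "M \<equiv> lebesgue_on \<Omega>"
abbreviation "H10 \<equiv> H10_space \<Omega>"
abbreviation "B \<equiv> B_local \<Omega> c"

definition elastic_const :: real where "elastic_const = 1 / (real CARD('n) * (real CARD('n) + 2))"

lemma elastic_const_pos: "elastic_const > 0" by (simp add: elastic_const_def)

definition grad_form :: "(real^'n \<Rightarrow> real^'n^'n) \<Rightarrow> (real^'n \<Rightarrow> real^'n^'n) \<Rightarrow> real" where
  "grad_form G H = elastic_const * (LINT x|M. c x * elastic_form (G x) (H x))"

lemma B_local_eq: "B u v = grad_form (weak_grad \<Omega> u) (weak_grad \<Omega> v)"
  by (simp add: B_local_def grad_form_def elastic_form_def elastic_const_def)

lemma elastic_measurable:
  fixes G H :: "real^'n \<Rightarrow> real^'n^'n"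
  assumes "G \<in> borel_measurable M" "H \<in> borel_measurable M"
  shows "(\<lambda>x. c x * elastic_form (G x) (H x)) \<in> borel_measurable M"
proof -
  note [measurable] = assms c_meas
  show ?thesis unfolding elastic_form_def by measurable
qed

lemma elastic_integrable:
  fixes G H :: "real^'n \<Rightarrow> real^'n^'n"
  assumes "sq_integrable M G" "sq_integrable M H"
  shows "integrable M (\<lambda>x. c x * elastic_form (G x) (H x))"
proof (rule Bochner_Integration.integrable_bound)
  show "integrable M (\<lambda>x. c_max * ((2 + real CARD('n)) * ((norm (G x))\<^sup>2 + (norm (H x))\<^sup>2)))"
    using assms[THEN sq_integrableD(2)] by simp
  show "AE x in M. norm (c x * elastic_form (G x) (H x)) \<le> norm (c_max * ((2 + real CARD('n)) * ((norm (G x))\<^sup>2 + (norm (H x))\<^sup>2)))"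
  proof (rule AE_I2)
    fix x assume "x \<in> space M"
    then have c: "c_min \<le> c x" "c x \<le> c_max" using c_bounds by auto
    have "\<bar>c x * elastic_form (G x) (H x)\<bar> \<le> c_max * ((2 + real CARD('n)) * ((norm (G x))\<^sup>2 + (norm (H x))\<^sup>2))"
      unfolding abs_mult by (rule mult_mono[OF _ elastic_form_bounds(2)]) (use c c_min in auto)
    then show "norm (c x * elastic_form (G x) (H x)) \<le> norm (c_max * ((2 + real CARD('n)) * ((norm (G x))\<^sup>2 + (norm (H x))\<^sup>2)))"
      by simp
  qed
qed (intro elastic_measurable assms[THEN sq_integrableD(1)])

lemma grad_form_cong:
  assumes "sq_integrable M G" "sq_integrable M G'" "sq_integrable M H" "sq_integrable M H'"
    and "AE x in M. G x = G' x" "AE x in M. H x = H' x"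
  shows "grad_form G H = grad_form G' H'"
proof -
  have "(LINT x|M. c x * elastic_form (G x) (H x)) = (LINT x|M. c x * elastic_form (G' x) (H' x))"
  proof (rule integral_cong_AE)
    show "AE x in M. c x * elastic_form (G x) (H x) = c x * elastic_form (G' x) (H' x)"
      using assms(5,6) by eventually_elim simp
  qed (intro elastic_measurable assms(1-4)[THEN sq_integrableD(1)])+
  then show ?thesis by (simp add: grad_form_def)
qed

lemma grad_form_lincomb:
  assumes "sq_integrable M G" "sq_integrable M G'" "sq_integrable M H"
  shows "grad_form (\<lambda>x. s *\<^sub>R G x + t *\<^sub>R G' x) H = s * grad_form G H + t * grad_form G' H"
proof -
  have "(LINT x|M. c x * elastic_form (s *\<^sub>R G x + t *\<^sub>R G' x) (H x))
      = (LINT x|M. s * (c x * elastic_form (G x) (H x)) + t * (c x * elastic_form (G' x) (H x)))"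
    by (intro Bochner_Integration.integral_cong refl) (simp add: elastic_form_lincomb algebra_simps)
  also have "\<dots> = s * (LINT x|M. c x * elastic_form (G x) (H x)) + t * (LINT x|M. c x * elastic_form (G' x) (H x))"
    using elastic_integrable[OF assms(1,3)] elastic_integrable[OF assms(2,3)] by simp
  finally show ?thesis by (simp add: grad_form_def algebra_simps)
qed

lemma grad_form_commute: "grad_form G H = grad_form H G"
  by (simp add: grad_form_def elastic_form_commute)

lemma grad_form_bounds:
  assumes G: "sq_integrable M G"
  shows "elastic_const * c_min * 2 * (LINT x|M. (norm (Sym (G x)))\<^sup>2) \<le> grad_form G G"
    and "grad_form G G \<le> elastic_const * c_max * (2 + real CARD('n)) * (LINT x|M. (norm (G x))\<^sup>2)"
proof -
  have i: "integrable M (\<lambda>x. (norm (Sym (G x)))\<^sup>2)" "integrable M (\<lambda>x. (norm (G x))\<^sup>2)"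
    using sq_integrableD(2)[OF sq_integrable_Sym[OF G]] sq_integrableD(2)[OF G] by auto
  have "(LINT x|M. c_min * (2 * (norm (Sym (G x)))\<^sup>2)) \<le> (LINT x|M. c x * elastic_form (G x) (G x))"
  proof (rule integral_mono)
    fix x assume "x \<in> space M"
    then have c: "c_min \<le> c x" using c_bounds by auto
    show "c_min * (2 * (norm (Sym (G x)))\<^sup>2) \<le> c x * elastic_form (G x) (G x)"
      by (intro mult_mono elastic_form_bounds(1)) (use c c_min in auto)
  qed (use i elastic_integrable[OF G G] in auto)
  then have "elastic_const * (LINT x|M. c_min * (2 * (norm (Sym (G x)))\<^sup>2)) \<le> grad_form G G"
    unfolding grad_form_def using elastic_const_pos by (intro mult_left_mono) auto
  then show "elastic_const * c_min * 2 * (LINT x|M. (norm (Sym (G x)))\<^sup>2) \<le> grad_form G G"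
    using i by (simp add: mult.assoc)
  have "(LINT x|M. c x * elastic_form (G x) (G x)) \<le> (LINT x|M. c_max * ((2 + real CARD('n)) * (norm (G x))\<^sup>2))"
  proof (rule integral_mono)
    fix x assume "x \<in> space M"
    then have c: "c_min \<le> c x" "c x \<le> c_max" using c_bounds by auto
    have "0 \<le> elastic_form (G x) (G x)" using elastic_form_bounds(1)[of "G x"] by (rule order_trans[rotated]) simp
    then show "c x * elastic_form (G x) (G x) \<le> c_max * ((2 + real CARD('n)) * (norm (G x))\<^sup>2)"
      by (intro mult_mono elastic_form_bounds(3)) (use c c_min in auto)
  qed (use i elastic_integrable[OF G G] in auto)
  then have "grad_form G G \<le> elastic_const * (LINT x|M. c_max * ((2 + real CARD('n)) * (norm (G x))\<^sup>2))"
    unfolding grad_form_def using elastic_const_pos by (intro mult_left_mono) auto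
  then show "grad_form G G \<le> elastic_const * c_max * (2 + real CARD('n)) * (LINT x|M. (norm (G x))\<^sup>2)"
    using i by (simp add: mult.assoc)
qed

text \<open>The added \<open>1\<close> keeps the coercivity constant positive for an empty \<open>\<Omega>\<close>.\<close>

definition diam_bound :: real where "diam_bound = diameter \<Omega> + 1"

lemma diam_bound: "0 < diam_bound" "0 \<le> diam_bound" "x \<in> \<Omega> \<Longrightarrow> y \<in> \<Omega> \<Longrightarrow> norm (x - y) \<le> diam_bound"
  using diameter_ge_0[OF bd] diameter_bounded_bound[OF bd, of x y] by (auto simp: diam_bound_def dist_norm)

definition C_L2 :: real where "C_L2 = diam_bound\<^sup>2 / (2 * (elastic_const * c_min * 2))"

definition C_grad :: real where "C_grad = 2 / (elastic_const * c_min * 2)"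

lemma C_pos: "0 < C_L2" "0 < C_grad"
  using diam_bound(1) elastic_const_pos c_min by (simp_all add: C_L2_def C_grad_def)

text \<open>Stated for an arbitrary pair of \<open>u\<close> and \<open>G\<close>, to serve both \<open>H\<^sup>1\<^sub>0\<close> and the piecewise affine fields.\<close>

lemma L2_le_energy:
  fixes u :: "real^'n \<Rightarrow> real^'n"
  assumes G: "sq_integrable M G"
    and P: "2 * (LINT x|M. (norm (u x))\<^sup>2) \<le> diam_bound\<^sup>2 * (LINT x|M. (norm (Sym (G x)))\<^sup>2)"
  shows "(LINT x|M. (norm (u x))\<^sup>2) \<le> C_L2 * grad_form G G"
proof -
  have k: "elastic_const * c_min * 2 > 0" using elastic_const_pos c_min by simp
  note P
  also have "diam_bound\<^sup>2 * (LINT x|M. (norm (Sym (G x)))\<^sup>2) \<le> diam_bound\<^sup>2 * (grad_form G G / (elastic_const * c_min * 2))"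
    using grad_form_bounds(1)[OF G] k by (intro mult_left_mono) (simp_all add: pos_le_divide_eq mult.commute)
  finally have "(LINT x|M. (norm (u x))\<^sup>2) \<le> diam_bound\<^sup>2 * (grad_form G G / (elastic_const * c_min * 2)) / 2" by simp
  also have "\<dots> = C_L2 * grad_form G G" by (simp add: C_L2_def)
  finally show ?thesis .
qed

lemma grad_le_energy:
  assumes G: "sq_integrable M G"
    and K: "(LINT x|M. (norm (G x))\<^sup>2) \<le> 2 * (LINT x|M. (norm (Sym (G x)))\<^sup>2)"
  shows "(LINT x|M. (norm (G x))\<^sup>2) \<le> C_grad * grad_form G G"
proof -
  have k: "elastic_const * c_min * 2 > 0" using elastic_const_pos c_min by simp
  note K
  also have "2 * (LINT x|M. (norm (Sym (G x)))\<^sup>2) \<le> 2 * (grad_form G G / (elastic_const * c_min * 2))"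
    using grad_form_bounds(1)[OF G] k by (intro mult_left_mono) (simp_all add: pos_le_divide_eq mult.commute)
  also have "\<dots> = C_grad * grad_form G G" by (simp add: C_grad_def)
  finally show ?thesis .
qed

lemma H10_energy_bounds:
  assumes u: "u \<in> H10"
  shows "(LINT x|M. (norm (u x))\<^sup>2) \<le> C_L2 * B u u"
    and "(LINT x|M. (norm (weak_grad \<Omega> u x))\<^sup>2) \<le> C_grad * B u u"
  unfolding B_local_eq
  by (rule L2_le_energy[OF H10_spaceD(2)[OF op u] H10_inequalities(2)[OF op u diam_bound(2,3)]],
      assumption, assumption, rule grad_le_energy[OF H10_spaceD(2)[OF op u] H10_inequalities(1)[OF op u diam_bound(2,3)]])

text \<open>Fields and weak gradients are Cauchy in \<open>L\<^sup>2\<close> by coercivity and Korn's inequality. Choosing for the \<open>n\<close>-th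
  field a test field within \<open>1/(n + 1)\<close> gives a diagonal sequence with the same limits, so the limit belongs
  to \<open>H\<^sup>1\<^sub>0\<close>.\<close>

lemma H10_complete:
  assumes s: "\<And>n. s n \<in> H10"
    and cau: "\<forall>e>0. \<exists>N. \<forall>m\<ge>N. \<forall>n\<ge>N. B (\<lambda>x. s m x - s n x) (\<lambda>x. s m x - s n x) < e"
  shows "\<exists>u\<in>H10. \<exists>r::nat\<Rightarrow>nat. strict_mono r \<and>
    (\<lambda>n. B (\<lambda>x. s (r n) x - u x) (\<lambda>x. s (r n) x - u x)) \<longlonglongrightarrow> 0"
proof -
  have d: "(\<lambda>x. u x - v x) \<in> H10"
    and dg: "AE x in M. weak_grad \<Omega> (\<lambda>x. u x - v x) x = weak_grad \<Omega> u x - weak_grad \<Omega> v x"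
    if "u \<in> H10" "v \<in> H10" for u v
    using H10_lincomb[OF op that, of 1 "-1"] by auto
  note D = H10_spaceD[OF op]
  have sq: "sq_integrable M (s n)" "sq_integrable M (weak_grad \<Omega> (s n))" for n using D[OF s] by auto
  have nsq: "(LINT x|M. (norm (weak_grad \<Omega> (\<lambda>x. s m x - s n x) x))\<^sup>2) = (LINT x|M. (norm (weak_grad \<Omega> (s m) x - weak_grad \<Omega> (s n) x))\<^sup>2)" for m n
    by (rule LINT_norm_sq_cong[OF sq_integrableD(1)[OF D(2)[OF d[OF s s]]] sq_integrableD(1)[OF sq_integrable_diff[OF sq(2) sq(2)]] dg[OF s s]])
  have bU: "(LINT x|M. (norm (s m x - s n x))\<^sup>2) \<le> C_L2 * B (\<lambda>x. s m x - s n x) (\<lambda>x. s m x - s n x)" for m n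
    by (rule H10_energy_bounds(1)[OF d[OF s s]])
  have bG: "(LINT x|M. (norm (weak_grad \<Omega> (s m) x - weak_grad \<Omega> (s n) x))\<^sup>2) \<le> C_grad * B (\<lambda>x. s m x - s n x) (\<lambda>x. s m x - s n x)" for m n
    unfolding nsq[symmetric] by (rule H10_energy_bounds(2)[OF d[OF s s]])
  obtain r1 u where "strict_mono (r1 :: nat \<Rightarrow> nat)" and u: "sq_integrable M u" and "AE x in M. (\<lambda>n. s (r1 n) x) \<longlonglongrightarrow> u x"
    and ulim: "(\<lambda>n. LINT x|M. (norm (s n x - u x))\<^sup>2) \<longlonglongrightarrow> 0"
    by (rule L2_complete[OF sq(1) L2_Cauchy_dominated[OF cau C_pos(1) bU]])
  obtain r2 G where "strict_mono (r2 :: nat \<Rightarrow> nat)" and G: "sq_integrable M G" and "AE x in M. (\<lambda>n. weak_grad \<Omega> (s (r2 n)) x) \<longlonglongrightarrow> G x"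
    and Glim: "(\<lambda>n. LINT x|M. (norm (weak_grad \<Omega> (s n) x - G x))\<^sup>2) \<longlonglongrightarrow> 0"
    by (rule L2_complete[OF sq(2) L2_Cauchy_dominated[OF cau C_pos(2) bG]])
  define near where "near n \<phi> \<longleftrightarrow> (\<forall>i. test_function \<Omega> (\<lambda>x. \<phi> x $ i)) \<and> (LINT x|M. (norm (\<phi> x - s n x))\<^sup>2) < step n
     \<and> (LINT x|M. (norm (classical_grad \<phi> x - weak_grad \<Omega> (s n) x))\<^sup>2) < step n" for n \<phi>
  have "\<exists>\<phi>. near n \<phi>" for n
  proof -
    obtain \<phi> where \<phi>: "\<And>k i. test_function \<Omega> (\<lambda>x. \<phi> k x $ i)"
      "(\<lambda>k. LINT x|M. (norm (\<phi> k x - s n x))\<^sup>2) \<longlonglongrightarrow> 0"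
      "(\<lambda>k. LINT x|M. (norm (classical_grad (\<phi> k) x - weak_grad \<Omega> (s n) x))\<^sup>2) \<longlonglongrightarrow> 0"
      using D(4)[OF s] by blast
    have "\<forall>\<^sub>F k in sequentially. (LINT x|M. (norm (\<phi> k x - s n x))\<^sup>2) < step n \<and> (LINT x|M. (norm (classical_grad (\<phi> k) x - weak_grad \<Omega> (s n) x))\<^sup>2) < step n"
      using order_tendstoD(2)[OF \<phi>(2) step(3)] order_tendstoD(2)[OF \<phi>(3) step(3)] by (rule eventually_conj)
    then obtain k where "(LINT x|M. (norm (\<phi> k x - s n x))\<^sup>2) < step n \<and> (LINT x|M. (norm (classical_grad (\<phi> k) x - weak_grad \<Omega> (s n) x))\<^sup>2) < step n"
      by (auto simp: eventually_sequentially)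
    then have "near n (\<phi> k)" using \<phi>(1) by (simp add: near_def)
    then show ?thesis by (rule exI[of _ "\<phi> k"])
  qed
  then obtain \<phi> where "\<And>n. near n (\<phi> n)" by metis
  then have \<phi>: "\<And>n i. test_function \<Omega> (\<lambda>x. \<phi> n x $ i)"
    and \<phi>u: "\<And>n. (LINT x|M. (norm (\<phi> n x - s n x))\<^sup>2) < step n"
    and \<phi>G: "\<And>n. (LINT x|M. (norm (classical_grad (\<phi> n) x - weak_grad \<Omega> (s n) x))\<^sup>2) < step n"
    unfolding near_def by blast+
  note sq\<phi> = sq_integrable_test_field[OF op \<phi>]
  have diag: "(\<lambda>n. LINT x|M. (norm (p n x - w x))\<^sup>2) \<longlonglongrightarrow> 0"
    if sqp: "\<And>n. sq_integrable M (p n)" "\<And>n. sq_integrable M (q n)" "sq_integrable M w"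
      and pq: "\<And>n. (LINT x|M. (norm (p n x - q n x))\<^sup>2) < step n" and q: "(\<lambda>n. LINT x|M. (norm (q n x - w x))\<^sup>2) \<longlonglongrightarrow> 0"
    for p q :: "nat \<Rightarrow> real^'n \<Rightarrow> 'b::euclidean_space" and w
  proof -
    have "(\<lambda>n. LINT x|M. (norm (p n x - q n x - 0))\<^sup>2) \<longlonglongrightarrow> 0"
      by (rule tendsto_sandwich[OF _ _ tendsto_const step(1)]) (use less_imp_le[OF pq] in auto)
    from L2_tendsto_lincomb[OF sq_integrable_diff[OF sqp(1) sqp(2)] sqp(2) _ sqp(3) this q, of 1 1]
    show ?thesis by (simp add: sq_integrable_def)
  qed
  note I = H10_spaceI[OF op \<phi> u G diag[OF sq\<phi>(1) sq(1) u \<phi>u ulim] diag[OF sq\<phi>(2) sq(2) G \<phi>G Glim]]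
  have lim: "(\<lambda>n. B (\<lambda>x. s n x - u x) (\<lambda>x. s n x - u x)) \<longlonglongrightarrow> 0"
  proof (rule tendsto_sandwich[OF _ _ tendsto_const])
    let ?k = "elastic_const * c_max * (2 + real CARD('n))"
    show "(\<lambda>n. ?k * (LINT x|M. (norm (weak_grad \<Omega> (s n) x - G x))\<^sup>2)) \<longlonglongrightarrow> 0"
      using tendsto_mult_left[OF Glim, of ?k] by simp
    have "0 \<le> B (\<lambda>x. s n x - u x) (\<lambda>x. s n x - u x)" for n
      unfolding B_local_eq
      by (rule order_trans[OF _ grad_form_bounds(1)[OF D(2)[OF d[OF s I(1)]]]])
         (use elastic_const_pos c_min in \<open>auto intro!: mult_nonneg_nonneg integral_nonneg_AE\<close>)
    then show "\<forall>\<^sub>F n in sequentially. 0 \<le> B (\<lambda>x. s n x - u x) (\<lambda>x. s n x - u x)" by simp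
    have "B (\<lambda>x. s n x - u x) (\<lambda>x. s n x - u x) \<le> ?k * (LINT x|M. (norm (weak_grad \<Omega> (s n) x - G x))\<^sup>2)" for n
    proof -
      have "AE x in M. weak_grad \<Omega> (\<lambda>x. s n x - u x) x = weak_grad \<Omega> (s n) x - G x"
        using dg[OF s I(1)] I(2) by eventually_elim simp
      then have nq: "(LINT x|M. (norm (weak_grad \<Omega> (\<lambda>x. s n x - u x) x))\<^sup>2) = (LINT x|M. (norm (weak_grad \<Omega> (s n) x - G x))\<^sup>2)"
        by (rule LINT_norm_sq_cong[OF sq_integrableD(1)[OF D(2)[OF d[OF s I(1)]]] sq_integrableD(1)[OF sq_integrable_diff[OF sq(2) G]]])
      show ?thesis
        using grad_form_bounds(2)[OF D(2)[OF d[OF s[of n] I(1)]]] unfolding B_local_eq nq .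
    qed
    then show "\<forall>\<^sub>F n in sequentially. B (\<lambda>x. s n x - u x) (\<lambda>x. s n x - u x) \<le> ?k * (LINT x|M. (norm (weak_grad \<Omega> (s n) x - G x))\<^sup>2)"
      by simp
  qed
  show ?thesis
    using I(1) lim by (intro bexI[of _ u] exI[of _ "\<lambda>n. n"]) (auto simp: strict_mono_def)
qed

lemma coercive_form_H10: "coercive_form \<Omega> \<Omega> H10 B C_L2"
proof -
  note D = H10_spaceD[OF op]
  show ?thesis
  proof
    have t: "test_function \<Omega> (\<lambda>x. (0 :: real^'n) $ i)" for i
      by (simp add: test_function_def Ck_const)
    have sq0: "sq_integrable M (\<lambda>_. 0 :: real^'n)" "sq_integrable M (\<lambda>_. 0 :: real^'n^'n)"
      by (auto simp: sq_integrable_def)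
    have cg0: "classical_grad (\<lambda>_. 0 :: real^'n) x = 0" for x
      by (simp add: classical_grad_def vec_eq_iff partial_deriv_def)
    show "(\<lambda>_. 0) \<in> H10"
      by (rule H10_spaceI(1)[OF op, of "\<lambda>_ _. 0", OF t sq0]) (simp_all add: cg0)
    show "B (\<lambda>x. s *\<^sub>R u x + t *\<^sub>R v x) w = s * B u w + t * B v w"
      if "u \<in> H10" "v \<in> H10" "w \<in> H10" for u v w s t
    proof -
      note sqg = D(2)[OF that(1)] D(2)[OF that(2)] D(2)[OF that(3)]
      have "grad_form (weak_grad \<Omega> (\<lambda>x. s *\<^sub>R u x + t *\<^sub>R v x)) (weak_grad \<Omega> w)
          = grad_form (\<lambda>x. s *\<^sub>R weak_grad \<Omega> u x + t *\<^sub>R weak_grad \<Omega> v x) (weak_grad \<Omega> w)"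
        by (rule grad_form_cong[OF D(2)[OF H10_lincomb(1)[OF op that(1,2)]] sq_integrable_lincomb[OF sqg(1,2)] sqg(3,3) H10_lincomb(2)[OF op that(1,2)]])
           simp
      then show ?thesis unfolding B_local_eq by (simp add: grad_form_lincomb[OF sqg])
    qed
    show "B u v = B v u" for u v unfolding B_local_eq by (rule grad_form_commute)
  qed (fact C_pos(1) D(1) H10_lincomb(1)[OF op] H10_complete H10_energy_bounds(1) | assumption)+
qed

end

section \<open>Continuous piecewise affine fields\<close>

locale mesh_setting =
  fixes \<Omega> :: "(real^'n) set" and \<delta> :: real and \<T> :: "(real^'n) set set"
  assumes op: "open \<Omega>" and bd: "bounded \<Omega>" and \<delta>_pos: "\<delta> > 0" and mesh: "mesh_of (enlarged \<Omega> \<delta>) \<T>"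
begin

abbreviation "D \<equiv> enlarged \<Omega> \<delta>"

abbreviation "P1 \<equiv> P1_space \<Omega> \<delta> \<T>"

lemma D_open: "open D" by (rule open_enlarged[OF op])

lemma \<Omega>_D: "\<Omega> \<subseteq> D" by (rule subset_enlarged)

lemma finite_mesh: "finite \<T>"
  and cell: "T \<in> \<T> \<Longrightarrow> convex T" "T \<in> \<T> \<Longrightarrow> closed T"
  and cover: "closure D \<subseteq> \<Union>\<T>"
  using mesh convex_simplex closed_simplex unfolding mesh_of_def triangulation_def by blast+

text \<open>A cell is a full-dimensional convex set, hence the closure of its interior, and \<open>D\<close> is open. So almost
  everywhere information on \<open>D\<close> says something about every cell.\<close>

lemma cell_meets: "T \<in> \<T> \<Longrightarrow> interior T \<inter> D \<noteq> {}"
proof -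
  assume T: "T \<in> \<T>"
  then have s: "int CARD('n) simplex T" and m: "T \<inter> D \<noteq> {}" using mesh by (auto simp: mesh_of_def)
  have "aff_dim T = DIM(real^'n)" using aff_dim_simplex[OF s] by simp
  then have "affine hull T = UNIV" by (simp only: aff_dim_eq_full)
  then have "interior T = rel_interior T" by (rule rel_interior_interior[symmetric])
  then have "interior T \<noteq> {}" using rel_interior_eq_empty[OF cell(1)[OF T]] m by auto
  then have "closure (interior T) = closure T" by (rule convex_closure_interior[OF cell(1)[OF T]])
  then have "T \<subseteq> closure (interior T)" using closure_subset by auto
  then have "D \<inter> closure (interior T) \<noteq> {}" using m by blast
  then show "interior T \<inter> D \<noteq> {}" using open_Int_closure_eq_empty[OF D_open] by blast
qed

definition slopes :: "(real^'n \<Rightarrow> real^'n) \<Rightarrow> ((real^'n) set \<Rightarrow> real^'n^'n) \<Rightarrow> ((real^'n) set \<Rightarrow> real^'n) \<Rightarrow> bool" where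
  "slopes u A b \<longleftrightarrow> (\<forall>T\<in>\<T>. \<forall>x\<in>T \<inter> closure D. u x = A T *v x + b T)"

lemma P1_slopes:
  assumes "u \<in> P1"
  obtains A b where "slopes u A b"
  using assms unfolding P1_space_def slopes_def by (auto dest!: bchoice)

lemma P1_outside: "u \<in> P1 \<Longrightarrow> x \<in> D \<Longrightarrow> x \<notin> \<Omega> \<Longrightarrow> u x = 0"
  by (simp add: P1_space_def)

text \<open>Continuity is automatic once the affine pieces fit together.\<close>

lemma slopes_continuous:
  assumes "slopes u A b"
  shows "continuous_on (closure D) u"
proof -
  have "continuous_on (\<Union>T\<in>\<T>. T \<inter> closure D) u"
  proof (rule continuous_on_closed_Union[OF finite_mesh])
    fix T assume T: "T \<in> \<T>"
    show "closed (T \<inter> closure D)" using cell(2)[OF T] by auto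
    have "continuous_on (T \<inter> closure D) (\<lambda>x. A T *v x + b T)" by (intro continuous_intros)
    then show "continuous_on (T \<inter> closure D) u"
      by (rule continuous_on_eq) (use assms T in \<open>simp add: slopes_def\<close>)
  qed
  moreover have "(\<Union>T\<in>\<T>. T \<inter> closure D) = closure D" using cover by blast
  ultimately show ?thesis by simp
qed

lemma P1_I:
  assumes "slopes u A b" "\<And>x. x \<in> D \<Longrightarrow> x \<notin> \<Omega> \<Longrightarrow> u x = 0"
  shows "u \<in> P1"
  using slopes_continuous[OF assms(1)] assms unfolding P1_space_def slopes_def by blast

lemma slopes_lincomb:
  assumes "slopes u A b" "slopes v A' b'"
  shows "slopes (\<lambda>x. s *\<^sub>R u x + t *\<^sub>R v x) (\<lambda>T. s *\<^sub>R A T + t *\<^sub>R A' T) (\<lambda>T. s *\<^sub>R b T + t *\<^sub>R b' T)"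
  using assms by (simp add: slopes_def matrix_vector_mult_add_rdistrib scaleR_matrix_vector_assoc[symmetric] algebra_simps)

lemma P1_lincomb:
  assumes "u \<in> P1" "v \<in> P1"
  shows "(\<lambda>x. s *\<^sub>R u x + t *\<^sub>R v x) \<in> P1"
proof -
  obtain A b where "slopes u A b" by (rule P1_slopes[OF assms(1)])
  moreover obtain A' b' where "slopes v A' b'" by (rule P1_slopes[OF assms(2)])
  ultimately show ?thesis
    using P1_outside[OF assms(1)] P1_outside[OF assms(2)] by (intro P1_I[OF slopes_lincomb]) auto
qed

definition zero_ext :: "(real^'n \<Rightarrow> real^'n) \<Rightarrow> real^'n \<Rightarrow> real^'n" where
  "zero_ext u x = (if x \<in> \<Omega> then u x else 0)"

lemma zero_ext_D: "u \<in> P1 \<Longrightarrow> x \<in> D \<Longrightarrow> zero_ext u x = u x"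
  using P1_outside by (auto simp: zero_ext_def)

lemma norm_matrix_vector_le: "norm (A *v x) \<le> norm (A :: real^'n^'n) * norm x"
proof -
  have "(norm (A *v x))\<^sup>2 = (\<Sum>i\<in>UNIV. (A $ i \<bullet> x)\<^sup>2)"
    by (simp add: norm_sq_vec matrix_vector_mul_component)
  also have "\<dots> \<le> (\<Sum>i\<in>UNIV. (norm (A $ i))\<^sup>2 * (norm x)\<^sup>2)"
  proof (rule sum_mono)
    fix i
    have "\<bar>A $ i \<bullet> x\<bar> \<le> norm (A $ i) * norm x" by (rule Cauchy_Schwarz_ineq2)
    from power_mono[OF this, of 2] show "(A $ i \<bullet> x)\<^sup>2 \<le> (norm (A $ i))\<^sup>2 * (norm x)\<^sup>2"
      by (simp add: power_mult_distrib)
  qed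
  also have "\<dots> = (norm A * norm x)\<^sup>2"
    by (simp add: norm_sq_vec[of A] power_mult_distrib sum_distrib_right)
  finally show ?thesis by (rule power2_le_imp_le) simp
qed

text \<open>Space is covered by the closed set of points at distance at least \<open>\<delta>/2\<close> from \<open>\<Omega>\<close>, where the
  extension vanishes, and by the parts of the cells within that distance, which lie inside \<open>D\<close>.\<close>

lemma zero_ext_Lipschitz:
  assumes u: "u \<in> P1" and A: "slopes u A b" and L: "\<And>T. T \<in> \<T> \<Longrightarrow> norm (A T) \<le> L" "0 \<le> L"
  shows "norm (zero_ext u x - zero_ext u y) \<le> L * norm (x - y)"
proof (cases "\<Omega> = {}")
  case True
  then show ?thesis unfolding zero_ext_def using L(2) by simp
next
  case ne: False
  define near where "near T = T \<inter> {z. infdist z \<Omega> \<le> \<delta> / 2}" for T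
  define far where "far = {z. \<delta> / 2 \<le> infdist z \<Omega>}"
  have cl: "closed (near T)" if "T \<in> \<T>" for T
    unfolding near_def using cell(2)[OF that] by (intro closed_Int closed_Collect_le continuous_intros)
  have clf: "closed far" unfolding far_def by (intro closed_Collect_le continuous_intros)
  have nD: "z \<in> D" if "infdist z \<Omega> \<le> \<delta> / 2" for z
    using that \<delta>_pos ne by (auto simp: enlarged_def)
  have cov: "z \<in> far \<or> (\<exists>T\<in>\<T>. z \<in> near T)" for z
  proof (cases "z \<in> far")
    case False
    then have i: "infdist z \<Omega> \<le> \<delta> / 2" by (simp add: far_def)
    then have "z \<in> closure D" using nD closure_subset by blast
    then show ?thesis using cover i by (auto simp: near_def)
  qed simp
  have far0: "zero_ext u z = 0" if "z \<in> far" for z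
  proof -
    have "z \<notin> \<Omega>" using that \<delta>_pos by (auto simp: far_def)
    then show ?thesis by (simp add: zero_ext_def)
  qed
  have nearA: "zero_ext u z = A T *v z + b T" if "T \<in> \<T>" "z \<in> near T" for T z
  proof -
    have "z \<in> D" using that nD by (auto simp: near_def)
    then show ?thesis using that A closure_subset[of D] zero_ext_D[OF u] by (auto simp: near_def slopes_def)
  qed
  (* Along a segment, the Lipschitz bounds on finitely many closed pieces add up to a global one. *)
  define \<gamma> where "\<gamma> t = x + t *\<^sub>R (y - x)" for t :: real
  have \<gamma>c: "continuous_on UNIV \<gamma>" unfolding \<gamma>_def by (intro continuous_intros)
  have \<gamma>d: "norm (\<gamma> s - \<gamma> t) = norm (x - y) * \<bar>s - t\<bar>" for s t
  proof -
    have "\<gamma> s - \<gamma> t = (s - t) *\<^sub>R (y - x)" by (simp add: \<gamma>_def algebra_simps)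
    then show ?thesis by (simp add: norm_minus_commute)
  qed
  have "(L * norm (x - y))-lipschitz_on {0..1} (\<lambda>t. zero_ext u (\<gamma> t))"
  proof (rule lipschitz_on_closed_Union[where I="insert far (near ` \<T>)" and U="\<lambda>S. \<gamma> -` S"])
    show "finite (insert far (near ` \<T>))" using finite_mesh by simp
    show "closed (\<gamma> -` S)" if "S \<in> insert far (near ` \<T>)" for S
      using that cl clf \<gamma>c by (intro continuous_closed_vimage) (auto simp: continuous_on_eq_continuous_at)
    show "0 \<le> L * norm (x - y)" using L(2) by simp
    show "{0..1} \<subseteq> (\<Union>S\<in>insert far (near ` \<T>). \<gamma> -` S)" using cov by auto
    show "(L * norm (x - y))-lipschitz_on (\<gamma> -` S) (\<lambda>t. zero_ext u (\<gamma> t))" if S: "S \<in> insert far (near ` \<T>)" for S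
    proof (rule lipschitz_onI)
      fix s t assume st: "s \<in> \<gamma> -` S" "t \<in> \<gamma> -` S"
      consider "S = far" | T where "T \<in> \<T>" "S = near T" using S by blast
      then show "dist (zero_ext u (\<gamma> s)) (zero_ext u (\<gamma> t)) \<le> L * norm (x - y) * dist s t"
      proof cases
        case 1 then show ?thesis using st far0 L(2) by simp
      next
        case 2
        then have "zero_ext u (\<gamma> s) - zero_ext u (\<gamma> t) = A T *v (\<gamma> s - \<gamma> t)"
          using st nearA by (simp add: matrix_vector_mult_diff_distrib)
        then have "norm (zero_ext u (\<gamma> s) - zero_ext u (\<gamma> t)) \<le> norm (A T) * norm (\<gamma> s - \<gamma> t)"
          using norm_matrix_vector_le by simp
        also have "\<dots> \<le> L * norm (\<gamma> s - \<gamma> t)" using L 2 by (intro mult_right_mono) auto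
        finally show ?thesis by (simp add: \<gamma>d dist_norm mult.assoc)
      qed
    qed (use L(2) in simp)
  qed
  from lipschitz_on_normD[OF this, of 0 1] show ?thesis by (simp add: \<gamma>_def norm_minus_commute)
qed

lemma AE_cell_interior: "AE x in lebesgue. \<forall>T\<in>\<T>. x \<notin> frontier T"
proof -
  have "AE x in lebesgue. x \<notin> frontier T" if "T \<in> \<T>" for T
    using negligible_convex_frontier[OF cell(1)[OF that]] by (intro AE_not_in) (simp add: negligible_iff_null_sets)
  then show ?thesis using finite_mesh by (simp add: AE_finite_all)
qed

text \<open>Points off \<open>D\<close> have distance at least \<open>\<delta>\<close> from \<open>\<Omega>\<close>, so the extension vanishes around them, including the
  points on the frontier of \<open>D\<close>.\<close>

lemma zero_ext_has_derivative:
  assumes u: "u \<in> P1" and A: "slopes u A b" and x: "\<forall>T\<in>\<T>. x \<notin> frontier T"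
  shows "(x \<notin> D \<and> (zero_ext u has_derivative (\<lambda>_. 0)) (at x)) \<or>
    (\<exists>T\<in>\<T>. x \<in> interior T \<and> x \<in> D \<and> (zero_ext u has_derivative (\<lambda>h. A T *v h)) (at x))"
proof (cases "x \<in> D")
  case True
  then obtain T where T: "T \<in> \<T>" "x \<in> T" using cover closure_subset by blast
  then have xi: "x \<in> interior T" using x cell(2)[OF T(1)] by (auto simp: frontier_def closure_closed)
  have "((\<lambda>y. A T *v y + b T) has_derivative (\<lambda>h. A T *v h)) (at x)"
    by (auto intro!: derivative_eq_intros bounded_linear.has_derivative[OF matrix_vector_mul_bounded_linear])
  then have "(zero_ext u has_derivative (\<lambda>h. A T *v h)) (at x)"
  proof (rule has_derivative_transform_within_open[where s="interior T \<inter> D"])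
    show "open (interior T \<inter> D)" using D_open by auto
    show "x \<in> interior T \<inter> D" using True xi by simp
    fix y assume "y \<in> interior T \<inter> D"
    then have "y \<in> T \<inter> closure D" "y \<in> D" using interior_subset closure_subset by blast+
    then show "A T *v y + b T = zero_ext u y" using A T zero_ext_D[OF u] by (simp add: slopes_def)
  qed
  then show ?thesis using T xi True by blast
next
  case False
  have "((\<lambda>_. 0) has_derivative (\<lambda>_. 0)) (at x)" by simp
  then have "(zero_ext u has_derivative (\<lambda>_. 0)) (at x)"
  proof (rule has_derivative_transform_within_open[where s="ball x \<delta>"])
    fix y assume "y \<in> ball x \<delta>"
    then have "y \<notin> \<Omega>" using enlarged_far[OF _ False, of y] by (auto simp: dist_norm norm_minus_commute)
    then show "0 = zero_ext u y" by (simp add: zero_ext_def)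
  qed (use \<delta>_pos in auto)
  then show ?thesis using False by blast
qed

lemma classical_grad_of_derivative:
  assumes "(v has_derivative (\<lambda>h. (A :: real^'n^'n) *v h)) (at x)"
  shows "classical_grad v x = A" "(\<lambda>x. v x $ i) differentiable (at x)"
proof -
  have d: "((\<lambda>y. v y $ i) has_derivative (\<lambda>h. (A *v h) $ i)) (at x)" for i
    by (rule bounded_linear.has_derivative[OF bounded_linear_vec_nth assms])
  have "partial_deriv j (\<lambda>y. v y $ i) x = A $ i $ j" for i j
    using partial_deriv_eq[OF d, of j i] by (simp add: matrix_vector_mult_basis column_def)
  then show "classical_grad v x = A" by (simp add: classical_grad_def vec_eq_iff)
  show "(\<lambda>x. v x $ i) differentiable (at x)" using d by (auto simp: differentiable_def)
qed

text \<open>A cell on which \<open>\<nabla>u \<noteq> 0\<close> meets the zero set of \<open>u\<close> in a null set, since a nonconstant affine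
  function vanishes at most on a hyperplane; hence the gradient vanishes almost everywhere off \<open>\<Omega>\<close>.\<close>

lemma zero_ext_lipc_field:
  assumes u: "u \<in> P1" and A: "slopes u A b" and L: "\<And>T. T \<in> \<T> \<Longrightarrow> norm (A T) \<le> L" "0 \<le> L"
  shows "lipc_field \<Omega> (zero_ext u)" "AE x in lebesgue. norm (classical_grad (zero_ext u) x) \<le> L"
proof -
  have der: "AE x in lebesgue. (x \<notin> D \<and> (zero_ext u has_derivative (\<lambda>h. (0::real^'n^'n) *v h)) (at x)) \<or>
    (\<exists>T\<in>\<T>. x \<in> interior T \<and> x \<in> D \<and> (zero_ext u has_derivative (\<lambda>h. A T *v h)) (at x))"
    using AE_cell_interior by eventually_elim (use zero_ext_has_derivative[OF u A] in simp)
  have dif: "AE x in lebesgue. (\<lambda>x. zero_ext u x $ i) differentiable (at x)" for i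
    using der by eventually_elim (use classical_grad_of_derivative(2) in blast)
  show "AE x in lebesgue. norm (classical_grad (zero_ext u) x) \<le> L"
    using der
  proof eventually_elim
    case (elim x)
    then show ?case
    proof
      assume "x \<notin> D \<and> (zero_ext u has_derivative (\<lambda>h. (0::real^'n^'n) *v h)) (at x)"
      then have "classical_grad (zero_ext u) x = 0" by (intro classical_grad_of_derivative(1)) simp
      then show ?thesis using L(2) by simp
    next
      assume "\<exists>T\<in>\<T>. x \<in> interior T \<and> x \<in> D \<and> (zero_ext u has_derivative (\<lambda>h. A T *v h)) (at x)"
      then obtain T where "T \<in> \<T>" "(zero_ext u has_derivative (\<lambda>h. A T *v h)) (at x)" by blast
      then show ?thesis using classical_grad_of_derivative(1) L(1) by metis
    qed
  qed
  have hyp: "AE x in lebesgue. A T $ i \<noteq> 0 \<longrightarrow> A T $ i \<bullet> x \<noteq> - b T $ i" for T i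
  proof (cases "A T $ i = 0")
    case False
    then have "negligible {x. A T $ i \<bullet> x = - b T $ i}" by (intro negligible_hyperplane) simp
    then have "AE x in lebesgue. x \<notin> {x. A T $ i \<bullet> x = - b T $ i}"
      by (intro AE_not_in) (simp add: negligible_iff_null_sets)
    then show ?thesis by eventually_elim simp
  qed simp
  have hyp': "AE x in lebesgue. \<forall>T\<in>\<T>. \<forall>i. A T $ i \<noteq> 0 \<longrightarrow> A T $ i \<bullet> x \<noteq> - b T $ i"
    using hyp finite_mesh by (simp add: AE_finite_all AE_all_countable)
  have g0: "AE x in lebesgue. x \<notin> \<Omega> \<longrightarrow> classical_grad (zero_ext u) x = 0"
    using der hyp'
  proof eventually_elim
    case (elim x)
    from elim(1) show ?case
    proof
      assume "x \<notin> D \<and> (zero_ext u has_derivative (\<lambda>h. (0::real^'n^'n) *v h)) (at x)"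
      then have "classical_grad (zero_ext u) x = 0" by (intro classical_grad_of_derivative(1)) simp
      then show ?thesis by simp
    next
      assume "\<exists>T\<in>\<T>. x \<in> interior T \<and> x \<in> D \<and> (zero_ext u has_derivative (\<lambda>h. A T *v h)) (at x)"
      then obtain T where T: "T \<in> \<T>" "x \<in> interior T" "x \<in> D" "(zero_ext u has_derivative (\<lambda>h. A T *v h)) (at x)" by blast
      show ?thesis
      proof
        assume "x \<notin> \<Omega>"
        then have "u x = 0" using P1_outside[OF u T(3)] by simp
        moreover have "x \<in> T \<inter> closure D" using T(2,3) interior_subset closure_subset by blast
        ultimately have "A T *v x + b T = 0" using A T(1) by (simp add: slopes_def)
        then have "A T $ i \<bullet> x + b T $ i = 0" for i
          by (metis matrix_vector_mul_component vector_add_component zero_index)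
        then have "A T $ i = 0" for i using elim(2) T(1) by (metis add_eq_0_iff2)
        then have "A T = 0" by (simp add: vec_eq_iff)
        then show "classical_grad (zero_ext u) x = 0" using classical_grad_of_derivative(1)[OF T(4)] by simp
      qed
    qed
  qed
  have lip: "lipc (\<lambda>x. zero_ext u x $ i)" for i
    unfolding lipc_def
  proof (intro conjI)
    have "L-lipschitz_on UNIV (\<lambda>x. zero_ext u x $ i)"
    proof (rule lipschitz_onI[OF _ L(2)])
      fix x y
      have "\<bar>zero_ext u x $ i - zero_ext u y $ i\<bar> \<le> norm (zero_ext u x - zero_ext u y)"
        using component_le_norm_cart[of "zero_ext u x - zero_ext u y" i] by simp
      also have "\<dots> \<le> L * norm (x - y)" by (rule zero_ext_Lipschitz[OF u A L])
      finally show "dist (zero_ext u x $ i) (zero_ext u y $ i) \<le> L * dist x y" by (simp add: dist_norm)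
    qed
    then show "\<exists>L. L-lipschitz_on UNIV (\<lambda>x. zero_ext u x $ i)" ..
    show "bounded {x. zero_ext u x $ i \<noteq> 0}"
      by (rule bounded_subset[OF bd]) (auto simp: zero_ext_def split: if_splits)
  qed (rule dif)
  show "lipc_field \<Omega> (zero_ext u)"
    using lip g0 by (simp add: lipc_field_def zero_ext_def)
qed

lemma P1_measurable:
  assumes "u \<in> P1"
  shows "u \<in> borel_measurable (lebesgue_on D)" "u \<in> borel_measurable (lebesgue_on \<Omega>)"
proof -
  have c: "continuous_on (closure D) u" using assms by (simp add: P1_space_def)
  show "u \<in> borel_measurable (lebesgue_on D)"
    by (rule continuous_imp_measurable_on_sets_lebesgue[OF continuous_on_subset[OF c closure_subset]]) (use D_open in simp)
  have "\<Omega> \<subseteq> closure D" using \<Omega>_D closure_subset by blast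
  then show "u \<in> borel_measurable (lebesgue_on \<Omega>)"
    using op by (intro continuous_imp_measurable_on_sets_lebesgue continuous_on_subset[OF c]) auto
qed

lemma slopes_bound:
  obtains L where "0 \<le> L" "\<And>T. T \<in> \<T> \<Longrightarrow> norm ((A :: (real^'n) set \<Rightarrow> real^'n^'n) T) \<le> L"
proof
  show "0 \<le> (\<Sum>T\<in>\<T>. norm (A T))" by (rule sum_nonneg) simp
  show "norm (A T) \<le> (\<Sum>T\<in>\<T>. norm (A T))" if "T \<in> \<T>" for T
    by (rule member_le_sum[OF that]) (use finite_mesh in auto)
qed

lemma zero_ext_lipc: "u \<in> P1 \<Longrightarrow> lipc_field \<Omega> (zero_ext u)"
  by (metis P1_slopes slopes_bound zero_ext_lipc_field(1))

lemma P1_sq_integrable: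
  assumes "u \<in> P1"
  shows "sq_integrable (lebesgue_on \<Omega>) u"
proof (rule sq_integrable_cong_AE[OF sq_integrable_lebesgue_on[OF _ sq_integrable_lipc] P1_measurable(2)[OF assms]])
  show "lipc (\<lambda>x. zero_ext u x $ i)" for i using zero_ext_lipc[OF assms] by (simp add: lipc_field_def)
  show "AE x in lebesgue_on \<Omega>. zero_ext u x = u x" by (rule AE_I2) (simp add: zero_ext_def)
qed (use op in simp)

lemma P1_weak_grad:
  assumes "u \<in> P1"
  shows "sq_integrable (lebesgue_on \<Omega>) (weak_grad \<Omega> u)" "is_weak_grad \<Omega> u (weak_grad \<Omega> u)"
    "AE x in lebesgue_on \<Omega>. weak_grad \<Omega> u x = classical_grad (zero_ext u) x"
    "sq_integrable (lebesgue_on \<Omega>) (classical_grad (zero_ext u))"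
proof -
  have l: "lipc (\<lambda>x. zero_ext u x $ i)" for i using zero_ext_lipc[OF assms] by (simp add: lipc_field_def)
  show sq: "sq_integrable (lebesgue_on \<Omega>) (classical_grad (zero_ext u))"
    by (rule sq_integrable_lebesgue_on[OF _ sq_integrable_classical_grad[OF l]]) (use op in simp)
  have "(LINT x|lebesgue_on \<Omega>. u x $ i * partial_deriv j \<phi> x) = (LINT x|lebesgue_on \<Omega>. zero_ext u x $ i * partial_deriv j \<phi> x)" for i j \<phi>
    by (intro Bochner_Integration.integral_cong refl) (simp add: zero_ext_def)
  then have w: "is_weak_grad \<Omega> u (classical_grad (zero_ext u))"
    using is_weak_grad_lipc[OF op l] by (simp add: is_weak_grad_def)
  show "sq_integrable (lebesgue_on \<Omega>) (weak_grad \<Omega> u)" "is_weak_grad \<Omega> u (weak_grad \<Omega> u)"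
    "AE x in lebesgue_on \<Omega>. weak_grad \<Omega> u x = classical_grad (zero_ext u) x"
    using weak_grad_eq[OF op sq w] by auto
qed

text \<open>An affine map is determined by its values at \<open>p\<close> and \<open>p + t e\<^sub>j\<close>, and for small \<open>t\<close> almost every \<open>p\<close>
  in a ball inside \<open>V\<close> has all these points in the set of convergence.\<close>

lemma affine_convergent:
  fixes A :: "nat \<Rightarrow> real^'n^'n" and b :: "nat \<Rightarrow> real^'n"
  assumes V: "open V" "V \<noteq> {}" and ae: "AE x in lebesgue. x \<in> V \<longrightarrow> convergent (\<lambda>n. A n *v x + b n)"
  shows "convergent A" "convergent b"
proof -
  from ae obtain N where N: "{x. \<not> (x \<in> V \<longrightarrow> convergent (\<lambda>n. A n *v x + b n))} \<subseteq> N" "N \<in> null_sets lebesgue"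
    by (auto simp: eventually_ae_filter)
  then have good: "convergent (\<lambda>n. A n *v x + b n)" if "x \<in> V" "x \<notin> N" for x using that by blast
  obtain p0 r where r: "r > 0" "ball p0 r \<subseteq> V" using V by (metis ex_in_conv open_contains_ball)
  define t where "t = r / 2"
  have t: "t > 0" using r by (simp add: t_def)
  have neg: "negligible N" using N(2) by (simp add: negligible_iff_null_sets)
  have ng: "negligible (N \<union> (\<Union>j\<in>UNIV. (+) (- t *\<^sub>R axis j 1 :: real^'n) ` N))"
  proof (intro negligible_Un neg negligible_Union)
    fix S assume "S \<in> range (\<lambda>j. (+) (- t *\<^sub>R axis j 1 :: real^'n) ` N)"
    then show "negligible S" using negligible_translation[OF neg] by blast
  qed simp
  have "\<not> negligible (ball p0 (r/2))" using r by (intro open_not_negligible) auto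
  then have "\<not> ball p0 (r/2) \<subseteq> N \<union> (\<Union>j\<in>UNIV. (+) (- t *\<^sub>R axis j 1 :: real^'n) ` N)"
    using negligible_subset[OF ng] by meson
  then obtain p where "p \<in> ball p0 (r/2)" "p \<notin> N \<union> (\<Union>j\<in>UNIV. (+) (- t *\<^sub>R axis j 1 :: real^'n) ` N)"
    by (meson subsetI)
  then have p: "p \<in> ball p0 (r/2)" "p \<notin> N" "\<And>j. p \<notin> (+) (- t *\<^sub>R axis j 1 :: real^'n) ` N"
    by (simp_all only: Un_iff UN_iff) blast+
  have pV: "p \<in> V" using p(1) r by (auto intro: subsetD[OF r(2)])
  have c0: "convergent (\<lambda>n. A n *v p + b n)" by (rule good[OF pV p(2)])
  have cj: "convergent (\<lambda>n. A n *v (p + t *\<^sub>R axis j 1) + b n)" for j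
  proof (rule good)
    have "norm (p0 - (p + t *\<^sub>R axis j 1)) \<le> norm (p0 - p) + norm (t *\<^sub>R axis j 1 :: real^'n)"
      using norm_triangle_ineq4[of "p0 - p" "t *\<^sub>R axis j 1"] by (simp add: algebra_simps)
    also have "\<dots> < r" using p(1) t by (simp add: dist_norm t_def)
    finally show "p + t *\<^sub>R axis j 1 \<in> V" using r(2) by (auto simp: dist_norm)
    show "p + t *\<^sub>R axis j 1 \<notin> N"
    proof
      assume "p + t *\<^sub>R axis j 1 \<in> N"
      then have "- t *\<^sub>R axis j 1 + (p + t *\<^sub>R axis j 1) \<in> (+) (- t *\<^sub>R axis j 1) ` N" by (rule imageI)
      then show False using p(3)[of j] by simp
    qed
  qed
  have "convergent (\<lambda>n. A n $ i $ j)" for i j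
  proof -
    obtain l0 lj where l: "(\<lambda>n. A n *v p + b n) \<longlonglongrightarrow> l0" "(\<lambda>n. A n *v (p + t *\<^sub>R axis j 1) + b n) \<longlonglongrightarrow> lj"
      using c0 cj[of j] by (auto simp: convergent_def)
    have "(\<lambda>n. ((A n *v (p + t *\<^sub>R axis j 1) + b n) - (A n *v p + b n)) $ i / t) \<longlonglongrightarrow> (lj - l0) $ i / t"
      using t by (intro tendsto_intros l) auto
    moreover have "((A n *v (p + t *\<^sub>R axis j 1) + b n) - (A n *v p + b n)) $ i / t = A n $ i $ j" for n
      using t by (simp add: matrix_vector_right_distrib matrix_vector_mult_scaleR matrix_vector_mult_basis column_def)
    ultimately show ?thesis by (auto simp: convergent_def)
  qed
  then obtain l where "\<And>i j. (\<lambda>n. A n $ i $ j) \<longlonglongrightarrow> l i j" unfolding convergent_def by metis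
  then have "A \<longlonglongrightarrow> (\<chi> i j. l i j)" by (intro vec_tendstoI) simp
  then show "convergent A" by (auto simp: convergent_def)
  then obtain A' where A': "A \<longlonglongrightarrow> A'" by (auto simp: convergent_def)
  obtain l0 where l0: "(\<lambda>n. A n *v p + b n) \<longlonglongrightarrow> l0" using c0 by (auto simp: convergent_def)
  have "(\<lambda>n. A n *v p) \<longlonglongrightarrow> A' *v p"
    unfolding matrix_vector_mult_def by (intro vec_tendstoI) (simp, intro tendsto_intros A')
  from tendsto_diff[OF l0 this] have "b \<longlonglongrightarrow> l0 - A' *v p" by simp
  then show "convergent b" by (auto simp: convergent_def)
qed

text \<open>Almost everywhere convergence on \<open>\<Omega>\<close> extends to \<open>D\<close>, as all functions vanish on \<open>D - \<Omega>\<close>, and thus reaches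
  every cell, where \<open>affine_convergent\<close> applies. Convergence of the affine pieces is then uniform and
  identifies the limit as an element of the space.\<close>

lemma P1_limit:
  assumes s: "\<And>n. s n \<in> P1" and cau: "L2_Cauchy (lebesgue_on \<Omega>) s"
  obtains r :: "nat \<Rightarrow> nat" and u A b L where "strict_mono r" "u \<in> P1" "L \<longlonglongrightarrow> 0" "\<And>n. 0 \<le> L n"
    "\<And>n. slopes (\<lambda>x. s (r n) x - u x) (A n) (b n)" "\<And>n T. T \<in> \<T> \<Longrightarrow> norm (A n T) \<le> L n"
proof -
  obtain r u0 where r: "strict_mono r" and "sq_integrable (lebesgue_on \<Omega>) u0"
    and ae: "AE x in lebesgue_on \<Omega>. (\<lambda>n. s (r n) x) \<longlonglongrightarrow> u0 x"
    and "(\<lambda>n. LINT x|lebesgue_on \<Omega>. (norm (s n x - u0 x))\<^sup>2) \<longlonglongrightarrow> 0"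
    by (rule L2_complete[OF P1_sq_integrable[OF s] cau])
  have "\<exists>A b. slopes (s n) A b" for n using P1_slopes[OF s] by metis
  then obtain A b where Ab: "\<And>n. slopes (s n) (A n) (b n)" by metis
  have "AE x in lebesgue. x \<in> \<Omega> \<longrightarrow> (\<lambda>n. s (r n) x) \<longlonglongrightarrow> u0 x"
    using ae op by (simp add: AE_restrict_space_iff)
  then have aeD: "AE x in lebesgue. x \<in> D \<longrightarrow> convergent (\<lambda>n. s (r n) x)"
  proof eventually_elim
    case (elim x)
    show ?case
    proof (cases "x \<in> \<Omega>")
      case True then show ?thesis using elim by (auto simp: convergent_def)
    next
      case False then show ?thesis using P1_outside[OF s] by (auto simp: convergent_def)
    qed
  qed
  have conv: "convergent (\<lambda>n. A (r n) T)" "convergent (\<lambda>n. b (r n) T)" if T: "T \<in> \<T>" for T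
  proof -
    have V: "open (interior T \<inter> D)" "interior T \<inter> D \<noteq> {}" using D_open cell_meets[OF T] by auto
    have "AE x in lebesgue. x \<in> interior T \<inter> D \<longrightarrow> convergent (\<lambda>n. A (r n) T *v x + b (r n) T)"
      using aeD
    proof eventually_elim
      case (elim x)
      show ?case
      proof
        assume x: "x \<in> interior T \<inter> D"
        then have "x \<in> T \<inter> closure D" using interior_subset closure_subset by blast
        then have "s (r n) x = A (r n) T *v x + b (r n) T" for n using Ab T by (simp add: slopes_def)
        then show "convergent (\<lambda>n. A (r n) T *v x + b (r n) T)" using elim x by simp
      qed
    qed
    from affine_convergent[OF V this] show "convergent (\<lambda>n. A (r n) T)" "convergent (\<lambda>n. b (r n) T)" by auto
  qed
  define A' where "A' T = lim (\<lambda>n. A (r n) T)" for T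
  define b' where "b' T = lim (\<lambda>n. b (r n) T)" for T
  have A': "(\<lambda>n. A (r n) T) \<longlonglongrightarrow> A' T" and b': "(\<lambda>n. b (r n) T) \<longlonglongrightarrow> b' T" if "T \<in> \<T>" for T
    using conv[OF that] by (simp_all add: A'_def b'_def convergent_LIMSEQ_iff)
  define u where "u x = lim (\<lambda>n. s (r n) x)" for x
  have su: "slopes u A' b'"
    unfolding slopes_def
  proof (intro ballI)
    fix T x assume T: "T \<in> \<T>" and x: "x \<in> T \<inter> closure D"
    have "(\<lambda>n. A (r n) T *v x) \<longlonglongrightarrow> A' T *v x"
      unfolding matrix_vector_mult_def by (intro vec_tendstoI) (simp, intro tendsto_intros A'[OF T])
    then have "(\<lambda>n. A (r n) T *v x + b (r n) T) \<longlonglongrightarrow> A' T *v x + b' T" by (intro tendsto_add b'[OF T])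
    moreover have "s (r n) x = A (r n) T *v x + b (r n) T" for n using Ab T x by (simp add: slopes_def)
    ultimately show "u x = A' T *v x + b' T" unfolding u_def by (simp add: limI)
  qed
  have uP: "u \<in> P1"
    by (rule P1_I[OF su]) (simp add: u_def P1_outside[OF s])
  define L where "L n = (\<Sum>T\<in>\<T>. norm (A (r n) T - A' T))" for n
  have "L \<longlonglongrightarrow> (\<Sum>T\<in>\<T>. norm (A' T - A' T))"
    unfolding L_def by (intro tendsto_intros A')
  then have L0: "L \<longlonglongrightarrow> 0" by simp
  have Lp: "0 \<le> L n" for n unfolding L_def by (rule sum_nonneg) simp
  have sl: "slopes (\<lambda>x. s (r n) x - u x) (\<lambda>T. A (r n) T - A' T) (\<lambda>T. b (r n) T - b' T)" for n
    using slopes_lincomb[OF Ab su, of 1 "r n" "-1"] by simp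
  have "norm (A (r n) T - A' T) \<le> L n" if "T \<in> \<T>" for n T
    unfolding L_def by (rule member_le_sum[OF that]) (use finite_mesh in auto)
  with r uP L0 Lp sl show thesis by (rule that)
qed

lemma P1_AE_zero:
  assumes u: "u \<in> P1" and ae: "AE x in lebesgue_on \<Omega>. u x = 0"
  shows "AE x in lebesgue_on D. u x = 0"
proof -
  have "AE x in lebesgue. x \<in> \<Omega> \<longrightarrow> u x = 0" using ae op by (simp add: AE_restrict_space_iff)
  then have "AE x in lebesgue. x \<in> D \<longrightarrow> u x = 0"
    by eventually_elim (use P1_outside[OF u] in blast)
  then show ?thesis using D_open by (simp add: AE_restrict_space_iff)
qed

lemma zero_P1: "(\<lambda>_. 0) \<in> P1"
  by (rule P1_I[of _ "\<lambda>_. 0" "\<lambda>_. 0"]) (simp_all add: slopes_def)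

lemma diff_P1: "u \<in> P1 \<Longrightarrow> v \<in> P1 \<Longrightarrow> (\<lambda>x. u x - v x) \<in> P1"
  using P1_lincomb[of u v 1 "-1"] by simp

text \<open>The two bounds on the energy make completeness a matter of the finitely many slopes: an energy-Cauchy
  sequence is Cauchy in \<open>L\<^sup>2\<close>, so the slopes converge along a subsequence, and then so does the energy.\<close>

lemma coercive_form_P1:
  assumes C: "C > 0" "\<And>u. u \<in> P1 \<Longrightarrow> (LINT x|lebesgue_on \<Omega>. (norm (u x))\<^sup>2) \<le> C * B u u"
    and lin: "\<And>u v w s t. u \<in> P1 \<Longrightarrow> v \<in> P1 \<Longrightarrow> w \<in> P1 \<Longrightarrow> B (\<lambda>x. s *\<^sub>R u x + t *\<^sub>R v x) w = s * B u w + t * B v w"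
    and com: "\<And>u v. u \<in> P1 \<Longrightarrow> v \<in> P1 \<Longrightarrow> B u v = B v u"
    and upper: "\<And>u A b L. u \<in> P1 \<Longrightarrow> slopes u A b \<Longrightarrow> (\<And>T. T \<in> \<T> \<Longrightarrow> norm (A T) \<le> L) \<Longrightarrow> 0 \<le> L \<Longrightarrow> B u u \<le> K * L\<^sup>2"
  shows "coercive_form \<Omega> D P1 B C"
proof
  fix s :: "nat \<Rightarrow> real^'n \<Rightarrow> real^'n"
  assume s: "\<And>n. s n \<in> P1"
    and cau: "\<forall>e>0. \<exists>N. \<forall>m\<ge>N. \<forall>n\<ge>N. B (\<lambda>x. s m x - s n x) (\<lambda>x. s m x - s n x) < e"
  have "L2_Cauchy (lebesgue_on \<Omega>) s"
    by (rule L2_Cauchy_dominated[OF cau C(1) C(2)[OF diff_P1[OF s s]]])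
  then obtain r u A b L where r: "strict_mono (r :: nat \<Rightarrow> nat)" and u: "u \<in> P1" and L: "L \<longlonglongrightarrow> 0" "\<And>n. 0 \<le> L n"
    and sl: "\<And>n. slopes (\<lambda>x. s (r n) x - u x) (A n) (b n)" and AL: "\<And>n T. T \<in> \<T> \<Longrightarrow> norm (A n T) \<le> L n"
    by (rule P1_limit[OF s]) (rule that)
  have "(\<lambda>n. B (\<lambda>x. s (r n) x - u x) (\<lambda>x. s (r n) x - u x)) \<longlonglongrightarrow> 0"
  proof (rule tendsto_sandwich[OF _ _ tendsto_const])
    show "(\<lambda>n. K * (L n)\<^sup>2) \<longlonglongrightarrow> 0" using tendsto_mult_left[OF tendsto_power[OF L(1), of 2], of K] by simp
    have "0 \<le> B (\<lambda>x. s (r n) x - u x) (\<lambda>x. s (r n) x - u x)" for n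
    proof -
      have "0 \<le> C * B (\<lambda>x. s (r n) x - u x) (\<lambda>x. s (r n) x - u x)"
        by (rule order_trans[OF _ C(2)[OF diff_P1[OF s u]]]) (simp add: integral_nonneg_AE)
      then show ?thesis using C(1) by (simp add: zero_le_mult_iff)
    qed
    then show "\<forall>\<^sub>F n in sequentially. 0 \<le> B (\<lambda>x. s (r n) x - u x) (\<lambda>x. s (r n) x - u x)" by simp
    have "B (\<lambda>x. s (r n) x - u x) (\<lambda>x. s (r n) x - u x) \<le> K * (L n)\<^sup>2" for n
      by (rule upper[OF diff_P1[OF s u] sl AL L(2)])
    then show "\<forall>\<^sub>F n in sequentially. B (\<lambda>x. s (r n) x - u x) (\<lambda>x. s (r n) x - u x) \<le> K * (L n)\<^sup>2" by simp
  qed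
  then show "\<exists>u\<in>P1. \<exists>r::nat\<Rightarrow>nat. strict_mono r \<and> (\<lambda>n. B (\<lambda>x. s (r n) x - u x) (\<lambda>x. s (r n) x - u x)) \<longlonglongrightarrow> 0"
    using u r by blast
qed (fact P1_sq_integrable zero_P1 P1_lincomb lin com C P1_AE_zero | assumption)+

end

section \<open>The two discrete forms\<close>

lemma emeasure_lebesgue_bounded: "bounded S \<Longrightarrow> S \<in> sets borel \<Longrightarrow> emeasure lebesgue S < \<infinity>"
  using emeasure_bounded_finite[of S] by simp

lemma finite_measure_lebesgue_on:
  assumes "open \<Omega>" "bounded \<Omega>"
  shows "finite_measure (lebesgue_on (\<Omega> :: (real^'n) set))"
proof
  have "emeasure (lebesgue_on \<Omega>) (space (lebesgue_on \<Omega>)) = emeasure lebesgue \<Omega>"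
    using assms by (subst emeasure_restrict_space) auto
  then show "emeasure (lebesgue_on \<Omega>) (space (lebesgue_on \<Omega>)) \<noteq> \<infinity>"
    using emeasure_lebesgue_bounded[OF assms(2)] assms(1) by auto
qed

text \<open>The zero extension is a field to which Korn's and Poincare's inequality apply, and its classical gradient
  represents the weak gradient.\<close>

lemma coercive_form_P1_local:
  fixes \<Omega> :: "(real^'n) set"
  assumes "local_setting \<Omega> c c_min c_max" "mesh_setting \<Omega> \<delta> \<T>"
  shows "\<exists>C. coercive_form \<Omega> (enlarged \<Omega> \<delta>) (P1_space \<Omega> \<delta> \<T>) (B_local \<Omega> c) C"
proof -
  interpret l: local_setting \<Omega> c c_min c_max by fact
  interpret m: mesh_setting \<Omega> \<delta> \<T> by fact
  let ?M = "lebesgue_on \<Omega>"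
  interpret finite_measure ?M by (rule finite_measure_lebesgue_on[OF l.op l.bd])
  have "coercive_form \<Omega> m.D m.P1 (B_local \<Omega> c) l.C_L2"
  proof (rule m.coercive_form_P1[where K="l.elastic_const * c_max * (2 + real CARD('n)) * measure ?M (space ?M)"])
    show "l.C_L2 > 0" by (rule l.C_pos)
    show "B_local \<Omega> c u v = B_local \<Omega> c v u" for u v unfolding l.B_local_eq by (rule l.grad_form_commute)
    show "(LINT x|?M. (norm (u x))\<^sup>2) \<le> l.C_L2 * B_local \<Omega> c u u" if u: "u \<in> m.P1" for u
      unfolding l.B_local_eq
    proof (rule l.L2_le_energy[OF m.P1_weak_grad(1)[OF u]])
      note w = m.P1_weak_grad[OF u]
      have "(LINT x|?M. (norm (u x))\<^sup>2) = (LINT x|?M. (norm (m.zero_ext u x))\<^sup>2)"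
        by (intro Bochner_Integration.integral_cong refl) (simp add: m.zero_ext_def)
      moreover have "(LINT x|?M. (norm (Sym (weak_grad \<Omega> u x)))\<^sup>2) = (LINT x|?M. (norm (Sym (classical_grad (m.zero_ext u) x)))\<^sup>2)"
        by (rule LINT_norm_sq_cong[OF sq_integrableD(1)[OF sq_integrable_Sym[OF w(1)]] sq_integrableD(1)[OF sq_integrable_Sym[OF w(4)]]])
           (use w(3) in \<open>auto elim: eventually_mono\<close>)
      ultimately show "2 * (LINT x|?M. (norm (u x))\<^sup>2) \<le> l.diam_bound\<^sup>2 * (LINT x|?M. (norm (Sym (weak_grad \<Omega> u x)))\<^sup>2)"
        using lipc_field_inequalities(2)[OF l.op m.zero_ext_lipc[OF u] l.diam_bound(2,3)] by simp
    qed
    show "B_local \<Omega> c (\<lambda>x. s *\<^sub>R u x + t *\<^sub>R v x) w = s * B_local \<Omega> c u w + t * B_local \<Omega> c v w"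
      if "u \<in> m.P1" "v \<in> m.P1" "w \<in> m.P1" for u v w s t
    proof -
      note Wu = m.P1_weak_grad[OF that(1)] and Wv = m.P1_weak_grad[OF that(2)] and Ww = m.P1_weak_grad[OF that(3)]
      have "is_weak_grad \<Omega> (\<lambda>x. s *\<^sub>R u x + t *\<^sub>R v x) (\<lambda>x. s *\<^sub>R weak_grad \<Omega> u x + t *\<^sub>R weak_grad \<Omega> v x)"
        by (intro is_weak_grad_lincomb l.op m.P1_sq_integrable that Wu Wv)
      from weak_grad_eq[OF l.op sq_integrable_lincomb[OF Wu(1) Wv(1)] this]
      have "l.grad_form (weak_grad \<Omega> (\<lambda>x. s *\<^sub>R u x + t *\<^sub>R v x)) (weak_grad \<Omega> w)
          = l.grad_form (\<lambda>x. s *\<^sub>R weak_grad \<Omega> u x + t *\<^sub>R weak_grad \<Omega> v x) (weak_grad \<Omega> w)"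
        by (intro l.grad_form_cong sq_integrable_lincomb Wu(1) Wv(1) Ww(1)) auto
      then show ?thesis unfolding l.B_local_eq by (simp add: l.grad_form_lincomb[OF Wu(1) Wv(1) Ww(1)])
    qed
    show "B_local \<Omega> c u u \<le> l.elastic_const * c_max * (2 + real CARD('n)) * measure ?M (space ?M) * L\<^sup>2"
      if u: "u \<in> m.P1" and A: "m.slopes u A b" and L: "\<And>T. T \<in> \<T> \<Longrightarrow> norm (A T) \<le> L" "0 \<le> L" for u A b L
    proof -
      note w = m.P1_weak_grad[OF u]
      have "AE x in lebesgue. norm (classical_grad (m.zero_ext u) x) \<le> L"
        by (rule m.zero_ext_lipc_field(2)[OF u A L])
      then have "AE x in lebesgue. x \<in> \<Omega> \<longrightarrow> norm (classical_grad (m.zero_ext u) x) \<le> L"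
        by eventually_elim simp
      then have "AE x in ?M. norm (classical_grad (m.zero_ext u) x) \<le> L"
        using l.op by (simp add: AE_restrict_space_iff)
      then have "AE x in ?M. (norm (weak_grad \<Omega> u x))\<^sup>2 \<le> L\<^sup>2"
        using w(3) by eventually_elim (simp add: power_mono)
      then have "(LINT x|?M. (norm (weak_grad \<Omega> u x))\<^sup>2) \<le> (LINT x|?M. L\<^sup>2)"
        by (intro integral_mono_AE sq_integrableD(2)[OF w(1)]) auto
      also have "\<dots> = measure ?M (space ?M) * L\<^sup>2" by simp
      finally have b: "(LINT x|?M. (norm (weak_grad \<Omega> u x))\<^sup>2) \<le> measure ?M (space ?M) * L\<^sup>2" .
      show ?thesis
      proof (cases "\<Omega> = {}")
        case True
        then have "l.grad_form (weak_grad \<Omega> u) (weak_grad \<Omega> u) = 0"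
          unfolding l.grad_form_def by (simp add: integral_eq_zero_AE AE_restrict_space_iff)
        moreover have "measure ?M (space ?M) = 0" using True by (simp add: measure_restrict_space)
        ultimately show ?thesis unfolding l.B_local_eq by simp
      next
        case False
        then obtain x where "x \<in> \<Omega>" by blast
        then have "0 \<le> c_max" using l.c_bounds[of x] l.c_min by linarith
        then have "l.elastic_const * c_max * (2 + real CARD('n)) * (LINT x|?M. (norm (weak_grad \<Omega> u x))\<^sup>2)
            \<le> l.elastic_const * c_max * (2 + real CARD('n)) * (measure ?M (space ?M) * L\<^sup>2)"
          using l.elastic_const_pos by (intro mult_left_mono b mult_nonneg_nonneg) auto
        then show ?thesis
          using l.grad_form_bounds(2)[OF w(1)] unfolding l.B_local_eq by (simp add: mult.assoc)
      qed
    qed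
  qed
  then show ?thesis ..
qed

context nonlocal_setting
begin

lemma D_bounded: "bounded D"
proof (cases "\<Omega> = {}")
  case True then show ?thesis by (simp add: enlarged_def)
next
  case False
  obtain R where R: "\<And>x. x \<in> \<Omega> \<Longrightarrow> norm x \<le> R" using bd by (auto simp: bounded_iff)
  have "norm x \<le> R + \<delta>" if x: "x \<in> D" for x
  proof (cases "x \<in> \<Omega>")
    case True then show ?thesis using R[OF True] \<delta>_pos by simp
  next
    case F: False
    then have "infdist x \<Omega> < \<delta>" using x by (simp add: enlarged_def)
    then have "Inf (dist x ` \<Omega>) < \<delta>" using False by (simp add: infdist_notempty)
    then obtain y where "y \<in> \<Omega>" "dist x y < \<delta>"
      using cInf_lessD[of "dist x ` \<Omega>" \<delta>] False by auto
    then show ?thesis using R[of y] norm_triangle_ineq2[of x y] by (simp add: dist_norm)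
  qed
  then show ?thesis by (auto simp: bounded_iff)
qed

text \<open>For a Lipschitz function the difference quotient is bounded by the constant \<open>L\<close>, and the kernel has mass one
  around each point of \<open>D\<close>.\<close>

lemma energy_Lipschitz:
  assumes u: "\<And>x y. x \<in> D \<Longrightarrow> y \<in> D \<Longrightarrow> norm (u x - u y) \<le> L * norm (x - y)" and L: "0 \<le> L" and C: "0 \<le> C"
  shows "(\<integral>\<^sup>+p. ennreal (C * (energy_kernel u p * indicator A p)) \<partial>lebesgue) \<le> ennreal (C * L\<^sup>2 * measure lebesgue D)"
proof -
  note [measurable] = radial_kernel_borel[OF kernel]
  have [measurable]: "D \<in> sets borel" using D_open by simp
  have one: "(\<integral>\<^sup>+y. ennreal (\<kappa> (x - y)) \<partial>lborel) = 1" for x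
  proof -
    have "(\<integral>\<^sup>+y. ennreal (\<kappa> (x - y)) \<partial>lborel) = (\<integral>\<^sup>+y. ennreal (\<kappa> (y + - x)) \<partial>lborel)"
      using radial_kernelD(2)[OF kernel, of "_ + - _"] by (intro nn_integral_cong) (metis minus_diff_eq uminus_add_conv_diff add.commute)
    also have "\<dots> = (\<integral>\<^sup>+y. ennreal (\<kappa> y) \<partial>lborel)"
      by (rule nn_integral_lborel_translation[of "\<lambda>y. ennreal (\<kappa> y)"]) measurable
    also have "\<dots> = ennreal (LINT y|lborel. \<kappa> y)"
      by (rule nn_integral_eq_integral[OF radial_kernel_integral(1)[OF kernel]]) (simp add: radial_kernelD(1)[OF kernel])
    finally show ?thesis using radial_kernel_integral(2)[OF kernel] by simp
  qed
  have le: "energy_kernel u (x, y) * indicator A (x, y) \<le> L\<^sup>2 * indicator D x * \<kappa> (x - y)" for x y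
  proof (cases "(x, y) \<in> A")
    case True
    then have xy: "x \<in> D" "y \<in> D" using AD by auto
    have "\<bar>proj_diff u x y\<bar> \<le> norm (u x - u y) * norm ((x - y) /\<^sub>R norm (x - y))"
      unfolding proj_diff_def by (rule Cauchy_Schwarz_ineq2)
    also have "\<dots> \<le> norm (u x - u y)"
      by (rule mult_left_le) (cases "x = y", simp_all)
    also have "\<dots> \<le> L * norm (x - y)" by (rule u[OF xy])
    finally have "(proj_diff u x y)\<^sup>2 \<le> (L * norm (x - y))\<^sup>2"
      using power_mono[of "\<bar>proj_diff u x y\<bar>" "L * norm (x - y)" 2] by simp
    then have "(proj_diff u x y)\<^sup>2 / (norm (x - y))\<^sup>2 \<le> L\<^sup>2"
      by (cases "x = y") (simp_all add: pos_divide_le_eq power_mult_distrib)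
    from mult_left_mono[OF this radial_kernelD(1)[OF kernel, of "x - y"]] xy True
    show ?thesis by (simp add: energy_kernel_def mult.commute)
  qed (simp add: radial_kernelD(1)[OF kernel])
  have "(\<integral>\<^sup>+p. ennreal (C * (energy_kernel u p * indicator A p)) \<partial>lebesgue)
      \<le> (\<integral>\<^sup>+p. ennreal (C * L\<^sup>2 * indicator D (fst p) * \<kappa> (fst p - snd p)) \<partial>lebesgue)"
  proof (intro nn_integral_mono ennreal_leI)
    fix p :: "(real^'n) \<times> (real^'n)"
    have "C * (energy_kernel u p * indicator A p) \<le> C * (L\<^sup>2 * indicator D (fst p) * \<kappa> (fst p - snd p))"
      using le[of "fst p" "snd p"] C by (intro mult_left_mono) simp_all
    then show "C * (energy_kernel u p * indicator A p) \<le> C * L\<^sup>2 * indicator D (fst p) * \<kappa> (fst p - snd p)"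
      by (simp add: mult.assoc)
  qed
  also have "\<dots> = (\<integral>\<^sup>+p. ennreal (C * L\<^sup>2 * indicator D (fst p) * \<kappa> (fst p - snd p)) \<partial>(lborel \<Otimes>\<^sub>M lborel))"
    by (simp add: nn_integral_completion lborel_prod)
  also have "\<dots> = (\<integral>\<^sup>+x. (\<integral>\<^sup>+y. ennreal (C * L\<^sup>2 * indicator D (fst (x, y)) * \<kappa> (fst (x, y) - snd (x, y))) \<partial>lborel) \<partial>lborel)"
    by (rule lborel.nn_integral_fst[symmetric]) measurable
  also have "\<dots> = (\<integral>\<^sup>+x. ennreal (C * L\<^sup>2) * indicator D x \<partial>lborel)"
  proof (rule nn_integral_cong)
    fix x
    have "(\<integral>\<^sup>+y. ennreal (C * L\<^sup>2 * indicator D x * \<kappa> (x - y)) \<partial>lborel) = (\<integral>\<^sup>+y. ennreal (C * L\<^sup>2) * indicator D x * ennreal (\<kappa> (x - y)) \<partial>lborel)"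
      by (intro nn_integral_cong) (use C in \<open>auto simp: ennreal_mult radial_kernelD(1)[OF kernel] indicator_def\<close>)
    also have "\<dots> = ennreal (C * L\<^sup>2) * indicator D x * (\<integral>\<^sup>+y. ennreal (\<kappa> (x - y)) \<partial>lborel)"
      by (rule nn_integral_cmult) measurable
    finally show "(\<integral>\<^sup>+y. ennreal (C * L\<^sup>2 * indicator D (fst (x, y)) * \<kappa> (fst (x, y) - snd (x, y))) \<partial>lborel) = ennreal (C * L\<^sup>2) * indicator D x"
      by (simp add: one)
  qed
  also have "\<dots> = ennreal (C * L\<^sup>2) * emeasure lborel D"
    by (rule nn_integral_cmult_indicator) simp
  also have "emeasure lborel D = ennreal (measure lebesgue D)"
    using emeasure_bounded_finite[OF D_bounded] by (simp add: emeasure_eq_ennreal_measure measure_completion)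
  also have "ennreal (C * L\<^sup>2) * \<dots> = ennreal (C * L\<^sup>2 * measure lebesgue D)"
    using C by (simp add: ennreal_mult)
  finally show ?thesis .
qed

end

text \<open>Piecewise affine fields are Lipschitz, hence belong to the continuous space and inherit its coercivity.\<close>

lemma coercive_form_P1_nonlocal:
  fixes \<Omega> :: "(real^'n) set"
  assumes "nonlocal_setting \<Omega> \<delta> \<kappa> c c_min c_max" "mesh_setting \<Omega> \<delta> \<T>"
  shows "\<exists>C. coercive_form \<Omega> (enlarged \<Omega> \<delta>) (P1_space \<Omega> \<delta> \<T>) (B_nonlocal \<Omega> \<delta> \<kappa> c) C"
proof -
  interpret n: nonlocal_setting \<Omega> \<delta> \<kappa> c c_min c_max by fact
  interpret m: mesh_setting \<Omega> \<delta> \<T> by fact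
  have lip: "norm (u x - u y) \<le> L * norm (x - y)"
    if "u \<in> m.P1" "m.slopes u A b" "\<And>T. T \<in> \<T> \<Longrightarrow> norm (A T) \<le> L" "0 \<le> L" "x \<in> n.D" "y \<in> n.D" for u A b L x y
    using m.zero_ext_Lipschitz[OF that(1-4), of x y] m.zero_ext_D[OF that(1)] that(5,6) by simp
  have sub: "u \<in> X0_space \<Omega> \<delta> \<kappa>" if u: "u \<in> m.P1" for u
    unfolding n.X0_space_iff
  proof (intro conjI)
    show um: "u \<in> borel_measurable (lebesgue_on n.D)" by (rule m.P1_measurable(1)[OF u])
    show "sq_integrable (lebesgue_on \<Omega>) u" by (rule m.P1_sq_integrable[OF u])
    obtain A b where A: "m.slopes u A b" by (rule m.P1_slopes[OF u])
    obtain L where L: "0 \<le> L" "\<And>T. T \<in> \<T> \<Longrightarrow> norm (A T) \<le> L" by (rule m.slopes_bound) (rule that)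
    show "sq_integrable lebesgue (n.weighted_diff u)"
      unfolding n.weighted_diff_sq_integrable_iff[OF um]
      using n.energy_Lipschitz[OF lip[OF u A L(2,1)] L(1), of 1] by (auto intro: order.strict_trans1)
    show "AE x in lebesgue. x \<in> n.D - \<Omega> \<longrightarrow> u x = 0" using m.P1_outside[OF u] by simp
  qed
  obtain C where C: "C > 0" and P: "\<And>u. u \<in> X0_space \<Omega> \<delta> \<kappa> \<Longrightarrow>
    (LINT x|lebesgue_on \<Omega>. (norm (u x))\<^sup>2) \<le> C * B_nonlocal \<Omega> \<delta> \<kappa> c u u"
    by (rule n.nonlocal_Poincare) (rule that)
  have "coercive_form \<Omega> m.D m.P1 (B_nonlocal \<Omega> \<delta> \<kappa> c) C"
  proof (rule m.coercive_form_P1[where K="\<bar>c_max\<bar> / 2 * measure lebesgue n.D"])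
    show "B_nonlocal \<Omega> \<delta> \<kappa> c u v = B_nonlocal \<Omega> \<delta> \<kappa> c v u" for u v
      by (simp add: n.B_nonlocal_eq mult.commute)
    show "B_nonlocal \<Omega> \<delta> \<kappa> c u u \<le> \<bar>c_max\<bar> / 2 * measure lebesgue n.D * L\<^sup>2"
      if u: "u \<in> m.P1" and A: "m.slopes u A b" and L: "\<And>T. T \<in> \<T> \<Longrightarrow> norm (A T) \<le> L" "0 \<le> L" for u A b L
    proof -
      have wd: "sq_integrable lebesgue (n.weighted_diff u)" using sub[OF u] by (simp add: n.X0_space_iff)
      have Bu: "B_nonlocal \<Omega> \<delta> \<kappa> c u u = (LINT p|lebesgue. (norm (n.weighted_diff u p))\<^sup>2)"
        by (simp add: n.B_nonlocal_eq power2_eq_square)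
      have "ennreal (B_nonlocal \<Omega> \<delta> \<kappa> c u u) = (\<integral>\<^sup>+p. ennreal ((norm (n.weighted_diff u p))\<^sup>2) \<partial>lebesgue)"
        unfolding Bu by (rule nn_integral_eq_integral[symmetric]) (use sq_integrableD(2)[OF wd] in auto)
      also have "\<dots> \<le> (\<integral>\<^sup>+p. ennreal (\<bar>c_max\<bar> / 2 * (n.energy_kernel u p * indicator n.A p)) \<partial>lebesgue)"
      proof (intro nn_integral_mono ennreal_leI)
        fix p
        have "0 \<le> n.energy_kernel u p * indicator n.A p" using n.weighted_diff_sq_bounds(3)[of u p] by simp
        then have "c_max / 2 * (n.energy_kernel u p * indicator n.A p) \<le> \<bar>c_max\<bar> / 2 * (n.energy_kernel u p * indicator n.A p)"
          by (intro mult_right_mono) simp_all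
        then show "(norm (n.weighted_diff u p))\<^sup>2 \<le> \<bar>c_max\<bar> / 2 * (n.energy_kernel u p * indicator n.A p)"
          using n.weighted_diff_sq_bounds(2)[of u p] by simp
      qed
      also have "\<dots> \<le> ennreal (\<bar>c_max\<bar> / 2 * L\<^sup>2 * measure lebesgue n.D)"
        by (rule n.energy_Lipschitz[OF lip[OF u A L] L(2)]) simp_all
      finally have "B_nonlocal \<Omega> \<delta> \<kappa> c u u \<le> \<bar>c_max\<bar> / 2 * L\<^sup>2 * measure lebesgue n.D"
        by (subst (asm) ennreal_le_iff) auto
      then show ?thesis by (simp add: ac_simps)
    qed
    show "C > 0" by (rule C)
    show "(LINT x|lebesgue_on \<Omega>. (norm (u x))\<^sup>2) \<le> C * B_nonlocal \<Omega> \<delta> \<kappa> c u u" if "u \<in> m.P1" for u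
      by (rule P[OF sub[OF that]])
    show "B_nonlocal \<Omega> \<delta> \<kappa> c (\<lambda>x. s *\<^sub>R u x + t *\<^sub>R v x) w = s * B_nonlocal \<Omega> \<delta> \<kappa> c u w + t * B_nonlocal \<Omega> \<delta> \<kappa> c v w"
      if "u \<in> m.P1" "v \<in> m.P1" "w \<in> m.P1" for u v w s t
      by (rule n.B_nonlocal_lincomb[OF sub[OF that(1)] sub[OF that(2)] sub[OF that(3)]])
  qed
  then show ?thesis ..
qed

section \<open>Admissible controls\<close>

lemma Z_ad_bound:
  assumes "a \<in> Linf \<Omega>" "b \<in> Linf \<Omega>"
  obtains K where "\<And>z. z \<in> Z_ad \<Omega> a b \<Longrightarrow> AE x in lebesgue_on \<Omega>. norm (z x) \<le> K"
proof -
  obtain Ka Kb where K: "AE x in lebesgue_on \<Omega>. norm (a x) \<le> Ka" "AE x in lebesgue_on \<Omega>. norm (b x) \<le> Kb"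
    using assms by (auto simp: Linf_def)
  have "AE x in lebesgue_on \<Omega>. norm (z x) \<le> real CARD('a) * (Ka + Kb)" if "z \<in> Z_ad \<Omega> a b" for z
  proof -
    have "AE x in lebesgue_on \<Omega>. \<forall>i. a x $ i \<le> z x $ i \<and> z x $ i \<le> b x $ i" using that by (simp add: Z_ad_def)
    then show ?thesis
      using K
    proof eventually_elim
      case (elim x)
      have "\<bar>z x $ i\<bar> \<le> Ka + Kb" for i
      proof -
        have "\<bar>a x $ i\<bar> \<le> Ka" "\<bar>b x $ i\<bar> \<le> Kb"
          using elim(2,3) component_le_norm_cart[of "a x" i] component_le_norm_cart[of "b x" i] by linarith+
        moreover have "a x $ i \<le> z x $ i" "z x $ i \<le> b x $ i" using elim(1) by auto
        ultimately show ?thesis by linarith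
      qed
      then have "(\<Sum>i\<in>UNIV. \<bar>z x $ i\<bar>) \<le> real CARD('a) * (Ka + Kb)"
        using sum_bounded_above[of UNIV "\<lambda>i. \<bar>z x $ i\<bar>" "Ka + Kb"] by simp
      then show ?case using norm_le_l1_cart[of "z x"] by linarith
    qed
  qed
  then show thesis by (rule that)
qed

lemma Z_ad_measurable: "z \<in> Z_ad \<Omega> a b \<Longrightarrow> z \<in> borel_measurable (lebesgue_on \<Omega>)"
  by (simp add: Z_ad_def L2_def)

lemma Z_ad_midpoint:
  assumes "g \<in> Z_ad \<Omega> a b" "g' \<in> Z_ad \<Omega> a b"
  shows "(\<lambda>x. (1/2) *\<^sub>R g x + (1/2) *\<^sub>R g' x) \<in> Z_ad \<Omega> a b"
proof -
  have "sq_integrable (lebesgue_on \<Omega>) (\<lambda>x. (1/2) *\<^sub>R g x + (1/2) *\<^sub>R g' x)"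
    using assms by (intro sq_integrable_lincomb) (auto simp: Z_ad_def L2_iff_sq_integrable)
  moreover have "AE x in lebesgue_on \<Omega>. \<forall>i. a x $ i \<le> g x $ i \<and> g x $ i \<le> b x $ i"
    "AE x in lebesgue_on \<Omega>. \<forall>i. a x $ i \<le> g' x $ i \<and> g' x $ i \<le> b x $ i" using assms by (auto simp: Z_ad_def)
  then have "AE x in lebesgue_on \<Omega>. \<forall>i. a x $ i \<le> ((1/2) *\<^sub>R g x + (1/2) *\<^sub>R g' x) $ i \<and> ((1/2) *\<^sub>R g x + (1/2) *\<^sub>R g' x) $ i \<le> b x $ i"
  proof eventually_elim
    case (elim x)
    show ?case
    proof
      fix i
      have "a x $ i \<le> g x $ i" "g x $ i \<le> b x $ i" "a x $ i \<le> g' x $ i" "g' x $ i \<le> b x $ i" using elim by auto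
      then show "a x $ i \<le> ((1/2) *\<^sub>R g x + (1/2) *\<^sub>R g' x) $ i \<and> ((1/2) *\<^sub>R g x + (1/2) *\<^sub>R g' x) $ i \<le> b x $ i"
        by simp
    qed
  qed
  ultimately show ?thesis by (simp add: Z_ad_def L2_iff_sq_integrable)
qed

lemma Z_ad_lim:
  assumes fin: "finite_measure (lebesgue_on \<Omega>)" and ab: "a \<in> Linf \<Omega>" "b \<in> Linf \<Omega>"
    and g: "\<And>n. g n \<in> Z_ad \<Omega> a b" and conv: "AE x in lebesgue_on \<Omega>. convergent (\<lambda>n. g n x)"
  shows "(\<lambda>x. lim (\<lambda>n. g n x)) \<in> Z_ad \<Omega> a b"
proof -
  let ?M = "lebesgue_on \<Omega>" and ?g = "\<lambda>x. lim (\<lambda>n. g n x)"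
  interpret finite_measure ?M by fact
  obtain K where K: "\<And>z. z \<in> Z_ad \<Omega> a b \<Longrightarrow> AE x in ?M. norm (z x) \<le> K" by (rule Z_ad_bound[OF ab]) (rule that)
  have lim: "AE x in ?M. (\<lambda>n. g n x) \<longlonglongrightarrow> ?g x"
    using conv by eventually_elim (simp add: convergent_LIMSEQ_iff)
  have "AE x in ?M. \<forall>n i. a x $ i \<le> g n x $ i \<and> g n x $ i \<le> b x $ i"
    unfolding AE_all_countable using g by (auto simp: Z_ad_def AE_all_countable)
  then have bnd: "AE x in ?M. \<forall>i. a x $ i \<le> ?g x $ i \<and> ?g x $ i \<le> b x $ i"
    using lim
  proof eventually_elim
    case (elim x)
    have "(\<lambda>n. g n x $ i) \<longlonglongrightarrow> ?g x $ i" for i by (intro tendsto_vec_nth elim)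
    then have "a x $ i \<le> ?g x $ i" "?g x $ i \<le> b x $ i" for i
      using elim(1) LIMSEQ_le_const[of "\<lambda>n. g n x $ i" "?g x $ i" "a x $ i"]
        LIMSEQ_le_const2[of "\<lambda>n. g n x $ i" "?g x $ i" "b x $ i"] by blast+
    then show ?case by blast
  qed
  have "AE x in ?M. \<forall>n. norm (g n x) \<le> K" unfolding AE_all_countable using K g by blast
  then have nb: "AE x in ?M. (norm (?g x))\<^sup>2 \<le> K\<^sup>2"
    using lim
  proof eventually_elim
    case (elim x)
    have "norm (?g x) \<le> K" by (rule LIMSEQ_le_const2[OF tendsto_norm[OF elim(2)]]) (use elim(1) in auto)
    then show ?case by (simp add: power_mono)
  qed
  have "?g \<in> borel_measurable ?M" using Z_ad_measurable[OF g] by measurable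
  then have "sq_integrable ?M ?g" by (rule sq_integrable_bound[OF _ _ nb]) simp
  with bnd show ?thesis by (simp add: Z_ad_def L2_iff_sq_integrable)
qed

lemma P0_space_midpoint:
  assumes "g \<in> P0_space \<Omega> \<delta> \<T>" "g' \<in> P0_space \<Omega> \<delta> \<T>"
  shows "(\<lambda>x. (1/2) *\<^sub>R g x + (1/2) *\<^sub>R g' x) \<in> P0_space \<Omega> \<delta> \<T>"
  unfolding P0_space_def mem_Collect_eq
proof
  fix T assume "T \<in> \<T>"
  then obtain c c' where "\<forall>x\<in>interior T \<inter> enlarged \<Omega> \<delta>. g x = c" "\<forall>x\<in>interior T \<inter> enlarged \<Omega> \<delta>. g' x = c'"
    using assms unfolding P0_space_def by blast
  then show "\<exists>c. \<forall>x\<in>interior T \<inter> enlarged \<Omega> \<delta>. (1/2) *\<^sub>R g x + (1/2) *\<^sub>R g' x = c"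
    by (intro exI[of _ "(1/2) *\<^sub>R c + (1/2) *\<^sub>R c'"]) simp
qed

text \<open>The value of \<open>lim\<close> depends on the sequence alone, so constancy on a cell persists even where the sequence diverges.\<close>

lemma P0_space_lim:
  assumes "\<And>n. g n \<in> P0_space \<Omega> \<delta> \<T>"
  shows "(\<lambda>x. lim (\<lambda>n. g n x)) \<in> P0_space \<Omega> \<delta> \<T>"
  unfolding P0_space_def mem_Collect_eq
proof
  fix T assume "T \<in> \<T>"
  then have "\<forall>n. \<exists>c. \<forall>x\<in>interior T \<inter> enlarged \<Omega> \<delta>. g n x = c" using assms unfolding P0_space_def by blast
  then obtain c where "\<And>n x. x \<in> interior T \<inter> enlarged \<Omega> \<delta> \<Longrightarrow> g n x = c n" by metis
  then show "\<exists>c. \<forall>x\<in>interior T \<inter> enlarged \<Omega> \<delta>. lim (\<lambda>n. g n x) = c"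
    by (intro exI[of _ "lim c"]) simp
qed

section \<open>The four optimal control problems\<close>

theorem corollary4p2:
  fixes \<Omega> :: "(real^'n) set"
    and k :: "real \<Rightarrow> real^'n \<Rightarrow> real"
    and hc :: "real^'n \<Rightarrow> real"
    and h_min h_max :: real
    and a b :: "real^'n \<Rightarrow> real^'n"
    and F :: "real^'n \<Rightarrow> real^'n \<Rightarrow> real"
    and \<Gamma> :: "real^'n \<Rightarrow> real"
    and \<T> :: "real \<Rightarrow> (real^'n) set set"
    and \<delta> h :: real
  assumes "bounded \<Omega>" and "open \<Omega>" and "lipschitz_boundary \<Omega>"
    and "\<delta> > 0" and "h > 0"
    and "kernel_family k"
    and "hc \<in> borel_measurable (lebesgue_on (enlarged \<Omega> \<delta>))"
    and "0 < h_min" and "\<forall>x\<in>enlarged \<Omega> \<delta>. h_min \<le> hc x \<and> hc x \<le> h_max"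
    and "a \<in> Linf \<Omega>" and "b \<in> Linf \<Omega>" and "(\<lambda>_. 0) \<in> Z_ad \<Omega> a b"
    and "integrable (lebesgue_on \<Omega>) \<Gamma>" and "AE x in lebesgue_on \<Omega>. \<Gamma> x > 0"
    and "admissible_integrand \<Omega> F"
    and "\<forall>m>0. mesh_of (enlarged \<Omega> \<delta>) (\<T> m)" and "quasi_uniform \<T>"
  shows
    "unique_minimizer (enlarged \<Omega> \<delta>) \<Omega> (objective \<Omega> F \<Gamma>)
       (state_control_pairs \<Omega> (B_nonlocal \<Omega> \<delta> (k \<delta>) hc) (X0_space \<Omega> \<delta> (k \<delta>)) (Z_ad \<Omega> a b))
     \<and> unique_minimizer \<Omega> \<Omega> (objective \<Omega> F \<Gamma>)
       (state_control_pairs \<Omega> (B_local \<Omega> hc) (H10_space \<Omega>) (Z_ad \<Omega> a b))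
     \<and> unique_minimizer (enlarged \<Omega> \<delta>) \<Omega> (objective \<Omega> F \<Gamma>)
       (state_control_pairs \<Omega> (B_nonlocal \<Omega> \<delta> (k \<delta>) hc) (P1_space \<Omega> \<delta> (\<T> h))
          (Z_ad \<Omega> a b \<inter> P0_space \<Omega> \<delta> (\<T> h)))
     \<and> unique_minimizer (enlarged \<Omega> \<delta>) \<Omega> (objective \<Omega> F \<Gamma>)
       (state_control_pairs \<Omega> (B_local \<Omega> hc) (P1_space \<Omega> \<delta> (\<T> h))
          (Z_ad \<Omega> a b \<inter> P0_space \<Omega> \<delta> (\<T> h)))"
proof -
  have fin: "finite_measure (lebesgue_on \<Omega>)" by (rule finite_measure_lebesgue_on[OF assms(2,1)])
  have kernel: "radial_kernel \<delta> (k \<delta>)" using assms(4,6) by (simp add: kernel_family_def)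
  have mesh: "mesh_of (enlarged \<Omega> \<delta>) (\<T> h)" using assms(5,16) by simp
  have sub: "\<Omega> \<subseteq> enlarged \<Omega> \<delta>" by (rule subset_enlarged)
  have n: "nonlocal_setting \<Omega> \<delta> (k \<delta>) hc h_min h_max"
    by unfold_locales (use assms kernel in auto)
  have "hc \<in> borel_measurable (lebesgue_on \<Omega>)"
    by (rule measurable_restrict_mono[OF assms(7) sub])
  then have l: "local_setting \<Omega> hc h_min h_max"
    by unfold_locales (use assms sub in auto)
  have m: "mesh_setting \<Omega> \<delta> (\<T> h)"
    by unfold_locales (use assms mesh in auto)
  obtain K where K: "\<And>z. z \<in> Z_ad \<Omega> a b \<Longrightarrow> AE x in lebesgue_on \<Omega>. norm (z x) \<le> K"
    by (rule Z_ad_bound[OF assms(10,11)]) (rule that)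
  have zero: "(\<lambda>_. 0) \<in> P0_space \<Omega> \<delta> (\<T> h)" by (auto simp: P0_space_def)
  have continuous_controls: "unique_minimizer D \<Omega> (objective \<Omega> F \<Gamma>) (state_control_pairs \<Omega> B U (Z_ad \<Omega> a b))"
    if "coercive_form \<Omega> D U B C" for D U B C
    by (rule coercive_form.unique_minimizer_state_control[OF that fin, where K=K])
       (fact Z_ad_measurable K assms(12) Z_ad_midpoint Z_ad_lim[OF fin assms(10,11)] assms(13-15) | assumption)+
  have discrete_controls: "unique_minimizer D \<Omega> (objective \<Omega> F \<Gamma>)
      (state_control_pairs \<Omega> B U (Z_ad \<Omega> a b \<inter> P0_space \<Omega> \<delta> (\<T> h)))"
    if "coercive_form \<Omega> D U B C" for D U B C
  proof (rule coercive_form.unique_minimizer_state_control[OF that fin, where K=K])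
    show "(\<lambda>x. lim (\<lambda>n. g n x)) \<in> Z_ad \<Omega> a b \<inter> P0_space \<Omega> \<delta> (\<T> h)"
      if "\<And>n. g n \<in> Z_ad \<Omega> a b \<inter> P0_space \<Omega> \<delta> (\<T> h)" "AE x in lebesgue_on \<Omega>. convergent (\<lambda>n. g n x)" for g
      using that by (intro IntI Z_ad_lim[OF fin assms(10,11)] P0_space_lim) auto
    show "(\<lambda>x. (1/2) *\<^sub>R g x + (1/2) *\<^sub>R g' x) \<in> Z_ad \<Omega> a b \<inter> P0_space \<Omega> \<delta> (\<T> h)"
      if "g \<in> Z_ad \<Omega> a b \<inter> P0_space \<Omega> \<delta> (\<T> h)" "g' \<in> Z_ad \<Omega> a b \<inter> P0_space \<Omega> \<delta> (\<T> h)" for g g'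
      using that by (intro IntI Z_ad_midpoint P0_space_midpoint) auto
  qed (use Z_ad_measurable K assms(12-15) zero in auto)
  obtain C1 where C1: "coercive_form \<Omega> (enlarged \<Omega> \<delta>) (X0_space \<Omega> \<delta> (k \<delta>)) (B_nonlocal \<Omega> \<delta> (k \<delta>) hc) C1"
    using nonlocal_setting.coercive_form_X0[OF n] ..
  obtain C3 where C3: "coercive_form \<Omega> (enlarged \<Omega> \<delta>) (P1_space \<Omega> \<delta> (\<T> h)) (B_nonlocal \<Omega> \<delta> (k \<delta>) hc) C3"
    using coercive_form_P1_nonlocal[OF n m] ..
  obtain C4 where C4: "coercive_form \<Omega> (enlarged \<Omega> \<delta>) (P1_space \<Omega> \<delta> (\<T> h)) (B_local \<Omega> hc) C4"
    using coercive_form_P1_local[OF l m] ..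
  show ?thesis
    by (intro conjI continuous_controls[OF C1] continuous_controls[OF local_setting.coercive_form_H10[OF l]]
        discrete_controls[OF C3] discrete_controls[OF C4])
qed

end
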